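(* If $M$ is a closed hyperbolic surface of genus $g\geq 2$, then \[ N_{\mathrm{small}}(M) < \min\left( \frac{24 \pi^2(g-1)}{\operatorname{sys}(M)^3},\ \frac{16(g-1)}{\operatorname{sys}(M)^2} \right). \]
   Context: All surfaces are closed, oriented, hyperbolic. $\operatorname{sys}(M)$ is the length of a shortest closed geodesic in $M$. $N_{\mathrm{small}}(M)$ is the number of eigenvalues of the Laplace–Beltrami operator on $M$ lying in $[0,1/4]$, counted with multiplicity (including the eigenvalue $0$). *)

theory Defs
  imports "HOL-Analysis.Analysis" "HOL-Homology.Homology" "HOL-Algebra.Free_Abelian_Groups"
          "HOL-Library.Function_Algebras"
begin

definition uhp :: "complex set" where
  "uhp = {z. Im z > 0}"

definition hyp_dist :: "complex \<Rightarrow> complex \<Rightarrow> real" where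
  "hyp_dist z w = arcosh (1 + (cmod (z - w))\<^sup>2 / (2 * Im z * Im w))"

definition mobius :: "real \<Rightarrow> real \<Rightarrow> real \<Rightarrow> real \<Rightarrow> complex \<Rightarrow> complex" where
  "mobius a b c d z = (of_real a * z + of_real b) / (of_real c * z + of_real d)"

definition hyp_isom :: "(complex \<Rightarrow> complex) set" where
  "hyp_isom = {f. \<exists>a b c d. a * d - b * c = 1 \<and> f = mobius a b c d}"

text \<open>Gamma is a torsion-free cocompact Fuchsian group (acting freely and properly
  discontinuously with compact quotient); Gamma\H is then a closed oriented hyperbolic
  surface, and every such surface arises this way (uniformization).\<close>
definition cocompact_fuchsian :: "(complex \<Rightarrow> complex) set \<Rightarrow> bool" where
  "cocompact_fuchsian \<Gamma> \<longleftrightarrow>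
     \<Gamma> \<subseteq> hyp_isom \<and> id \<in> \<Gamma> \<and>
     (\<forall>f\<in>\<Gamma>. \<forall>g\<in>\<Gamma>. \<exists>h\<in>\<Gamma>. \<forall>z\<in>uhp. h z = f (g z)) \<and>
     (\<forall>f\<in>\<Gamma>. \<exists>g\<in>\<Gamma>. \<forall>z\<in>uhp. g (f z) = z) \<and>
     (\<forall>f\<in>\<Gamma>. (\<exists>z\<in>uhp. f z = z) \<longrightarrow> f = id) \<and>
     (\<forall>K. compact K \<and> K \<subseteq> uhp \<longrightarrow> finite {f\<in>\<Gamma>. f ` K \<inter> K \<noteq> {}}) \<and>
     (\<exists>K. compact K \<and> K \<subseteq> uhp \<and> uhp \<subseteq> (\<Union>f\<in>\<Gamma>. f ` K))"

definition orbit :: "(complex \<Rightarrow> complex) set \<Rightarrow> complex \<Rightarrow> complex set" where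
  "orbit \<Gamma> z = {f z | f. f \<in> \<Gamma>}"

definition surface_genus :: "(complex \<Rightarrow> complex) set \<Rightarrow> nat \<Rightarrow> bool" where
  "surface_genus \<Gamma> g \<longleftrightarrow>
     (\<exists>X :: complex set topology. quotient_map (top_of_set uhp) X (orbit \<Gamma>) \<and>
        homology_group 1 X \<cong> free_Abelian_group {..<2 * g})"

text \<open>Systole: length of a shortest closed geodesic of Gamma\H, i.e. the minimal
  displacement of a non-trivial deck transformation.\<close>
definition systole :: "(complex \<Rightarrow> complex) set \<Rightarrow> real" where
  "systole \<Gamma> = Inf {hyp_dist z (f z) | z f. z \<in> uhp \<and> f \<in> \<Gamma> \<and> f \<noteq> id}"

definition px :: "(complex \<Rightarrow> real) \<Rightarrow> complex \<Rightarrow> real" where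
  "px f z = deriv (\<lambda>t. f (Complex t (Im z))) (Re z)"
definition py :: "(complex \<Rightarrow> real) \<Rightarrow> complex \<Rightarrow> real" where
  "py f z = deriv (\<lambda>t. f (Complex (Re z) t)) (Im z)"

definition C2_on_uhp :: "(complex \<Rightarrow> real) \<Rightarrow> bool" where
  "C2_on_uhp f \<longleftrightarrow> f differentiable_on uhp \<and>
     px f differentiable_on uhp \<and> py f differentiable_on uhp \<and>
     continuous_on uhp (px (px f)) \<and> continuous_on uhp (py (px f)) \<and>
     continuous_on uhp (px (py f)) \<and> continuous_on uhp (py (py f))"

text \<open>Hyperbolic Laplace--Beltrami operator (non-negative convention).\<close>
definition hyp_laplacian :: "(complex \<Rightarrow> real) \<Rightarrow> complex \<Rightarrow> real" where
  "hyp_laplacian f z = - (Im z)\<^sup>2 * (px (px f) z + py (py f) z)"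

text \<open>Eigenspace of the Laplacian on M = Gamma\H, realised as Gamma-invariant functions
  on H (extended by 0 outside H).\<close>
definition eigenspace :: "(complex \<Rightarrow> complex) set \<Rightarrow> real \<Rightarrow> (complex \<Rightarrow> real) set" where
  "eigenspace \<Gamma> lam = {f. (\<forall>z. z \<notin> uhp \<longrightarrow> f z = 0) \<and> C2_on_uhp f \<and>
      (\<forall>h\<in>\<Gamma>. \<forall>z\<in>uhp. f (h z) = f z) \<and>
      (\<forall>z\<in>uhp. hyp_laplacian f z = lam * f z)}"

definition multiplicity :: "(complex \<Rightarrow> complex) set \<Rightarrow> real \<Rightarrow> nat" where
  "multiplicity \<Gamma> lam = vector_space.dim (\<lambda>c f. (\<lambda>z. c * f z)) (eigenspace \<Gamma> lam)"

definition N_small :: "(complex \<Rightarrow> complex) set \<Rightarrow> nat" where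
  "N_small \<Gamma> = (\<Sum>lam \<in> {lam. 0 \<le> lam \<and> lam \<le> 1/4 \<and> eigenspace \<Gamma> lam \<noteq> {0}}. multiplicity \<Gamma> lam)"

end

theory Submission
  imports Defs "HOL-Complex_Analysis.Complex_Analysis" "HOL-Real_Asymp.Real_Asymp"
begin

text \<open>Let \<open>R\<close> be half the systole, so that hyperbolic balls of radius \<open>R\<close> embed in the surface \<open>M\<close>.
  Averaging an eigenfunction over circles shows that an eigenfunction of eigenvalue \<open>\<le> 1/4\<close> is reproduced
  by a radial kernel supported in such a ball, with a factor bounded below by that of the spherical function
  at \<open>1/4\<close>; Bessel's inequality on each ball, integrated over \<open>M\<close>, gives
  \<open>N_small * m(R) \<le> area M\<close>, where \<open>m(R)\<close> is the integral of the squared spherical function at \<open>1/4\<close> over the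
  ball, and \<open>m(R) > pi * R^2\<close>, \<open>m(R) > 4 * R^3 / (3 * pi)\<close>.

  The area is bounded by \<open>4 * pi * (g - 1)\<close> as follows. The Delaunay complex of a generic fine net triangulates
  \<open>M\<close>, so the angle formula for triangles bounds the area by \<open>- 2 * pi * (V - E + F)\<close>. If \<open>2 - V + E - F\<close> exceeded
  \<open>2 * g\<close>, a non-zero integral harmonic 1-cochain would pair to zero with all \<open>2 * g\<close> generators of the homology
  group; it integrates to a circle-valued map whose logarithm is then a function on \<open>M\<close>, so the cochain is a
  coboundary and, being harmonic, zero.\<close>

section \<open>The hyperbolic plane\<close>

text \<open>The threshold 1/4 enters because \<open>sg (1 - sg) = lam\<close> has a real solution
  exactly for \<open>lam <= 1/4\<close>: the spherical function is then an average of real powers of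
  \<open>Im\<close>, hence positive, and it decreases in \<open>lam\<close>, so 1/4 is the worst
  case. Orthogonality of eigenfunctions comes from ball averages, which form symmetric operators on
  M, in place of Green's formula. The area is needed from above only, and all estimates for it point
  the same way: triangles cover M, sectors cover the directions at each vertex, so coverings are
  enough. The obstacle is that the genus is known only through the first homology of the quotient
  space. It enters as \<open>2 * g\<close> linear conditions on integral cochains, and counting
  dimensions then replaces a comparison of singular with simplicial homology. The lower bounds for
  m(R) come from comparing the spherical function with \<open>sqrt (r / sinh r)\<close> and with a
  multiple of \<open>r / sqrt (sinh r)\<close>. With R half the systole they turn the area bound
  into the two terms of the minimum.\<close>

text \<open>In the hyperboloid model, \<open>hcosh z w\<close> is minus the Lorentz product of the points over \<open>z\<close> and \<open>w\<close>, and
  \<open>hdet s t u\<close> is a constant multiple of the determinant of the points over \<open>s\<close>, \<open>t\<close>, \<open>u\<close>.\<close>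
definition hcosh :: "complex => complex => real" where
 "hcosh z w = 1 + (cmod (z - w))^2 / (2 * Im z * Im w)"

text \<open>The Cayley transform onto the unit disc with \<open>p\<close> sent to 0; its modulus is
  tanh of half the distance from \<open>p\<close>. \<open>icay\<close> is the inverse map.\<close>

definition cay :: "complex => complex => complex" where
 "cay p z = (z - p) / (z - cnj p)"

definition icay :: "complex => complex => complex" where
 "icay p w = (p - cnj p * w) / (1 - w)"

definition hdet :: "complex => complex => complex => real" where
 "hdet s t u = (Re s * ((cmod t)^2 - (cmod u)^2) - (cmod s)^2 * (Re t - Re u)
   + (cmod u)^2 * Re t - (cmod t)^2 * Re u) / (Im s * Im t * Im u)"

lemma uhp_iff: "z : uhp \<longleftrightarrow> Im z > 0"
 by (simp add: uhp_def)

lemma open_uhp: "open uhp"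
 unfolding uhp_def by (rule open_halfspace_Im_gt)

lemma convex_uhp: "convex uhp"
 unfolding uhp_def by (rule convex_halfspace_Im_gt)

lemma hcosh_formula:
 assumes "z : uhp" "w : uhp"
 shows "hcosh z w = ((Re z - Re w)^2 + (Im z)^2 + (Im w)^2) / (2 * Im z * Im w)"
 using assms unfolding hcosh_def uhp_iff cmod_power2
 by (simp add: field_simps power2_eq_square)

lemma hcosh_sym: "hcosh z w = hcosh w z"
 by (simp add: hcosh_def norm_minus_commute mult.commute mult.left_commute)

lemma hcosh_ge_1: "z : uhp ==> w : uhp ==> hcosh z w >= 1"
 by (simp add: hcosh_def uhp_iff)

lemma hcosh_self [simp]: "hcosh z z = 1"
 by (simp add: hcosh_def)

lemma hcosh_eq_1_iff: "z : uhp ==> w : uhp ==> hcosh z w = 1 \<longleftrightarrow> z = w"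
 by (auto simp: hcosh_def uhp_iff)

lemma hcosh_gt_1: "z : uhp ==> w : uhp ==> z ~= w ==> hcosh z w > 1"
 using hcosh_ge_1 hcosh_eq_1_iff by (metis order_le_imp_less_or_eq)

lemma continuous_on_hcosh [continuous_intros]:
 assumes "continuous_on S f" "continuous_on S g" "!!x. x : S ==> f x : uhp" "!!x. x : S ==> g x : uhp"
 shows "continuous_on S (%x. hcosh (f x) (g x))"
 unfolding hcosh_def using assms
 by (intro continuous_intros) (fastforce simp: uhp_iff)+

lemma cosh_hyp_dist: "z : uhp ==> w : uhp ==> cosh (hyp_dist z w) = hcosh z w"
 using hcosh_ge_1[of z w] by (simp add: hyp_dist_def hcosh_def)

lemma hyp_dist_nonneg: "z : uhp ==> w : uhp ==> hyp_dist z w >= 0"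
 using hcosh_ge_1[of z w] by (simp add: hyp_dist_def hcosh_def)

lemma hyp_dist_sym: "hyp_dist z w = hyp_dist w z"
 using hcosh_sym[of z w] by (simp add: hyp_dist_def hcosh_def)

lemma hyp_dist_less_iff:
 assumes "z : uhp" "w : uhp" "r >= 0"
 shows "hyp_dist z w < r \<longleftrightarrow> hcosh z w < cosh r"
 using cosh_real_nonneg_less_iff[of "hyp_dist z w" r] cosh_hyp_dist[OF assms(1,2)]
  hyp_dist_nonneg[OF assms(1,2)] assms(3) by simp

lemma hyp_dist_le_iff:
 assumes "z : uhp" "w : uhp" "r >= 0"
 shows "hyp_dist z w <= r \<longleftrightarrow> hcosh z w <= cosh r"
 using cosh_real_nonneg_le_iff[of "hyp_dist z w" r] cosh_hyp_dist[OF assms(1,2)]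
  hyp_dist_nonneg[OF assms(1,2)] assms(3) by simp

subsection \<open>The disc chart\<close>

lemma cay_denom_nz: "p : uhp ==> z : uhp ==> z - cnj p ~= 0"
 by (auto simp: uhp_iff complex_eq_iff)

lemma one_minus_norm_cay:
 assumes "p : uhp" "z : uhp"
 shows "1 - (cmod (cay p z))^2 = 4 * Im p * Im z / (cmod (z - cnj p))^2"
proof -
 have "(cmod (z - cnj p))^2 ~= 0" using cay_denom_nz[OF assms] by simp
 moreover have "(cmod (z - cnj p))^2 - (cmod (z - p))^2 = 4 * Im p * Im z"
  unfolding cmod_power2 by (simp add: power2_eq_square algebra_simps)
 ultimately show ?thesis
  by (simp add: cay_def norm_divide power_divide divide_simps)
qed

lemma norm_cay_less_1:
 assumes "p : uhp" "z : uhp" shows "cmod (cay p z) < 1"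
proof -
 have "1 - (cmod (cay p z))^2 > 0"
  unfolding one_minus_norm_cay[OF assms] using cay_denom_nz[OF assms] assms by (simp add: uhp_iff)
 then show ?thesis by (simp add: abs_square_less_1)
qed

lemma cay_self [simp]: "cay p p = 0"
 by (simp add: cay_def)

lemma icay_0 [simp]: "icay p 0 = p"
 by (simp add: icay_def)

lemma norm_less_1_ne: "cmod w < 1 ==> 1 - w ~= 0"
 by auto

lemma Im_icay:
 assumes "cmod w < 1"
 shows "Im (icay p w) = Im p * (1 - (cmod w)^2) / (cmod (1 - w))^2"
proof -
 have "Im (icay p w) = Im ((p - cnj p * w) * cnj (1 - w)) / (cmod (1 - w))^2"
  unfolding icay_def complex_div_cnj[of _ "1-w"]
  by (metis Im_divide_of_real of_real_power)
 moreover have "Im ((p - cnj p * w) * cnj (1 - w)) = Im p * (1 - (cmod w)^2)"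
  unfolding cmod_power2 by (simp add: power2_eq_square algebra_simps)
 ultimately show ?thesis by simp
qed

lemma icay_in_uhp:
 assumes "p : uhp" "cmod w < 1" shows "icay p w : uhp"
proof -
 have "(cmod w)^2 < 1" using assms(2) by (simp add: abs_square_less_1)
 then show ?thesis
  using assms norm_less_1_ne[OF assms(2)] by (auto simp: uhp_iff Im_icay[OF assms(2)] intro!: divide_pos_pos)
qed

lemma icay_cay:
 assumes "p : uhp" "z : uhp" shows "icay p (cay p z) = z"
proof -
 have 1: "z - cnj p ~= 0" "p - cnj p ~= 0"
  using assms by (auto simp: uhp_iff complex_eq_iff)
 have "1 - cay p z = (p - cnj p) / (z - cnj p)" "p - cnj p * cay p z = z * (p - cnj p) / (z - cnj p)"
  using 1(1) by (simp_all add: cay_def field_simps)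
 then show ?thesis using 1 by (simp add: icay_def)
qed

lemma cay_icay:
 assumes "p : uhp" "cmod w < 1" shows "cay p (icay p w) = w"
proof -
 have 1: "1 - w ~= 0" "p - cnj p ~= 0"
  using assms norm_less_1_ne by (auto simp: uhp_iff complex_eq_iff)
 have "icay p w - p = w * (p - cnj p) / (1 - w)" "icay p w - cnj p = (p - cnj p) / (1 - w)"
  using 1(1) by (simp_all add: icay_def field_simps)
 then show ?thesis using 1 by (simp add: cay_def)
qed

text \<open>In the disc, \<open>cosh d - 1 = 2 |a - b|^2 / ((1 - |a|^2) (1 - |b|^2))\<close>. Read
  in polar form about \<open>p\<close>, the formula is the hyperbolic law of cosines.\<close>

lemma hcosh_cay:
 assumes "p : uhp" "z : uhp" "w : uhp"
 shows "hcosh z w = ((1 + (cmod (cay p z))^2) * (1 + (cmod (cay p w))^2) - 4 * Re (cay p z * cnj (cay p w)))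
      / ((1 - (cmod (cay p z))^2) * (1 - (cmod (cay p w))^2))"
proof -
 define a b where "a = cay p z" and "b = cay p w"
 define A B where "A = (cmod a)^2" and "B = (cmod b)^2"
 have nz: "z - cnj p ~= 0" "w - cnj p ~= 0" using assms cay_denom_nz by auto
 have pos: "1 - A > 0" "1 - B > 0" using norm_cay_less_1 assms
  by (auto simp: a_def b_def A_def B_def abs_square_less_1)
 have "a - b = (p - cnj p) * (z - w) / ((z - cnj p) * (w - cnj p))"
  using nz by (simp add: a_def b_def cay_def field_simps)
 then have "(cmod (a - b))^2 = (2 * Im p)^2 * (cmod (z - w))^2 / ((cmod (z - cnj p))^2 * (cmod (w - cnj p))^2)"
  by (simp add: norm_mult norm_divide power_mult_distrib power_divide complex_diff_cnj)
 moreover have "(1 - A) * (1 - B) = (4 * Im p * Im z) * (4 * Im p * Im w) / ((cmod (z - cnj p))^2 * (cmod (w - cnj p))^2)"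
  unfolding A_def B_def a_def b_def using one_minus_norm_cay assms by simp
 ultimately have "2 * (cmod (a - b))^2 / ((1 - A) * (1 - B)) = (cmod (z - w))^2 / (2 * Im z * Im w)"
  using nz assms by (simp add: uhp_iff power2_eq_square)
 then have 1: "hcosh z w = 1 + 2 * (cmod (a - b))^2 / ((1 - A) * (1 - B))"
  by (simp add: hcosh_def)
 have 2: "(cmod (a - b))^2 = A + B - 2 * Re (a * cnj b)"
  unfolding A_def B_def cmod_power2 by (simp add: power2_eq_square algebra_simps)
 have "hcosh z w = ((1 - A) * (1 - B) + 2 * (A + B - 2 * Re (a * cnj b))) / ((1 - A) * (1 - B))"
  unfolding 1 2 using pos by (simp add: add_divide_distrib)
 also have "(1 - A) * (1 - B) + 2 * (A + B - 2 * Re (a * cnj b)) = (1 + A) * (1 + B) - 4 * Re (a * cnj b)"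
  by (simp add: algebra_simps)
 finally show ?thesis by (simp add: A_def B_def a_def b_def)
qed

lemma hcosh_center:
 assumes "p : uhp" "z : uhp"
 shows "hcosh p z = (1 + (cmod (cay p z))^2) / (1 - (cmod (cay p z))^2)"
 using hcosh_cay[OF assms(1) assms(1) assms(2)] by simp

text \<open>Since \<open>2 r / (1 - r^2)\<close> is sinh of the distance from \<open>p\<close>, the
  value is twice the product of both sinh and the sine of the angle at \<open>p\<close>; its sign
  tells on which side of the line from \<open>p\<close> to \<open>t\<close> the point
  \<open>z\<close> lies.\<close>

lemma hdet_cay:
 assumes "p : uhp" "t : uhp" "z : uhp"
 shows "hdet p t z = 8 * Im (cnj (cay p t) * cay p z) / ((1 - (cmod (cay p t))^2) * (1 - (cmod (cay p z))^2))"
proof -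
 have nz: "t - cnj p ~= 0" "z - cnj p ~= 0" using assms cay_denom_nz by auto
 define n1 n2 where "n1 = (cmod (t - cnj p))^2" and "n2 = (cmod (z - cnj p))^2"
 have n: "n1 > 0" "n2 > 0" using nz by (auto simp: n1_def n2_def)
 have c: "cay p x = (x - p) * cnj (x - cnj p) / of_real ((cmod (x - cnj p))^2)" for x
  unfolding cay_def by (metis complex_div_cnj of_real_power)
 have "Im (cnj (cay p t) * cay p z) = Im (cnj ((t - p) * cnj (t - cnj p)) * ((z - p) * cnj (z - cnj p)) / of_real (n1 * n2))"
  unfolding c n1_def n2_def by simp
 also have "... = Im (cnj ((t - p) * cnj (t - cnj p)) * ((z - p) * cnj (z - cnj p))) / (n1 * n2)"
  by (rule Im_divide_of_real)
 also have "Im (cnj ((t - p) * cnj (t - cnj p)) * ((z - p) * cnj (z - cnj p))) =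
   2 * Im p * (Re p * ((cmod t)^2 - (cmod z)^2) - (cmod p)^2 * (Re t - Re z)
   + (cmod z)^2 * Re t - (cmod t)^2 * Re z)"
  unfolding cmod_power2 by (simp add: power2_eq_square algebra_simps)
 also have "... = 2 * Im p * (hdet p t z * (Im p * Im t * Im z))"
  using assms by (simp add: hdet_def uhp_iff)
 finally have 1: "Im (cnj (cay p t) * cay p z) = 2 * Im p * (hdet p t z * (Im p * Im t * Im z)) / (n1 * n2)" .
 show ?thesis unfolding 1 one_minus_norm_cay[OF assms(1,2)] one_minus_norm_cay[OF assms(1,3)] n1_def[symmetric] n2_def[symmetric]
  using assms n by (simp add: uhp_iff field_simps)
qed

text \<open>Law of cosines at \<open>b\<close>: the worst case is the angle pi, where it becomes the
  addition formula of cosh.\<close>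

lemma hyp_triangle:
 assumes "a : uhp" "b : uhp" "c : uhp"
 shows "hyp_dist a c <= hyp_dist a b + hyp_dist b c"
proof -
 define u v where "u = cmod (cay b a)" and "v = cmod (cay b c)"
 have uv: "0 <= u" "u < 1" "0 <= v" "v < 1" using norm_cay_less_1 assms by (auto simp: u_def v_def)
 then have uv2: "u^2 < 1" "v^2 < 1" by (auto simp: abs_square_less_1)
 have s: "sinh (hyp_dist b x) = 2 * cmod (cay b x) / (1 - (cmod (cay b x))^2)" if "x : uhp" for x
 proof -
  define w where "w = cmod (cay b x)"
  have w: "0 <= w" "w^2 < 1" using norm_cay_less_1[OF assms(2) that] by (auto simp: w_def abs_square_less_1)
  have "(sinh (hyp_dist b x))^2 = ((1 + w^2) / (1 - w^2))^2 - 1"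
   using cosh_square_eq[of "hyp_dist b x"] cosh_hyp_dist[OF assms(2) that] hcosh_center[OF assms(2) that] by (simp add: w_def)
  also have "... = (2 * w / (1 - w^2))^2"
   using w by (simp add: divide_simps) Groebner_Basis.algebra
  finally have e: "(sinh (hyp_dist b x))^2 = (2 * w / (1 - w^2))^2" .
  show ?thesis unfolding w_def[symmetric]
   by (rule power2_eq_imp_eq[OF e]) (use w hyp_dist_nonneg[OF assms(2) that] in auto)
 qed
 have "hcosh a c = ((1 + u^2) * (1 + v^2) - 4 * Re (cay b a * cnj (cay b c))) / ((1 - u^2) * (1 - v^2))"
  using hcosh_cay[OF assms(2,1,3)] by (simp add: u_def v_def)
 also have "... <= ((1 + u^2) * (1 + v^2) + 4 * (u * v)) / ((1 - u^2) * (1 - v^2))"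
 proof (rule divide_right_mono)
  have "\<bar>Re (cay b a * cnj (cay b c))\<bar> <= u * v"
   using abs_Re_le_cmod[of "cay b a * cnj (cay b c)"] by (simp add: norm_mult u_def v_def)
  then show "(1 + u^2) * (1 + v^2) - 4 * Re (cay b a * cnj (cay b c)) <= (1 + u^2) * (1 + v^2) + 4 * (u * v)" by linarith
 qed (use uv2 in auto)
 also have "... = cosh (hyp_dist a b + hyp_dist b c)"
  unfolding add_divide_distrib[of "(1 + u^2) * (1 + v^2)"]
  using s[OF assms(1)] s[OF assms(3)] cosh_hyp_dist assms hcosh_center
  by (simp add: cosh_add hyp_dist_sym[of a b] u_def v_def)
 finally have "hcosh a c <= cosh (hyp_dist a b + hyp_dist b c)" .
 then show ?thesis using hyp_dist_le_iff assms hyp_dist_nonneg by simp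
qed

subsection \<open>Isometries\<close>

lemma hyp_isomE:
 assumes "f : hyp_isom"
 obtains a b c d where "a * d - b * c = 1" "f = mobius a b c d"
 using assms by (auto simp: hyp_isom_def)

lemma mobius_denom_nz:
 assumes "a * d - b * c = (1::real)" "z : uhp"
 shows "of_real c * z + of_real d ~= 0"
 using assms by (auto simp: complex_eq_iff uhp_iff)

lemma Im_mobius:
 assumes "a * d - b * c = (1::real)" "z : uhp"
 shows "Im (mobius a b c d z) = Im z / (cmod (of_real c * z + of_real d))^2"
proof -
 have "Im (mobius a b c d z) = Im ((of_real a * z + of_real b) * cnj (of_real c * z + of_real d)) / (cmod (of_real c * z + of_real d))^2"
  unfolding mobius_def complex_div_cnj[of _ "of_real c * z + of_real d"]
  by (metis Im_divide_of_real of_real_power)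
 moreover have "Im ((of_real a * z + of_real b) * cnj (of_real c * z + of_real d)) = (a * d - b * c) * Im z"
  by (simp add: algebra_simps)
 ultimately show ?thesis using assms by simp
qed

lemma hyp_isom_uhp: "f : hyp_isom ==> z : uhp ==> f z : uhp"
 using Im_mobius mobius_denom_nz by (elim hyp_isomE) (auto simp: uhp_iff)

lemma mobius_diff:
 assumes "a * d - b * c = (1::real)" "z : uhp" "w : uhp"
 shows "mobius a b c d z - mobius a b c d w = (z - w) / ((of_real c * z + of_real d) * (of_real c * w + of_real d))"
proof -
 have nz: "of_real c * z + of_real d ~= 0" "of_real c * w + of_real d ~= 0" using assms mobius_denom_nz by auto
 have 1: "complex_of_real a * of_real d - of_real b * of_real c = 1"
  using assms(1) by (metis of_real_1 of_real_diff of_real_mult)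
 have "mobius a b c d z - mobius a b c d w = ((of_real a * of_real d - of_real b * of_real c) * (z - w)) / ((of_real c * z + of_real d) * (of_real c * w + of_real d))"
  unfolding mobius_def diff_frac_eq[OF nz] by (simp add: algebra_simps)
 then show ?thesis unfolding 1 by simp
qed

lemma hcosh_isom:
 assumes "f : hyp_isom" "z : uhp" "w : uhp"
 shows "hcosh (f z) (f w) = hcosh z w"
proof -
 obtain a b c d where f: "a * d - b * c = 1" "f = mobius a b c d" using assms(1) by (rule hyp_isomE)
 have nz: "of_real c * z + of_real d ~= 0" "of_real c * w + of_real d ~= 0" using assms f mobius_denom_nz by auto
 show ?thesis
  unfolding hcosh_def f(2) mobius_diff[OF f(1) assms(2,3)] Im_mobius[OF f(1) assms(2)] Im_mobius[OF f(1) assms(3)]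
  using nz assms(2,3) by (simp add: norm_divide norm_mult power_divide power_mult_distrib uhp_iff)
qed

lemma hyp_dist_isom: "f : hyp_isom ==> z : uhp ==> w : uhp ==> hyp_dist (f z) (f w) = hyp_dist z w"
 using hcosh_isom[of f z w] by (simp add: hyp_dist_def hcosh_def)

text \<open>Up to the factor \<open>1 / Im z\<close>, the vector \<open>(|z|^2, Re z, 1)\<close> is
  transformed by the symmetric square of the matrix, whose determinant is
  \<open>(a d - b c)^3 = 1\<close>; the identity \<open>det\<close> expresses this.\<close>

lemma hdet_isom:
 assumes "f : hyp_isom" "s : uhp" "t : uhp" "u : uhp"
 shows "hdet (f s) (f t) (f u) = hdet s t u"
proof -
 obtain a b c d where f: "a * d - b * c = 1" "f = mobius a b c d" using assms(1) by (rule hyp_isomE)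
 define N where "N z = (cmod (of_real c * z + of_real d))^2" for z
 have N: "N z > 0" if "z : uhp" for z using mobius_denom_nz[OF f(1) that] by (simp add: N_def)
 have NN: "N z = c^2 * (cmod z)^2 + 2 * c * d * Re z + d^2" for z
  unfolding N_def cmod_power2 by (simp add: power2_eq_square algebra_simps)
 have A: "(cmod (f z))^2 = (a^2 * (cmod z)^2 + 2 * a * b * Re z + b^2) / N z" if "z : uhp" for z
 proof -
  have "(cmod (of_real a * z + of_real b))^2 = a^2 * (cmod z)^2 + 2 * a * b * Re z + b^2"
   unfolding cmod_power2 by (simp add: power2_eq_square algebra_simps)
  then show ?thesis by (simp add: f(2) mobius_def norm_divide power_divide N_def)
 qed
 have R: "Re (f z) = (a * c * (cmod z)^2 + (a * d + b * c) * Re z + b * d) / N z" if "z : uhp" for z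
 proof -
  have "Re (f z) = Re ((of_real a * z + of_real b) * cnj (of_real c * z + of_real d)) / N z"
   unfolding f(2) mobius_def N_def complex_div_cnj[of _ "of_real c * z + of_real d"]
   by (metis Re_divide_of_real of_real_power)
  moreover have "Re ((of_real a * z + of_real b) * cnj (of_real c * z + of_real d)) = a * c * (cmod z)^2 + (a * d + b * c) * Re z + b * d"
   unfolding cmod_power2 by (simp add: power2_eq_square algebra_simps)
  ultimately show ?thesis by simp
 qed
 have I: "Im (f z) = Im z / N z" if "z : uhp" for z using Im_mobius[OF f(1) that] by (simp add: f(2) N_def)
 define As xs where "As z = (cmod z)^2" and "xs z = Re z" for z :: complex
 have gen: "(R1/n1 * (P2/n2 - P3/n3) - P1/n1 * (R2/n2 - R3/n3) + P3/n3 * (R2/n2) - P2/n2 * (R3/n3)) / (y1/n1 * (y2/n2) * (y3/n3))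
   = (R1 * (P2 * n3 - P3 * n2) - P1 * (R2 * n3 - R3 * n2) + (P3 * R2 - P2 * R3) * n1) / (y1*y2*y3)" (is "?A / ?B = ?C / ?D")
  if n: "n1 > 0" "n2 > 0" "n3 > 0" "y1 > 0" "y2 > 0" "y3 > 0" for R1 R2 R3 P1 P2 P3 n1 n2 n3 y1 y2 y3 :: real
 proof -
  have "?A = ?C / (n1 * n2 * n3)" using n by (simp add: divide_simps) (simp add: algebra_simps)
  moreover have "?B = ?D / (n1 * n2 * n3)" by simp
  ultimately show ?thesis using n by simp
 qed
 have det: "(a * c * A1 + (a * d + b * c) * x1 + b * d) * ((a^2 * A2 + 2 * a * b * x2 + b^2) * (c^2 * A3 + 2 * c * d * x3 + d^2) - (a^2 * A3 + 2 * a * b * x3 + b^2) * (c^2 * A2 + 2 * c * d * x2 + d^2))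
   - (a^2 * A1 + 2 * a * b * x1 + b^2) * ((a * c * A2 + (a * d + b * c) * x2 + b * d) * (c^2 * A3 + 2 * c * d * x3 + d^2) - (a * c * A3 + (a * d + b * c) * x3 + b * d) * (c^2 * A2 + 2 * c * d * x2 + d^2))
   + ((a^2 * A3 + 2 * a * b * x3 + b^2) * (a * c * A2 + (a * d + b * c) * x2 + b * d) - (a^2 * A2 + 2 * a * b * x2 + b^2) * (a * c * A3 + (a * d + b * c) * x3 + b * d)) * (c^2 * A1 + 2 * c * d * x1 + d^2)
   = (a * d - b * c) ^ 3 * (x1 * (A2 - A3) - A1 * (x2 - x3) + A3 * x2 - A2 * x3)"
  for x1 x2 x3 A1 A2 A3 :: real by Groebner_Basis.algebra
 have y: "Im s > 0" "Im t > 0" "Im u > 0" using assms by (auto simp: uhp_iff)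
 show ?thesis
  unfolding hdet_def[of "f s"] A[OF assms(2)] A[OF assms(3)] A[OF assms(4)] R[OF assms(2)] R[OF assms(3)] R[OF assms(4)]
   I[OF assms(2)] I[OF assms(3)] I[OF assms(4)] gen[OF N[OF assms(2)] N[OF assms(3)] N[OF assms(4)] y]
  unfolding NN det f(1) by (simp add: hdet_def)
qed

lemma hyp_isom_has_field_derivative:
 assumes "f : hyp_isom"
 obtains f' where "!!z. z : uhp ==> (f has_field_derivative f' z) (at z)"
  "!!z. z : uhp ==> (cmod (f' z))\<^sup>2 / (Im (f z))^2 = 1 / (Im z)^2"
proof -
 obtain a b c d where f: "a * d - b * c = 1" "f = mobius a b c d" using assms(1) by (rule hyp_isomE)
 have 1: "complex_of_real a * of_real d - of_real b * of_real c = 1"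
  using f(1) by (metis of_real_1 of_real_diff of_real_mult)
 show ?thesis
 proof
  fix z assume z: "z : uhp"
  have nz: "of_real c * z + of_real d ~= 0" using mobius_denom_nz[OF f(1) z] .
  have "(f has_field_derivative (of_real a * (of_real c * z + of_real d) - (of_real a * z + of_real b) * of_real c) / ((of_real c * z + of_real d) * (of_real c * z + of_real d))) (at z)"
   unfolding f(2) mobius_def[abs_def] using nz by (auto intro!: derivative_eq_intros)
  moreover have "of_real a * (of_real c * z + of_real d) - (of_real a * z + of_real b) * of_real c = (1::complex)"
   unfolding 1[symmetric] by (simp add: algebra_simps)
  ultimately show "(f has_field_derivative 1 / ((of_real c * z + of_real d) * (of_real c * z + of_real d))) (at z)" by simp
  show "(cmod (1 / ((of_real c * z + of_real d) * (of_real c * z + of_real d))))^2 / (Im (f z))^2 = 1 / (Im z)^2"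
   unfolding f(2) Im_mobius[OF f(1) z] using nz z
   by (simp add: norm_divide norm_mult power_divide power_mult_distrib uhp_iff power2_eq_square)
 qed
qed

text \<open>Group elements are functions on the whole plane, so agreement on \<open>uhp\<close> has
  to be extended, poles included. Cross-multiplying gives a quadratic polynomial with three zeros.
  Numerator and denominator never vanish together, so the poles agree as well, and division by zero
  gives 0 there on both sides.\<close>

lemma hyp_isom_eqI:
 assumes "f : hyp_isom" "g : hyp_isom" and eq: "!!z. z : uhp ==> f z = g z"
 shows "f = g"
proof
 fix z
 obtain a b c d where f: "a * d - b * c = 1" "f = mobius a b c d" using assms(1) by (rule hyp_isomE)
 obtain a' b' c' d' where g: "a' * d' - b' * c' = 1" "g = mobius a' b' c' d'" using assms(2) by (rule hyp_isomE)
 define P where "P z = (of_real a * z + of_real b) * (of_real c' * z + of_real d') - (of_real a' * z + of_real b') * (of_real c * z + of_real d)" for z :: complex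
 define p0 p1 p2 where "p0 = complex_of_real (b * d' - b' * d)" and "p1 = complex_of_real (a * d' + b * c' - a' * d - b' * c)" and "p2 = complex_of_real (a * c' - a' * c)"
 have P: "P z = p2 * z^2 + p1 * z + p0" for z
  by (simp add: P_def p0_def p1_def p2_def power2_eq_square algebra_simps)
 have "P w = 0" if "w : uhp" for w
  using eq[OF that] mobius_denom_nz[OF f(1) that] mobius_denom_nz[OF g(1) that]
  unfolding f(2) g(2) mobius_def P_def by (simp add: field_simps)
 then have e: "P \<i> = 0" "P (2 * \<i>) = 0" "P (3 * \<i>) = 0" by (simp_all add: uhp_iff)
 have "p1 * \<i> = p2 - p0" "2 * (p1 * \<i>) = 4 * p2 - p0" "3 * (p1 * \<i>) = 9 * p2 - p0"
  using e unfolding P by (simp_all add: power2_eq_square algebra_simps)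
 then have "2 * p2 = 0" "p1 * \<i> = 0" "p0 = p2" by Groebner_Basis.algebra+
 then have "p2 = 0" "p1 = 0" "p0 = 0" by simp_all
 then have P0: "P z = 0" by (simp add: P)
 have nz1: "of_real a * z + of_real b ~= 0 \<or> of_real c * z + of_real d ~= (0::complex)"
 proof (rule ccontr)
  assume "~ ?thesis"
  then have "of_real a * (of_real c * z + of_real d) - of_real c * (of_real a * z + of_real b) = (0::complex)" by auto
  then have "complex_of_real (a * d - b * c) = 0" by (simp add: algebra_simps)
  then show False using f(1) by simp
 qed
 have nz2: "of_real a' * z + of_real b' ~= 0 \<or> of_real c' * z + of_real d' ~= (0::complex)"
 proof (rule ccontr)
  assume "~ ?thesis"
  then have "of_real a' * (of_real c' * z + of_real d') - of_real c' * (of_real a' * z + of_real b') = (0::complex)" by auto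
  then have "complex_of_real (a' * d' - b' * c') = 0" by (simp add: algebra_simps)
  then show False using g(1) by simp
 qed
 define n m n' m' where "n = of_real a * z + of_real b" and "m = of_real c * z + complex_of_real d"
  and "n' = of_real a' * z + of_real b'" and "m' = of_real c' * z + complex_of_real d'"
 have "n * m' = n' * m" "n ~= 0 \<or> m ~= 0" "n' ~= 0 \<or> m' ~= 0"
  using P0 nz1 nz2 by (simp_all add: P_def n_def m_def n'_def m'_def)
 then have "n / m = n' / m'"
  by (cases "m = 0"; cases "m' = 0") (auto simp: frac_eq_eq)
 then show "f z = g z" by (simp add: f(2) g(2) mobius_def n_def m_def n'_def m'_def)
qed

section \<open>Cocompact Fuchsian groups\<close>

text \<open>A bound on \<open>hcosh z w\<close> bounds the ratio of the imaginary parts both ways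
  and the horizontal distance, so a rectangle off the real axis suffices.\<close>

lemma compact_hyp_nbhd:
 assumes "compact K" "K \<subseteq> uhp"
 shows "EX K'. compact K' & K' \<subseteq> uhp & (ALL z:K. ALL w:uhp. hcosh z w <= C --> w : K')"
proof (cases "K = {}")
 case True then show ?thesis by (intro exI[of _ "{}"]) auto
next
 case False
 define D where "D = max C 1"
 have D: "D >= 1" "C <= D" by (auto simp: D_def)
 obtain z0 where z0: "z0 : K" "!!z. z : K ==> Im z0 <= Im z"
  using continuous_attains_inf[OF assms(1) False continuous_on_Im[OF continuous_on_id]] by auto
 obtain R where R: "!!z. z : K ==> cmod z <= R" "R > 0"
  using compact_imp_bounded[OF assms(1)] by (meson bounded_pos)
 define a where "a = Im z0 / (2 * D)"
 define K' where "K' = cbox (Complex (- (R + 2 * D * R)) a) (Complex (R + 2 * D * R) (2 * D * R))"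
 have a: "a > 0" using z0 assms D by (auto simp: a_def uhp_iff subset_iff)
 have "w : K'" if z: "z : K" and w: "w : uhp" and h: "hcosh z w <= C" for z w
 proof -
  have y: "Im z > 0" "Im w > 0" using z w assms by (auto simp: uhp_iff)
  have zR: "Im z <= R" "\<bar>Re z\<bar> <= R" using R(1)[OF z] abs_Im_le_cmod[of z] abs_Re_le_cmod[of z] by linarith+
  have "((Re z - Re w)^2 + (Im z)^2 + (Im w)^2) / (2 * Im z * Im w) <= D"
   using h D hcosh_formula[of z w] z w assms by auto
  then have h': "(Re z - Re w)^2 + (Im z)^2 + (Im w)^2 <= 2 * D * Im z * Im w"
   using y by (simp add: divide_le_eq mult_ac)
  have "(Im w) * Im w <= (2 * D * Im z) * Im w" using h' by (simp add: power2_eq_square) (smt (verit) zero_le_square)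
  then have w1: "Im w <= 2 * D * Im z" using y by simp
  have "Im z * Im z <= (2 * D * Im w) * Im z" using h' by (simp add: power2_eq_square mult_ac) (smt (verit) zero_le_square)
  then have w2: "Im z <= 2 * D * Im w" using y by simp
  have "(Re z - Re w)^2 <= 2 * D * Im z * Im w" using h' by (smt (verit) zero_le_power2)
  also have "... <= 2 * D * Im z * (2 * D * Im z)" using w1 y D by (intro mult_left_mono) auto
  also have "... = (2 * D * Im z)^2" by (simp add: power2_eq_square)
  finally have "\<bar>Re z - Re w\<bar> <= 2 * D * Im z"
   using y D by (metis abs_le_square_iff abs_of_nonneg mult_nonneg_nonneg less_imp_le order_trans zero_le_one zero_le_numeral)
  moreover have "2 * D * Im z <= 2 * D * R" using zR D by simp
  moreover have "a <= Im w" using w2 z0(2)[OF z] D by (simp add: a_def field_simps)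
  ultimately show ?thesis using w1 zR unfolding K'_def in_cbox_complex_iff by simp linarith
 qed
 moreover have "K' \<subseteq> uhp" using a by (auto simp: K'_def in_cbox_complex_iff uhp_iff)
 moreover have "compact K'" by (simp add: K'_def compact_cbox)
 ultimately show ?thesis by blast
qed

locale fuchsian =
 fixes \<Gamma> :: "(complex => complex) set"
 assumes fuchs: "cocompact_fuchsian \<Gamma>"
begin

lemmas fuchs_conj = fuchs[unfolded cocompact_fuchsian_def]

lemma isom: "f : \<Gamma> ==> f : hyp_isom"
 using fuchs_conj[THEN conjunct1] by (rule subsetD)

lemma id_in: "id : \<Gamma>"
 using fuchs_conj[THEN conjunct2, THEN conjunct1] .

lemma fix_id: "f : \<Gamma> ==> z : uhp ==> f z = z ==> f = id"
 using fuchs_conj[THEN conjunct2, THEN conjunct2, THEN conjunct2, THEN conjunct2, THEN conjunct1] by auto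

lemma finite_hits: "compact K ==> K \<subseteq> uhp ==> finite {f:\<Gamma>. f ` K \<inter> K ~= {}}"
 using fuchs_conj[THEN conjunct2, THEN conjunct2, THEN conjunct2, THEN conjunct2, THEN conjunct2, THEN conjunct1] by simp

lemma in_uhp: "f : \<Gamma> ==> z : uhp ==> f z : uhp"
 using isom hyp_isom_uhp by blast

text \<open>Closure of \<Gamma> is given only up to agreement on \<open>uhp\<close>: at a pole the
  composite of two functions can differ from the element that represents the product. Products and
  inverses are therefore chosen.\<close>

definition cmp where "cmp f g = (SOME h. h : \<Gamma> & (ALL z:uhp. h z = f (g z)))"
definition ivt where "ivt f = (SOME g. g : \<Gamma> & (ALL z:uhp. g (f z) = z))"

lemma cmp_props:
 assumes "f : \<Gamma>" "g : \<Gamma>"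
 shows "cmp f g : \<Gamma>" "z : uhp ==> cmp f g z = f (g z)"
proof -
 have "EX h. h : \<Gamma> & (ALL z:uhp. h z = f (g z))"
  using fuchs_conj[THEN conjunct2, THEN conjunct2, THEN conjunct1, rule_format, OF assms] by auto
 from someI_ex[OF this] show "cmp f g : \<Gamma>" "z : uhp ==> cmp f g z = f (g z)" by (auto simp: cmp_def)
qed

lemma ivt_props:
 assumes "f : \<Gamma>"
 shows "ivt f : \<Gamma>" "z : uhp ==> ivt f (f z) = z"
proof -
 have "EX g. g : \<Gamma> & (ALL z:uhp. g (f z) = z)"
  using fuchs_conj[THEN conjunct2, THEN conjunct2, THEN conjunct2, THEN conjunct1, rule_format, OF assms] by auto
 from someI_ex[OF this] show "ivt f : \<Gamma>" "z : uhp ==> ivt f (f z) = z" by (auto simp: ivt_def)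
qed

lemma hcosh_inv: "f : \<Gamma> ==> z : uhp ==> w : uhp ==> hcosh (f z) (f w) = hcosh z w"
 using isom hcosh_isom by blast

lemma inj: "f : \<Gamma> ==> z : uhp ==> w : uhp ==> f z = f w \<longleftrightarrow> z = w"
 using ivt_props(2) by metis

lemma ivt_right: "f : \<Gamma> ==> z : uhp ==> f (ivt f z) = z"
 by (metis inj ivt_props in_uhp)

text \<open>The action is free, and \<open>g^-1 f\<close> fixes \<open>z\<close>.\<close>

lemma eqI: 
 assumes "f : \<Gamma>" "g : \<Gamma>" "z : uhp" "f z = g z" shows "f = g"
proof -
 have "cmp (ivt g) f = id"
  using fix_id[of "cmp (ivt g) f" z] cmp_props ivt_props assms by metis
 then have "ivt g (f w) = w" if "w : uhp" for w
  using cmp_props(2)[of "ivt g" f w] ivt_props assms that by auto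
 then have "f w = g w" if "w : uhp" for w
  using ivt_right[OF assms(2), of "f w"] in_uhp[OF assms(1)] that by metis
 then show ?thesis using hyp_isom_eqI isom assms by blast
qed

lemma bij_cmp_right:
 assumes "g : \<Gamma>" shows "bij_betw (%f. cmp f g) \<Gamma> \<Gamma>"
proof (rule bij_betw_byWitness[where f' = "%f. cmp f (ivt g)"])
 have i: "\<i> : uhp" by (simp add: uhp_iff)
 show "ALL f:\<Gamma>. cmp (cmp f g) (ivt g) = f"
  by (intro ballI eqI[where z=\<i>]) (use i assms in "auto simp: cmp_props ivt_props ivt_right in_uhp")
 show "ALL f:\<Gamma>. cmp (cmp f (ivt g)) g = f"
  by (intro ballI eqI[where z=\<i>]) (use i assms in "auto simp: cmp_props ivt_props ivt_right in_uhp")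
qed (use assms cmp_props ivt_props in auto)

lemma ivt_ivt: assumes "f : \<Gamma>" shows "ivt (ivt f) = f"
 by (rule eqI[where z=\<i>]) (use assms in \<open>auto simp: ivt_props uhp_iff\<close>,
   metis assms imaginary_unit.sel(2) ivt_props ivt_right in_uhp uhp_iff zero_less_one)

lemma bij_ivt: "bij_betw ivt \<Gamma> \<Gamma>"
 by (rule bij_betw_byWitness[where f' = ivt]) (auto simp: ivt_ivt ivt_props)

definition KK where "KK = (SOME K. compact K & K \<subseteq> uhp & uhp \<subseteq> (\<Union>f\<in>\<Gamma>. f ` K))"

lemma KK: "compact KK" "KK \<subseteq> uhp" "uhp \<subseteq> (\<Union>f\<in>\<Gamma>. f ` KK)"
proof -
 have "EX K. compact K & K \<subseteq> uhp & uhp \<subseteq> (\<Union>f\<in>\<Gamma>. f ` K)"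
  using fuchs_conj[THEN conjunct2, THEN conjunct2, THEN conjunct2, THEN conjunct2, THEN conjunct2, THEN conjunct2] .
 from someI_ex[OF this] show "compact KK" "KK \<subseteq> uhp" "uhp \<subseteq> (\<Union>f\<in>\<Gamma>. f ` KK)" by (auto simp: KK_def)
qed

lemma move: assumes "z : uhp" obtains f where "f : \<Gamma>" "f z : KK"
proof -
 obtain f w where "f : \<Gamma>" "w : KK" "z = f w" using KK(3) assms by blast
 then have "ivt f : \<Gamma>" "ivt f z : KK" using ivt_props KK by auto
 then show ?thesis by (rule that)
qed

lemma finite_near:
 assumes "compact K" "K \<subseteq> uhp" "q : uhp"
 shows "finite {f:\<Gamma>. EX z:K. hcosh z (f q) <= C}"
proof -
 obtain K' where K': "compact K'" "K' \<subseteq> uhp" "!!z w. z : K ==> w : uhp ==> hcosh z w <= C ==> w : K'"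
  using compact_hyp_nbhd[OF assms(1,2), of C] by blast
 have "finite {f:\<Gamma>. f ` (insert q K') \<inter> (insert q K') ~= {}}"
  by (rule finite_hits) (use K' assms in auto)
 moreover have "{f:\<Gamma>. EX z:K. hcosh z (f q) <= C} \<subseteq> {f:\<Gamma>. f ` (insert q K') \<inter> (insert q K') ~= {}}"
  using K'(3) in_uhp assms(3) by auto
 ultimately show ?thesis using finite_subset by blast
qed

lemma countable_Gamma: "countable \<Gamma>"
proof -
 have i: "\<i> : uhp" by (simp add: uhp_iff)
 have "\<Gamma> = (\<Union>n::nat. {f:\<Gamma>. EX z:{\<i>}. hcosh z (f \<i>) <= n})"
  by (auto intro: real_arch_simple)
 moreover have "countable ..."
  by (rule countable_UN, simp, rule countable_finite, rule finite_near) (use i in auto)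
 ultimately show ?thesis by simp
qed

text \<open>Conjugation moves any point into \<open>KK\<close>. There only finitely many elements
  displace some point by \<open>hcosh <= 2\<close>, and each of them, having no fixed point, attains
  a minimum above 1 on \<open>KK\<close>.\<close>

lemma displacement_gap: "EX C0>1. ALL f:\<Gamma>-{id}. ALL z:uhp. hcosh z (f z) >= C0"
proof -
 obtain K' where K': "compact K'" "K' \<subseteq> uhp" "!!z w. z : KK ==> w : uhp ==> hcosh z w <= 2 ==> w : K'"
  using compact_hyp_nbhd[OF KK(1,2), of 2] by blast
 define A where "A = {f:\<Gamma>. f ~= id & (EX z:KK. hcosh z (f z) <= 2)}"
 have "A \<subseteq> {f:\<Gamma>. f ` (KK \<union> K') \<inter> (KK \<union> K') ~= {}}"
  unfolding A_def using K'(3) in_uhp KK(2) by blast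
 moreover have "finite {f:\<Gamma>. f ` (KK \<union> K') \<inter> (KK \<union> K') ~= {}}"
  by (rule finite_hits) (use K' KK in auto)
 ultimately have fA: "finite A" using finite_subset by blast
 have "ALL f:A. EX c>1. ALL z:KK. hcosh z (f z) >= c"
 proof
  fix f assume f: "f : A"
  then have fG: "f : \<Gamma>" "f ~= id" "KK ~= {}" by (auto simp: A_def)
  have cf: "continuous_on KK f"
  proof -
   obtain f' where "!!z. z : uhp ==> (f has_field_derivative f' z) (at z)"
    using hyp_isom_has_field_derivative[OF isom[OF fG(1)]] by metis
   then show ?thesis using KK(2) by (meson DERIV_isCont continuous_at_imp_continuous_on subsetD)
  qed
  have "continuous_on KK (%z. hcosh z (f z))"
   by (rule continuous_on_hcosh) (use cf KK(2) in_uhp fG in "auto intro: continuous_intros")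
  then obtain z0 where z0: "z0 : KK" "!!z. z : KK ==> hcosh z0 (f z0) <= hcosh z (f z)"
   using continuous_attains_inf[OF KK(1) fG(3)] by blast
  have "hcosh z0 (f z0) > 1" using hcosh_gt_1[of z0 "f z0"] z0(1) KK(2) in_uhp fG fix_id by fastforce
  then show "EX c>1. ALL z:KK. hcosh z (f z) >= c" using z0 by blast
 qed
 then obtain c where c: "!!f. f : A ==> c f > 1" "!!f z. f : A ==> z : KK ==> hcosh z (f z) >= c f"
  by metis
 define C0 where "C0 = Min (insert 2 (c ` A))"
 have C0: "C0 > 1" "C0 <= 2" "!!f. f : A ==> C0 <= c f" using fA c by (auto simp: C0_def)
 have onK: "hcosh z (f z) >= C0" if "f : \<Gamma>" "f ~= id" "z : KK" for f z
 proof (cases "f : A")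
  case True then show ?thesis using c(2)[OF True that(3)] C0(3) by fastforce
 next
  case False then have "hcosh z (f z) > 2" using that by (auto simp: A_def)
  then show ?thesis using C0 by simp
 qed
 have "hcosh z (f z) >= C0" if f: "f : \<Gamma>" "f ~= id" and z: "z : uhp" for f z
 proof -
  obtain k where k: "k : \<Gamma>" "k z : KK" using move[OF z] .
  define f' where "f' = cmp (cmp k f) (ivt k)"
  have f': "f' : \<Gamma>" "f' (k z) = k (f z)"
   using k f z by (auto simp: f'_def cmp_props ivt_props in_uhp)
  have "f' ~= id"
  proof
   assume "f' = id" then have "k (f z) = k z" using f' by simp
   then have "f z = z" using inj k f z in_uhp by blast
   then show False using fix_id f z by blast
  qed
  then have "hcosh (k z) (f' (k z)) >= C0" using onK k f' by blast
  then show ?thesis using f' hcosh_inv k f z in_uhp by simp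
 qed
 then show ?thesis using C0(1) by blast
qed

lemma nontrivial: "EX f:\<Gamma>. f ~= id"
proof (rule ccontr)
 assume "~ ?thesis" then have "\<Gamma> = {id}" using id_in by auto
 then have "uhp \<subseteq> KK" using KK(3) by auto
 then have "bounded uhp" using KK(1) compact_imp_bounded bounded_subset by blast
 then obtain B where B: "!!z. z : uhp ==> cmod z <= B" "B > 0" by (meson bounded_pos)
 from B(1)[of "\<i> * of_real (B + 1)"] B(2) show False by (simp add: uhp_iff norm_mult del: of_real_add)
qed

lemma systole_le: assumes "f : \<Gamma>" "f ~= id" "z : uhp" shows "systole \<Gamma> <= hyp_dist z (f z)"
 unfolding systole_def
 by (rule cInf_lower) (use assms in_uhp hyp_dist_nonneg in "auto intro!: bdd_belowI[of _ 0]")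

lemma systole_pos: "systole \<Gamma> > 0"
proof -
 obtain C0 where C0: "C0 > 1" "!!f z. f : \<Gamma> ==> f ~= id ==> z : uhp ==> hcosh z (f z) >= C0"
  using displacement_gap by auto
 have "arcosh C0 <= systole \<Gamma>"
  unfolding systole_def
 proof (rule cInf_greatest)
  show "{hyp_dist z (f z) |z f. z : uhp & f : \<Gamma> & f ~= id} ~= {}"
  proof -
   obtain f where "f : \<Gamma>" "f ~= id" using nontrivial by blast
   moreover have "\<i> : uhp" by (simp add: uhp_iff)
   ultimately show ?thesis by blast
  qed
  fix x assume "x : {hyp_dist z (f z) |z f. z : uhp & f : \<Gamma> & f ~= id}"
  then obtain z f where x: "x = hyp_dist z (f z)" "z : uhp" "f : \<Gamma>" "f ~= id" by blast
  then have "C0 <= cosh x" using C0(2) cosh_hyp_dist in_uhp by simp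
  moreover have "x >= 0" using x hyp_dist_nonneg in_uhp by auto
  moreover have "cosh (arcosh C0) = C0" "arcosh C0 >= 0" using C0(1) by simp_all
  ultimately show "arcosh C0 <= x" using cosh_real_nonneg_le_iff by metis
 qed
 moreover have "arcosh C0 > 0" using C0(1) by simp
 ultimately show ?thesis by simp
qed

end

section \<open>Polar coordinates and radial averages\<close>

lemma partial_derivatives:
 assumes "(f::complex => real) differentiable (at z)"
 shows "(f has_derivative (%h. px f z * Re h + py f z * Im h)) (at z)"
proof -
 obtain D where D: "(f has_derivative D) (at z)" using assms by (auto simp: differentiable_def)
 interpret D: bounded_linear D using D by (rule has_derivative_bounded_linear)
 have "((%t. Complex t (Im z)) has_derivative (%h. of_real h)) (at (Re z))"
  unfolding Complex_eq by (auto intro!: derivative_eq_intros)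
 from has_derivative_compose[OF this, of f D]
 have "((%t. f (Complex t (Im z))) has_derivative (%h. D (of_real h))) (at (Re z))" using D by simp
 moreover have "(%h. D (of_real h)) = (*) (D 1)"
  by (rule ext) (metis D.scaleR mult.commute mult.right_neutral real_scaleR_def scaleR_conv_of_real)
 ultimately have "((%t. f (Complex t (Im z))) has_real_derivative D 1) (at (Re z))"
  by (simp add: has_field_derivative_def)
 then have 1: "px f z = D 1" by (simp add: px_def DERIV_imp_deriv)
 have "((%t. Complex (Re z) t) has_derivative (%h. \<i> * of_real h)) (at (Im z))"
  unfolding Complex_eq by (auto intro!: derivative_eq_intros)
 from has_derivative_compose[OF this, of f D]
 have "((%t. f (Complex (Re z) t)) has_derivative (%h. D (\<i> * of_real h))) (at (Im z))" using D by simp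
 moreover have "(%h. D (\<i> * of_real h)) = (*) (D \<i>)"
  by (rule ext) (metis D.scaleR mult.commute real_scaleR_def scaleR_conv_of_real)
 ultimately have "((%t. f (Complex (Re z) t)) has_real_derivative D \<i>) (at (Im z))"
  by (simp add: has_field_derivative_def)
 then have 2: "py f z = D \<i>" by (simp add: py_def DERIV_imp_deriv)
 have "D h = px f z * Re h + py f z * Im h" for h
 proof -
  have "h = Re h *\<^sub>R 1 + Im h *\<^sub>R \<i>" by (simp add: complex_eq_iff)
  then have "D h = Re h * D 1 + Im h * D \<i>" by (metis D.add D.scaleR real_scaleR_def)
  then show ?thesis by (simp add: 1 2)
 qed
 then have "D = (%h. px f z * Re h + py f z * Im h)" by auto
 then show ?thesis using D by simp
qed

lemma chain_horizontal:
 assumes "(f::complex => real) differentiable (at (g (Complex s t)))" "(g has_field_derivative d) (at (Complex s t))"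
 shows "((%s. f (g (Complex s t))) has_real_derivative px f (g (Complex s t)) * Re d + py f (g (Complex s t)) * Im d) (at s)"
proof -
 have "((%s. Complex s t) has_derivative (%h. of_real h)) (at s)"
  unfolding Complex_eq by (auto intro!: derivative_eq_intros)
 from has_derivative_compose[OF this assms(2)[unfolded has_field_derivative_def]]
 have "((%s. g (Complex s t)) has_derivative (%h. d * of_real h)) (at s)" .
 from has_derivative_compose[OF this partial_derivatives[OF assms(1)]]
 have "((%s. f (g (Complex s t))) has_derivative (%h. px f (g (Complex s t)) * Re (d * of_real h) + py f (g (Complex s t)) * Im (d * of_real h))) (at s)" .
 then show ?thesis unfolding has_field_derivative_def
  by (rule has_derivative_eq_rhs) (auto simp: algebra_simps)
qed

lemma chain_vertical:
 assumes "(f::complex => real) differentiable (at (g (Complex s t)))" "(g has_field_derivative d) (at (Complex s t))"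
 shows "((%t. f (g (Complex s t))) has_real_derivative py f (g (Complex s t)) * Re d - px f (g (Complex s t)) * Im d) (at t)"
proof -
 have "((%t. Complex s t) has_derivative (%h. \<i> * of_real h)) (at t)"
  unfolding Complex_eq by (auto intro!: derivative_eq_intros)
 from has_derivative_compose[OF this assms(2)[unfolded has_field_derivative_def]]
 have "((%t. g (Complex s t)) has_derivative (%h. d * (\<i> * of_real h))) (at t)" .
 from has_derivative_compose[OF this partial_derivatives[OF assms(1)]]
 have "((%t. f (g (Complex s t))) has_derivative (%h. px f (g (Complex s t)) * Re (d * (\<i> * of_real h)) + py f (g (Complex s t)) * Im (d * (\<i> * of_real h)))) (at t)" .
 then show ?thesis unfolding has_field_derivative_def
  by (rule has_derivative_eq_rhs) (auto simp: algebra_simps)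
qed

lemma field_derivative_horizontal:
 assumes "(g has_field_derivative d) (at (Complex s t))"
 shows "((%s. Re (g (Complex s t))) has_real_derivative Re d) (at s)" "((%s. Im (g (Complex s t))) has_real_derivative Im d) (at s)"
proof -
 have "((%s. Complex s t) has_derivative (%h. of_real h)) (at s)"
  unfolding Complex_eq by (auto intro!: derivative_eq_intros)
 from has_derivative_compose[OF this assms(1)[unfolded has_field_derivative_def]]
 have "((%s. g (Complex s t)) has_derivative (%h. d * of_real h)) (at s)" .
 from has_derivative_Re[OF this] has_derivative_Im[OF this]
 show "((%s. Re (g (Complex s t))) has_real_derivative Re d) (at s)" "((%s. Im (g (Complex s t))) has_real_derivative Im d) (at s)"
  by (auto simp: has_field_derivative_def mult_commute_abs)
qed

lemma field_derivative_vertical: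
 assumes "(g has_field_derivative d) (at (Complex s t))"
 shows "((%t. Re (g (Complex s t))) has_real_derivative - Im d) (at t)" "((%t. Im (g (Complex s t))) has_real_derivative Re d) (at t)"
proof -
 have "((%t. Complex s t) has_derivative (%h. \<i> * of_real h)) (at t)"
  unfolding Complex_eq by (auto intro!: derivative_eq_intros)
 from has_derivative_compose[OF this assms(1)[unfolded has_field_derivative_def]]
 have "((%t. g (Complex s t)) has_derivative (%h. d * (\<i> * of_real h))) (at t)" .
 from has_derivative_Re[OF this] has_derivative_Im[OF this]
 show "((%t. Re (g (Complex s t))) has_real_derivative - Im d) (at t)" "((%t. Im (g (Complex s t))) has_real_derivative Re d) (at t)"
  by (auto simp: has_field_derivative_def elim!: has_derivative_eq_rhs)
qed

text \<open>Polar coordinates about \<open>p\<close> in a logarithmic chart: at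
  \<open>ze = s + i t\<close> the angle is \<open>t\<close> and the distance \<open>r\<close>
  satisfies \<open>tanh (r/2) = exp s\<close>, so \<open>s < 0\<close> and the centre is at minus
  infinity. The chart is holomorphic; \<open>pol1\<close> and \<open>pol2\<close> are its first two
  derivatives.\<close>

definition pol :: "complex => complex => complex" where "pol p ze = icay p (exp ze)"
definition pol1 :: "complex => complex => complex" where "pol1 p ze = 2 * \<i> * of_real (Im p) * exp ze / (1 - exp ze)^2"
definition pol2 :: "complex => complex => complex" where "pol2 p ze = 2 * \<i> * of_real (Im p) * exp ze * (1 + exp ze) / (1 - exp ze)^3"

lemma norm_exp_less_1: "Re ze < 0 ==> cmod (exp ze) < 1"
 by simp

lemma exp_ne_1: "Re ze < 0 ==> 1 - exp ze ~= 0"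
 using norm_exp_less_1 norm_less_1_ne by blast

lemma pol_in_uhp: "p : uhp ==> Re ze < 0 ==> pol p ze : uhp"
 unfolding pol_def by (rule icay_in_uhp) auto

lemma pol_deriv: "Re ze < 0 ==> (pol p has_field_derivative pol1 p ze) (at ze)"
proof -
 assume "Re ze < 0"
 then have nz: "1 - exp ze ~= 0" by (rule exp_ne_1)
 have "(pol p has_field_derivative (- (cnj p * exp ze) * (1 - exp ze) - (p - cnj p * exp ze) * - exp ze) / ((1 - exp ze) * (1 - exp ze))) (at ze)"
  unfolding pol_def[abs_def] icay_def using nz by (auto intro!: derivative_eq_intros)
 moreover have "(- (cnj p * exp ze) * (1 - exp ze) - (p - cnj p * exp ze) * - exp ze) = (p - cnj p) * exp ze"
  by (simp add: algebra_simps)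
 moreover have "p - cnj p = 2 * \<i> * of_real (Im p)" by (simp add: complex_eq_iff)
 ultimately show ?thesis by (simp add: pol1_def power2_eq_square)
qed

lemma pol1_deriv: "Re ze < 0 ==> (pol1 p has_field_derivative pol2 p ze) (at ze)"
proof -
 assume "Re ze < 0"
 then have nz: "1 - exp ze ~= 0" by (rule exp_ne_1)
 define c where "c = 2 * \<i> * complex_of_real (Im p)"
 define e where "e = exp ze"
 have "(pol1 p has_field_derivative (c * e * (1 - e)^2 - (c * e) * (2 * (1 - e) * - e)) / ((1 - e)^2 * (1 - e)^2)) (at ze)"
  unfolding pol1_def[abs_def] c_def e_def using nz by (auto intro!: derivative_eq_intros)
 moreover have "(c * e * (1 - e)^2 - (c * e) * (2 * (1 - e) * - e)) = (1 - e) * (c * e * (1 + e))"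
  by (simp add: power2_eq_square algebra_simps)
 moreover have "(1 - e)^2 * (1 - e)^2 = (1 - e) * (1 - e) ^ 3" by (simp add: power2_eq_square power3_eq_cube)
 ultimately show ?thesis using nz by (simp add: pol2_def c_def e_def)
qed

text \<open>In other words the metric is \<open>(ds^2 + dt^2) / (sinh s)^2\<close>, from which both
  the Laplacian and the area element in these coordinates are read off.\<close>

lemma pol_conformal:
 assumes "p : uhp" "Re ze < 0"
 shows "(cmod (pol1 p ze))^2 / (Im (pol p ze))^2 = 1 / (sinh (Re ze))^2"
proof -
 have n: "cmod (exp ze) < 1" "1 - exp ze ~= 0" using assms exp_ne_1 by auto
 define e where "e = exp (Re ze)"
 have e: "e > 0" "e < 1" using assms by (auto simp: e_def)
 have i: "Im (pol p ze) = Im p * (1 - e^2) / (cmod (1 - exp ze))^2"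
  unfolding pol_def Im_icay[OF n(1)] by (simp add: e_def)
 have m: "cmod (pol1 p ze) = 2 * Im p * e / (cmod (1 - exp ze))^2"
  using assms by (simp add: pol1_def norm_mult norm_divide norm_power e_def uhp_iff)
 have e2: "e^2 < 1" using e by (simp add: abs_square_less_1)
 have s: "sinh (Re ze) = (e^2 - 1) / (2 * e)"
  using e unfolding sinh_field_def e_def by (simp add: exp_minus field_simps power2_eq_square)
 have "cmod (pol1 p ze) / Im (pol p ze) = 2 * e / (1 - e^2)"
  unfolding i m using n assms e2 by (simp add: uhp_iff)
 then have "(cmod (pol1 p ze) / Im (pol p ze))^2 = (2 * e / (1 - e^2))^2" by simp
 also have "... = 1 / ((e^2 - 1) / (2 * e))^2" by (simp add: power_divide power2_commute)
 finally show ?thesis by (simp add: power_divide s)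
qed

lemma pol_periodic: "pol p (Complex s (2 * pi)) = pol p (Complex s 0)" "pol1 p (Complex s (2 * pi)) = pol1 p (Complex s 0)"
proof -
 have "exp (Complex s (2 * pi)) = exp (Complex s 0)"
  by (simp add: exp_eq_polar Complex_eq exp_add)
 then show "pol p (Complex s (2 * pi)) = pol p (Complex s 0)" "pol1 p (Complex s (2 * pi)) = pol1 p (Complex s 0)"
  by (simp_all add: pol_def pol1_def)
qed

section \<open>Circle averages and the radial equation\<close>

definition eigen_on :: "(complex => real) => real => bool" where
 "eigen_on f lam \<longleftrightarrow> C2_on_uhp f & (ALL z:uhp. hyp_laplacian f z = lam * f z)"

text \<open>The average over the circle about \<open>p\<close> times \<open>2 * pi\<close>;
  \<open>sph1\<close> is its derivative in \<open>s\<close>.\<close>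

definition sph :: "(complex => real) => complex => real => real" where
 "sph f p s = integral {0..2*pi} (%t. f (pol p (Complex s t)))"
definition sph1 :: "(complex => real) => complex => real => real" where
 "sph1 f p s = integral {0..2*pi} (%t. px f (pol p (Complex s t)) * Re (pol1 p (Complex s t)) + py f (pol p (Complex s t)) * Im (pol1 p (Complex s t)))"

lemma C2D:
 assumes "C2_on_uhp f" "z : uhp"
 shows "f differentiable (at z)" "px f differentiable (at z)" "py f differentiable (at z)"
 using assms open_uhp unfolding C2_on_uhp_def by (auto simp: differentiable_on_eq_differentiable_at)

text \<open>In the coordinates \<open>s + i t\<close> the eigenvalue equation is the flat one with
  right-hand side divided by \<open>(sinh s)^2\<close>. Integrating over a period of
  \<open>t\<close> removes the second \<open>t\<close>-derivative and leaves
  \<open>u'' = - lam u / (sinh s)^2\<close>.\<close>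

lemma sph_derivs:
 assumes eig: "eigen_on f lam" and p: "p : uhp" and s: "s < 0"
 shows "(sph f p has_real_derivative sph1 f p s) (at s)"
  "(sph1 f p has_real_derivative - lam * sph f p s / (sinh s)^2) (at s)"
proof -
 have C2: "C2_on_uhp f" using eig by (simp add: eigen_on_def)
 let ?U = "{..<0::real}" and ?I = "{0..2*pi}"
 have U: "pol p (Complex s t) : uhp" if "s < 0" for s t using pol_in_uhp[OF p] that by simp
 have cS: "continuous_on (?U \<times> ?I) (%x. Complex (fst x) (snd x))"
  unfolding Complex_eq by (intro continuous_intros)
 have cpol: "continuous_on (?U \<times> ?I) (%x. pol p (Complex (fst x) (snd x)))"
  "continuous_on (?U \<times> ?I) (%x. pol1 p (Complex (fst x) (snd x)))"
  "continuous_on (?U \<times> ?I) (%x. pol2 p (Complex (fst x) (snd x)))"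
  unfolding pol_def icay_def pol1_def pol2_def
  by (intro continuous_intros cS; use exp_ne_1 in fastforce)+
 have cc: "continuous_on (?U \<times> ?I) (%x. h (pol p (Complex (fst x) (snd x))))" if "continuous_on uhp h" for h :: "complex => real"
  by (rule continuous_on_compose2[OF that cpol(1)]) (use U in auto)
 have ch: "continuous_on uhp f" "continuous_on uhp (px f)" "continuous_on uhp (py f)"
   "continuous_on uhp (px (px f))" "continuous_on uhp (py (px f))" "continuous_on uhp (px (py f))" "continuous_on uhp (py (py f))"
  using C2 unfolding C2_on_uhp_def by (auto intro: differentiable_imp_continuous_on)
 define Fs where "Fs s t = px f (pol p (Complex s t)) * Re (pol1 p (Complex s t)) + py f (pol p (Complex s t)) * Im (pol1 p (Complex s t))" for s t
 define Ft where "Ft s t = py f (pol p (Complex s t)) * Re (pol1 p (Complex s t)) - px f (pol p (Complex s t)) * Im (pol1 p (Complex s t))" for s t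
 define Fss where "Fss s t = (px (px f) (pol p (Complex s t)) * Re (pol1 p (Complex s t)) + py (px f) (pol p (Complex s t)) * Im (pol1 p (Complex s t))) * Re (pol1 p (Complex s t))
   + px f (pol p (Complex s t)) * Re (pol2 p (Complex s t))
   + ((px (py f) (pol p (Complex s t)) * Re (pol1 p (Complex s t)) + py (py f) (pol p (Complex s t)) * Im (pol1 p (Complex s t))) * Im (pol1 p (Complex s t))
   + py f (pol p (Complex s t)) * Im (pol2 p (Complex s t)))" for s t
 define Ftt where "Ftt s t = (py (py f) (pol p (Complex s t)) * Re (pol1 p (Complex s t)) - px (py f) (pol p (Complex s t)) * Im (pol1 p (Complex s t))) * Re (pol1 p (Complex s t))
   + py f (pol p (Complex s t)) * (- Im (pol2 p (Complex s t)))
   - ((py (px f) (pol p (Complex s t)) * Re (pol1 p (Complex s t)) - px (px f) (pol p (Complex s t)) * Im (pol1 p (Complex s t))) * Im (pol1 p (Complex s t))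
   + px f (pol p (Complex s t)) * Re (pol2 p (Complex s t)))" for s t
 have dF: "((%s. f (pol p (Complex s t))) has_real_derivative Fs s t) (at s)" if "s < 0" for s t
  unfolding Fs_def using chain_horizontal[of f "pol p" s t "pol1 p (Complex s t)"] C2D[OF C2 U[OF that]] pol_deriv[of "Complex s t"] that by simp
 have dFt: "((%t. f (pol p (Complex s t))) has_real_derivative Ft s t) (at t)" if "s < 0" for s t
  unfolding Ft_def using chain_vertical[of f "pol p" s t "pol1 p (Complex s t)"] C2D[OF C2 U[OF that]] pol_deriv[of "Complex s t"] that by simp
 have dFs: "((%s. Fs s t) has_real_derivative Fss s t) (at s)" if "s < 0" for s t
 proof -
  have d0: "(pol p has_field_derivative pol1 p (Complex s t)) (at (Complex s t))" "(pol1 p has_field_derivative pol2 p (Complex s t)) (at (Complex s t))"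
   using pol_deriv[of "Complex s t"] pol1_deriv[of "Complex s t"] that by auto
  note d = chain_horizontal[OF C2D(2)[OF C2 U[OF that]] d0(1)] chain_horizontal[OF C2D(3)[OF C2 U[OF that]] d0(1)] field_derivative_horizontal[OF d0(2)]
  show ?thesis unfolding Fs_def[abs_def] Fss_def
   by (rule DERIV_cong[OF DERIV_add[OF DERIV_mult[OF d(1) d(3)] DERIV_mult[OF d(2) d(4)]]]) (simp add: algebra_simps)
 qed
 have dFtt: "((%t. Ft s t) has_real_derivative Ftt s t) (at t)" if "s < 0" for s t
 proof -
  have d0: "(pol p has_field_derivative pol1 p (Complex s t)) (at (Complex s t))" "(pol1 p has_field_derivative pol2 p (Complex s t)) (at (Complex s t))"
   using pol_deriv[of "Complex s t"] pol1_deriv[of "Complex s t"] that by auto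
  note d = chain_vertical[OF C2D(2)[OF C2 U[OF that]] d0(1)] chain_vertical[OF C2D(3)[OF C2 U[OF that]] d0(1)] field_derivative_vertical[OF d0(2)]
  show ?thesis unfolding Ft_def[abs_def] Ftt_def
   by (rule DERIV_cong[OF DERIV_diff[OF DERIV_mult[OF d(2) d(3)] DERIV_mult[OF d(1) d(4)]]]) (simp add: algebra_simps)
 qed
 \<comment> \<open>By the Cauchy-Riemann equations the terms with \<open>pol2\<close> and the mixed
   partials cancel in \<open>Fss + Ftt\<close>, leaving the flat Laplacian of \<open>f\<close> times
   \<open>|pol1|^2\<close>.\<close>
 have sum: "Fss s t = - Ftt s t - lam * f (pol p (Complex s t)) / (sinh s)^2" if "s < 0" for s t
 proof -
  let ?z = "pol p (Complex s t)" and ?d = "pol1 p (Complex s t)"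
  have "Fss s t + Ftt s t = (px (px f) ?z + py (py f) ?z) * ((Re ?d)^2 + (Im ?d)^2)"
   unfolding Fss_def Ftt_def by (simp add: power2_eq_square algebra_simps)
  also have "(Re ?d)^2 + (Im ?d)^2 = (cmod ?d)^2" by (simp add: cmod_power2)
  also have "(cmod ?d)^2 = (Im ?z)^2 / (sinh s)^2"
   using pol_conformal[OF p, of "Complex s t"] U[OF that, of t] that by (simp add: uhp_iff field_simps)
  also have "(px (px f) ?z + py (py f) ?z) * ((Im ?z)^2 / (sinh s)^2) = - hyp_laplacian f ?z / (sinh s)^2"
   by (simp add: hyp_laplacian_def)
  also have "hyp_laplacian f ?z = lam * f ?z" using eig U[OF that] by (simp add: eigen_on_def)
  finally show ?thesis by simp
 qed
 have cI: "continuous_on ?I (%t. (s, t)) " for s :: real by (intro continuous_intros)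
 have slice: "continuous_on ?I (%t. h s t)" if "continuous_on (?U \<times> ?I) (%x. h (fst x) (snd x))" "s < 0" for h :: "real => real => real" and s
  using continuous_on_compose2[OF that(1) cI[of s]] that(2) by auto
 have cFs: "continuous_on (?U \<times> ?I) (%x. Fs (fst x) (snd x))" unfolding Fs_def
  by (intro continuous_intros cc cpol ch)
 have cFss: "continuous_on (?U \<times> ?I) (%x. Fss (fst x) (snd x))" unfolding Fss_def
  by (intro continuous_intros cc cpol ch)
 have cFtt: "continuous_on (?U \<times> ?I) (%x. Ftt (fst x) (snd x))" unfolding Ftt_def
  by (intro continuous_intros cc cpol ch)
 have cF: "continuous_on (?U \<times> ?I) (%x. f (pol p (Complex (fst x) (snd x))))" by (intro cc ch)
 have atU: "at s within ?U = at s" by (rule at_within_open) (use s in auto)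
 have "((%s. integral (cbox 0 (2*pi)) (%t. f (pol p (Complex s t)))) has_field_derivative integral (cbox 0 (2*pi)) (Fs s)) (at s within ?U)"
 proof (rule leibniz_rule_field_derivative)
  show "((%x. f (pol p (Complex x t))) has_field_derivative Fs x t) (at x within ?U)" if "x : ?U" for x t
   using dF[of x t] that has_field_derivative_at_within by auto
  show "(%t. f (pol p (Complex x t))) integrable_on cbox 0 (2*pi)" if "x : ?U" for x
   using slice[OF cF] that by (auto intro!: integrable_continuous_real)
  show "continuous_on (?U \<times> cbox 0 (2*pi)) (%(x, t). Fs x t)" using cFs by (simp add: split_beta')
 qed (use s in auto)
 then show "(sph f p has_real_derivative sph1 f p s) (at s)"
  unfolding atU sph_def[abs_def] sph1_def Fs_def by simp
 have "((%s. integral (cbox 0 (2*pi)) (Fs s)) has_field_derivative integral (cbox 0 (2*pi)) (Fss s)) (at s within ?U)"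
 proof (rule leibniz_rule_field_derivative)
  show "((%x. Fs x t) has_field_derivative Fss x t) (at x within ?U)" if "x : ?U" for x t
   using dFs[of x t] that has_field_derivative_at_within by auto
  show "Fs x integrable_on cbox 0 (2*pi)" if "x : ?U" for x
   using slice[OF cFs] that by (auto intro!: integrable_continuous_real)
  show "continuous_on (?U \<times> cbox 0 (2*pi)) (%(x, t). Fss x t)" using cFss by (simp add: split_beta')
 qed (use s in auto)
 moreover have "integral (cbox 0 (2*pi)) (Fss s) = - lam * sph f p s / (sinh s)^2"
 proof -
  have "(Ftt s has_integral (Ft s (2*pi) - Ft s 0)) {0..2*pi}"
   by (rule fundamental_theorem_of_calculus)
    (use dFtt[OF s] in "auto simp: has_real_derivative_iff_has_vector_derivative[symmetric] intro: has_field_derivative_at_within")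
  then have i1: "(Ftt s has_integral 0) {0..2*pi}" by (simp add: Ft_def pol_periodic)
  have i2: "((%t. f (pol p (Complex s t))) has_integral sph f p s) {0..2*pi}"
   unfolding sph_def using slice[OF cF s] by (intro integrable_integral integrable_continuous_real)
  have "((%t. - Ftt s t - (lam / (sinh s)^2) * f (pol p (Complex s t))) has_integral (- 0 - (lam / (sinh s)^2) * sph f p s)) {0..2*pi}"
   by (intro has_integral_diff has_integral_neg has_integral_mult_right i1 i2)
  then have "(Fss s has_integral (- lam * sph f p s / (sinh s)^2)) {0..2*pi}"
   by (rule has_integral_eq_rhs[OF has_integral_eq[rotated]]) (simp_all add: sum[OF s])
  then show ?thesis by (simp add: integral_unique)
 qed
 ultimately show "(sph1 f p has_real_derivative - lam * sph f p s / (sinh s)^2) (at s)"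
  unfolding atU sph1_def[abs_def] Fs_def by simp
qed

lemma pol_near:
 assumes p: "p : uhp" and e: "e > 0"
 shows "EX s0<0. ALL s<s0. ALL t. cmod (pol p (Complex s t) - p) < e & cmod (pol1 p (Complex s t)) < e"
proof -
 define y where "y = Im p"
 have y: "y > 0" using p by (simp add: y_def uhp_iff)
 \<comment> \<open>\<open>exp s < 1/2\<close> gives \<open>|1 - w| > 1/2\<close>; the two quantities
   are then at most \<open>4 y exp s\<close> and \<open>8 y exp s\<close>, both below
   \<open>e\<close>.\<close>
 define s0 where "s0 = ln (min (1/2) (e / (8 * y)))"
 have m: "min (1/2) (e / (8 * y)) > 0" using e y by simp
 have "s0 < 0" unfolding s0_def using m by (intro ln_less_zero) auto
 moreover have "cmod (pol p (Complex s t) - p) < e & cmod (pol1 p (Complex s t)) < e" if "s < s0" for s t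
 proof -
  define w where "w = exp (Complex s t)"
  have "exp s < exp s0" using that by simp
  then have es: "exp s < 1/2" "exp s < e / (8 * y)" using m by (auto simp: s0_def)
  have nw: "cmod w = exp s" by (simp add: w_def)
  have n1: "cmod (1 - w) > 1/2" using norm_triangle_ineq2[of 1 w] es nw by simp
  then have nz: "1 - w ~= 0" by auto
  have d: "pol p (Complex s t) - p = w * (p - cnj p) / (1 - w)"
   using nz by (simp add: pol_def icay_def w_def field_simps)
  have pc: "cmod (p - cnj p) = 2 * y" using y by (simp add: complex_diff_cnj norm_mult y_def)
  have "cmod (pol p (Complex s t) - p) = exp s * (2 * y) / cmod (1 - w)"
   unfolding d by (simp add: norm_mult norm_divide nw pc)
  also have "... <= exp s * (2 * y) / (1/2)" using n1 y by (intro divide_left_mono) auto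
  also have "... < e" using es(2) y e by (simp add: field_simps)
  finally have 1: "cmod (pol p (Complex s t) - p) < e" .
  have "cmod (pol1 p (Complex s t)) = 2 * y * exp s / (cmod (1 - w))^2"
   unfolding pol1_def w_def[symmetric] y_def[symmetric] using y by (simp add: norm_mult norm_divide norm_power nw)
  also have "... <= 2 * y * exp s / (1/4)"
  proof (rule divide_left_mono)
   have "(1/2)^2 <= (cmod (1 - w))^2" by (rule power_mono) (use n1 in auto)
   then show "1/4 <= (cmod (1 - w))^2" by (simp add: power2_eq_square)
   show "0 <= 2 * y * exp s" using y by simp
   show "0 < (cmod (1 - w))^2 * (1/4)" using nz by simp
  qed
  also have "... < e" using es(2) y by (simp add: field_simps)
  finally show ?thesis using 1 by simp
 qed
 ultimately show ?thesis by blast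
qed

lemma continuous_pol_slice:
 assumes p: "p : uhp" and s: "s < 0" and h: "continuous_on uhp (h::complex => real)"
 shows "continuous_on A (%t. h (pol p (Complex s t)))" "continuous_on A (%t. pol1 p (Complex s t))"
proof -
 have c: "continuous_on A (%t. Complex s t)" unfolding Complex_eq by (intro continuous_intros)
 have "continuous_on A (%t. pol p (Complex s t))" unfolding pol_def icay_def
  by (intro continuous_intros c) (use exp_ne_1 s in fastforce)
 then show "continuous_on A (%t. h (pol p (Complex s t)))"
  by (rule continuous_on_compose2[OF h]) (use pol_in_uhp[OF p] s in auto)
 show "continuous_on A (%t. pol1 p (Complex s t))" unfolding pol1_def
  by (intro continuous_intros c) (use exp_ne_1 s in fastforce)
qed

lemma integral_const_bound:
 assumes "continuous_on {0..2*pi} g" "!!t. t : {0..2*pi} ==> \<bar>g t\<bar> <= (B::real)"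
 shows "\<bar>integral {0..2*pi} g\<bar> <= 2 * pi * B"
proof -
 have "norm (integral {0..2*pi} g) <= integral {0..2*pi} (%_. B)"
  by (rule integral_norm_bound_integral) (use assms in "auto intro: integrable_continuous_real")
 then show ?thesis by simp
qed

text \<open>Boundary values at the centre; they single out the regular solution of the radial
  equation.\<close>

lemma sph_limits:
 assumes C2: "C2_on_uhp f" and p: "p : uhp"
 shows "(sph f p \<longlongrightarrow> 2 * pi * f p) at_bot" "(sph1 f p \<longlongrightarrow> 0) at_bot"
proof -
 have ch: "continuous_on uhp f" "continuous_on uhp (px f)" "continuous_on uhp (py f)"
  using C2 unfolding C2_on_uhp_def by (auto intro: differentiable_imp_continuous_on)
 have near: "EX s0<0. ALL s<s0. ALL t. \<bar>h (pol p (Complex s t)) - h p\<bar> < e & cmod (pol1 p (Complex s t)) < e" if ch0: "continuous_on uhp h" and e: "e > 0" for h :: "complex => real" and e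
 proof -
  have "isCont h p" using ch0 p open_uhp continuous_on_eq_continuous_at by blast
  then obtain d where d: "d > 0" "!!z. cmod (z - p) < d ==> \<bar>h z - h p\<bar> < e"
   using e unfolding continuous_at_eps_delta by (metis dist_norm real_norm_def)
  then obtain s0 where "s0 < 0" "ALL s<s0. ALL t. cmod (pol p (Complex s t) - p) < min d e & cmod (pol1 p (Complex s t)) < min d e"
   using pol_near[OF p, of "min d e"] e by auto
  then show ?thesis using d by (intro exI[of _ s0]) auto
 qed
 show "(sph f p \<longlongrightarrow> 2 * pi * f p) at_bot"
 proof (rule tendstoI)
  fix e :: real assume e: "e > 0"
  obtain s0 where s0: "s0 < 0" "!!s t. s < s0 ==> \<bar>f (pol p (Complex s t)) - f p\<bar> < e / 10"
   using near[OF ch(1), of "e/10"] e by auto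
  have "dist (sph f p s) (2 * pi * f p) < e" if "s < s0" for s
  proof -
   have c: "continuous_on {0..2*pi} (%t. f (pol p (Complex s t)))" using continuous_pol_slice(1)[OF p _ ch(1)] that s0 by auto
   have "sph f p s - 2 * pi * f p = integral {0..2*pi} (%t. f (pol p (Complex s t)) - f p)"
    unfolding sph_def using c by (subst integral_diff) (auto intro: integrable_continuous_real)
   moreover have "\<bar>...\<bar> <= 2 * pi * (e / 10)"
    by (rule integral_const_bound) (use c s0(2)[OF that] in "auto intro!: continuous_intros less_imp_le")
   moreover have "2 * pi * (e / 10) < e" using e pi_less_4 by simp
   ultimately show ?thesis by (simp add: dist_real_def)
  qed
  then show "\<forall>\<^sub>F s in at_bot. dist (sph f p s) (2 * pi * f p) < e"
   unfolding eventually_at_bot_linorder by (intro exI[of _ "s0 - 1"]) auto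
 qed
 show "(sph1 f p \<longlongrightarrow> 0) at_bot"
 proof (rule tendstoI)
  fix e :: real assume e: "e > 0"
  define B where "B = \<bar>px f p\<bar> + \<bar>py f p\<bar> + 2"
  have B: "B > 0" by (simp add: B_def add_nonneg_pos)
  define d where "d = min 1 (e / (10 * B))"
  have d: "d > 0" "d <= 1" "d * B <= e / 10" using e B by (auto simp: d_def min_def field_simps)
  obtain s1 where s1: "s1 < 0" "!!s t. s < s1 ==> \<bar>px f (pol p (Complex s t)) - px f p\<bar> < d & cmod (pol1 p (Complex s t)) < d"
   using near[OF ch(2) d(1)] by auto
  obtain s2 where s2: "s2 < 0" "!!s t. s < s2 ==> \<bar>py f (pol p (Complex s t)) - py f p\<bar> < d & cmod (pol1 p (Complex s t)) < d"
   using near[OF ch(3) d(1)] by auto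
  have key: "dist (sph1 f p s) 0 < e" if "s < min s1 s2" for s
  proof -
   have s: "s < 0" using that s1 by simp
   have "\<bar>sph1 f p s\<bar> <= 2 * pi * (e / 10)" unfolding sph1_def
   proof (rule integral_const_bound)
    show "continuous_on {0..2 * pi} (%t. px f (pol p (Complex s t)) * Re (pol1 p (Complex s t)) + py f (pol p (Complex s t)) * Im (pol1 p (Complex s t)))"
     by (intro continuous_intros continuous_pol_slice(1)[OF p s ch(2)] continuous_pol_slice(1)[OF p s ch(3)] continuous_pol_slice(2)[OF p s ch(1)])
    fix t
    let ?a = "px f (pol p (Complex s t))" and ?b = "py f (pol p (Complex s t))" and ?g = "pol1 p (Complex s t)"
    have n: "\<bar>?a\<bar> <= \<bar>px f p\<bar> + 1" "\<bar>?b\<bar> <= \<bar>py f p\<bar> + 1" "cmod ?g <= d"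
     using s1(2)[of s t] s2(2)[of s t] that d by auto
    have "\<bar>?a * Re ?g + ?b * Im ?g\<bar> <= \<bar>?a\<bar> * \<bar>Re ?g\<bar> + \<bar>?b\<bar> * \<bar>Im ?g\<bar>"
     by (metis abs_mult abs_triangle_ineq)
    also have "... <= (\<bar>px f p\<bar> + 1) * d + (\<bar>py f p\<bar> + 1) * d"
     using n abs_Re_le_cmod[of ?g] abs_Im_le_cmod[of ?g] by (intro add_mono mult_mono) auto
    also have "... = d * B" by (simp add: B_def algebra_simps)
    finally show "\<bar>?a * Re ?g + ?b * Im ?g\<bar> <= e / 10" using d(3) by simp
   qed
   moreover have "2 * pi * (e / 10) < e" using e pi_less_4 by simp
   ultimately show ?thesis by simp
  qed
  then show "\<forall>\<^sub>F s in at_bot. dist (sph1 f p s) 0 < e"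
   unfolding eventually_at_bot_linorder by (intro exI[of _ "min s1 s2 - 1"] allI impI key) linarith
 qed
qed

text \<open>The centre is at minus infinity, so initial conditions take the form of limits there,
  combined with the sign of a derivative.\<close>

lemma mono_from_bot:
 fixes f :: "real => real"
 assumes der: "!!s. s < 0 ==> (f has_real_derivative f' s) (at s)" and f': "!!s. s < 0 ==> f' s >= 0"
  and lim: "(f \<longlongrightarrow> L) at_bot" and s: "s < 0"
 shows "f s >= L"
proof (rule tendsto_upperbound[OF lim])
 have "f x <= f s" if "x <= s" for x
  by (rule DERIV_nonneg_imp_nondecreasing[OF that]) (use der f' s in "meson order_le_less_trans")
 then show "\<forall>\<^sub>F x in at_bot. f x <= f s" unfolding eventually_at_bot_linorder by blast
qed simp

lemma mono_from_bot_strict: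
 fixes f :: "real => real"
 assumes der: "!!s. s < 0 ==> (f has_real_derivative f' s) (at s)" and f': "!!s. s < 0 ==> f' s > 0"
  and lim: "(f \<longlongrightarrow> L) at_bot" and s: "s < 0"
 shows "f s > L"
proof -
 have "f (s - 1) >= L" by (rule mono_from_bot[OF der _ lim]) (use f' s in "auto intro: less_imp_le")
 moreover have "f (s - 1) < f s"
  by (rule DERIV_pos_imp_increasing) (use der f' s in "auto, meson order_le_less_trans")
 ultimately show ?thesis by simp
qed

text \<open>For \<open>sg = 1/2 + sqrt (1/4 - lam)\<close> the eigenvalue is \<open>lam\<close>: an
  explicit positive eigenfunction for every \<open>lam <= 1/4\<close>.\<close>

lemma eigen_Im_powr: "eigen_on (%z. Im z powr sg) (sg * (1 - sg))"
proof -
 have x: "px (%z. h (Im z)) = (%z. 0)" for h :: "real => real" by (rule ext) (simp add: px_def)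
 have pe: "py h z = d" if "((%t. h (Complex (Re z) t)) has_real_derivative d) (at (Im z))" for h z d
  using that by (simp add: py_def DERIV_imp_deriv)
 have y1: "py (%z. Im z powr ta) z = ta * Im z powr (ta - 1)" if "z : uhp" for ta z
  by (rule pe) (use that in "auto simp: uhp_iff intro!: derivative_eq_intros")
 have y2: "((%t. py (%z. Im z powr sg) (Complex (Re z) t)) has_real_derivative sg * ((sg - 1) * Im z powr (sg - 2))) (at (Im z))" if z: "z : uhp" for z
 proof (rule has_field_derivative_transform_within_open)
  show "((%t. sg * t powr (sg - 1)) has_real_derivative sg * ((sg - 1) * Im z powr (sg - 2))) (at (Im z))"
   using z by (auto simp: uhp_iff intro!: derivative_eq_intros)
  show "open {0::real<..}" "Im z : {0<..}" using z by (auto simp: uhp_iff)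
  show "sg * t powr (sg - 1) = py (%z. Im z powr sg) (Complex (Re z) t)" if "t : {0<..}" for t
   using y1[of "Complex (Re z) t" sg] that by (simp add: uhp_iff)
 qed
 have yy: "py (py (%z. Im z powr sg)) z = sg * ((sg - 1) * Im z powr (sg - 2))" if "z : uhp" for z
  by (rule pe[OF y2[OF that]])
 have xy: "px (py (%z. Im z powr sg)) z = 0" if "z : uhp" for z
 proof -
  have "(%t. py (%z. Im z powr sg) (Complex t (Im z))) = (%t. sg * Im z powr (sg - 1))"
   using y1[of "Complex _ (Im z)" sg] that by (auto simp: uhp_iff)
  then show ?thesis by (simp add: px_def)
 qed
 have dI: "(%z. c * Im z powr ta) differentiable_on uhp" for c ta
  unfolding differentiable_on_eq_differentiable_at[OF open_uhp]
 proof
  fix z assume "z : uhp"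
  have I: "(Im has_derivative Im) (at z)" using bounded_linear_imp_has_derivative[OF bounded_linear_Im] by simp
  have "((%u. c * u powr ta) has_derivative (*) (c * (ta * Im z powr (ta - 1)))) (at (Im z))"
   unfolding has_field_derivative_def[symmetric] using \<open>z : uhp\<close> by (auto simp: uhp_iff intro!: derivative_eq_intros)
  from has_derivative_compose[OF I this] show "(%z. c * Im z powr ta) differentiable at z" by (auto simp: differentiable_def)
 qed
 have c0: "continuous_on uhp (%z. c * Im z powr ta)" for c ta using differentiable_imp_continuous_on[OF dI] .
 have py0: "py (%z. 0) = (%z. 0)" "px (%z. 0) = (%z. 0)" by (auto simp: py_def px_def fun_eq_iff)
 have "C2_on_uhp (%z. Im z powr sg)"
  unfolding C2_on_uhp_def x[of "%u. u powr sg"] py0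
 proof (intro conjI)
  show "(%z. Im z powr sg) differentiable_on uhp" using dI[of 1 sg] by simp
  show "py (%z. Im z powr sg) differentiable_on uhp"
   unfolding differentiable_on_eq_differentiable_at[OF open_uhp]
  proof
   fix z assume z: "z : uhp"
   have "(%z. sg * Im z powr (sg - 1)) differentiable at z"
    using dI z unfolding differentiable_on_eq_differentiable_at[OF open_uhp] by blast
   then obtain D where "((%z. sg * Im z powr (sg - 1)) has_derivative D) (at z)" by (auto simp: differentiable_def)
   then have "(py (%z. Im z powr sg) has_derivative D) (at z)"
    by (rule has_derivative_transform_within_open[OF _ open_uhp z]) (simp add: y1)
   then show "py (%z. Im z powr sg) differentiable at z" by (auto simp: differentiable_def)
  qed
  show "continuous_on uhp (px (py (%z. Im z powr sg)))" using xy continuous_on_cong[OF refl, of uhp "px (py (%z. Im z powr sg))" "%z. 0"] by simp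
  have "continuous_on uhp (%z. (sg * (sg - 1)) * Im z powr (sg - 2))" by (rule c0)
  then show "continuous_on uhp (py (py (%z. Im z powr sg)))"
   using yy continuous_on_cong[OF refl, of uhp "py (py (%z. Im z powr sg))" "%z. (sg * (sg - 1)) * Im z powr (sg - 2)"] by simp
 qed auto
 moreover have "hyp_laplacian (%z. Im z powr sg) z = sg * (1 - sg) * Im z powr sg" if z: "z : uhp" for z
 proof -
  have "(Im z)^2 * Im z powr (sg - 2) = Im z powr sg"
   using z by (simp add: uhp_iff powr_diff)
  moreover have "hyp_laplacian (%z. Im z powr sg) z = sg * (1 - sg) * ((Im z)^2 * Im z powr (sg - 2))"
   unfolding hyp_laplacian_def x[of "%u. u powr sg"] py0 yy[OF z] by (simp add: algebra_simps)
  ultimately show ?thesis by simp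
 qed
 ultimately show ?thesis by (simp add: eigen_on_def)
qed

section \<open>The hyperbolic area measure\<close>

lemma lborel_complex_pair: "lborel = distr (lborel \<Otimes>\<^sub>M lborel) borel (%(x, y). Complex x y)"
proof (rule lborel_eqI)
 have m: "(%(x, y). Complex x y) : borel_measurable (lborel \<Otimes>\<^sub>M lborel)"
  unfolding lborel_prod split_beta' Complex_eq
  by (simp, intro borel_measurable_continuous_onI continuous_intros)
 fix l u :: complex assume le: "!!b. b : Basis ==> l \<bullet> b <= u \<bullet> b"
 have le': "Re l <= Re u" "Im l <= Im u" using le[of 1] le[of \<i>] by (auto simp: Basis_complex_def)
 have "(%(x, y). Complex x y) -` box l u \<inter> space (lborel \<Otimes>\<^sub>M lborel) = {Re l <..< Re u} \<times> {Im l <..< Im u}"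
  by (auto simp: in_box_complex_iff space_pair_measure)
 then show "emeasure (distr (lborel \<Otimes>\<^sub>M lborel) borel (%(x, y). Complex x y)) (box l u) = (\<Prod>b\<in>Basis. (u - l) \<bullet> b)"
  using le' by (simp add: emeasure_distr[OF m] lborel.emeasure_pair_measure_Times Basis_complex_def ennreal_mult)
qed simp

lemma nn_integral_complex:
 assumes [measurable]: "f : borel_measurable borel"
 shows "(\<integral>\<^sup>+ z. f z \<partial>lborel) = (\<integral>\<^sup>+ x. \<integral>\<^sup>+ y. f (Complex x y) \<partial>lborel \<partial>lborel)"
proof -
 have m[measurable]: "(%(x, y). Complex x y) : borel_measurable (lborel \<Otimes>\<^sub>M lborel)"
  unfolding lborel_prod split_beta' Complex_eq
  by (simp, intro borel_measurable_continuous_onI continuous_intros)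
 have "(\<integral>\<^sup>+ z. f z \<partial>lborel) = (\<integral>\<^sup>+ p. f (case p of (x, y) => Complex x y) \<partial>(lborel \<Otimes>\<^sub>M lborel))"
  by (subst lborel_complex_pair, subst nn_integral_distr) auto
 also have "... = (\<integral>\<^sup>+ x. \<integral>\<^sup>+ y. f (case (x,y) of (x, y) => Complex x y) \<partial>lborel \<partial>lborel)"
  by (rule lborel.nn_integral_fst[symmetric]) measurable
 finally show ?thesis by simp
qed

section \<open>Change of variables under holomorphic maps\<close>

definition vc :: "real^2 => complex" where "vc v = Complex (v$1) (v$2)"
definition cv :: "complex => real^2" where "cv z = vector [Re z, Im z]"

lemma vc_cv [simp]: "vc (cv z) = z" and cv_vc [simp]: "cv (vc v) = v"
 by (simp_all add: vc_def cv_def vec_eq_iff forall_2)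

lemma linear_vc: "linear vc" and linear_cv: "linear cv"
 by (auto intro!: linearI simp: vc_def cv_def vec_eq_iff forall_2 complex_eq_iff)

lemma lborel_complex_vec: "lborel = distr lborel borel vc"
proof (rule lborel_eqI)
 have m: "vc : borel_measurable borel"
  using linear_vc by (intro borel_measurable_continuous_onI) (simp add: linear_continuous_on linear_conv_bounded_linear)
 fix l u :: complex assume le: "!!b. b : Basis ==> l \<bullet> b <= u \<bullet> b"
 have le': "Re l <= Re u" "Im l <= Im u" using le[of 1] le[of \<i>] by (auto simp: Basis_complex_def)
 have "vc -` box l u = box (cv l) (cv u)"
  by (auto simp: in_box_complex_iff mem_box_cart forall_2 vc_def cv_def)
 moreover have "emeasure lborel (box (cv l) (cv u)) = ennreal ((Re u - Re l) * (Im u - Im l))"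
 proof -
  have B: "(Basis :: (real^2) set) = {axis 1 1, axis 2 1}"
   by (auto simp: Basis_vec_def UNIV_2)
  have ne: "axis 1 1 ~= (axis 2 1 :: real^2)" by (simp add: axis_eq_axis)
  have "emeasure lborel (box (cv l) (cv u)) = (\<Prod>b\<in>Basis. (cv u - cv l) \<bullet> b)"
  proof (rule emeasure_lborel_box)
   fix b :: "real^2" assume "b : Basis"
   then consider "b = axis 1 1" | "b = axis 2 1" unfolding B by auto
   then show "cv l \<bullet> b <= cv u \<bullet> b" by cases (simp_all add: inner_axis cv_def le')
  qed
  also have "(\<Prod>b\<in>Basis. (cv u - cv l) \<bullet> b) = (Re u - Re l) * (Im u - Im l)"
   unfolding B using ne by (simp add: inner_axis cv_def)
  finally show ?thesis .
 qed
 ultimately show "emeasure (distr lborel borel vc) (box l u) = (\<Prod>b\<in>Basis. (u - l) \<bullet> b)"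
  using m by (simp add: emeasure_distr Basis_complex_def)
qed simp

lemma nn_integral_vec:
 assumes "f : borel_measurable borel"
 shows "(\<integral>\<^sup>+ z. f z \<partial>lborel) = (\<integral>\<^sup>+ v. f (vc v) \<partial>lborel)"
proof -
 have m: "vc : borel_measurable borel"
  using linear_vc by (intro borel_measurable_continuous_onI) (simp add: linear_continuous_on linear_conv_bounded_linear)
 show ?thesis by (subst lborel_complex_vec, subst nn_integral_distr) (use m assms in auto)
qed

text \<open>A holomorphic map has real Jacobian \<open>|g'|^2\<close>. The substitution rule is
  applied on \<open>real^2\<close>, to which \<open>vc\<close> and \<open>cv\<close> carry the
  integrals; it compares integrals with a finite value.\<close>

lemma nn_integral_holomorphic_image:
 fixes g :: "complex => complex" and f :: "complex => real"
 assumes S[measurable]: "S : sets borel" and gS: "g ` S : sets borel"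
  and der: "!!z. z : S ==> (g has_field_derivative g' z) (at z)"
  and cg': "continuous_on S g'" and inj: "inj_on g S"
  and f: "f : borel_measurable borel" "!!z. 0 <= f z"
 shows "(\<integral>\<^sup>+ z. ennreal (f z) * indicator (g ` S) z \<partial>lborel) = (\<integral>\<^sup>+ z. ennreal ((cmod (g' z))^2 * f (g z)) * indicator S z \<partial>lborel)"
proof -
 define F where "F v = f (vc v)" for v
 define G where "G v = cv (g (vc v))" for v
 define T where "T = vc -` S"
 define J where "J v = (cmod (g' (vc v)))^2" for v
 have bl: "bounded_linear vc" "bounded_linear cv" using linear_vc linear_cv by (simp_all add: linear_conv_bounded_linear)
 have mvc[measurable]: "vc : borel_measurable borel"
  by (intro borel_measurable_continuous_onI) (simp add: bl linear_continuous_on)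
 have oT[measurable]: "T : sets borel" unfolding T_def using measurable_sets[OF mvc S] by simp
 have lT: "T : sets lebesgue" using oT by simp
 have GT: "G ` T = vc -` (g ` S)"
 proof (intro equalityI subsetI)
  fix x assume "x : vc -` g ` S"
  then obtain y where "y : S" "vc x = g y" by auto
  then have "x = G (cv y)" "cv y : T" by (auto simp: G_def T_def) (metis cv_vc)
  then show "x : G ` T" by blast
 qed (auto simp: G_def T_def)
 have [measurable]: "G ` T : sets borel" unfolding GT using measurable_sets[OF mvc gS] by simp
 have derG: "(G has_derivative (%h. cv (g' (vc v) * vc h))) (at v within T)" if "v : T" for v
 proof -
  have "(g has_derivative (*) (g' (vc v))) (at (vc v))"
   using der[of "vc v"] that by (simp add: T_def has_field_derivative_def)
  from has_derivative_compose[OF bounded_linear_imp_has_derivative[OF bl(1)] this]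
  have "((%v. g (vc v)) has_derivative (%h. g' (vc v) * vc h)) (at v within T)" .
  from has_derivative_compose[OF this bounded_linear_imp_has_derivative[OF bl(2)]]
  show ?thesis by (simp add: G_def[abs_def])
 qed
 have det: "\<bar>det (matrix (%h. cv (c * vc h)))\<bar> = (cmod c)^2" for c
  unfolding cmod_power2 by (simp add: det_2 matrix_def cv_def vc_def axis_def power2_eq_square)
 have injG: "inj_on G T" using inj by (auto simp: inj_on_def G_def T_def) (metis cv_vc vc_cv)
 have cov: "((%v. J v * F (G v)) absolutely_integrable_on T & integral T (%v. J v * F (G v)) = b)
  \<longleftrightarrow> (F absolutely_integrable_on (G ` T) & integral (G ` T) F = b)" for b
  using has_absolute_integral_change_of_variables[of T G "%v h. cv (g' (vc v) * vc h)" "%v. vec (F v) :: real^1" "vec b"] lT derG injG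
  by (simp add: det J_def absolutely_integrable_on_1_iff integral_on_1_eq vec_eq_iff)
 have hi: "(h absolutely_integrable_on A & integral A h = b) \<longleftrightarrow> (h has_integral b) A" if "!!x. x : A ==> 0 <= h x" for A b and h :: "real^2 => real"
  unfolding has_integral_iff using nonnegative_absolutely_integrable_1[of h A] that by (metis absolutely_integrable_on_def)
 have F0: "F v >= 0" "J v >= 0" for v by (auto simp: F_def f J_def)
 have cov2: "((%v. J v * F (G v)) has_integral b) T \<longleftrightarrow> (F has_integral b) (G ` T)" for b
  using cov[of b] hi[of T "%v. J v * F (G v)" b] hi[of "G ` T" F b] F0 by simp
 have [measurable]: "F : borel_measurable borel" unfolding F_def using f by measurable
 define H where "H v = indicator T v * (J v * F (G v))" for v
 define h where "h z = indicator S z * ((cmod (g' z))^2 * f (g z))" for z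
 have mh[measurable]: "h : borel_measurable borel"
 proof -
  have cg: "continuous_on S g" using der by (meson DERIV_isCont continuous_at_imp_continuous_on)
  have 1: "(%z. indicator S z *\<^sub>R g z) : borel_measurable borel" "(%z. indicator S z *\<^sub>R g' z) : borel_measurable borel"
   by (rule borel_measurable_continuous_on_indicator; use S cg cg' in auto)+
  have "h = (%z. indicator S z * ((cmod (indicator S z *\<^sub>R g' z))^2 * f (indicator S z *\<^sub>R g z)))"
   by (auto simp: h_def indicator_def)
  moreover have "... : borel_measurable borel" using 1 S f(1) by measurable
  ultimately show ?thesis by simp
 qed
 have Hh: "H = (%v. h (vc v))" by (auto simp: H_def h_def T_def indicator_def J_def F_def G_def)
 have [measurable]: "H : borel_measurable borel" unfolding Hh by measurable
 have R: "(\<integral>\<^sup>+ z. ennreal ((cmod (g' z))^2 * f (g z)) * indicator S z \<partial>lborel) = (\<integral>\<^sup>+ v. ennreal (H v) \<partial>lborel)"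
 proof -
  have "(\<integral>\<^sup>+ z. ennreal ((cmod (g' z))^2 * f (g z)) * indicator S z \<partial>lborel) = (\<integral>\<^sup>+ z. ennreal (h z) \<partial>lborel)"
   by (intro nn_integral_cong) (auto simp: h_def indicator_def)
  also have "... = (\<integral>\<^sup>+ v. ennreal (h (vc v)) \<partial>lborel)" by (rule nn_integral_vec) measurable
  finally show ?thesis by (simp add: Hh)
 qed
 define L where "L v = indicator (G ` T) v * F v" for v
 have [measurable]: "L : borel_measurable borel" unfolding L_def by measurable
 have Lf: "(\<integral>\<^sup>+ z. ennreal (f z) * indicator (g ` S) z \<partial>lborel) = (\<integral>\<^sup>+ v. ennreal (L v) \<partial>lborel)"
 proof -
  have "(\<integral>\<^sup>+ z. ennreal (f z) * indicator (g ` S) z \<partial>lborel) = (\<integral>\<^sup>+ v. ennreal (f (vc v)) * indicator (g ` S) (vc v) \<partial>lborel)"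
   by (rule nn_integral_vec) (use f gS in measurable)
  also have "... = (\<integral>\<^sup>+ v. ennreal (L v) \<partial>lborel)"
   by (intro nn_integral_cong) (auto simp: L_def GT F_def indicator_def)
  finally show ?thesis .
 qed
 have HL: "(H has_integral b) UNIV \<longleftrightarrow> (L has_integral b) UNIV" for b
 proof -
  have "(H has_integral b) UNIV \<longleftrightarrow> ((%v. J v * F (G v)) has_integral b) T"
   unfolding has_integral_restrict_UNIV[symmetric, of "%v. J v * F (G v)"] by (rule has_integral_cong) (auto simp: H_def)
  moreover have "(L has_integral b) UNIV \<longleftrightarrow> (F has_integral b) (G ` T)"
   unfolding has_integral_restrict_UNIV[symmetric, of F] by (rule has_integral_cong) (auto simp: L_def)
  ultimately show ?thesis using cov2 by simp
 qed
 have fin: "(\<integral>\<^sup>+ v. ennreal (k v) \<partial>lborel) = ennreal b \<longleftrightarrow> (k has_integral b) UNIV" if "k : borel_measurable borel" "!!v. 0 <= k v" "b >= 0" for k :: "real^2 => real" and b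
 proof -
  have "k : borel_measurable lebesgue" using measurable_completion[of k lborel borel] that(1) by simp
  then have "(k has_integral b) UNIV \<longleftrightarrow> integral\<^sup>N lebesgue k = ennreal b"
   using has_integral_iff_nn_integral_lebesgue[of k b, OF that(2)] that(3) by simp
  also have "integral\<^sup>N lebesgue k = integral\<^sup>N lborel k"
   by (rule nn_integral_completion)
  finally show ?thesis by simp
 qed
 have pos: "H v >= 0" "L v >= 0" for v using F0 by (auto simp: H_def L_def)
 have "(\<integral>\<^sup>+ v. ennreal (H v) \<partial>lborel) = ennreal b \<longleftrightarrow> (\<integral>\<^sup>+ v. ennreal (L v) \<partial>lborel) = ennreal b" if "b >= 0" for b
  using fin[of H b] fin[of L b] HL[of b] pos that by simp
 note iff = this
 \<comment> \<open>Two values in [0, infinity] that equal the same finite numbers are equal, so the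
   finite rule settles the infinite case too.\<close>
 have ext: "A = B" if h: "!!b. b >= 0 ==> A = ennreal b \<longleftrightarrow> B = ennreal b" for A B :: ennreal
 proof (cases A rule: ennreal_cases)
  case (real r) then show ?thesis using h[of r] by metis
 next
  case top
  note At = this
  show ?thesis
  proof (cases B rule: ennreal_cases)
   case (real r) then show ?thesis using h[of r] by metis
  next
   case top then show ?thesis using At by metis
  qed
 qed
 show ?thesis unfolding R Lf by (rule ext[symmetric]) (rule iff)
qed

text \<open>The rule for indicator functions says that two measures agree; every measurable
  integrand with values in [0, infinity] then has the same integral under both.\<close>

lemma nn_integral_holomorphic_image':
 fixes g :: "complex => complex" and F :: "complex => ennreal"
 assumes S[measurable]: "S : sets borel" and gS[measurable]: "g ` S : sets borel"
  and der: "!!z. z : S ==> (g has_field_derivative g' z) (at z)"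
  and cg': "continuous_on S g'" and inj: "inj_on g S"
  and F[measurable]: "F : borel_measurable borel"
 shows "(\<integral>\<^sup>+ z. F z * indicator (g ` S) z \<partial>lborel) = (\<integral>\<^sup>+ z. ennreal ((cmod (g' z))^2) * F (g z) * indicator S z \<partial>lborel)"
proof -
 have cg: "continuous_on S g" using der by (meson DERIV_isCont continuous_at_imp_continuous_on)
 define G where "G z = indicator S z *\<^sub>R g z" for z
 define J where "J z = (cmod (indicator S z *\<^sub>R g' z))^2" for z
 have [measurable]: "G : borel_measurable borel" unfolding G_def[abs_def]
  by (rule borel_measurable_continuous_on_indicator; use S cg in auto)
 have "(%z. indicator S z *\<^sub>R g' z) : borel_measurable borel"
  by (rule borel_measurable_continuous_on_indicator; use S cg' in auto)
 then have [measurable]: "J : borel_measurable borel" unfolding J_def by measurable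
 have eq: "distr (density lborel (%z. ennreal (J z) * indicator S z)) borel G = density lborel (indicator (g ` S))"
 proof (rule measure_eqI)
  fix A assume "A : sets (distr (density lborel (%z. ennreal (J z) * indicator S z)) borel G)"
  then have A[measurable]: "A : sets borel" by simp
  have "emeasure (distr (density lborel (%z. ennreal (J z) * indicator S z)) borel G) A
    = (\<integral>\<^sup>+ z. ennreal (J z) * indicator S z * indicator (G -` A) z \<partial>lborel)"
   using measurable_sets[of G borel borel A] by (simp add: emeasure_distr emeasure_density)
  also have "... = (\<integral>\<^sup>+ z. ennreal ((cmod (g' z))^2 * indicat_real A (g z)) * indicator S z \<partial>lborel)"
   by (intro nn_integral_cong) (auto simp: indicator_def J_def G_def)
  also have "... = (\<integral>\<^sup>+ z. ennreal (indicat_real A z) * indicator (g ` S) z \<partial>lborel)"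
   by (rule nn_integral_holomorphic_image[symmetric, OF S gS der cg' inj]) auto
  also have "... = emeasure (density lborel (indicator (g ` S))) A"
   by (subst emeasure_density) (auto intro!: nn_integral_cong simp: indicator_def)
  finally show "emeasure (distr (density lborel (%z. ennreal (J z) * indicator S z)) borel G) A = emeasure (density lborel (indicator (g ` S))) A" .
 qed simp
 have "(\<integral>\<^sup>+ z. F z * indicator (g ` S) z \<partial>lborel) = (\<integral>\<^sup>+ z. F z \<partial>density lborel (indicator (g ` S)))"
  by (subst nn_integral_density) (auto simp: mult.commute)
 also have "... = (\<integral>\<^sup>+ z. F (G z) \<partial>density lborel (%z. ennreal (J z) * indicator S z))"
  unfolding eq[symmetric] by (subst nn_integral_distr) auto
 also have "... = (\<integral>\<^sup>+ z. ennreal (J z) * indicator S z * F (G z) \<partial>lborel)"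
  by (subst nn_integral_density) auto
 also have "... = (\<integral>\<^sup>+ z. ennreal ((cmod (g' z))^2) * F (g z) * indicator S z \<partial>lborel)"
  by (intro nn_integral_cong) (auto simp: indicator_def J_def G_def)
 finally show ?thesis .
qed

definition hmu :: "complex measure" where
 "hmu = density lborel (%z. ennreal (indicator uhp z / (Im z)^2))"

lemma uhp_borel [measurable]: "uhp : sets borel"
 using open_uhp by simp

lemma sets_hmu [measurable_cong, simp]: "sets hmu = sets borel" and space_hmu [simp]: "space hmu = UNIV"
 by (simp_all add: hmu_def)

lemma nn_integral_hmu:
 assumes [measurable]: "F : borel_measurable borel"
 shows "(\<integral>\<^sup>+ z. F z \<partial>hmu) = (\<integral>\<^sup>+ z. ennreal (1 / (Im z)^2) * F z * indicator uhp z \<partial>lborel)"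
 unfolding hmu_def by (subst nn_integral_density) (auto intro!: nn_integral_cong simp: indicator_def)

lemma hmu_isom:
 assumes f: "f : hyp_isom" "f ` uhp = uhp" and [measurable]: "F : borel_measurable borel"
 shows "(\<integral>\<^sup>+ z. F (f z) * indicator uhp z \<partial>hmu) = (\<integral>\<^sup>+ z. F z * indicator uhp z \<partial>hmu)"
proof -
 obtain f' where f': "!!z. z : uhp ==> (f has_field_derivative f' z) (at z)"
  "!!z. z : uhp ==> (cmod (f' z))\<^sup>2 / (Im (f z))^2 = 1 / (Im z)^2"
  using hyp_isom_has_field_derivative[OF f(1)] by metis
 have inj: "inj_on f uhp"
  by (intro inj_onI) (metis f(1) hcosh_eq_1_iff hcosh_isom hcosh_self)
 have hol: "f holomorphic_on uhp" unfolding holomorphic_on_def field_differentiable_def using f'(1) by (blast intro: has_field_derivative_at_within)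
 have "continuous_on uhp (deriv f)" using holomorphic_deriv[OF hol open_uhp] holomorphic_on_imp_continuous_on by blast
 then have cf': "continuous_on uhp f'" using f'(1) by (metis (no_types, lifting) DERIV_imp_deriv continuous_on_cong)
 have cf: "continuous_on uhp f" using holomorphic_on_imp_continuous_on[OF hol] .
 define G where "G z = indicator uhp z *\<^sub>R f z" for z
 have G[measurable]: "G : borel_measurable borel" unfolding G_def[abs_def]
  by (rule borel_measurable_continuous_on_indicator; use cf in auto)
 have "(\<integral>\<^sup>+ z. F z * indicator uhp z \<partial>hmu) = (\<integral>\<^sup>+ z. (ennreal (1 / (Im z)^2) * F z) * indicator (f ` uhp) z \<partial>lborel)"
  unfolding f(2) by (subst nn_integral_hmu) (auto intro!: nn_integral_cong simp: indicator_def)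
 also have "... = (\<integral>\<^sup>+ z. ennreal ((cmod (f' z))^2) * (ennreal (1 / (Im (f z))^2) * F (f z)) * indicator uhp z \<partial>lborel)"
  by (rule nn_integral_holomorphic_image') (use f f' cf' inj in auto)
 also have "... = (\<integral>\<^sup>+ z. ennreal (1 / (Im z)^2) * (F (G z) * indicator uhp z) * indicator uhp z \<partial>lborel)"
 proof (intro nn_integral_cong)
  fix z
  have "ennreal ((cmod (f' z))^2) * ennreal (1 / (Im (f z))^2) = ennreal (1 / (Im z)^2)" if "z : uhp"
   using f'(2)[OF that] by (subst ennreal_mult[symmetric]) auto
  then show "ennreal ((cmod (f' z))^2) * (ennreal (1 / (Im (f z))^2) * F (f z)) * indicator uhp z = ennreal (1 / (Im z)^2) * (F (G z) * indicator uhp z) * indicator uhp z"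
   by (auto simp: indicator_def G_def mult.assoc[symmetric])
 qed
 also have "... = (\<integral>\<^sup>+ z. F (G z) * indicator uhp z \<partial>hmu)"
  by (rule nn_integral_hmu[symmetric]) measurable
 also have "... = (\<integral>\<^sup>+ z. F (f z) * indicator uhp z \<partial>hmu)"
  by (intro nn_integral_cong) (auto simp: indicator_def G_def)
 finally show ?thesis by simp
qed

section \<open>The spherical functions\<close>

text \<open>The spherical function of eigenvalue \<open>lam\<close>, with value 1 at the centre, as
  the circle average of an explicit eigenfunction.\<close>

definition phi :: "real => real => real" where
 "phi lam s = sph (%z. Im z powr (1/2 + sqrt (1/4 - lam))) \<i> s / (2 * pi)"
definition phi1 :: "real => real => real" where
 "phi1 lam s = sph1 (%z. Im z powr (1/2 + sqrt (1/4 - lam))) \<i> s / (2 * pi)"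

lemma i_uhp: "\<i> : uhp" by (simp add: uhp_iff)

lemma phi_eigen: "lam <= 1/4 ==> eigen_on (%z. Im z powr (1/2 + sqrt (1/4 - lam))) lam"
 using eigen_Im_powr[of "1/2 + sqrt (1/4 - lam)"] by (simp add: algebra_simps)

lemma phi_deriv:
 assumes "lam <= 1/4" "s < 0"
 shows "(phi lam has_real_derivative phi1 lam s) (at s)"
  "(phi1 lam has_real_derivative - lam * phi lam s / (sinh s)^2) (at s)"
proof -
 note d = sph_derivs[OF phi_eigen[OF assms(1)] i_uhp assms(2)]
 show "(phi lam has_real_derivative phi1 lam s) (at s)"
  unfolding phi_def[abs_def] phi1_def by (rule DERIV_cdivide[OF d(1)])
 show "(phi1 lam has_real_derivative - lam * phi lam s / (sinh s)^2) (at s)"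
  unfolding phi_def phi1_def[abs_def] by (rule DERIV_cong[OF DERIV_cdivide[OF d(2)]]) simp
qed

lemma phi_limits:
 assumes "lam <= 1/4"
 shows "(phi lam \<longlongrightarrow> 1) at_bot" "(phi1 lam \<longlongrightarrow> 0) at_bot"
proof -
 have C2: "C2_on_uhp (%z. Im z powr (1/2 + sqrt (1/4 - lam)))" using phi_eigen[OF assms] by (simp add: eigen_on_def)
 have "(phi lam \<longlongrightarrow> 2 * pi * (Im \<i> powr (1/2 + sqrt (1/4 - lam))) / (2 * pi)) at_bot"
  unfolding phi_def[abs_def] by (intro tendsto_intros sph_limits[OF C2 i_uhp]) auto
 then show "(phi lam \<longlongrightarrow> 1) at_bot" by simp
 have "(phi1 lam \<longlongrightarrow> 0 / (2 * pi)) at_bot"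
  unfolding phi1_def[abs_def] by (intro tendsto_intros sph_limits[OF C2 i_uhp]) auto
 then show "(phi1 lam \<longlongrightarrow> 0) at_bot" by simp
qed

lemma phi_pos:
 assumes "lam <= 1/4" "s < 0" shows "phi lam s > 0"
proof -
 let ?f = "%z. Im z powr (1/2 + sqrt (1/4 - lam))"
 have C2: "C2_on_uhp ?f" using phi_eigen[OF assms(1)] by (simp add: eigen_on_def)
 have c: "continuous_on {0..2*pi} (%t. ?f (pol \<i> (Complex s t)))"
  by (rule continuous_pol_slice(1)[OF i_uhp assms(2)]) (use C2 in "auto simp: C2_on_uhp_def intro: differentiable_imp_continuous_on")
 have pos: "?f (pol \<i> (Complex s t)) > 0" for t using pol_in_uhp[OF i_uhp, of "Complex s t"] assms by (simp add: uhp_iff)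
 obtain t0 where t0: "!!t. t : {0..2*pi} ==> ?f (pol \<i> (Complex s t0)) <= ?f (pol \<i> (Complex s t))"
  using continuous_attains_inf[OF _ _ c] by fastforce
 have "integral {0..2*pi} (%t. ?f (pol \<i> (Complex s t0))) <= integral {0..2*pi} (%t. ?f (pol \<i> (Complex s t)))"
  by (rule integral_le) (use c t0 in "auto intro: integrable_continuous_real")
 then have "2 * pi * ?f (pol \<i> (Complex s t0)) <= sph ?f \<i> s" by (simp add: sph_def)
 moreover have "2 * pi * ?f (pol \<i> (Complex s t0)) > 0" using pos by simp
 ultimately have "sph ?f \<i> s > 0" by linarith
 then show ?thesis by (simp add: phi_def)
qed

section \<open>Wronskians and Sturm comparison\<close>

lemma wronskian_deriv:
 fixes u v :: "real => real"
 assumes "(u has_real_derivative u1 s) (at s)" "(u1 has_real_derivative a) (at s)"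
  "(v has_real_derivative v1 s) (at s)" "(v1 has_real_derivative b) (at s)"
 shows "((%s. u1 s * v s - u s * v1 s) has_real_derivative a * v s - u s * b) (at s)"
 by (rule DERIV_cong[OF DERIV_diff[OF DERIV_mult[OF assms(2,3)] DERIV_mult[OF assms(1,4)]]]) (simp add: algebra_simps)

lemma ratio_deriv:
 fixes u v :: "real => real"
 assumes "(u has_real_derivative u1 s) (at s)" "(v has_real_derivative v1 s) (at s)" "v s > 0"
 shows "((%s. u s / v s) has_real_derivative (u1 s * v s - u s * v1 s) / (v s)^2) (at s)"
 by (rule DERIV_cong[OF DERIV_divide[OF assms(1,2)]]) (use assms in "auto simp: power2_eq_square")

text \<open>\<open>sph f p\<close> and \<open>phi lam\<close> solve the same radial equation. Their
  Wronskian is constant and tends to 0 at the centre, so it vanishes; hence the quotient is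
  constant, with limit \<open>2 * pi * f p\<close>.\<close>

lemma mean_value:
 assumes eig: "eigen_on f lam" and l: "lam <= 1/4" and p: "p : uhp" and s: "s < 0"
 shows "sph f p s = 2 * pi * f p * phi lam s"
proof -
 have C2: "C2_on_uhp f" using eig by (simp add: eigen_on_def)
 note du = sph_derivs[OF eig p] and dv = phi_deriv[OF l]
 note lu = sph_limits[OF C2 p] and lv = phi_limits[OF l]
 define W where "W s = sph1 f p s * phi lam s - sph f p s * phi1 lam s" for s
 have dW: "(W has_real_derivative 0) (at s)" if "s < 0" for s
  unfolding W_def[abs_def] by (rule DERIV_cong[OF wronskian_deriv[OF du[OF that] dv[OF that]]]) simp
 have "(W \<longlongrightarrow> 0 * 1 - 2 * pi * f p * 0) at_bot"
  unfolding W_def[abs_def] by (intro tendsto_intros lu lv)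
 then have lW: "(W \<longlongrightarrow> 0) at_bot" by simp
 have W0: "W s = 0" if "s < 0" for s
 proof -
  have "W s >= 0" by (rule mono_from_bot[OF dW _ lW that]) auto
  moreover have "- W s >= 0"
   by (rule mono_from_bot[of "%s. - W s" "%s. 0", OF _ _ _ that]) (use dW lW in "auto intro!: derivative_eq_intros tendsto_eq_intros")
  ultimately show ?thesis by simp
 qed
 define q where "q s = sph f p s / phi lam s" for s
 have dq: "(q has_real_derivative 0) (at s)" if "s < 0" for s
  unfolding q_def[abs_def] by (rule DERIV_cong[OF ratio_deriv[of _ "sph1 f p" _ _ "phi1 lam"]]) (use du dv phi_pos[OF l] that W0[OF that] in "auto simp: W_def")
 have "(q \<longlongrightarrow> 2 * pi * f p / 1) at_bot" unfolding q_def[abs_def] by (intro tendsto_intros lu lv) simp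
 then have lq: "(q \<longlongrightarrow> 2 * pi * f p) at_bot" by simp
 have "q s >= 2 * pi * f p" by (rule mono_from_bot[OF dq _ lq s]) auto
 moreover have "- q s >= - (2 * pi * f p)"
  by (rule mono_from_bot[of "%s. - q s" "%s. 0", OF _ _ _ s]) (use dq lq in "auto intro!: derivative_eq_intros tendsto_eq_intros")
 ultimately have "q s = 2 * pi * f p" by simp
 then show ?thesis using phi_pos[OF l s] by (simp add: q_def field_simps)
qed

text \<open>Sturm comparison: the Wronskian starts at 0 and increases, so
  \<open>phi lam / phi mu\<close> increases strictly from 1.\<close>

lemma phi_strict_antimono:
 assumes l: "lam < mu" "mu <= 1/4" and s: "s < 0"
 shows "phi mu s < phi lam s"
proof -
 have l': "lam <= 1/4" using l by simp
 note du = phi_deriv[OF l'] and dv = phi_deriv[OF l(2)]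
 note lu = phi_limits[OF l'] and lv = phi_limits[OF l(2)]
 define W where "W s = phi1 lam s * phi mu s - phi lam s * phi1 mu s" for s
 have dW: "(W has_real_derivative (mu - lam) * (phi lam s * phi mu s) / (sinh s)^2) (at s)" if "s < 0" for s
  unfolding W_def[abs_def] by (rule DERIV_cong[OF wronskian_deriv[OF du[OF that] dv[OF that]]]) (simp add: algebra_simps diff_divide_distrib)
 have "(W \<longlongrightarrow> 0 * 1 - 1 * 0) at_bot" unfolding W_def[abs_def] by (intro tendsto_intros lu lv)
 then have lW: "(W \<longlongrightarrow> 0) at_bot" by simp
 have W0: "W s > 0" if "s < 0" for s
  by (rule mono_from_bot_strict[OF dW _ lW that]) (use l phi_pos[OF l'] phi_pos[OF l(2)] in "auto intro!: divide_pos_pos mult_pos_pos")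
 define q where "q s = phi lam s / phi mu s" for s
 have dq: "(q has_real_derivative W s / (phi mu s)^2) (at s)" if "s < 0" for s
  unfolding q_def[abs_def] W_def by (rule ratio_deriv[of _ "phi1 lam" _ _ "phi1 mu"]) (use du dv phi_pos[OF l(2)] that in auto)
 have "(q \<longlongrightarrow> 1 / 1) at_bot" unfolding q_def[abs_def] by (intro tendsto_intros lu lv) simp
 then have lq: "(q \<longlongrightarrow> 1) at_bot" by simp
 have "q s > 1"
 proof (rule mono_from_bot_strict[OF dq _ lq s])
  fix s :: real assume "s < 0" then show "W s / (phi mu s)^2 > 0" using W0[of s] phi_pos[OF l(2), of s] by simp
 qed
 then show ?thesis using phi_pos[OF l(2) s] by (simp add: q_def field_simps)
qed

text \<open>With \<open>r\<close> the hyperbolic distance belonging to \<open>s\<close>, that is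
  \<open>tanh (r/2) = exp s\<close>, the three functions are \<open>r\<close>, \<open>sinh r\<close>
  and \<open>cosh r\<close>; moreover \<open>dr = aa s ds\<close>.\<close>

definition rr :: "real => real" where "rr s = ln ((1 + exp s) / (1 - exp s))"
definition aa :: "real => real" where "aa s = 2 * exp s / (1 - (exp s)^2)"
definition cc :: "real => real" where "cc s = (1 + (exp s)^2) / (1 - (exp s)^2)"

lemma exp_sq_less_1: "s < 0 ==> 1 - (exp s)^2 > (0::real)"
 by (simp add: abs_square_less_1)

lemma aa_sinh: "s < 0 ==> aa s = - 1 / sinh s"
proof -
 assume "s < 0"
 have "sinh s = ((exp s)^2 - 1) / (2 * exp s)"
  unfolding sinh_field_def by (simp add: exp_minus field_simps power2_eq_square)
 then have "aa s * sinh s = - 1"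
  unfolding aa_def using exp_sq_less_1[OF \<open>s < 0\<close>] by (simp add: divide_simps) (simp add: mult_ac)
 moreover from this have "sinh s ~= 0" by auto
 ultimately show ?thesis by (subst nonzero_eq_divide_eq) auto
qed

lemma aa_sq: "s < 0 ==> 1 / (sinh s)^2 = (aa s)^2"
 by (simp add: aa_sinh power_divide)

lemma cc_sq: "s < 0 ==> (cc s)\<^sup>2 = 1 + (aa s)^2"
 using exp_sq_less_1[of s] unfolding cc_def aa_def power_divide
 by (simp add: divide_simps) (simp add: power2_eq_square algebra_simps)

lemma aa_pos: "s < 0 ==> aa s > 0"
 using exp_sq_less_1[of s] by (simp add: aa_def)

lemma cc_gt_1: "s < 0 ==> cc s > 1"
 using exp_sq_less_1[of s] by (simp add: cc_def field_simps)

lemma rr_pos: "s < 0 ==> rr s > 0"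
 unfolding rr_def by (rule ln_gt_zero) (simp add: less_divide_eq)

lemma rr_deriv: "s < 0 ==> (rr has_real_derivative aa s) (at s)"
proof -
 assume s: "s < 0"
 then have e: "0 < exp s" "exp s < 1" by auto
 have "((%s. ln (1 + exp s) - ln (1 - exp s)) has_real_derivative exp s / (1 + exp s) - (- exp s) / (1 - exp s)) (at s)"
  using e by (auto intro!: derivative_eq_intros simp: add_pos_pos)
 moreover have "exp s / (1 + exp s) - (- exp s) / (1 - exp s) = aa s"
 proof -
  have "1 - (exp s)^2 = (1 + exp s) * (1 - exp s)" by (simp add: power2_eq_square algebra_simps)
  moreover have "1 + exp s ~= 0" "1 - exp s ~= 0" using e by linarith+
  ultimately show ?thesis unfolding aa_def by (simp add: divide_simps) (simp add: algebra_simps)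
 qed
 ultimately have "((%s. ln (1 + exp s) - ln (1 - exp s)) has_real_derivative aa s) (at s)" by simp
 then show ?thesis
 proof (rule has_field_derivative_transform_within_open)
  show "open {..<0::real}" "s : {..<0}" using s by auto
  show "ln (1 + exp s) - ln (1 - exp s) = rr s" if "s : {..<0}" for s :: real
  proof -
   have h: "1 + exp s > 0" "1 - exp s > 0" using that by (auto simp: add_pos_pos)
   then have h': "1 + exp s ~= 0" by linarith
   show ?thesis unfolding rr_def by (subst ln_div) (use h h' in simp_all)
  qed
 qed
qed

lemma aa_deriv: "s < 0 ==> (aa has_real_derivative aa s * cc s) (at s)"
proof -
 assume s: "s < 0"
 have n: "1 - (exp s)^2 ~= 0" using exp_sq_less_1[OF s] by simp
 have "(aa has_real_derivative (2 * exp s * (1 - (exp s)^2) - 2 * exp s * (- (2 * exp s * exp s))) / ((1 - (exp s)^2) * (1 - (exp s)^2))) (at s)"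
  unfolding aa_def[abs_def] using n by (auto intro!: derivative_eq_intros)
 moreover have "2 * exp s * (1 - (exp s)^2) - 2 * exp s * (- (2 * exp s * exp s)) = 2 * exp s * (1 + (exp s)^2)"
  by (simp add: power2_eq_square algebra_simps)
 ultimately show ?thesis by (simp add: aa_def cc_def)
qed

lemma cc_deriv: "s < 0 ==> (cc has_real_derivative (aa s)\<^sup>2) (at s)"
proof -
 assume s: "s < 0"
 have n: "1 - (exp s)^2 ~= 0" using exp_sq_less_1[OF s] by simp
 have "(cc has_real_derivative ((2 * exp s * exp s) * (1 - (exp s)^2) - (1 + (exp s)^2) * (- (2 * exp s * exp s))) / ((1 - (exp s)^2) * (1 - (exp s)^2))) (at s)"
  unfolding cc_def[abs_def] using n by (auto intro!: derivative_eq_intros)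
 moreover have "(2 * exp s * exp s) * (1 - (exp s)^2) - (1 + (exp s)^2) * (- (2 * exp s * exp s)) = (2 * exp s)^2"
  by (simp add: power2_eq_square algebra_simps)
 ultimately show ?thesis by (simp add: aa_def power_divide power2_eq_square)
qed

lemma rr_less_aa: "s < 0 ==> rr s < aa s"
proof -
 assume s: "s < 0"
 have "(%s. aa s - rr s) s > 0"
 proof (rule mono_from_bot_strict[OF _ _ _ s])
  show "((%s. aa s - rr s) has_real_derivative aa s * cc s - aa s) (at s)" if "s < 0" for s
   by (rule DERIV_diff[OF aa_deriv[OF that] rr_deriv[OF that]])
  show "aa s * cc s - aa s > 0" if "s < 0" for s using aa_pos[OF that] cc_gt_1[OF that] by simp
  show "((%s. aa s - rr s) \<longlongrightarrow> 0) at_bot" unfolding aa_def rr_def by real_asymp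
 qed
 then show ?thesis by simp
qed

text \<open>Sturm comparison with \<open>v = sqrt (r / sinh r)\<close>, where
  \<open>r / sinh r\<close> is the ratio of Euclidean to hyperbolic circle length. The coefficient
  in the equation of \<open>v\<close> differs from that of \<open>phi (1/4)\<close> by
  \<open>(1 - (aa/rr)^2) / 4\<close>, which is negative because \<open>r < sinh r\<close>.\<close>

lemma phi_lower_1:
 assumes s: "s < 0" shows "(phi (1/4) s)^2 * aa s > rr s"
proof -
 define q q1 v v1 where "q = (%s. rr s / aa s)" and "q1 = (%s. 1 - rr s * cc s / aa s)"
  and "v = (%s. sqrt (rr s / aa s))" and "v1 = (%s. (1 - rr s * cc s / aa s) / (2 * sqrt (rr s / aa s)))"
 have q: "q s > 0" if "s < 0" for s using rr_pos[OF that] aa_pos[OF that] by (simp add: q_def)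
 have dq: "(q has_real_derivative q1 s) (at s)" if "s < 0" for s
  unfolding q_def by (rule DERIV_cong[OF DERIV_divide[OF rr_deriv[OF that] aa_deriv[OF that]]])
   (use aa_pos[OF that] in "auto simp: q1_def field_simps")
 have dq1: "(q1 has_real_derivative q s - cc s) (at s)" if "s < 0" for s
 proof -
  have "((%s. 1 - rr s * cc s / aa s) has_real_derivative 0 - ((aa s * cc s + (aa s)^2 * rr s) * aa s - (rr s * cc s) * (aa s * cc s)) / (aa s * aa s)) (at s)"
   by (rule DERIV_diff[OF DERIV_const DERIV_divide[OF DERIV_mult[OF rr_deriv[OF that] cc_deriv[OF that]] aa_deriv[OF that]]]) (use aa_pos[OF that] in auto)
  moreover have "0 - ((aa s * cc s + (aa s)^2 * rr s) * aa s - (rr s * cc s) * (aa s * cc s)) / (aa s * aa s) = rr s * ((cc s)^2 - (aa s)^2) / aa s - cc s"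
   using aa_pos[OF that] by (simp add: field_simps power2_eq_square)
  ultimately show ?thesis unfolding q1_def q_def using cc_sq[OF that] by simp
 qed
 have v: "v s > 0" if "s < 0" for s using q[OF that] by (simp add: v_def q_def)
 have vv: "v = (%s. sqrt (q s))" "v1 = (%s. q1 s / (2 * sqrt (q s)))" by (auto simp: v_def v1_def q_def q1_def)
 have dv: "(v has_real_derivative v1 s) (at s)" if "s < 0" for s
  unfolding vv by (rule DERIV_cong[OF DERIV_chain2[OF DERIV_real_sqrt[OF q[OF that]] dq[OF that]]]) (simp add: field_simps)
 have dv1: "(v1 has_real_derivative v s * (1 - (aa s)^2 / (rr s)^2 - (aa s)^2) / 4) (at s)" if "s < 0" for s
 proof -
  have sq: "sqrt (q s) > 0" "sqrt (q s) * sqrt (q s) = q s" using q[OF that] by auto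
  have quot: "(A * (2 * r) - B * (2 * (B / (2 * r)))) / ((2 * r) * (2 * r)) = (2 * (r * r) * A - B^2) / (4 * (r * r) * r)" if "r > 0" for A B r :: real
   using that by (simp add: divide_simps) (simp add: power2_eq_square algebra_simps)
  have D1: "(v1 has_real_derivative ((q s - cc s) * (2 * sqrt (q s)) - q1 s * (2 * v1 s)) / ((2 * sqrt (q s)) * (2 * sqrt (q s)))) (at s)"
   unfolding vv(2)
   by (rule DERIV_divide[OF dq1[OF that] DERIV_cmult[OF dv[OF that], of 2, unfolded vv]]) (use sq in auto)
  have E1: "((q s - cc s) * (2 * sqrt (q s)) - q1 s * (2 * v1 s)) / ((2 * sqrt (q s)) * (2 * sqrt (q s))) = (2 * q s * (q s - cc s) - (q1 s)^2) / (4 * q s * sqrt (q s))"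
   using quot[OF sq(1), of "q s - cc s" "q1 s"] unfolding vv(2) sq(2) by simp
  have E2: "2 * q s * (q s - cc s) - (q1 s)^2 = (q s)^2 * (1 - (aa s)^2 / (rr s)^2 - (aa s)^2)"
  proof -
   have h: "(q s)^2 * ((aa s)^2 / (rr s)^2) = 1" using rr_pos[OF that] aa_pos[OF that] by (simp add: q_def power_divide)
   have h2: "q1 s = 1 - q s * cc s" by (simp add: q_def q1_def)
   have "2 * q s * (q s - cc s) - (q1 s)^2 = 2 * (q s)^2 - 1 - (q s)^2 * (cc s)^2"
    unfolding h2 by (simp add: power2_eq_square algebra_simps)
   also have "... = (q s)^2 - (q s)^2 * ((aa s)^2 / (rr s)^2) - (q s)^2 * (aa s)^2" unfolding cc_sq[OF that] h by (simp add: algebra_simps)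
   finally show ?thesis by (simp add: algebra_simps)
  qed
  have E3: "(q s)^2 * X / (4 * q s * sqrt (q s)) = v s * X / 4" for X
   unfolding vv(1) using sq q[OF that] by (simp add: divide_simps) (simp add: power2_eq_square algebra_simps sq)
  show ?thesis by (rule DERIV_cong[OF D1]) (simp only: E1 E2 E3)
 qed
 have l: "(1/4::real) <= 1/4" by simp
 note du = phi_deriv[OF l] and lu = phi_limits[OF l]
 have lv: "(v \<longlongrightarrow> 1) at_bot" "(v1 \<longlongrightarrow> 0) at_bot"
  unfolding v_def v1_def rr_def aa_def cc_def by real_asymp+
 define W where "W s = phi1 (1/4) s * v s - phi (1/4) s * v1 s" for s
 have dW: "(W has_real_derivative phi (1/4) s * v s * ((aa s)^2 / (rr s)^2 - 1) / 4) (at s)" if "s < 0" for s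
 proof -
  have alg: "- (1/4) * F / Y * V - F * (V * (1 - X - A) / 4) = F * V * (X - 1) / 4" if "1 / Y = A" for F V X A Y :: real
  proof -
   have e: "Z / Y = Z * A" for Z by (metis that mult.right_neutral times_divide_eq_right)
   show ?thesis unfolding e by (simp add: field_simps)
  qed
  show ?thesis unfolding W_def[abs_def]
   by (rule DERIV_cong[OF wronskian_deriv[OF du[OF that] dv[OF that] dv1[OF that]]]) (rule alg[OF aa_sq[OF that]])
 qed
 have "(W \<longlongrightarrow> 0 * 1 - 1 * 0) at_bot" unfolding W_def[abs_def] by (intro tendsto_intros lu lv)
 then have lW: "(W \<longlongrightarrow> 0) at_bot" by simp
 have W0: "W s > 0" if "s < 0" for s
 proof (rule mono_from_bot_strict[OF dW _ lW that])
  fix s :: real assume s: "s < 0"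
  have "(rr s)^2 < (aa s)^2" using rr_less_aa[OF s] rr_pos[OF s] by (intro power_strict_mono) auto
  then have "(aa s)^2 / (rr s)^2 > 1" using rr_pos[OF s] by simp
  then show "phi (1/4) s * v s * ((aa s)^2 / (rr s)^2 - 1) / 4 > 0" using phi_pos[OF l s] v[OF s] by simp
 qed
 define k where "k s = phi (1/4) s / v s" for s
 have dk: "(k has_real_derivative W s / (v s)^2) (at s)" if "s < 0" for s
  unfolding k_def[abs_def] W_def by (rule ratio_deriv[of _ "phi1 (1/4)" _ _ v1]) (use du dv v that in auto)
 have "(k \<longlongrightarrow> 1 / 1) at_bot" unfolding k_def[abs_def] by (intro tendsto_intros lu lv) simp
 then have lk: "(k \<longlongrightarrow> 1) at_bot" by simp
 have "k s > 1"
 proof (rule mono_from_bot_strict[OF dk _ lk s])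
  fix s :: real assume "s < 0" then show "W s / (v s)^2 > 0" using W0[of s] v[of s] by simp
 qed
 then have "phi (1/4) s > v s" using v[OF s] by (simp add: k_def field_simps)
 then have "(phi (1/4) s)^2 > (v s)\<^sup>2" using v[OF s] by (intro power_strict_mono) auto
 then have "(phi (1/4) s)^2 > rr s / aa s" using q[OF s] by (simp add: vv q_def)
 then show ?thesis using aa_pos[OF s] by (simp add: field_simps)
qed

text \<open>On the circle the function \<open>Im powr (1/2)\<close> is
  \<open>C / sqrt (d^2 + 2 rh (1 - cos t))\<close>. Enlarging the root to
  \<open>sqrt (d^2 + x^2)\<close> leaves an integrand whose antiderivative is an arsinh on each half
  of the circle.\<close>

lemma phi_lower_2_aux:
 assumes s: "s < 0" shows "phi (1/4) s >= sqrt (1 - (exp s)^2) * rr s / pi"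
proof -
 define rh d where "rh = exp s" and "d = 1 - exp s"
 have r: "0 < rh" "rh < 1" "d > 0" "d = 1 - rh" using s by (auto simp: rh_def d_def)
 define C where "C = sqrt (1 - rh\<^sup>2)"
 have C: "C > 0" using exp_sq_less_1[OF s] by (simp add: C_def rh_def)
 define f where "f t = Im (pol \<i> (Complex s t)) powr (1/2)" for t
 have f: "f t = C / sqrt (d^2 + 2 * rh * (1 - cos t))" for t
 proof -
  have n: "cmod (exp (Complex s t)) < 1" using s by simp
  have e: "exp (Complex s t) = of_real rh * cis t" by (simp add: exp_eq_polar rh_def)
  have "(cmod (1 - exp (Complex s t)))^2 = (1 - rh * cos t)^2 + (rh * sin t)^2"
   unfolding e cmod_power2 by simp
  also have "... = 1 - 2 * rh * cos t + (rh\<^sup>2 * (cos t)^2 + rh\<^sup>2 * (sin t)^2)" by (simp add: power2_eq_square algebra_simps)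
  also have "rh\<^sup>2 * (cos t)^2 + rh\<^sup>2 * (sin t)^2 = rh\<^sup>2" by (metis distrib_left sin_cos_squared_add2 mult.right_neutral)
  also have "1 - 2 * rh * cos t + rh\<^sup>2 = d^2 + 2 * rh * (1 - cos t)" by (simp add: r(4) power2_eq_square algebra_simps)
  finally have m: "(cmod (1 - exp (Complex s t)))^2 = d^2 + 2 * rh * (1 - cos t)" .
  have "Im (pol \<i> (Complex s t)) = (1 - rh\<^sup>2) / (d^2 + 2 * rh * (1 - cos t))"
   unfolding pol_def Im_icay[OF n] m by (simp add: rh_def)
  moreover have "(1 - rh\<^sup>2) / (d^2 + 2 * rh * (1 - cos t)) >= 0"
   using exp_sq_less_1[OF s] r by (intro divide_nonneg_nonneg add_nonneg_nonneg mult_nonneg_nonneg) (auto simp: rh_def)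
  ultimately show ?thesis by (simp add: f_def powr_half_sqrt real_sqrt_divide C_def)
 qed
 \<comment> \<open>\<open>x\<close> will be \<open>t\<close> on the first half of the circle and
   \<open>2 * pi - t\<close> on the second.\<close>
 have low: "f t >= C / sqrt (d^2 + x^2)" if "cos x = cos t" for t x
 proof -
  have "cos x = 1 - 2 * (sin (x/2))^2" using cos_double_sin[of "x/2"] by simp
  moreover have "(sin (x/2))^2 <= (x/2)^2" using abs_sin_x_le_abs_x[of "x/2"] abs_le_square_iff by blast
  ultimately have "1 - cos x <= x^2 / 2" by (simp add: power_divide)
  then have "2 * rh * (1 - cos t) <= 2 * rh * (x^2 / 2)" using r that by (intro mult_left_mono) auto
  also have "... <= x^2" using r by (simp add: mult_left_le_one_le)
  finally have "d^2 + 2 * rh * (1 - cos t) <= d^2 + x^2" by simp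
  moreover have "d^2 + 2 * rh * (1 - cos t) > 0" using r by (intro add_pos_nonneg) auto
  ultimately show ?thesis unfolding f using C by (intro divide_left_mono) auto
 qed
 have A: "((%t. C * arsinh (t / d)) has_real_derivative C / sqrt (d^2 + t^2)) (at t)" for t
 proof -
  have "sqrt ((t/d)^2 + 1) = sqrt (d^2 + t^2) / d"
  proof -
   have "(t/d)^2 + 1 = (d^2 + t^2) / d^2" using r by (simp add: power_divide add_divide_distrib)
   then show ?thesis using r by (simp add: real_sqrt_divide)
  qed
  moreover have "((%t. C * arsinh (t / d)) has_real_derivative C * (1 / sqrt ((t/d)^2 + 1) * (1 / d))) (at t)"
   by (rule DERIV_cmult[OF DERIV_chain2[OF arsinh_real_has_field_derivative]]) (use r in "auto intro!: derivative_eq_intros")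
  ultimately show ?thesis using r by simp
 qed
 have i1: "((%t. C / sqrt (d^2 + t^2)) has_integral (C * arsinh (pi / d) - C * arsinh (0 / d))) {0..pi}"
  by (rule fundamental_theorem_of_calculus) (use A in "auto simp: has_real_derivative_iff_has_vector_derivative[symmetric] intro: has_field_derivative_at_within")
 have A2: "((%t. - (C * arsinh ((2 * pi - t) / d))) has_real_derivative C / sqrt (d^2 + (2 * pi - t)^2)) (at t)" for t
  by (rule DERIV_cong[OF DERIV_minus[OF DERIV_chain2[OF A]]]) (auto intro!: derivative_eq_intros)
 have i2: "((%t. C / sqrt (d^2 + (2 * pi - t)^2)) has_integral (- (C * arsinh ((2 * pi - 2 * pi) / d)) - (- (C * arsinh ((2 * pi - pi) / d))))) {pi..2*pi}"
  by (rule fundamental_theorem_of_calculus) (use A2 in "auto simp: has_real_derivative_iff_has_vector_derivative[symmetric] intro: has_field_derivative_at_within")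
 have cf: "continuous_on A f" for A unfolding f_def
  by (rule continuous_pol_slice(1)[OF i_uhp s, of "%z. Im z powr (1/2)"])
   (use eigen_Im_powr[of "1/2"] in "auto simp: eigen_on_def C2_on_uhp_def intro: differentiable_imp_continuous_on")
 have int: "f integrable_on {a..b}" for a b using cf by (rule integrable_continuous_real)
 have "integral {0..pi} f >= C * arsinh (pi / d) - C * arsinh (0 / d)"
  by (rule has_integral_le[OF i1 integrable_integral[OF int]]) (use low in auto)
 moreover have "integral {pi..2*pi} f >= - (C * arsinh ((2 * pi - 2 * pi) / d)) - (- (C * arsinh ((2 * pi - pi) / d)))"
  by (rule has_integral_le[OF i2 integrable_integral[OF int]]) (use low in auto)
 moreover have "integral {0..2*pi} f = integral {0..pi} f + integral {pi..2*pi} f"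
  by (rule Henstock_Kurzweil_Integration.integral_combine[symmetric]) (use int in auto)
 ultimately have 1: "integral {0..2*pi} f >= 2 * C * arsinh (pi / d)" by simp
 \<comment> \<open>\<open>arsinh x >= ln (2 x)\<close>, and \<open>2 * pi\<close> exceeds
   \<open>1 + rh\<close>.\<close>
 have 2: "arsinh (pi / d) >= rr s"
 proof -
  define x where "x = pi / d"
  have x: "x > 0" using r by (simp add: x_def)
  have "sqrt (x^2 + 1) >= x" using x by (simp add: real_le_rsqrt)
  then have a: "2 * x <= x + sqrt (x^2 + 1)" by simp
  have "(1 + rh) / d <= 2 * x" unfolding x_def using r pi_gt3 by (simp add: divide_right_mono)
  then have "ln ((1 + rh) / d) <= ln (x + sqrt (x^2 + 1))" using a r by (subst ln_le_cancel_iff) (auto intro: add_pos_nonneg simp: x)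
  then show ?thesis unfolding arsinh_real_def x_def[symmetric] by (simp add: rr_def rh_def d_def)
 qed
 have "phi (1/4) s = integral {0..2*pi} f / (2 * pi)" by (simp add: phi_def sph_def f_def[abs_def])
 also have "... >= 2 * C * rr s / (2 * pi)"
  using 1 2 C by (intro divide_right_mono) (auto intro: order_trans[rotated])
 finally show ?thesis by (simp add: C_def rh_def)
qed

text \<open>\<open>v = r / sqrt (sinh r)\<close> has the decay of \<open>phi (1/4)\<close> far from
  the centre. A Wronskian argument shows that \<open>phi (1/4) / v\<close> decreases in
  \<open>s\<close>, and \<open>phi_lower_2_aux\<close> keeps it above values that tend to
  \<open>sqrt 2 / pi\<close> at \<open>s = 0\<close>, which is the boundary at infinity.\<close>

lemma phi_lower_2:
 assumes s: "s < 0" shows "(phi (1/4) s)^2 * aa s > 2 * (rr s)^2 / pi^2"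
proof -
 define q q1 v v1 where "q = (%s. (rr s)\<^sup>2 / aa s)" and "q1 = (%s. 2 * rr s - (rr s)^2 * cc s / aa s)"
  and "v = (%s. sqrt ((rr s)^2 / aa s))" and "v1 = (%s. (2 * rr s - (rr s)^2 * cc s / aa s) / (2 * sqrt ((rr s)^2 / aa s)))"
 have q: "q s > 0" if "s < 0" for s using rr_pos[OF that] aa_pos[OF that] by (simp add: q_def)
 have drr: "((%s. (rr s)\<^sup>2) has_real_derivative 2 * rr s * aa s) (at s)" if "s < 0" for s
  using rr_deriv[OF that] by (auto intro!: derivative_eq_intros)
 have dq: "(q has_real_derivative q1 s) (at s)" if "s < 0" for s
  unfolding q_def by (rule DERIV_cong[OF DERIV_divide[OF drr[OF that] aa_deriv[OF that]]])
   (use aa_pos[OF that] in "auto simp: q1_def field_simps power2_eq_square")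
 have dq1: "(q1 has_real_derivative 2 * aa s - 2 * rr s * cc s + q s) (at s)" if "s < 0" for s
 proof -
  have "((%s. 2 * rr s - (rr s)^2 * cc s / aa s) has_real_derivative 2 * aa s - (((2 * rr s * aa s) * cc s + (aa s)^2 * (rr s)^2) * aa s - ((rr s)^2 * cc s) * (aa s * cc s)) / (aa s * aa s)) (at s)"
   by (rule DERIV_diff[OF DERIV_cmult[OF rr_deriv[OF that]] DERIV_divide[OF DERIV_mult[OF drr[OF that] cc_deriv[OF that]] aa_deriv[OF that]]]) (use aa_pos[OF that] in auto)
  moreover have "2 * aa s - (((2 * rr s * aa s) * cc s + (aa s)^2 * (rr s)^2) * aa s - ((rr s)^2 * cc s) * (aa s * cc s)) / (aa s * aa s) = 2 * aa s - 2 * rr s * cc s + (rr s)^2 * ((cc s)^2 - (aa s)^2) / aa s"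
   using aa_pos[OF that] by (simp add: field_simps power2_eq_square)
  ultimately show ?thesis unfolding q1_def q_def using cc_sq[OF that] by simp
 qed
 have v: "v s > 0" if "s < 0" for s using q[OF that] by (simp add: v_def q_def)
 have vv: "v = (%s. sqrt (q s))" "v1 = (%s. q1 s / (2 * sqrt (q s)))" by (auto simp: v_def v1_def q_def q1_def)
 have dv: "(v has_real_derivative v1 s) (at s)" if "s < 0" for s
  unfolding vv by (rule DERIV_cong[OF DERIV_chain2[OF DERIV_real_sqrt[OF q[OF that]] dq[OF that]]]) (simp add: field_simps)
 have dv1: "(v1 has_real_derivative v s * (1 - (aa s)^2) / 4) (at s)" if "s < 0" for s
 proof -
  define q2 where "q2 = 2 * aa s - 2 * rr s * cc s + q s"
  have sq: "sqrt (q s) > 0" "sqrt (q s) * sqrt (q s) = q s" using q[OF that] by auto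
  have quot: "(A * (2 * r) - B * (2 * (B / (2 * r)))) / ((2 * r) * (2 * r)) = (2 * (r * r) * A - B^2) / (4 * (r * r) * r)" if "r > 0" for A B r :: real
   using that by (simp add: divide_simps) (simp add: power2_eq_square algebra_simps)
  have D1: "(v1 has_real_derivative (q2 * (2 * sqrt (q s)) - q1 s * (2 * v1 s)) / ((2 * sqrt (q s)) * (2 * sqrt (q s)))) (at s)"
   unfolding vv(2) q2_def
   by (rule DERIV_divide[OF dq1[OF that] DERIV_cmult[OF dv[OF that], of 2, unfolded vv]]) (use sq in auto)
  have E1: "(q2 * (2 * sqrt (q s)) - q1 s * (2 * v1 s)) / ((2 * sqrt (q s)) * (2 * sqrt (q s))) = (2 * q s * q2 - (q1 s)^2) / (4 * q s * sqrt (q s))"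
   using quot[OF sq(1), of "q2" "q1 s"] unfolding vv(2) sq(2) by simp
  have E2: "2 * q s * q2 - (q1 s)^2 = (q s)^2 * (1 - (aa s)^2)"
  proof -
   have h: "q s * aa s = (rr s)^2" using aa_pos[OF that] by (simp add: q_def)
   have h2: "q1 s = 2 * rr s - q s * cc s" by (simp add: q_def q1_def)
   have "2 * q s * q2 - (q1 s)^2 = 4 * (q s * aa s) + 2 * (q s)^2 - 4 * (rr s)^2 - (q s)^2 * (cc s)^2"
    unfolding h2 q2_def by (simp add: power2_eq_square algebra_simps)
   also have "... = (q s)^2 - (q s)^2 * (aa s)^2" unfolding cc_sq[OF that] h by (simp add: algebra_simps)
   finally show ?thesis by (simp add: algebra_simps)
  qed
  have E3: "(q s)^2 * X / (4 * q s * sqrt (q s)) = v s * X / 4" for X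
   unfolding vv(1) using sq q[OF that] by (simp add: divide_simps) (simp add: power2_eq_square algebra_simps sq)
  show ?thesis by (rule DERIV_cong[OF D1]) (simp only: E1 E2 E3)
 qed
 have l: "(1/4::real) <= 1/4" by simp
 note du = phi_deriv[OF l] and lu = phi_limits[OF l]
 have lv: "(v \<longlongrightarrow> 0) at_bot" "(v1 \<longlongrightarrow> 0) at_bot"
  unfolding v_def v1_def rr_def aa_def cc_def by real_asymp+
 define W where "W s = phi (1/4) s * v1 s - phi1 (1/4) s * v s" for s
 have dW: "(W has_real_derivative phi (1/4) s * v s / 4) (at s)" if "s < 0" for s
 proof -
  have alg: "- (- (1/4) * F / Y * V - F * (V * (1 - A) / 4)) = F * V / 4" if "1 / Y = A" for F V A Y :: real
  proof -
   have e: "Z / Y = Z * A" for Z by (metis that mult.right_neutral times_divide_eq_right)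
   show ?thesis unfolding e by (simp add: field_simps)
  qed
  have "((%s. - (phi1 (1/4) s * v s - phi (1/4) s * v1 s)) has_real_derivative phi (1/4) s * v s / 4) (at s)"
   by (rule DERIV_cong[OF DERIV_minus[OF wronskian_deriv[OF du[OF that] dv[OF that] dv1[OF that]]]])
    (rule alg[OF aa_sq[OF that]])
  then show ?thesis by (simp add: W_def[abs_def])
 qed
 have "(W \<longlongrightarrow> 1 * 0 - 0 * 0) at_bot" unfolding W_def[abs_def] by (intro tendsto_intros lu lv)
 then have lW: "(W \<longlongrightarrow> 0) at_bot" by simp
 have W0: "W s > 0" if "s < 0" for s
  by (rule mono_from_bot_strict[OF dW _ lW that]) (use phi_pos[OF l] v in auto)
 define k where "k s = phi (1/4) s / v s" for s
 have dk: "(k has_real_derivative - W s / (v s)^2) (at s)" if "s < 0" for s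
  unfolding k_def[abs_def] W_def by (rule DERIV_cong[OF ratio_deriv[of _ "phi1 (1/4)" _ _ v1]]) (use du dv v that in auto)
 have kmono: "k x > k y" if "x < y" "y < 0" for x y
 proof -
  have "- k x < - k y"
  proof (rule DERIV_pos_imp_increasing[OF that(1), of "%s. - k s"])
   fix u assume "x <= u" "u <= y"
   then have u: "u < 0" using that by simp
   have "((%s. - k s) has_real_derivative W u / (v u)^2) (at u)"
    by (rule DERIV_cong[OF DERIV_minus[OF dk[OF u]]]) simp
   moreover have "W u / (v u)^2 > 0" using W0[OF u] v[OF u] by simp
   ultimately show "EX d. ((%s. - k s) has_real_derivative d) (at u) & d > 0" by blast
  qed
  then show ?thesis by simp
 qed
 have kl: "k x >= sqrt (2 * exp x) / pi" if "x < 0" for x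
 proof -
  have "v x = rr x / sqrt (aa x)" using rr_pos[OF that] by (simp add: v_def real_sqrt_divide)
  moreover have "sqrt (1 - (exp x)^2) * sqrt (aa x) = sqrt (2 * exp x)"
   unfolding real_sqrt_mult[symmetric] aa_def using exp_sq_less_1[OF that] by simp
  moreover from calculation(1) have "rr x = v x * sqrt (aa x)" using aa_pos[OF that] by simp
  then have "(sqrt (1 - (exp x)^2) * rr x / pi) / v x = sqrt (1 - (exp x)^2) * sqrt (aa x) / pi"
   using v[OF that] by simp
  ultimately have "sqrt (2 * exp x) / pi = (sqrt (1 - (exp x)^2) * rr x / pi) / v x" by simp
  also have "... <= k x" unfolding k_def using phi_lower_2_aux[OF that] v[OF that] by (intro divide_right_mono) auto
  finally show ?thesis .
 qed
 \<comment> \<open>The limit gives a weak inequality at \<open>s/2\<close>; strict monotonicity from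
   \<open>s\<close> to \<open>s/2\<close> makes it strict at \<open>s\<close>.\<close>
 have "k (s/2) >= sqrt 2 / pi"
 proof (rule tendsto_upperbound)
  show "((%x. sqrt (2 * exp x) / pi) \<longlongrightarrow> sqrt 2 / pi) (at_left 0)" by (auto intro!: tendsto_eq_intros)
  have "\<forall>\<^sub>F x in at_left 0. x : {s/2<..<0}" using s by (intro eventually_at_leftI[of "s/2"]) auto
  then show "\<forall>\<^sub>F x in at_left 0. sqrt (2 * exp x) / pi <= k (s/2)"
   by eventually_elim (use kmono[of "s/2"] kl in "fastforce")
 qed simp
 then have "k s > sqrt 2 / pi" using kmono[of s "s/2"] s by simp
 then have "phi (1/4) s > sqrt 2 / pi * v s" using v[OF s] by (simp add: k_def field_simps)
 then have "(phi (1/4) s)^2 > (sqrt 2 / pi * v s)\<^sup>2" using v[OF s] by (intro power_strict_mono) auto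
 moreover have "(sqrt 2 / pi * v s)^2 = 2 / pi^2 * ((rr s)^2 / aa s)" using q[OF s] by (simp add: vv q_def power_mult_distrib power_divide)
 ultimately have "(phi (1/4) s)^2 * aa s > 2 / pi^2 * ((rr s)^2 / aa s) * aa s"
  using aa_pos[OF s] by (intro mult_strict_right_mono) auto
 then show ?thesis using aa_pos[OF s] by simp
qed

section \<open>Area in polar coordinates\<close>

lemma pol_window_image:
 assumes p: "p : uhp"
 shows "pol p ` {ze. Re ze < 0 & a <= Im ze & Im ze < a + 2*pi} = uhp - {p}"
proof (intro equalityI subsetI)
 fix z assume "z : pol p ` {ze. Re ze < 0 & a <= Im ze & Im ze < a + 2*pi}"
 then obtain ze where z: "Re ze < 0" "z = pol p ze" by auto
 have "cay p z = exp ze" using cay_icay[OF p norm_exp_less_1[OF z(1)]] by (simp add: z(2) pol_def)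
 then have "z ~= p" by auto
 then show "z : uhp - {p}" using z pol_in_uhp[OF p] by simp
next
 fix z assume z: "z : uhp - {p}"
 define w where "w = cay p z"
 have w: "w ~= 0" "cmod w < 1" "icay p w = z"
  using z icay_cay[OF p] norm_cay_less_1[OF p] cay_denom_nz[OF p] by (auto simp: w_def cay_def)
 define v where "v = w / of_real (cmod w) * cis (- a)"
 have "cmod v = 1" using w by (simp add: v_def norm_mult norm_divide)
 then obtain t where t: "0 <= t" "t < 2*pi" "v = Complex (cos t) (sin t)" by (rule complex_unimodular_polar)
 then have "v = cis t" by (simp add: cis.code)
 moreover have "v * cis a = w / of_real (cmod w)" by (simp add: v_def mult.assoc cis_mult)
 ultimately have "w / of_real (cmod w) = cis (t + a)" by (simp add: cis_mult)
 then have "w = of_real (cmod w) * cis (t + a)" using w by (simp add: field_simps)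
 moreover have "exp (Complex (ln (cmod w)) (t + a)) = of_real (cmod w) * cis (t + a)"
  using w(1) by (simp add: exp_eq_polar)
 ultimately have "z = pol p (Complex (ln (cmod w)) (t + a))" using w(3) by (simp add: pol_def)
 moreover have "ln (cmod w) < 0" using w by (simp add: ln_less_zero)
 ultimately show "z : pol p ` {ze. Re ze < 0 & a <= Im ze & Im ze < a + 2*pi}"
  using t by (auto intro!: image_eqI[of _ _ "Complex (ln (cmod w)) (t + a)"])
qed

lemma pol_inj:
 assumes p: "p : uhp"
 shows "inj_on (pol p) {ze. Re ze < 0 & a <= Im ze & Im ze < a + 2*pi}"
proof (rule inj_onI, clarify)
 fix x y :: complex assume h: "Re x < 0" "Re y < 0" "a <= Im x" "Im x < a + 2*pi" "a <= Im y" "Im y < a + 2*pi" "pol p x = pol p y"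
 then have "exp x = exp y" unfolding pol_def using cay_icay[OF p] norm_exp_less_1 by metis
 then show "x = y" by (rule exp_complex_eqI[rotated]) (use h in auto)
qed

text \<open>By \<open>pol_conformal\<close> the area element is \<open>ds dt / (sinh s)^2\<close>.
  The start \<open>a\<close> of the angular window is free, so that a triangle can be swept starting
  from one of its sides.\<close>

lemma hmu_polar:
 assumes p: "p : uhp" and F[measurable]: "F : borel_measurable borel"
 shows "(\<integral>\<^sup>+ z. F z \<partial>hmu) =
  (\<integral>\<^sup>+ s. \<integral>\<^sup>+ t. ennreal (1 / (sinh s)^2) * F (pol p (Complex s t)) * indicator {a..<a+2*pi} t \<partial>lborel * indicator {..<0} s \<partial>lborel)"
proof -
 define S where "S = {ze. Re ze < 0 & a <= Im ze & Im ze < a + 2*pi}"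
 have S[measurable]: "S : sets borel" unfolding S_def by measurable
 have img: "pol p ` S = uhp - {p}" unfolding S_def by (rule pol_window_image[OF p])
 have imgS: "pol p ` S : sets borel" unfolding img by measurable
 have c1: "continuous_on S (pol1 p)" unfolding S_def
  by (intro continuous_at_imp_continuous_on ballI DERIV_isCont[OF pol1_deriv]) auto
 have c0: "continuous_on S (pol p)" unfolding S_def
  by (intro continuous_at_imp_continuous_on ballI DERIV_isCont[OF pol_deriv]) auto
 define G where "G z = indicator S z *\<^sub>R pol p z" for z
 have G[measurable]: "G : borel_measurable borel" unfolding G_def[abs_def]
  by (rule borel_measurable_continuous_on_indicator; use c0 in auto)
 \<comment> \<open>The chart misses only the centre, a null set.\<close>
 have ae: "AE z in lborel. z ~= p"
  by (rule AE_lborel_singleton)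
 have "(\<integral>\<^sup>+ z. F z \<partial>hmu) = (\<integral>\<^sup>+ z. (ennreal (1 / (Im z)^2) * F z) * indicator (pol p ` S) z \<partial>lborel)"
  unfolding img nn_integral_hmu[OF F]
  by (rule nn_integral_cong_AE) (use ae in eventually_elim, auto simp: indicator_def)
 also have "... = (\<integral>\<^sup>+ z. ennreal ((cmod (pol1 p z))^2) * (ennreal (1 / (Im (pol p z))^2) * F (pol p z)) * indicator S z \<partial>lborel)"
  by (rule nn_integral_holomorphic_image'[OF S imgS _ c1]) (use pol_deriv pol_inj[OF p] in "auto simp: S_def")
 also have "... = (\<integral>\<^sup>+ z. ennreal (1 / (sinh (Re z))^2) * F (G z) * indicator S z \<partial>lborel)"
 proof (intro nn_integral_cong)
  fix z
  have "ennreal ((cmod (pol1 p z))^2) * ennreal (1 / (Im (pol p z))^2) = ennreal (1 / (sinh (Re z))^2)" if "z : S"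
   using pol_conformal[OF p, of z] that by (subst ennreal_mult[symmetric]) (auto simp: S_def)
  then show "ennreal ((cmod (pol1 p z))^2) * (ennreal (1 / (Im (pol p z))^2) * F (pol p z)) * indicator S z = ennreal (1 / (sinh (Re z))^2) * F (G z) * indicator S z"
   by (auto simp: indicator_def G_def mult.assoc[symmetric])
 qed
 also have "... = (\<integral>\<^sup>+ s. \<integral>\<^sup>+ t. ennreal (1 / (sinh s)^2) * F (G (Complex s t)) * indicator S (Complex s t) \<partial>lborel \<partial>lborel)"
  by (subst nn_integral_complex) (auto simp: sinh_field_def)
 also have "... = (\<integral>\<^sup>+ s. \<integral>\<^sup>+ t. ennreal (1 / (sinh s)^2) * F (pol p (Complex s t)) * indicator {a..<a+2*pi} t \<partial>lborel * indicator {..<0} s \<partial>lborel)"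
 proof (intro nn_integral_cong)
  fix s :: real
  show "(\<integral>\<^sup>+ t. ennreal (1 / (sinh s)^2) * F (G (Complex s t)) * indicator S (Complex s t) \<partial>lborel)
   = (\<integral>\<^sup>+ t. ennreal (1 / (sinh s)^2) * F (pol p (Complex s t)) * indicator {a..<a+2*pi} t \<partial>lborel) * indicator {..<0} s"
  proof (cases "s < 0")
   case True then show ?thesis by (auto intro!: nn_integral_cong simp: S_def G_def indicator_def)
  qed (simp add: S_def)
 qed
 finally show ?thesis .
qed

section \<open>Unfolding over the group\<close>

lemma hyp_isom_measurable [measurable]: "f : hyp_isom ==> f : borel_measurable borel"
 by (elim hyp_isomE) (simp add: mobius_def[abs_def])

lemma sigma_finite_hmu: "sigma_finite_measure hmu"
 unfolding hmu_def by (subst sigma_finite_measure.sigma_finite_iff_density_finite[OF sigma_finite_lborel]) auto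

lemma measurable_hmu [simp]: "measurable hmu N = measurable borel N"
 by (rule measurable_cong_sets) auto

context fuchsian
begin

lemma isom_measurable [measurable]: "f : \<Gamma> ==> f : borel_measurable borel"
 using isom hyp_isom_measurable by blast

lemma isom_image: "f : \<Gamma> ==> f ` uhp = uhp"
 using in_uhp ivt_right ivt_props by (auto simp: image_iff) (metis)

lemma hmu_invariant:
 assumes "f : \<Gamma>" "F : borel_measurable borel"
 shows "(\<integral>\<^sup>+ z. F (f z) * indicator uhp z \<partial>hmu) = (\<integral>\<^sup>+ z. F z * indicator uhp z \<partial>hmu)"
 using hmu_isom[OF isom[OF assms(1)] isom_image[OF assms(1)] assms(2)] .

lemma Gamma_measurable:
 fixes F :: "(complex => complex) => complex => ennreal"
 assumes "!!f. f : \<Gamma> ==> F f : borel_measurable borel"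
 shows "case_prod F : borel_measurable (count_space \<Gamma> \<Otimes>\<^sub>M hmu)"
 by (rule measurable_pair_measure_countable1[OF countable_Gamma]) (use assms in auto)

lemma Gamma_pair: "pair_sigma_finite (count_space \<Gamma>) hmu"
 unfolding pair_sigma_finite_def
 using sigma_finite_measure_count_space_countable[OF countable_Gamma] sigma_finite_hmu by simp

lemma Gamma_nn_integral_measurable:
 fixes F :: "(complex => complex) => complex => ennreal"
 assumes "!!f. f : \<Gamma> ==> F f : borel_measurable borel"
 shows "(%z. \<integral>\<^sup>+ f. F f z \<partial>count_space \<Gamma>) : borel_measurable borel"
proof -
 interpret P: pair_sigma_finite "count_space \<Gamma>" hmu by (rule Gamma_pair)
 have "(%(z, f). F f z) : borel_measurable (hmu \<Otimes>\<^sub>M count_space \<Gamma>)"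
  using measurable_pair_swap[OF Gamma_measurable[OF assms]] by (simp add: split_beta')
 from P.M1.borel_measurable_nn_integral[OF this] show ?thesis
  by (simp add: measurable_cong_sets[OF sets_hmu refl])
qed

lemma Gamma_Fubini:
 fixes F :: "(complex => complex) => complex => ennreal"
 assumes "!!f. f : \<Gamma> ==> F f : borel_measurable borel"
 shows "(\<integral>\<^sup>+ z. (\<integral>\<^sup>+ f. F f z \<partial>count_space \<Gamma>) \<partial>hmu) = (\<integral>\<^sup>+ f. (\<integral>\<^sup>+ z. F f z \<partial>hmu) \<partial>count_space \<Gamma>)"
 using pair_sigma_finite.Fubini'[OF Gamma_pair Gamma_measurable[OF assms]] by simp

section \<open>Weights in place of a fundamental domain\<close>

definition ncnt :: "complex => ennreal" where
 "ncnt z = (\<integral>\<^sup>+ f. indicator KK (f z) \<partial>count_space \<Gamma>)"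
text \<open>The translates of \<open>KK\<close> cover with overlaps; dividing by their multiplicity
  makes the values of \<open>chi\<close> along an orbit add up to 1.\<close>

definition chi :: "complex => ennreal" where
 "chi z = indicator KK z / ncnt z"

lemma KK_borel [measurable]: "KK : sets borel"
 using KK(1) by (simp add: borel_compact)

lemma ncnt_measurable [measurable]: "ncnt : borel_measurable borel"
 unfolding ncnt_def[abs_def] by (rule Gamma_nn_integral_measurable) measurable

lemma chi_measurable [measurable]: "chi : borel_measurable borel"
 unfolding chi_def[abs_def] by measurable

lemma ncnt_bounds:
 assumes z: "z : uhp" shows "ncnt z >= 1" "ncnt z < top_class.top"
proof -
 have eq: "ncnt z = emeasure (count_space \<Gamma>) {f:\<Gamma>. f z : KK}"
 proof -
  have "ncnt z = (\<integral>\<^sup>+ f. indicator {f:\<Gamma>. f z : KK} f \<partial>count_space \<Gamma>)"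
   unfolding ncnt_def by (rule nn_integral_cong) (simp add: indicator_def)
  also have "... = emeasure (count_space \<Gamma>) {f:\<Gamma>. f z : KK}" by (rule nn_integral_indicator) auto
  finally show ?thesis .
 qed
 have "{f:\<Gamma>. f z : KK} \<subseteq> {f:\<Gamma>. f ` (insert z KK) \<inter> insert z KK ~= {}}" by auto
 moreover have "finite {f:\<Gamma>. f ` (insert z KK) \<inter> insert z KK ~= {}}"
  by (rule finite_hits) (use z KK in auto)
 ultimately have fin: "finite {f:\<Gamma>. f z : KK}" using finite_subset by blast
 have card: "ncnt z = of_nat (card {f:\<Gamma>. f z : KK})"
  unfolding eq by (rule emeasure_count_space_finite) (use fin in auto)
 obtain f where "f : \<Gamma>" "f z : KK" using move[OF z] .
 then have "card {f:\<Gamma>. f z : KK} >= 1" using fin by (simp add: Suc_le_eq card_gt_0_iff) blast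
 then show "ncnt z >= 1" unfolding card by (metis of_nat_1 of_nat_mono)
 show "ncnt z < top_class.top" unfolding card by (simp add: of_nat_less_top)
qed

lemma ncnt_invariant:
 assumes "g : \<Gamma>" "z : uhp" shows "ncnt (g z) = ncnt z"
proof -
 have "ncnt z = (\<integral>\<^sup>+ f. indicator KK (cmp f g z) \<partial>count_space \<Gamma>)"
  unfolding ncnt_def by (rule nn_integral_bij_count_space[symmetric, OF bij_cmp_right[OF assms(1)]])
 also have "... = ncnt (g z)" unfolding ncnt_def
  by (intro nn_integral_cong) (simp add: cmp_props assms)
 finally show ?thesis by simp
qed

lemma chi_sum:
 assumes z: "z : uhp" shows "(\<integral>\<^sup>+ f. chi (f z) \<partial>count_space \<Gamma>) = 1"
proof -
 have "(\<integral>\<^sup>+ f. chi (f z) \<partial>count_space \<Gamma>) = (\<integral>\<^sup>+ f. indicator KK (f z) / ncnt z \<partial>count_space \<Gamma>)"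
  by (intro nn_integral_cong) (simp add: chi_def ncnt_invariant z)
 also have "... = ncnt z / ncnt z" unfolding ncnt_def by (rule nn_integral_divide) simp
 also have "... = 1" using ncnt_bounds[OF z] by (intro ennreal_divide_self) auto
 finally show ?thesis .
qed

lemma chi_support: "chi z ~= 0 ==> z : uhp"
 using KK(2) by (auto simp: chi_def indicator_def split: if_splits)

lemma chi_uhp: "chi z * indicator uhp z = chi z"
 using chi_support[of z] by (auto simp: indicator_def)

text \<open>Insert 1 as the sum of \<open>chi (f z)\<close> over \<Gamma>, exchange sum and
  integral, and move each term by \<open>f^-1\<close>, which preserves \<open>hmu\<close>.\<close>

lemma unfolding_sum:
 assumes [measurable]: "F : borel_measurable borel"
 shows "(\<integral>\<^sup>+ z. F z * indicator uhp z \<partial>hmu) = (\<integral>\<^sup>+ z. chi z * (\<integral>\<^sup>+ f. F (f z) \<partial>count_space \<Gamma>) \<partial>hmu)"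
proof -
 have "(\<integral>\<^sup>+ z. F z * indicator uhp z \<partial>hmu) = (\<integral>\<^sup>+ z. (\<integral>\<^sup>+ f. F z * indicator uhp z * chi (f z) \<partial>count_space \<Gamma>) \<partial>hmu)"
 proof (intro nn_integral_cong)
  fix z
  show "F z * indicator uhp z = (\<integral>\<^sup>+ f. F z * indicator uhp z * chi (f z) \<partial>count_space \<Gamma>)"
   by (subst nn_integral_cmult) (auto simp: chi_sum indicator_def)
 qed
 also have "... = (\<integral>\<^sup>+ f. (\<integral>\<^sup>+ z. F z * indicator uhp z * chi (f z) \<partial>hmu) \<partial>count_space \<Gamma>)"
  by (rule Gamma_Fubini) measurable
 also have "... = (\<integral>\<^sup>+ f. (\<integral>\<^sup>+ z. F (ivt f z) * chi z \<partial>hmu) \<partial>count_space \<Gamma>)"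
 proof (rule nn_integral_cong)
  fix f assume "f : space (count_space \<Gamma>)"
  then have f: "f : \<Gamma>" by simp
  have [measurable]: "ivt f : borel_measurable borel" using ivt_props(1)[OF f] by (rule isom_measurable)
  have "(\<integral>\<^sup>+ z. F z * indicator uhp z * chi (f z) \<partial>hmu) = (\<integral>\<^sup>+ z. (F (ivt f (f z)) * chi (f z)) * indicator uhp z \<partial>hmu)"
   by (intro nn_integral_cong) (auto simp: indicator_def ivt_props f)
  also have "... = (\<integral>\<^sup>+ z. (F (ivt f z) * chi z) * indicator uhp z \<partial>hmu)"
   by (rule hmu_invariant[OF f]) measurable
  also have "... = (\<integral>\<^sup>+ z. F (ivt f z) * chi z \<partial>hmu)" by (simp add: mult.assoc chi_uhp)
  finally show "(\<integral>\<^sup>+ z. F z * indicator uhp z * chi (f z) \<partial>hmu) = (\<integral>\<^sup>+ z. F (ivt f z) * chi z \<partial>hmu)" .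
 qed
 also have "... = (\<integral>\<^sup>+ f. (\<integral>\<^sup>+ z. F (f z) * chi z \<partial>hmu) \<partial>count_space \<Gamma>)"
  by (rule nn_integral_bij_count_space[OF bij_ivt])
 also have "... = (\<integral>\<^sup>+ z. (\<integral>\<^sup>+ f. F (f z) * chi z \<partial>count_space \<Gamma>) \<partial>hmu)"
  by (rule Gamma_Fubini[symmetric]) measurable
 also have "... = (\<integral>\<^sup>+ z. chi z * (\<integral>\<^sup>+ f. F (f z) \<partial>count_space \<Gamma>) \<partial>hmu)"
  by (intro nn_integral_cong) (subst nn_integral_multc, auto simp: mult.commute)
 finally show ?thesis .
qed

text \<open>Summing the kernel over \<Gamma> in its second variable gives a symmetric function of
  two points of M; by Fubini both sides are the same double integral over M.\<close>

lemma symmetric_kernel: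
 assumes k[measurable]: "(%(x, y). k x y) : borel_measurable (borel \<Otimes>\<^sub>M borel)"
  and sym: "!!x y. x : uhp ==> y : uhp ==> k x y = k y x"
  and inv: "!!f x y. f : \<Gamma> ==> x : uhp ==> y : uhp ==> k (f x) (f y) = k x y"
  and F[measurable]: "F : borel_measurable borel" "!!f z. f : \<Gamma> ==> z : uhp ==> F (f z) = F z"
  and G[measurable]: "G : borel_measurable borel" "!!f z. f : \<Gamma> ==> z : uhp ==> G (f z) = G z"
 shows "(\<integral>\<^sup>+ x. chi x * G x * (\<integral>\<^sup>+ y. k x y * F y * indicator uhp y \<partial>hmu) \<partial>hmu)
    = (\<integral>\<^sup>+ x. chi x * F x * (\<integral>\<^sup>+ y. k x y * G y * indicator uhp y \<partial>hmu) \<partial>hmu)"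
proof -
 interpret S: sigma_finite_measure hmu by (rule sigma_finite_hmu)
 interpret P: pair_sigma_finite hmu hmu by unfold_locales
 define K where "K x y = (\<integral>\<^sup>+ f. k x (f y) \<partial>count_space \<Gamma>)" for x y
 have kx[measurable]: "k x : borel_measurable borel" for x
  using measurable_Pair2[OF k, of x] by simp
 have Ksym: "K x y = K y x" if "x : uhp" "y : uhp" for x y
 proof -
  have "K x y = (\<integral>\<^sup>+ f. k x (ivt f y) \<partial>count_space \<Gamma>)"
   unfolding K_def by (rule nn_integral_bij_count_space[symmetric, OF bij_ivt])
  also have "... = (\<integral>\<^sup>+ f. k y (f x) \<partial>count_space \<Gamma>)"
  proof (intro nn_integral_cong)
   fix f assume "f : space (count_space \<Gamma>)"
   then have f: "f : \<Gamma>" by simp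
   have "k x (ivt f y) = k (f x) (f (ivt f y))" using inv[OF f that(1)] ivt_props[OF f] in_uhp that by metis
   also have "... = k (f x) y" using ivt_right[OF f that(2)] by simp
   also have "... = k y (f x)" using sym in_uhp[OF f] that by blast
   finally show "k x (ivt f y) = k y (f x)" .
  qed
  finally show ?thesis by (simp add: K_def)
 qed
 have KM[measurable]: "(%(x, y). K x y) : borel_measurable (hmu \<Otimes>\<^sub>M hmu)"
 proof -
  have "(%(p, f). k (fst p) (f (snd p))) : borel_measurable ((hmu \<Otimes>\<^sub>M hmu) \<Otimes>\<^sub>M count_space \<Gamma>)"
  proof -
   have "(%(f, p). k (fst p) (f (snd p))) : borel_measurable (count_space \<Gamma> \<Otimes>\<^sub>M (hmu \<Otimes>\<^sub>M hmu))"
   proof (rule measurable_pair_measure_countable1[OF countable_Gamma])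
    fix f assume "f : \<Gamma>"
    then have [measurable]: "f : borel_measurable borel" by (rule isom_measurable)
    have [measurable]: "(%p. (fst p, f (snd p))) : measurable (hmu \<Otimes>\<^sub>M hmu) (borel \<Otimes>\<^sub>M borel)" by measurable
    from measurable_compose[OF this k]
    show "(%y. case (f, y) of (f, p) => k (fst p) (f (snd p))) : borel_measurable (hmu \<Otimes>\<^sub>M hmu)" by simp
   qed
   from measurable_pair_swap[OF this] show ?thesis by (simp add: split_beta')
  qed
  from sigma_finite_measure.borel_measurable_nn_integral[OF sigma_finite_measure_count_space_countable[OF countable_Gamma] this]
  show ?thesis by (simp add: K_def split_beta')
 qed
 have main: "(\<integral>\<^sup>+ x. chi x * G x * (\<integral>\<^sup>+ y. k x y * F y * indicator uhp y \<partial>hmu) \<partial>hmu)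
   = (\<integral>\<^sup>+ x. (\<integral>\<^sup>+ y. chi x * chi y * G x * F y * K x y \<partial>hmu) \<partial>hmu)"
  if F[measurable]: "F : borel_measurable borel" and Finv: "!!f z. f : \<Gamma> ==> z : uhp ==> F (f z) = F z" for F G
 proof (intro nn_integral_cong)
  fix x
  have "(\<integral>\<^sup>+ y. k x y * F y * indicator uhp y \<partial>hmu) = (\<integral>\<^sup>+ y. chi y * (\<integral>\<^sup>+ f. k x (f y) * F (f y) \<partial>count_space \<Gamma>) \<partial>hmu)"
   by (rule unfolding_sum) measurable
  also have "... = (\<integral>\<^sup>+ y. chi y * F y * K x y \<partial>hmu)"
  proof (intro nn_integral_cong)
   fix y
   show "chi y * (\<integral>\<^sup>+ f. k x (f y) * F (f y) \<partial>count_space \<Gamma>) = chi y * F y * K x y"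
   proof (cases "y : uhp")
    case True
    have "(\<integral>\<^sup>+ f. k x (f y) * F (f y) \<partial>count_space \<Gamma>) = (\<integral>\<^sup>+ f. k x (f y) * F y \<partial>count_space \<Gamma>)"
     by (intro nn_integral_cong) (simp add: Finv True)
    also have "... = K x y * F y" unfolding K_def by (rule nn_integral_multc) simp
    finally show ?thesis by (simp add: mult_ac)
   next
    case False
    then have "chi y = 0" using chi_support by blast
    then show ?thesis by simp
   qed
  qed
  finally have e: "(\<integral>\<^sup>+ y. k x y * F y * indicator uhp y \<partial>hmu) = (\<integral>\<^sup>+ y. chi y * F y * K x y \<partial>hmu)" .
  have [measurable]: "K x : borel_measurable borel"
   unfolding K_def by (rule Gamma_nn_integral_measurable) measurable
  show "chi x * G x * (\<integral>\<^sup>+ y. k x y * F y * indicator uhp y \<partial>hmu) = (\<integral>\<^sup>+ y. chi x * chi y * G x * F y * K x y \<partial>hmu)"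
   unfolding e by (subst nn_integral_cmult[symmetric]) (auto intro!: nn_integral_cong simp: mult_ac)
 qed
 have "(\<integral>\<^sup>+ x. (\<integral>\<^sup>+ y. chi x * chi y * G x * F y * K x y \<partial>hmu) \<partial>hmu) = (\<integral>\<^sup>+ y. (\<integral>\<^sup>+ x. chi x * chi y * G x * F y * K x y \<partial>hmu) \<partial>hmu)"
  by (rule P.Fubini'[symmetric]) (use KM in measurable)
 also have "... = (\<integral>\<^sup>+ x. (\<integral>\<^sup>+ y. chi x * chi y * F x * G y * K x y \<partial>hmu) \<partial>hmu)"
 proof (intro nn_integral_cong)
  fix x y
  show "chi y * chi x * G y * F x * K y x = chi x * chi y * F x * G y * K x y"
   using Ksym[of x y] chi_support[of x] chi_support[of y] by (cases "chi x = 0"; cases "chi y = 0") (auto simp: mult_ac)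
 qed
 finally have eq: "(\<integral>\<^sup>+ x. (\<integral>\<^sup>+ y. chi x * chi y * G x * F y * K x y \<partial>hmu) \<partial>hmu) = (\<integral>\<^sup>+ x. (\<integral>\<^sup>+ y. chi x * chi y * F x * G y * K x y \<partial>hmu) \<partial>hmu)" .
 show ?thesis
  apply (subst main[of F G, OF F(1)], rule F(2), assumption, assumption)
  apply (subst main[of G F, OF G(1)], rule G(2), assumption, assumption)
  apply (rule eq)
  done
qed

text \<open>Integrating a \<Gamma>-invariant function against \<open>nu\<close> means integrating it
  over M; the total mass of \<open>nu\<close> is the area of M.\<close>

definition nu :: "complex measure" where "nu = density hmu chi"

lemma sets_nu [measurable_cong, simp]: "sets nu = sets borel" and space_nu [simp]: "space nu = UNIV"
 by (simp_all add: nu_def)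

lemma nn_integral_nu: "F : borel_measurable borel ==> (\<integral>\<^sup>+ z. F z \<partial>nu) = (\<integral>\<^sup>+ z. chi z * F z \<partial>hmu)"
 unfolding nu_def by (rule nn_integral_density) auto

lemma hmu_compact_finite:
 assumes K: "compact K" "K \<subseteq> uhp" shows "emeasure hmu K < top_class.top"
proof (cases "K = {}")
 case False
 have [measurable]: "K : sets borel" using K by (simp add: borel_compact)
 obtain z0 where z0: "z0 : K" "!!z. z : K ==> Im z0 <= Im z"
  using continuous_attains_inf[OF K(1) False continuous_on_Im[OF continuous_on_id]] by auto
 have p: "Im z0 > 0" using z0 K by (auto simp: uhp_iff)
 have "emeasure hmu K = (\<integral>\<^sup>+ z. indicator K z \<partial>hmu)" by simp
 also have "... = (\<integral>\<^sup>+ z. ennreal (1 / (Im z)^2) * indicator K z * indicator uhp z \<partial>lborel)" by (rule nn_integral_hmu) simp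
 also have "... <= (\<integral>\<^sup>+ z. ennreal (1 / (Im z0)^2) * indicator K z \<partial>lborel)"
 proof (intro nn_integral_mono)
  fix z show "ennreal (1 / (Im z)^2) * indicator K z * indicator uhp z <= ennreal (1 / (Im z0)^2) * indicator K z"
   using z0(2)[of z] p by (auto simp: indicator_def intro!: ennreal_leI divide_left_mono power_mono mult_pos_pos)
 qed
 also have "... = ennreal (1 / (Im z0)^2) * emeasure lborel K" by (simp add: nn_integral_cmult)
 also have "... < top_class.top" using emeasure_compact_finite[OF K(1)] by (simp add: ennreal_mult_less_top)
 finally show ?thesis .
qed simp

lemma nu_finite: "emeasure nu UNIV < top_class.top" "emeasure nu UNIV <= emeasure hmu KK"
proof -
 have "emeasure nu UNIV = (\<integral>\<^sup>+ z. chi z \<partial>hmu)" by (simp add: nu_def emeasure_density)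
 also have "... <= (\<integral>\<^sup>+ z. indicator KK z \<partial>hmu)"
 proof (intro nn_integral_mono)
  fix z show "chi z <= indicator KK z"
  proof (cases "z : KK")
   case True
   then have n: "ncnt z >= 1" "ncnt z < top_class.top" using ncnt_bounds KK(2) by blast+
   have "1 / ncnt z <= 1" using n by (cases "ncnt z") (auto simp: divide_ennreal simp flip: ennreal_1)
   then show ?thesis using True by (simp add: chi_def)
  qed (simp add: chi_def)
 qed
 finally show "emeasure nu UNIV <= emeasure hmu KK" by simp
 then show "emeasure nu UNIV < top_class.top" using hmu_compact_finite[OF KK(1,2)] by (rule order_le_less_trans)
qed

end

section \<open>Lower bounds for the ball integral\<close>

lemma nn_integral_FTC_atMost:
 fixes f F :: "real => real"
 assumes f[measurable]: "f : borel_measurable borel"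
  and der: "!!x. x <= b ==> (F has_real_derivative f x) (at x)" and nn: "!!x. x <= b ==> 0 <= f x"
  and lim: "(F \<longlongrightarrow> T) at_bot"
 shows "(\<integral>\<^sup>+ x. ennreal (f x) * indicator {..b} x \<partial>lborel) = ennreal (F b - T)"
proof -
 have "(\<integral>\<^sup>+ x. ennreal (f x) * indicator {..b} x \<partial>lborel) = (\<integral>\<^sup>+ x. ennreal (f (0 + (-1) * x)) * indicator {..b} (0 + (-1) * x) \<partial>lborel)"
  by (subst nn_integral_real_affine[where c = "-1" and t = 0]) auto
 also have "... = (\<integral>\<^sup>+ x. ennreal (f (- x)) * indicator {-b..} x \<partial>lborel)"
  by (intro nn_integral_cong) (auto simp: indicator_def)
 also have "... = ennreal (- T - (- F (- (- b))))"
 proof (rule nn_integral_FTC_atLeast)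
  show "((%x. - F (- x)) has_real_derivative f (- x)) (at x)" if "- b <= x" for x
   by (rule DERIV_cong[OF DERIV_minus[OF DERIV_chain2[OF der]]]) (use that in "auto intro!: derivative_eq_intros")
  show "((%x. - F (- x)) \<longlongrightarrow> - T) at_top"
   by (rule tendsto_minus) (rule filterlim_compose[OF lim filterlim_uminus_at_bot_at_top])
 qed (use nn in auto)
 finally show ?thesis by simp
qed

lemma aa_measurable [measurable]: "aa : borel_measurable borel"
 and rr_measurable [measurable]: "rr : borel_measurable borel"
 and cc_measurable [measurable]: "cc : borel_measurable borel"
 unfolding aa_def[abs_def] rr_def[abs_def] cc_def[abs_def] by measurable

text \<open>The radial equation controls \<open>phi\<close> for negative \<open>s\<close> only; the
  cut-off gives a Borel function on the whole line.\<close>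

definition phim :: "real => real => real" where "phim lam s = indicator {..<0} s *\<^sub>R phi lam s"

lemma phim_eq: "s < 0 ==> phim lam s = phi lam s"
 by (simp add: phim_def)

lemma phim_measurable: "lam <= 1/4 ==> phim lam : borel_measurable borel"
 unfolding phim_def[abs_def]
 by (rule borel_measurable_continuous_on_indicator)
  (auto intro!: continuous_at_imp_continuous_on DERIV_isCont[OF phi_deriv(1)])

lemma eigen_const: "eigen_on (%_. c) 0"
proof -
 have "px (%_. c) = (%_. 0)" "py (%_. c) = (%_. 0)" "px (%_. 0) = (%_. 0)" "py (%_. 0) = (%_. 0)"
  by (auto simp: px_def py_def fun_eq_iff)
 then show ?thesis by (simp add: eigen_on_def C2_on_uhp_def hyp_laplacian_def)
qed

lemma phi_0: "s < 0 ==> phi 0 s = 1"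
 using mean_value[OF eigen_const[of 1] _ i_uhp, of s] by (simp add: sph_def)

lemma phi_le_1: "0 <= lam ==> lam <= 1/4 ==> s < 0 ==> phi lam s <= 1"
 using phi_strict_antimono[of 0 lam s] phi_0[of s] by (cases "lam = 0") auto

lemma phi_antimono: "lam <= mu ==> mu <= 1/4 ==> s < 0 ==> phi mu s <= phi lam s"
 using phi_strict_antimono[of lam mu s] by (cases "lam = mu") auto

lemma phim_bounds: "0 <= lam ==> lam <= 1/4 ==> 0 <= phim lam s & phim lam s <= 1"
 using phi_le_1[of lam s] phi_pos[of lam s] by (auto simp: phim_def indicator_def)

text \<open>The distribution of area over the radial coordinate in a ball:
  \<open>2 * pi * (aa s)^2 ds\<close> is \<open>2 * pi * sinh r dr\<close>, and \<open>s < S\<close>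
  means that the radius is below \<open>rr S\<close>.\<close>

definition LL :: "real => real measure" where
 "LL S = density lborel (%s. ennreal (2 * pi * (aa s)^2) * indicator {..<S} s)"

lemma sets_LL [measurable_cong, simp]: "sets (LL S) = sets borel" and space_LL [simp]: "space (LL S) = UNIV"
 by (simp_all add: LL_def)

lemma nn_integral_LL: "f : borel_measurable borel ==> (\<integral>\<^sup>+ s. f s \<partial>LL S) = (\<integral>\<^sup>+ s. ennreal (2 * pi * (aa s)^2) * indicator {..<S} s * f s \<partial>lborel)"
 unfolding LL_def by (rule nn_integral_density) auto

lemma LL_total: assumes "S < 0" shows "emeasure (LL S) UNIV = ennreal (2 * pi * (cc S - 1))"
proof -
 have lim: "((%s. 2 * pi * cc s) \<longlongrightarrow> 2 * pi) at_bot" unfolding cc_def by real_asymp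
 have "emeasure (LL S) UNIV = (\<integral>\<^sup>+ s. ennreal (2 * pi * (aa s)^2) * indicator {..<S} s \<partial>lborel)"
  by (simp add: LL_def emeasure_density)
 also have "... = (\<integral>\<^sup>+ s. ennreal (2 * pi * (aa s)^2) * indicator {..S} s \<partial>lborel)"
  by (rule nn_integral_cong_AE) (use AE_lborel_singleton[of S] in eventually_elim, auto simp: indicator_def)
 also have "... = ennreal (2 * pi * cc S - 2 * pi)"
  by (rule nn_integral_FTC_atMost[OF _ _ _ lim]) (use assms in "auto intro!: DERIV_cmult cc_deriv")
 finally show ?thesis by (simp add: algebra_simps)
qed

lemma finite_LL: "S < 0 ==> finite_measure (LL S)"
 by (rule finite_measureI) (simp add: LL_total)

lemma LL_AE: "AE s in LL S. s < S"
 unfolding LL_def by (subst AE_density) (auto simp: indicator_def)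

text \<open>\<open>cval S lam\<close> is the factor by which integration over a ball multiplies an
  eigenfunction of eigenvalue \<open>lam\<close>; \<open>mval S\<close> is m(R) for
  \<open>R = rr S\<close>.\<close>

definition cval :: "real => real => real" where "cval S lam = (\<integral>s. phim lam s \<partial>LL S)"
definition mval :: "real => real" where "mval S = (\<integral>s. (phim (1/4) s)\<^sup>2 \<partial>LL S)"

lemma LL_integrable_bounded:
 assumes "S < 0" "f : borel_measurable borel" "!!s. \<bar>f s\<bar> <= (B::real)"
 shows "integrable (LL S) f"
 by (rule finite_measure.integrable_const_bound[OF finite_LL[OF assms(1)]]) (use assms in auto)

lemma LL_pos: "S < 0 ==> emeasure (LL S) (space (LL S)) ~= 0"
 using cc_gt_1[of S] by (simp add: LL_total)

lemma cval_strict_antimono: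
 assumes S: "S < 0" and l: "0 <= lam" "lam < mu" "mu <= 1/4"
 shows "cval S mu < cval S lam"
 unfolding cval_def
proof (rule finite_measure.integral_less_AE_space[OF finite_LL[OF S]])
 show "integrable (LL S) (phim mu)" "integrable (LL S) (phim lam)"
  by (rule LL_integrable_bounded[OF S phim_measurable, where B=1]; use l phim_bounds in "auto simp: abs_le_iff intro: order_trans[of _ 0]")+
 show "AE s in LL S. phim mu s < phim lam s"
  using LL_AE by eventually_elim (use S l phi_strict_antimono in "auto simp: phim_eq")
qed (rule LL_pos[OF S])

text \<open>\<open>aa s ds\<close> is \<open>dr\<close>, so \<open>F\<close> is the integral of
  \<open>2 * pi * g\<close> over the radius, and the pointwise bound on
  \<open>(phi (1/4))^2 * aa\<close> only has to be integrated.\<close>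

lemma LL_strict_lower:
 assumes S: "S < 0" and g: "g : borel_measurable borel" "!!s. s < 0 ==> 0 <= g s"
  and less: "!!s. s < 0 ==> g s < (phi (1/4) s)^2 * aa s"
  and F: "!!s. s < 0 ==> (F has_real_derivative 2 * pi * (g s * aa s)) (at s)" "(F \<longlongrightarrow> 0) at_bot"
 shows "F S < mval S"
proof -
 note [measurable] = g(1) phim_measurable[of "1/4", simplified]
 have int: "integrable (LL S) (%s. (phim (1/4) s)\<^sup>2)"
 proof (rule LL_integrable_bounded[OF S, where B=1])
  fix s show "\<bar>(phim (1/4) s)\<^sup>2\<bar> <= 1" using phim_bounds[of "1/4" s] by (simp add: power_le_one)
 qed measurable
 have q: "(\<integral>\<^sup>+ s. ennreal (g s / aa s) \<partial>LL S) = ennreal (F S)"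
 proof -
  have "(\<integral>\<^sup>+ s. ennreal (g s / aa s) \<partial>LL S) = (\<integral>\<^sup>+ s. ennreal (2 * pi * (aa s)^2) * indicator {..<S} s * ennreal (g s / aa s) \<partial>lborel)"
   by (rule nn_integral_LL) measurable
  also have "... = (\<integral>\<^sup>+ s. ennreal (2 * pi * (g s * aa s)) * indicator {..S} s \<partial>lborel)"
  proof (rule nn_integral_cong_AE, use AE_lborel_singleton[of S] in eventually_elim)
   fix s assume "s ~= S"
   show "ennreal (2 * pi * (aa s)^2) * indicator {..<S} s * ennreal (g s / aa s) = ennreal (2 * pi * (g s * aa s)) * indicator {..S} s"
   proof (cases "s < S")
    case True
    then have s: "s < 0" using S by simp
    have "2 * pi * (aa s)^2 * (g s / aa s) = 2 * pi * (g s * aa s)" using aa_pos[OF s] by (simp add: power2_eq_square)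
    then show ?thesis using True g(2)[OF s] aa_pos[OF s] by (simp add: ennreal_mult[symmetric])
   qed (use \<open>s ~= S\<close> in "auto simp: indicator_def")
  qed
  also have "... = ennreal (F S - 0)"
   by (rule nn_integral_FTC_atMost[OF _ _ _ F(2)]) (use S F(1) g(2) aa_pos in "auto simp: less_imp_le")
  finally show ?thesis by simp
 qed
 have F0: "F S >= 0"
  by (rule mono_from_bot[OF F(1) _ F(2) S]) (use g(2) aa_pos in "auto simp: less_imp_le")
 define G where "G s = indicator {..<0} s * (g s / aa s)" for s
 have [measurable]: "G : borel_measurable borel" unfolding G_def by measurable
 have G0: "G s >= 0" for s using g(2)[of s] aa_pos[of s] by (auto simp: G_def indicator_def)
 have q': "(\<integral>\<^sup>+ s. ennreal (G s) \<partial>LL S) = ennreal (F S)"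
  unfolding q[symmetric] by (rule nn_integral_cong_AE, use LL_AE in eventually_elim) (use S in "auto simp: G_def")
 have intG: "integrable (LL S) G"
  by (rule integrableI_nn_integral_finite[OF _ _ q']) (use G0 F0 in auto)
 have "(\<integral>s. G s \<partial>LL S) = F S"
 proof -
  have "0 <= (\<integral>s. G s \<partial>LL S)" by (rule integral_nonneg_AE) (simp add: G0)
  moreover have "ennreal (\<integral>s. G s \<partial>LL S) = ennreal (F S)"
   using nn_integral_eq_integral[OF intG] G0 q' by simp
  ultimately show ?thesis using F0 by simp
 qed
 moreover have "(\<integral>s. G s \<partial>LL S) < mval S" unfolding mval_def
 proof (rule finite_measure.integral_less_AE_space[OF finite_LL[OF S] intG int])
  show "AE s in LL S. G s < (phim (1/4) s)^2"
   using LL_AE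
  proof eventually_elim
   fix s assume "s < S" then have s: "s < 0" using S by simp
   show "G s < (phim (1/4) s)^2" using less[OF s] aa_pos[OF s] s by (simp add: G_def phim_eq field_simps)
  qed
 qed (rule LL_pos[OF S])
 ultimately show ?thesis by simp
qed

lemma mval_lower_1: assumes S: "S < 0" shows "pi * (rr S)^2 < mval S"
proof (rule LL_strict_lower[OF S, of rr])
 show "((%s. pi * (rr s)^2) has_real_derivative 2 * pi * (rr s * aa s)) (at s)" if "s < 0" for s
  using rr_deriv[OF that] by (auto intro!: derivative_eq_intros)
 show "((%s. pi * (rr s)^2) \<longlongrightarrow> 0) at_bot" unfolding rr_def by real_asymp
qed (use rr_pos phi_lower_1 in "auto simp: less_imp_le")

lemma mval_lower_2: assumes S: "S < 0" shows "4 * (rr S)^3 / (3 * pi) < mval S"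
proof (rule LL_strict_lower[OF S, of "%s. 2 * (rr s)^2 / pi^2"])
 show "((%s. 4 * (rr s)^3 / (3 * pi)) has_real_derivative 2 * pi * (2 * (rr s)^2 / pi^2 * aa s)) (at s)" if "s < 0" for s
  using rr_deriv[OF that] by (auto intro!: derivative_eq_intros simp: field_simps power2_eq_square)
 show "((%s. 4 * (rr s)^3 / (3 * pi)) \<longlongrightarrow> 0) at_bot" unfolding rr_def by real_asymp
qed (use phi_lower_2 in auto)

text \<open>The coordinate \<open>s\<close> of \<open>z\<close> in polar coordinates about
  \<open>x\<close>. At \<open>z = x\<close> it is \<open>ln 0 = 0\<close>, so the centre falls
  outside the ball \<open>rad x z < S\<close> for negative \<open>S\<close>; this changes no
  integral.\<close>

definition rad :: "complex => complex => real" where "rad x z = ln (cmod (cay x z))"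

definition bker :: "(real => real) => real => complex => complex => real" where
 "bker k S x z = (if x : uhp & z : uhp & rad x z < S then k (rad x z) else 0)"

lemma rad_pol: assumes "x : uhp" "s < 0" shows "rad x (pol x (Complex s t)) = s"
proof -
 have "cay x (pol x (Complex s t)) = exp (Complex s t)"
  unfolding pol_def by (rule cay_icay) (use assms in auto)
 then show ?thesis by (simp add: rad_def)
qed

lemma bker_pol: "x : uhp ==> S < 0 ==> s < 0 ==> bker k S x (pol x (Complex s t)) = (if s < S then k s else 0)"
 by (simp add: bker_def rad_pol pol_in_uhp)

lemma cnj_measurable [measurable]: "cnj : borel_measurable borel"
 by (intro borel_measurable_continuous_onI continuous_intros)

declare hyp_isom_measurable [measurable del]

lemma bker_measurable [measurable]:
 assumes [measurable]: "k : borel_measurable borel"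
 shows "(%(x, z). bker k S x z) : borel_measurable (borel \<Otimes>\<^sub>M borel)"
 unfolding bker_def rad_def cay_def split_beta' by measurable

text \<open>In polar coordinates the kernel is constant on circles, so the angular integral is
  \<open>sph h x s\<close> and only \<open>LL S\<close> remains.\<close>

lemma bker_nn_integral:
 assumes x: "x : uhp" and S: "S < 0" and k[measurable]: "k : borel_measurable borel" and k0: "!!s. 0 <= k s"
  and h[measurable]: "h : borel_measurable borel" and hc: "continuous_on uhp h" and h0: "!!z. z : uhp ==> 0 <= h z"
  and H[measurable]: "H : borel_measurable borel" and hH: "!!s. s < 0 ==> sph h x s = 2 * pi * H s"
 shows "(\<integral>\<^sup>+ z. ennreal (bker k S x z * h z) \<partial>hmu) = (\<integral>\<^sup>+ s. ennreal (k s * H s) \<partial>LL S)"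
proof -
 have mb[measurable]: "(%z. ennreal (bker k S x z * h z)) : borel_measurable borel" by measurable
 have "(\<integral>\<^sup>+ z. ennreal (bker k S x z * h z) \<partial>hmu)
  = (\<integral>\<^sup>+ s. \<integral>\<^sup>+ t. ennreal (1 / (sinh s)^2) * ennreal (bker k S x (pol x (Complex s t)) * h (pol x (Complex s t))) * indicator {0..<0+2*pi} t \<partial>lborel * indicator {..<0} s \<partial>lborel)"
  by (rule hmu_polar[OF x mb])
 also have "... = (\<integral>\<^sup>+ s. ennreal (2 * pi * (aa s)^2) * indicator {..<S} s * ennreal (k s * H s) \<partial>lborel)"
 proof (rule nn_integral_cong)
  fix s :: real
  show "(\<integral>\<^sup>+ t. ennreal (1 / (sinh s)^2) * ennreal (bker k S x (pol x (Complex s t)) * h (pol x (Complex s t))) * indicator {0..<0+2*pi} t \<partial>lborel) * indicator {..<0} s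
   = ennreal (2 * pi * (aa s)^2) * indicator {..<S} s * ennreal (k s * H s)"
  proof (cases "s < S")
   case True
   then have s: "s < 0" using S by simp
   have c: "continuous_on {0..2*pi} (%t. h (pol x (Complex s t)))" by (rule continuous_pol_slice(1)[OF x s hc])
   have pu: "pol x (Complex s t) : uhp" for t using pol_in_uhp[OF x] s by simp
   have hi: "((%t. h (pol x (Complex s t))) has_integral sph h x s) {0..2*pi}"
    unfolding sph_def using c by (intro integrable_integral integrable_continuous_real)
   have i: "(\<integral>\<^sup>+ t. ennreal (h (pol x (Complex s t))) * indicator {0..2*pi} t \<partial>lborel) = ennreal (sph h x s)"
    by (rule nn_integral_has_integral_lebesgue'[OF _ hi]) (use h0 pu in auto)
   have sph0: "sph h x s >= 0" by (rule has_integral_nonneg[OF hi]) (use h0 pu in auto)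
   have m: "(%t. ennreal (h (pol x (Complex s t))) * indicator {0..2*pi} t) : borel_measurable borel"
   proof -
    have "(%t. indicator {0..2*pi} t *\<^sub>R h (pol x (Complex s t))) : borel_measurable borel"
     by (rule borel_measurable_continuous_on_indicator) (use c in auto)
    then have "(%t. ennreal (indicator {0..2*pi} t *\<^sub>R h (pol x (Complex s t))) * indicator {0..2*pi} t) : borel_measurable borel" by measurable
    moreover have "(%t. ennreal (indicator {0..2*pi} t *\<^sub>R h (pol x (Complex s t))) * indicator {0..2*pi} t) = (%t. ennreal (h (pol x (Complex s t))) * indicator {0..2*pi} t)"
     by (auto simp: indicator_def)
    ultimately show ?thesis by simp
   qed
   have "(\<integral>\<^sup>+ t. ennreal (1 / (sinh s)^2) * ennreal (bker k S x (pol x (Complex s t)) * h (pol x (Complex s t))) * indicator {0..<0+2*pi} t \<partial>lborel)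
     = (\<integral>\<^sup>+ t. ennreal ((aa s)^2 * k s) * (ennreal (h (pol x (Complex s t))) * indicator {0..2*pi} t) \<partial>lborel)"
   proof (rule nn_integral_cong_AE, use AE_lborel_singleton[of "2*pi"] in eventually_elim)
    fix t :: real assume "t ~= 2 * pi"
    then show "ennreal (1 / (sinh s)^2) * ennreal (bker k S x (pol x (Complex s t)) * h (pol x (Complex s t))) * indicator {0..<0+2*pi} t
     = ennreal ((aa s)^2 * k s) * (ennreal (h (pol x (Complex s t))) * indicator {0..2*pi} t)"
     using True by (auto simp: indicator_def bker_pol[OF x S s] aa_sq[OF s] ennreal_mult[symmetric] k0 h0[OF pu] mult.assoc)
   qed
   also have "... = ennreal ((aa s)^2 * k s) * ennreal (sph h x s)"
    unfolding i[symmetric] by (rule nn_integral_cmult) (use m in simp)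
   also have "... = ennreal (2 * pi * (aa s)^2) * ennreal (k s * H s)"
   proof -
    have "H s >= 0" using sph0 hH[OF s] pi_gt_zero by (auto simp: zero_le_mult_iff simp del: pi_gt_zero)
    then show ?thesis using hH[OF s] k0[of s] by (simp add: ennreal_mult[symmetric] mult_ac)
   qed
   finally show ?thesis using True s by simp
  next
   case False
   then show ?thesis by (cases "s < 0") (auto simp: bker_pol[OF x S])
  qed
 qed
 also have "... = (\<integral>\<^sup>+ s. ennreal (k s * H s) \<partial>LL S)"
  by (rule nn_integral_LL[symmetric]) measurable
 finally show ?thesis .
qed

section \<open>Counting small eigenvalues\<close>

lemma cmod_cay_sq:
 assumes "x : uhp" "z : uhp"
 shows "(cmod (cay x z))^2 = (hcosh x z - 1) / (hcosh x z + 1)"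
proof -
 define u where "u = (cmod (cay x z))^2"
 have u: "u < 1" using norm_cay_less_1[OF assms] by (simp add: u_def abs_square_less_1)
 have h: "hcosh x z = (1 + u) / (1 - u)" using hcosh_center[OF assms] by (simp add: u_def)
 have "hcosh x z - 1 = 2 * u / (1 - u)" "hcosh x z + 1 = 2 / (1 - u)" unfolding h using u by (simp_all add: field_simps)
 then show ?thesis using u by (simp add: u_def[symmetric])
qed

lemma rad_eqI:
 assumes "x : uhp" "z : uhp" "x' : uhp" "z' : uhp" "hcosh x z = hcosh x' z'"
 shows "rad x z = rad x' z'"
proof -
 have "(cmod (cay x z))^2 = (cmod (cay x' z'))^2" using cmod_cay_sq assms by simp
 then show ?thesis by (simp add: rad_def power2_eq_iff_nonneg)
qed

lemma rad_less_dist: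
 assumes "x : uhp" "z : uhp" "S < 0" "rad x z < S"
 shows "hyp_dist x z < rr S"
proof -
 define u where "u = cmod (cay x z)"
 have "u ~= 0" using assms by (auto simp: rad_def u_def)
 then have u: "u > 0" "u < 1" using norm_cay_less_1[OF assms(1,2)] by (auto simp: u_def)
 have "u < exp S" using assms(4) u by (simp add: rad_def u_def[symmetric]) (metis exp_less_mono exp_ln)
 then have "u^2 < (exp S)^2" using u by (intro power_strict_mono) auto
 moreover have e: "1 - (exp S)^2 > 0" using exp_sq_less_1[OF assms(3)] .
 ultimately have "hcosh x z < cc S"
  unfolding hcosh_center[OF assms(1,2)] cc_def u_def[symmetric] by (intro frac_less) auto
 also have "cc S = cosh (rr S)"
 proof -
  have E: "0 < exp S" "exp S < 1" using assms by auto
  have p: "(1 + exp S) / (1 - exp S) > 0" using E by (simp add: add_pos_pos)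
  have "cosh (rr S) = ((1 + exp S) / (1 - exp S) + inverse ((1 + exp S) / (1 - exp S))) / 2"
   unfolding rr_def by (rule cosh_ln_real[OF p])
  also have "... = ((1 + exp S)^2 + (1 - exp S)^2) / (2 * ((1 + exp S) * (1 - exp S)))"
  proof -
   have n: "1 + exp S ~= 0" "1 - exp S ~= 0" using E by linarith+
   have "(a / b + inverse (a / b)) / 2 = (a^2 + b^2) / (2 * (a * b))" if "a ~= 0" "b ~= 0" for a b :: real
    using that by (simp add: field_simps power2_eq_square)
   from this[OF n] show ?thesis .
  qed
  also have "... = (2 * (1 + (exp S)^2)) / (2 * (1 - (exp S)^2))" by (simp add: power2_eq_square algebra_simps)
  also have "... = cc S" unfolding cc_def by (rule mult_divide_mult_cancel_left) simp
  finally show ?thesis by simp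
 qed
 finally show ?thesis using hyp_dist_less_iff[OF assms(1,2)] rr_pos[OF assms(3)] by simp
qed

context fuchsian
begin

declare isom_measurable [measurable del]

section \<open>Eigenfunctions on the surface and their orthogonality\<close>

definition efun :: "(complex => real) => real => bool" where
 "efun f lam \<longleftrightarrow> eigen_on f lam & (ALL z. z ~: uhp --> f z = 0) & (ALL h:\<Gamma>. ALL z:uhp. f (h z) = f z)"

lemma efun_cont: "efun f lam ==> continuous_on uhp f"
 by (auto simp: efun_def eigen_on_def C2_on_uhp_def intro: differentiable_imp_continuous_on)

lemma cont_measurable:
 assumes "continuous_on uhp f" "!!z. z ~: uhp ==> f z = (0::real)" shows "f : borel_measurable borel"
proof -
 have "(%z. indicator uhp z *\<^sub>R f z) : borel_measurable borel"
  by (rule borel_measurable_continuous_on_indicator) (use assms in auto)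
 moreover have "(%z. indicator uhp z *\<^sub>R f z) = f" 
 proof
  fix z show "indicator uhp z *\<^sub>R f z = f z" by (cases "z : uhp") (use assms(2)[of z] in auto)
 qed
 ultimately show ?thesis by simp
qed

lemma efun_measurable: "efun f lam ==> f : borel_measurable borel"
 using cont_measurable efun_cont by (auto simp: efun_def)

lemma invariant_bounded:
 assumes "continuous_on uhp f" "!!z. z ~: uhp ==> f z = (0::real)" "!!h z. h : \<Gamma> ==> z : uhp ==> f (h z) = f z"
 shows "EX B>=0. ALL z. \<bar>f z\<bar> <= B"
proof -
 have "compact (f ` KK)" using compact_continuous_image[OF continuous_on_subset[OF assms(1) KK(2)] KK(1)] .
 then obtain B where B: "!!z. z : KK ==> \<bar>f z\<bar> <= B" "B > 0"
  using compact_imp_bounded by (metis bounded_pos imageI real_norm_def)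
 have "\<bar>f z\<bar> <= B" for z
 proof (cases "z : uhp")
  case True
  obtain h where "h : \<Gamma>" "h z : KK" using move[OF True] .
  then show ?thesis using B(1)[of "h z"] assms(3)[of h z] True by simp
 qed (use assms(2) B in auto)
 then show ?thesis using B(2) by (intro exI[of _ B]) auto
qed

lemma efun_bounded: "efun f lam ==> EX B>=0. ALL z. \<bar>f z\<bar> <= B"
 using invariant_bounded efun_cont by (auto simp: efun_def)

lemma finite_nu: "finite_measure nu"
 by (rule finite_measureI) (use nu_finite in auto)

lemma nu_integrable:
 assumes "f : borel_measurable borel" "!!z. \<bar>f z\<bar> <= (B::real)"
 shows "integrable nu f"
 by (rule finite_measure.integrable_const_bound[OF finite_nu]) (use assms in "auto simp: measurable_cong_sets[OF sets_nu refl]")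

lemma efun_mult_integrable:
 assumes "efun f lam" "efun h mu" shows "integrable nu (%z. f z * h z)"
proof -
 obtain B C where "B >= 0" "!!z. \<bar>f z\<bar> <= B" "C >= 0" "!!z. \<bar>h z\<bar> <= C" using efun_bounded assms by metis
 then show ?thesis
  by (intro nu_integrable[where B="B * C"] borel_measurable_times efun_measurable[OF assms(1)] efun_measurable[OF assms(2)])
   (auto simp: abs_mult intro!: mult_mono)
qed

lemma efun_integrable: assumes "efun f lam" shows "integrable nu f"
proof -
 obtain B where "!!z. \<bar>f z\<bar> <= B" using efun_bounded assms by metis
 then show ?thesis by (rule nu_integrable[OF efun_measurable[OF assms]])
qed

lemma sph_add_const:
 assumes "continuous_on uhp f" "x : uhp" "s < 0"
 shows "sph (%z. f z + C) x s = sph f x s + 2 * pi * C"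
 unfolding sph_def using continuous_pol_slice(1)[OF assms(2,3,1), of "{0..2*pi}"]
 by (subst integral_add) (auto intro: integrable_continuous_real)

text \<open>The mean value property, integrated over the radius. The shift by \<open>C\<close> keeps
  the integrand nonnegative; as an eigenfunction of eigenvalue 0 the constant contributes
  \<open>C * cval S 0\<close>.\<close>

lemma ball_mean:
 assumes f: "efun f lam" and l: "0 <= lam" "lam <= 1/4" and C: "!!z. \<bar>f z\<bar> <= C" and x: "x : uhp" and S: "S < 0"
 shows "(\<integral>\<^sup>+ z. ennreal (bker (%_. 1) S x z) * ennreal (f z + C) * indicator uhp z \<partial>hmu) = ennreal (f x * cval S lam + C * cval S 0)"
proof -
 note [measurable] = efun_measurable[OF f] phim_measurable[OF l(2)]
 have C0: "0 <= f z + C" for z using C[of z] by simp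
 have eig: "eigen_on f lam" using f by (simp add: efun_def)
 have m0[measurable]: "phim 0 : borel_measurable borel" by (rule phim_measurable) simp
 have bk: "bker (%_. 1) S x z = 0" if "z ~: uhp" for z using that by (simp add: bker_def)
 have b0: "0 <= bker (%_. 1) S x z" for z by (simp add: bker_def)
 have "(\<integral>\<^sup>+ z. ennreal (bker (%_. 1) S x z) * ennreal (f z + C) * indicator uhp z \<partial>hmu) = (\<integral>\<^sup>+ z. ennreal (bker (%_. 1) S x z * (f z + C)) \<partial>hmu)"
  by (intro nn_integral_cong) (use bk C0 b0 in "auto simp: indicator_def ennreal_mult")
 also have "... = (\<integral>\<^sup>+ s. ennreal (1 * (f x * phim lam s + C * phim 0 s)) \<partial>LL S)"
 proof (rule bker_nn_integral[OF x S])
  show "sph (%z. f z + C) x s = 2 * pi * (f x * phim lam s + C * phim 0 s)" if "s < 0" for s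
   using sph_add_const[OF efun_cont[OF f] x that, of C] mean_value[OF eig l(2) x that] that phi_0[OF that]
   by (simp add: phim_eq algebra_simps)
 qed (use C0 efun_cont[OF f] in "auto intro!: continuous_intros")
 also have "... = ennreal (\<integral>s. 1 * (f x * phim lam s + C * phim 0 s) \<partial>LL S)"
 proof (rule nn_integral_eq_integral)
  have i: "integrable (LL S) (phim mu)" if "0 <= mu" "mu <= 1/4" for mu
   by (rule LL_integrable_bounded[OF S phim_measurable, where B=1]) (use phim_bounds[OF that] that in "auto simp: abs_le_iff intro: order_trans[of _ 0]")
  show "integrable (LL S) (%s. 1 * (f x * phim lam s + C * phim 0 s))" using i[of lam] i[of 0] l by simp
  have "0 <= f x * phi lam s + C" if "s < 0" for s
  proof -
   have "\<bar>f x * phi lam s\<bar> <= C * 1"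
    unfolding abs_mult using C[of x] phi_le_1[OF l that] phi_pos[OF l(2) that] by (intro mult_mono) auto
   then show ?thesis by linarith
  qed
  then show "AE s in LL S. 0 <= 1 * (f x * phim lam s + C * phim 0 s)"
   using LL_AE[of S] by (elim eventually_mono) (use S in "simp add: phim_eq phi_0")
 qed
 also have "(\<integral>s. 1 * (f x * phim lam s + C * phim 0 s) \<partial>LL S) = f x * cval S lam + C * cval S 0"
 proof -
  have i: "integrable (LL S) (phim mu)" if "0 <= mu" "mu <= 1/4" for mu
   by (rule LL_integrable_bounded[OF S phim_measurable, where B=1]) (use phim_bounds[OF that] that in "auto simp: abs_le_iff intro: order_trans[of _ 0]")
  show ?thesis unfolding cval_def using i[of lam] i[of 0] l by simp
 qed
 finally show ?thesis .
qed

text \<open>Integration over balls is a symmetric operator on M, because its kernel depends on the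
  distance alone; \<open>ball_mean\<close> evaluates it on both eigenfunctions.\<close>

lemma symmetric_real:
 assumes f: "efun f lam" and l: "0 <= lam" "lam <= 1/4" and h: "efun h mu" and m: "0 <= mu" "mu <= 1/4"
  and C: "!!z. \<bar>f z\<bar> <= C" "!!z. \<bar>h z\<bar> <= C" and S: "S < 0"
 shows "(\<integral>z. (h z + C) * (f z * cval S lam + C * cval S 0) \<partial>nu) = (\<integral>z. (f z + C) * (h z * cval S mu + C * cval S 0) \<partial>nu)"
proof -
 note [measurable] = efun_measurable[OF f] efun_measurable[OF h]
 have inv: "f (g z) = f z" "h (g z) = h z" if "g : \<Gamma>" "z : uhp" for g z using f h that by (auto simp: efun_def)
 have C0: "0 <= C" using C(1)[of 0] by linarith
 have cv: "0 <= cval S lam" "cval S lam <= cval S 0" if "0 <= lam" "lam <= 1/4" for lam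
  using cval_strict_antimono[OF S, of 0 lam] that phim_bounds[OF that] unfolding cval_def by (auto intro!: integral_nonneg_AE) (cases "lam = 0", auto)
 have nonneg: "0 <= f z * cval S lam + C * cval S 0" if "efun f lam" "0 <= lam" "lam <= 1/4" "!!z. \<bar>f z\<bar> <= C" for f lam z
 proof -
  have "\<bar>f z * cval S lam\<bar> <= C * cval S 0" unfolding abs_mult using cv[OF that(2,3)] that(4)[of z] by (intro mult_mono) auto
  then show ?thesis by linarith
 qed
 have half: "(\<integral>\<^sup>+ x. chi x * ennreal (h x + C) * (\<integral>\<^sup>+ y. ennreal (bker (%_. 1) S x y) * ennreal (f y + C) * indicator uhp y \<partial>hmu) \<partial>hmu)
   = ennreal (\<integral>z. (h z + C) * (f z * cval S lam + C * cval S 0) \<partial>nu)"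
  if f: "efun f lam" and l: "0 <= lam" "lam <= 1/4" and h: "efun h mu" and C: "!!z. \<bar>f z\<bar> <= C" "!!z. \<bar>h z\<bar> <= C" for f lam h mu
 proof -
  note [measurable] = efun_measurable[OF f] efun_measurable[OF h]
  have h0: "0 <= h z + C" for z using C(2)[of z] by linarith
  have "(\<integral>\<^sup>+ x. chi x * ennreal (h x + C) * (\<integral>\<^sup>+ y. ennreal (bker (%_. 1) S x y) * ennreal (f y + C) * indicator uhp y \<partial>hmu) \<partial>hmu)
   = (\<integral>\<^sup>+ x. chi x * ennreal ((h x + C) * (f x * cval S lam + C * cval S 0)) \<partial>hmu)"
  proof (rule nn_integral_cong)
   fix x
   show "chi x * ennreal (h x + C) * (\<integral>\<^sup>+ y. ennreal (bker (%_. 1) S x y) * ennreal (f y + C) * indicator uhp y \<partial>hmu) = chi x * ennreal ((h x + C) * (f x * cval S lam + C * cval S 0))"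
   proof (cases "x : uhp")
    case True
    show ?thesis unfolding ball_mean[OF f l C(1) True S] using h0[of x] nonneg[OF f l C(1), of x] by (simp add: ennreal_mult mult.assoc)
   next
    case False then have "chi x = 0" using chi_support by blast
    then show ?thesis by simp
   qed
  qed
  also have "... = (\<integral>\<^sup>+ x. ennreal ((h x + C) * (f x * cval S lam + C * cval S 0)) \<partial>nu)"
   by (rule nn_integral_nu[symmetric]) measurable
  also have "... = ennreal (\<integral>z. (h z + C) * (f z * cval S lam + C * cval S 0) \<partial>nu)"
  proof (rule nn_integral_eq_integral)
   have e: "(h z + C) * (f z * cval S lam + C * cval S 0) = cval S lam * (f z * h z) + C * cval S lam * f z + C * cval S 0 * h z + C * C * cval S 0" for z
    by (simp add: algebra_simps)
   show "integrable nu (%z. (h z + C) * (f z * cval S lam + C * cval S 0))" unfolding e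
    by (intro Bochner_Integration.integrable_add integrable_mult_right efun_mult_integrable[OF f h] efun_integrable[OF f] efun_integrable[OF h] finite_measure.integrable_const[OF finite_nu])
  qed (use h0 nonneg[OF f l C(1)] in auto)
  finally show ?thesis .
 qed
 have "(\<integral>\<^sup>+ x. chi x * ennreal (h x + C) * (\<integral>\<^sup>+ y. ennreal (bker (%_. 1) S x y) * ennreal (f y + C) * indicator uhp y \<partial>hmu) \<partial>hmu)
   = (\<integral>\<^sup>+ x. chi x * ennreal (f x + C) * (\<integral>\<^sup>+ y. ennreal (bker (%_. 1) S x y) * ennreal (h y + C) * indicator uhp y \<partial>hmu) \<partial>hmu)"
 proof (rule symmetric_kernel)
  show "(%(x, y). ennreal (bker (%_. 1) S x y)) : borel_measurable (borel \<Otimes>\<^sub>M borel)"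
   using bker_measurable[of "%_. 1" S] by (simp add: split_beta')
  show "ennreal (bker (%_. 1) S x y) = ennreal (bker (%_. 1) S y x)" if "x : uhp" "y : uhp" for x y
   using rad_eqI[OF that that(2,1) hcosh_sym] that by (simp add: bker_def)
  show "ennreal (bker (%_. 1) S (g x) (g y)) = ennreal (bker (%_. 1) S x y)" if "g : \<Gamma>" "x : uhp" "y : uhp" for g x y
   using rad_eqI[OF in_uhp[OF that(1,2)] in_uhp[OF that(1,3)] that(2,3) hcosh_inv[OF that]] that in_uhp[OF that(1)] by (simp add: bker_def)
 qed (use inv in auto)
 then have "ennreal (\<integral>z. (h z + C) * (f z * cval S lam + C * cval S 0) \<partial>nu) = ennreal (\<integral>z. (f z + C) * (h z * cval S mu + C * cval S 0) \<partial>nu)"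
  unfolding half[OF f l h C] half[OF h m f C(2,1)] .
 moreover have "0 <= (\<integral>z. (h z + C) * (f z * cval S lam + C * cval S 0) \<partial>nu)" "0 <= (\<integral>z. (f z + C) * (h z * cval S mu + C * cval S 0) \<partial>nu)"
 proof -
  have p: "0 <= h z + C" "0 <= f z + C" for z using C(1)[of z] C(2)[of z] by linarith+
  show "0 <= (\<integral>z. (h z + C) * (f z * cval S lam + C * cval S 0) \<partial>nu)"
   by (rule integral_nonneg_AE, rule AE_I2, rule mult_nonneg_nonneg[OF p(1) nonneg[OF f l C(1)]])
  show "0 <= (\<integral>z. (f z + C) * (h z * cval S mu + C * cval S 0) \<partial>nu)"
   by (rule integral_nonneg_AE, rule AE_I2, rule mult_nonneg_nonneg[OF p(2) nonneg[OF h m C(2)]])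
 qed
 ultimately show ?thesis by simp
qed

lemma zero_efun: "efun (%_. 0) 0"
 using eigen_const[of 0] by (simp add: efun_def)

text \<open>The two functions are eigenvectors of the symmetric ball operator with the eigenvalues
  \<open>cval S lam\<close> and \<open>cval S mu\<close>, which differ by strict
  monotonicity.\<close>

lemma orthogonal:
 assumes f: "efun f lam" and l: "0 <= lam" "lam <= 1/4" and h: "efun h mu" and m: "0 <= mu" "mu <= 1/4" and ne: "lam ~= mu"
 shows "(\<integral>z. f z * h z \<partial>nu) = 0"
proof -
 \<comment> \<open>The radius is arbitrary.\<close>
 define S where "S = (-1::real)"
 have S: "S < 0" by (simp add: S_def)
 obtain B1 B2 where B: "B1 >= 0" "!!z. \<bar>f z\<bar> <= B1" "B2 >= 0" "!!z. \<bar>h z\<bar> <= B2" using efun_bounded f h by metis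
 define C where "C = B1 + B2 + 1"
 have C: "\<bar>f z\<bar> <= C" "\<bar>h z\<bar> <= C" "C > 0" for z
  using B(1,3) B(2)[of z] B(4)[of z] by (auto simp: C_def)
 have ex: "(\<integral>z. (h z + C) * (f z * a + C * b) \<partial>nu) = a * (\<integral>z. f z * h z \<partial>nu) + C * a * (\<integral>z. f z \<partial>nu) + C * b * (\<integral>z. h z \<partial>nu) + C * C * b * measure nu UNIV"
  if f: "efun f lam" and h: "efun h mu" for f h lam mu a b
 proof -
  have e: "(h z + C) * (f z * a + C * b) = a * (f z * h z) + C * a * f z + C * b * h z + C * C * b" for z
   by (simp add: algebra_simps)
  note i = efun_mult_integrable[OF f h] efun_integrable[OF f] efun_integrable[OF h]
  have c: "integrable nu (%z. C * C * b)" by (rule finite_measure.integrable_const[OF finite_nu])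
  show ?thesis unfolding e using i c by (simp add: Bochner_Integration.integral_add mult.commute)
 qed
 \<comment> \<open>Pairing with the zero function leaves only its shift \<open>C\<close>: this is
   symmetry of the operator between \<open>f\<close> and a constant, and it removes the mixed terms
   below.\<close>
 have z: "C * a * (\<integral>z. f z \<partial>nu) = C * cval S 0 * (\<integral>z. f z \<partial>nu)" if f: "efun f lam" "0 <= lam" "lam <= 1/4" "!!z. \<bar>f z\<bar> <= C" "a = cval S lam" for f lam a
 proof -
  have "(\<integral>z. ((%_. 0) z + C) * (f z * cval S lam + C * cval S 0) \<partial>nu) = (\<integral>z. (f z + C) * ((%_. 0) z * cval S 0 + C * cval S 0) \<partial>nu)"
   by (rule symmetric_real[OF f(1,2,3) zero_efun _ _ f(4) _ S]) (use C in auto)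
  then show ?thesis unfolding ex[OF f(1) zero_efun] ex[OF zero_efun f(1)] using f(5) by (simp add: mult_ac)
 qed
 have "(\<integral>z. (h z + C) * (f z * cval S lam + C * cval S 0) \<partial>nu) = (\<integral>z. (f z + C) * (h z * cval S mu + C * cval S 0) \<partial>nu)"
  by (rule symmetric_real[OF f l h m C(1,2) S])
 then have "cval S lam * (\<integral>z. f z * h z \<partial>nu) = cval S mu * (\<integral>z. f z * h z \<partial>nu)"
  unfolding ex[OF f h] ex[OF h f] using z[OF f l C(1) refl] z[OF h m C(2) refl] by (simp add: mult.commute[of "h _"])
 moreover have "cval S lam ~= cval S mu"
  using cval_strict_antimono[OF S, of lam mu] cval_strict_antimono[OF S, of mu lam] l m ne by (cases "lam < mu") auto
 ultimately show ?thesis by simp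
qed

end

section \<open>The local inequality on embedded balls\<close>

context fuchsian
begin

text \<open>Two translates of \<open>z\<close> inside the ball would be closer than
  \<open>2 * rr S\<close>, which is at most the displacement of the element relating them.\<close>

lemma ball_count:
 assumes x: "x : uhp" and z: "z : uhp" and S: "S < 0"
  and sep: "ALL g:\<Gamma>-{id}. ALL w:uhp. 2 * rr S <= hyp_dist w (g w)"
 shows "(\<integral>\<^sup>+ f. ennreal (bker (%_. 1) S x (f z)) \<partial>count_space \<Gamma>) <= 1"
proof (cases "EX f0:\<Gamma>. rad x (f0 z) < S")
 case True
 then obtain f0 where f0: "f0 : \<Gamma>" "rad x (f0 z) < S" by blast
 have uniq: "f = f0" if f: "f : \<Gamma>" "rad x (f z) < S" for f
 proof (rule ccontr)
  assume ne: "f ~= f0"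
  define k where "k = cmp f (ivt f0)"
  have k: "k : \<Gamma>" "k (f0 z) = f z"
   using f f0 z by (auto simp: k_def cmp_props ivt_props in_uhp)
  have "k ~= id" using k ne eqI[OF f(1) f0(1) z] by auto
  then have "2 * rr S <= hyp_dist (f0 z) (f z)" using sep in_uhp[OF f0(1) z] k by (metis Diff_iff singletonD)
  also have "... <= hyp_dist (f0 z) x + hyp_dist x (f z)" by (rule hyp_triangle) (use in_uhp f f0 x z in auto)
  also have "... < 2 * rr S"
   using rad_less_dist[OF x in_uhp[OF f(1) z] S f(2)] rad_less_dist[OF x in_uhp[OF f0(1) z] S f0(2)] hyp_dist_sym[of x] by simp
  finally show False by simp
 qed
 have "(\<integral>\<^sup>+ f. ennreal (bker (%_. 1) S x (f z)) \<partial>count_space \<Gamma>) <= (\<integral>\<^sup>+ f. indicator {f0} f \<partial>count_space \<Gamma>)"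
  by (rule nn_integral_mono) (use uniq in "auto simp: bker_def indicator_def")
 also have "... = emeasure (count_space \<Gamma>) {f0}" by (rule nn_integral_indicator) (use f0 in auto)
 also have "... = 1" using f0 by (simp add: emeasure_count_space)
 finally show ?thesis .
next
 case False
 then have "(\<integral>\<^sup>+ f. ennreal (bker (%_. 1) S x (f z)) \<partial>count_space \<Gamma>) = (\<integral>\<^sup>+ f. 0 \<partial>count_space \<Gamma>)"
  by (intro nn_integral_cong) (auto simp: bker_def)
 then show ?thesis by simp
qed

text \<open>Put \<open>h = sum of f_i(x) f_i\<close> and \<open>s0 = h(x)\<close>, and integrate
  \<open>0 <= (h - s0 p)^2\<close> over the ball, \<open>p\<close> being the spherical function at
  1/4. The ball embeds, so \<open>h^2\<close> contributes at most \<open>s0\<close>;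
  \<open>p^2\<close> contributes \<open>m\<close>; and \<open>h p\<close> contributes at least
  \<open>s0 m\<close>, because \<open>phi\<close> decreases in \<open>lam\<close>. So
  \<open>0 <= s0 - s0^2 m\<close>.\<close>

lemma local_bound:
 assumes I: "finite I" and f: "!!i. i : I ==> efun (f i) (lam i)" and l: "!!i. i : I ==> 0 <= lam i" "!!i. i : I ==> lam i <= 1/4"
  and on: "!!i j. i : I ==> j : I ==> (\<integral>z. f i z * f j z \<partial>nu) = (if i = j then 1 else 0)"
  and x: "x : uhp" and S: "S < 0"
  and sep: "ALL g:\<Gamma>-{id}. ALL w:uhp. 2 * rr S <= hyp_dist w (g w)"
 shows "(\<Sum>i\<in>I. (f i x)\<^sup>2) * mval S <= 1"
proof -
 define h where "h z = (\<Sum>i\<in>I. f i x * f i z)" for z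
 define s0 where "s0 = (\<Sum>i\<in>I. (f i x)\<^sup>2)"
 have s0: "s0 >= 0" by (simp add: s0_def sum_nonneg)
 have hc: "continuous_on uhp h" unfolding h_def
  by (intro continuous_intros efun_cont[OF f])
 have hout: "h z = 0" if "z ~: uhp" for z using f that by (auto simp: h_def efun_def intro!: sum.neutral)
 have hinv: "h (g z) = h z" if "g : \<Gamma>" "z : uhp" for g z
  unfolding h_def by (rule sum.cong) (use f that in "auto simp: efun_def")
 have hm[measurable]: "h : borel_measurable borel" by (rule cont_measurable[OF hc hout])
 obtain C where C: "C >= 0" "!!z. \<bar>h z\<bar> <= C" 
 proof -
  have "EX B>=0. ALL z. \<bar>h z\<bar> <= B" by (rule invariant_bounded[OF hc]) (fact hout, fact hinv)
  then show ?thesis using that by blast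
 qed
 have C': "0 <= h z + C" for z using C(2)[of z] by linarith
 define p where "p = phim (1/4)"
 have p[measurable]: "p : borel_measurable borel" unfolding p_def by (rule phim_measurable) simp
 have p01: "0 <= p s" "p s <= 1" for s using phim_bounds[of "1/4" s] by (auto simp: p_def)
 have m0[measurable]: "phim 0 : borel_measurable borel" by (rule phim_measurable) simp
 have step1: "(\<integral>\<^sup>+ z. ennreal ((h z)^2) \<partial>nu) = ennreal s0"
 proof -
  have e: "(h z)^2 = (\<Sum>i\<in>I. \<Sum>j\<in>I. (f i x * f j x) * (f i z * f j z))" for z
   unfolding h_def power2_eq_square sum_product by (intro sum.cong refl) (simp add: mult_ac)
  have int: "integrable nu (%z. (f i x * f j x) * (f i z * f j z))" if "i : I" "j : I" for i j
   using efun_mult_integrable[OF f[OF that(1)] f[OF that(2)]] by simp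
  have inth: "integrable nu (%z. (h z)\<^sup>2)" unfolding e by (intro Bochner_Integration.integrable_sum int)
  have "(\<integral>z. (h z)\<^sup>2 \<partial>nu) = (\<Sum>i\<in>I. \<Sum>j\<in>I. \<integral>z. (f i x * f j x) * (f i z * f j z) \<partial>nu)"
   unfolding e by (subst Bochner_Integration.integral_sum, intro Bochner_Integration.integrable_sum int, assumption, assumption)
    (intro sum.cong refl Bochner_Integration.integral_sum int, assumption+)
  also have "... = (\<Sum>i\<in>I. \<Sum>j\<in>I. (f i x * f j x) * (if i = j then 1 else 0))"
   by (intro sum.cong refl) (simp add: on)
  also have "... = s0" using I by (simp add: s0_def power2_eq_square if_distrib sum.delta cong: if_cong)
  finally have "(\<integral>z. (h z)\<^sup>2 \<partial>nu) = s0" .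
  then show ?thesis using nn_integral_eq_integral[OF inth] by simp
 qed
 define A where "A = (\<integral>\<^sup>+ z. ennreal (bker (%_. 1) S x z * (h z)^2) \<partial>hmu)"
 have b0: "0 <= bker (%_. 1) S x z" for z by (simp add: bker_def)
 have step2: "A <= ennreal s0"
 proof -
  have "A = (\<integral>\<^sup>+ z. ennreal (bker (%_. 1) S x z * (h z)^2) * indicator uhp z \<partial>hmu)"
   unfolding A_def by (intro nn_integral_cong) (auto simp: bker_def indicator_def)
  also have "... = (\<integral>\<^sup>+ z. chi z * (\<integral>\<^sup>+ g. ennreal (bker (%_. 1) S x (g z) * (h (g z))^2) \<partial>count_space \<Gamma>) \<partial>hmu)"
   by (rule unfolding_sum) measurable
  also have "... <= (\<integral>\<^sup>+ z. chi z * ennreal ((h z)^2) \<partial>hmu)"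
  proof (rule nn_integral_mono)
   fix z
   show "chi z * (\<integral>\<^sup>+ g. ennreal (bker (%_. 1) S x (g z) * (h (g z))^2) \<partial>count_space \<Gamma>) <= chi z * ennreal ((h z)^2)"
   proof (cases "z : uhp")
    case True
    have "(\<integral>\<^sup>+ g. ennreal (bker (%_. 1) S x (g z) * (h (g z))^2) \<partial>count_space \<Gamma>)
     = (\<integral>\<^sup>+ g. ennreal (bker (%_. 1) S x (g z)) * ennreal ((h z)^2) \<partial>count_space \<Gamma>)"
     by (intro nn_integral_cong) (simp add: hinv True ennreal_mult b0)
    also have "... = (\<integral>\<^sup>+ g. ennreal (bker (%_. 1) S x (g z)) \<partial>count_space \<Gamma>) * ennreal ((h z)^2)"
     by (rule nn_integral_multc) simp
    also have "... <= 1 * ennreal ((h z)^2)"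
     by (intro mult_right_mono ball_count[OF x True S sep]) auto
    finally show ?thesis by (intro mult_left_mono) auto
   next
    case False then have "chi z = 0" using chi_support by blast
    then show ?thesis by simp
   qed
  qed
  also have "... = (\<integral>\<^sup>+ z. ennreal ((h z)^2) \<partial>nu)" by (rule nn_integral_nu[symmetric]) measurable
  finally show ?thesis using step1 by simp
 qed
 define c where "c = cval S (1/4)"
 have ip: "integrable (LL S) p" "integrable (LL S) (%s. (p s)\<^sup>2)"
  by (rule LL_integrable_bounded[OF S, where B=1]; use p01 in "auto simp: abs_le_iff power_le_one intro: order_trans[of _ 0]")+
 have c0: "c >= 0" unfolding c_def cval_def p_def[symmetric] by (rule integral_nonneg_AE) (simp add: p01)
 have m0': "mval S >= 0" unfolding mval_def by (rule integral_nonneg_AE) simp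
 have sph1: "sph (%_. 1) x s = 2 * pi * 1" for s by (simp add: sph_def)
 have b2: "(\<integral>\<^sup>+ z. ennreal (bker (%s. (p s)\<^sup>2) S x z) \<partial>hmu) = ennreal (mval S)"
 proof -
  have "(\<integral>\<^sup>+ z. ennreal (bker (%s. (p s)\<^sup>2) S x z * 1) \<partial>hmu) = (\<integral>\<^sup>+ s. ennreal ((p s)^2 * 1) \<partial>LL S)"
   by (rule bker_nn_integral[OF x S _ _ _ _ _ _ sph1]) auto
  also have "... = ennreal (mval S)" using nn_integral_eq_integral[OF ip(2)] by (simp add: mval_def p_def)
  finally show ?thesis by simp
 qed
 have b3: "(\<integral>\<^sup>+ z. ennreal (bker p S x z) \<partial>hmu) = ennreal c"
 proof -
  have "(\<integral>\<^sup>+ z. ennreal (bker p S x z * 1) \<partial>hmu) = (\<integral>\<^sup>+ s. ennreal (p s * 1) \<partial>LL S)"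
   by (rule bker_nn_integral[OF x S _ _ _ _ _ _ sph1]) (use p01 in auto)
  also have "... = ennreal c" using nn_integral_eq_integral[OF ip(1)] p01 by (simp add: c_def cval_def p_def)
  finally show ?thesis by simp
 qed
 define H where "H s = (\<Sum>i\<in>I. (f i x)\<^sup>2 * phim (lam i) s) + C" for s
 have [measurable]: "H : borel_measurable borel" unfolding H_def
  by (intro borel_measurable_add borel_measurable_sum borel_measurable_times borel_measurable_const phim_measurable l)
 define b1 where "b1 = (\<integral>\<^sup>+ z. ennreal (bker p S x z * (h z + C)) \<partial>hmu)"
 have b1: "b1 >= ennreal (s0 * mval S + C * c)"
 proof -
  have sphh: "sph (%z. h z + C) x s = 2 * pi * H s" if s: "s < 0" for s
  proof -
   have ci: "(%t. f i x * f i (pol x (Complex s t))) integrable_on {0..2*pi}" if "i : I" for i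
    by (intro integrable_continuous_real continuous_intros continuous_pol_slice(1)[OF x s efun_cont[OF f[OF that]]])
   have "sph h x s = (\<Sum>i\<in>I. f i x * sph (f i) x s)"
    unfolding sph_def h_def using ci by (subst integral_sum[OF I]) auto
   also have "... = (\<Sum>i\<in>I. f i x * (2 * pi * f i x * phi (lam i) s))"
    by (intro sum.cong refl) (use mean_value[OF _ _ x s] f l in "auto simp: efun_def")
   also have "... = 2 * pi * (\<Sum>i\<in>I. (f i x)\<^sup>2 * phim (lam i) s)"
    unfolding sum_distrib_left by (intro sum.cong refl) (simp add: phim_eq[OF s] power2_eq_square)
   finally show ?thesis using sph_add_const[OF hc x s, of C] by (simp add: H_def algebra_simps)
  qed
  have "b1 = (\<integral>\<^sup>+ s. ennreal (p s * H s) \<partial>LL S)" unfolding b1_def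
   by (rule bker_nn_integral[OF x S _ _ _ _ _ _ sphh]) (use p01 C' hc in "auto intro!: continuous_intros")
  also have "... >= (\<integral>\<^sup>+ s. ennreal (s0 * (p s)^2 + C * p s) \<partial>LL S)"
  proof (rule nn_integral_mono_AE, use LL_AE in eventually_elim, rule ennreal_leI)
   fix s assume "s < S" then have s: "s < 0" using S by simp
   have "s0 * p s <= (\<Sum>i\<in>I. (f i x)\<^sup>2 * phim (lam i) s)"
    unfolding s0_def sum_distrib_right
    by (intro sum_mono mult_left_mono) (use phi_antimono[OF _ _ s] l in "auto simp: p_def phim_eq[OF s]")
   then have "p s * (s0 * p s + C) <= p s * H s" unfolding H_def using p01(1) by (intro mult_left_mono) auto
   then show "s0 * (p s)^2 + C * p s <= p s * H s" by (simp add: power2_eq_square algebra_simps)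
  qed
  also have "(\<integral>\<^sup>+ s. ennreal (s0 * (p s)^2 + C * p s) \<partial>LL S) = ennreal (\<integral>s. s0 * (p s)^2 + C * p s \<partial>LL S)"
   by (rule nn_integral_eq_integral) (use ip p01 s0 C(1) in auto)
  also have "(\<integral>s. s0 * (p s)^2 + C * p s \<partial>LL S) = s0 * mval S + C * c"
   using ip by (simp add: mval_def c_def cval_def p_def)
  finally show ?thesis .
 qed
 \<comment> \<open>The shift by \<open>C\<close> keeps every term nonnegative; it adds
   \<open>2 s0 C c\<close> to both sides and cancels at the end.\<close>
 have step3: "ennreal (2 * s0) * b1 <= A + ennreal (s0^2) * ennreal (mval S) + ennreal (2 * s0 * C) * ennreal c"
 proof -
  have "ennreal (2 * s0) * b1 = (\<integral>\<^sup>+ z. ennreal (2 * s0) * ennreal (bker p S x z * (h z + C)) \<partial>hmu)"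
   unfolding b1_def by (rule nn_integral_cmult[symmetric]) simp
  also have "... <= (\<integral>\<^sup>+ z. ennreal (bker (%_. 1) S x z * (h z)^2) + ennreal (s0^2) * ennreal (bker (%s. (p s)\<^sup>2) S x z) + ennreal (2 * s0 * C) * ennreal (bker p S x z) \<partial>hmu)"
  proof (rule nn_integral_mono)
   fix z
   show "ennreal (2 * s0) * ennreal (bker p S x z * (h z + C)) <= ennreal (bker (%_. 1) S x z * (h z)^2) + ennreal (s0^2) * ennreal (bker (%s. (p s)\<^sup>2) S x z) + ennreal (2 * s0 * C) * ennreal (bker p S x z)"
   proof (cases "x : uhp & z : uhp & rad x z < S")
    case True
    define q where "q = p (rad x z)"
    have q: "q >= 0" using p01 by (simp add: q_def)
    have "0 <= (h z - s0 * q)^2" by simp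
    then have "2 * s0 * (q * (h z + C)) <= (h z)^2 + s0^2 * q^2 + 2 * s0 * C * q"
     by (simp add: power2_eq_square algebra_simps)
    then have "ennreal (2 * s0 * (q * (h z + C))) <= ennreal ((h z)^2 + s0^2 * q^2 + 2 * s0 * C * q)" by (rule ennreal_leI)
    then show ?thesis using True q s0 C(1) C'[of z]
     by (simp add: bker_def q_def[symmetric] ennreal_mult[symmetric] ennreal_plus[symmetric] del: ennreal_plus)
   qed (auto simp: bker_def)
  qed
  also have "... = A + ennreal (s0^2) * ennreal (mval S) + ennreal (2 * s0 * C) * ennreal c"
   unfolding A_def b2[symmetric] b3[symmetric]
   by (subst nn_integral_add, simp, simp, subst nn_integral_add, simp, simp, subst nn_integral_cmult, simp, subst nn_integral_cmult, simp, simp)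
  finally show ?thesis .
 qed
 have "ennreal (2 * s0 * (s0 * mval S + C * c)) = ennreal (2 * s0) * ennreal (s0 * mval S + C * c)"
  using s0 C(1) c0 m0' by (intro ennreal_mult) auto
 also have "... <= ennreal (2 * s0) * b1" by (rule mult_left_mono[OF b1]) simp
 also have "... <= ennreal s0 + ennreal (s0^2) * ennreal (mval S) + ennreal (2 * s0 * C) * ennreal c"
  using step3 step2 by (meson add_right_mono order_trans)
 also have "... = ennreal (s0 + s0^2 * mval S + 2 * s0 * C * c)"
  using s0 C(1) c0 m0' by (simp add: ennreal_mult[symmetric] ennreal_plus[symmetric] del: ennreal_plus)
 finally have "2 * s0 * (s0 * mval S + C * c) <= s0 + s0^2 * mval S + 2 * s0 * C * c"
  using s0 C(1) c0 m0' by (subst (asm) ennreal_le_iff) auto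
 then have "s0 * (s0 * mval S) <= s0 * 1" by (simp add: power2_eq_square algebra_simps)
 then have "s0 * mval S <= 1" using s0 by (cases "s0 = 0") auto
 then show ?thesis by (simp add: s0_def)
qed

lemma spectral_bound:
 assumes I: "finite I" and f: "!!i. i : I ==> efun (f i) (lam i)" and l: "!!i. i : I ==> 0 <= lam i" "!!i. i : I ==> lam i <= 1/4"
  and on: "!!i j. i : I ==> j : I ==> (\<integral>z. f i z * f j z \<partial>nu) = (if i = j then 1 else 0)"
  and S: "S < 0"
  and sep: "ALL g:\<Gamma>-{id}. ALL w:uhp. 2 * rr S <= hyp_dist w (g w)"
 shows "real (card I) * mval S <= measure nu UNIV"
proof -
 have m: "mval S > 0" using mval_lower_1[OF S] rr_pos[OF S] by (smt (verit) mult_pos_pos pi_gt_zero zero_less_power)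
 have int: "integrable nu (%z. f i z * f i z)" if "i : I" for i using efun_mult_integrable f that by blast
 have "real (card I) = (\<Sum>i\<in>I. \<integral>z. f i z * f i z \<partial>nu)" by (simp add: on)
 also have "... = (\<integral>z. (\<Sum>i\<in>I. f i z * f i z) \<partial>nu)" by (rule Bochner_Integration.integral_sum[symmetric]) (rule int)
 also have "... <= (\<integral>z. 1 / mval S \<partial>nu)"
 proof (rule integral_mono)
  show "integrable nu (%z. \<Sum>i\<in>I. f i z * f i z)" by (intro Bochner_Integration.integrable_sum int)
  show "integrable nu (%z. 1 / mval S)" by (rule finite_measure.integrable_const[OF finite_nu])
  fix z
  show "(\<Sum>i\<in>I. f i z * f i z) <= 1 / mval S"
  proof (cases "z : uhp")
   case True
   from local_bound[OF I f l on True S sep] show ?thesis using m by (simp add: power2_eq_square field_simps)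
  next
   case False
   then have "(\<Sum>i\<in>I. f i z * f i z) = 0" using f by (intro sum.neutral) (auto simp: efun_def)
   then show ?thesis using m by simp
  qed
 qed
 also have "... = measure nu UNIV / mval S" by simp
 finally show ?thesis using m by (simp add: field_simps)
qed

end

section \<open>Orthonormal bases of the eigenspaces\<close>

lemma px_lincomb:
 assumes "f differentiable (at z)" "h differentiable (at z)"
 shows "px (%z. a * f z + b * h z) z = a * px f z + b * px h z" "py (%z. a * f z + b * h z) z = a * py f z + b * py h z"
proof -
 have d: "((%z. a * f z + b * h z) has_derivative (%v. a * (px f z * Re v + py f z * Im v) + b * (px h z * Re v + py h z * Im v))) (at z)"
  by (intro has_derivative_add has_derivative_mult_right partial_derivatives assms)
 then have "(%z. a * f z + b * h z) differentiable (at z)" by (auto simp: differentiable_def)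
 from has_derivative_unique[OF partial_derivatives[OF this] d]
 have e: "px (%z. a * f z + b * h z) z * Re v + py (%z. a * f z + b * h z) z * Im v = a * (px f z * Re v + py f z * Im v) + b * (px h z * Re v + py h z * Im v)" for v
  by (auto dest: fun_cong[of _ _ v])
 from e[of 1] e[of \<i>] show "px (%z. a * f z + b * h z) z = a * px f z + b * px h z" "py (%z. a * f z + b * h z) z = a * py f z + b * py h z"
  by simp_all
qed

lemma differentiable_cong_uhp:
 assumes "!!w. w : uhp ==> (f::complex => real) w = h w" "z : uhp" "h differentiable (at z)"
 shows "f differentiable (at z)"
proof -
 obtain D where "(h has_derivative D) (at z)" using assms(3) by (auto simp: differentiable_def)
 then have "(f has_derivative D) (at z)"
  by (rule has_derivative_transform_within_open[OF _ open_uhp assms(2)]) (simp add: assms(1))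
 then show ?thesis by (auto simp: differentiable_def)
qed

lemma px_cong_uhp:
 assumes "!!w. w : uhp ==> f w = h w" "z : uhp"
 shows "px f z = px h z" "py f z = py h z"
proof -
 have "(%t. f (Complex t (Im z))) = (%t. h (Complex t (Im z)))" using assms by (auto simp: uhp_iff)
 then show "px f z = px h z" by (simp add: px_def)
 have "\<forall>\<^sub>F t in nhds (Im z). t : {0<..}" using assms(2) by (intro eventually_nhds_in_open) (auto simp: uhp_iff)
 then have "\<forall>\<^sub>F t in nhds (Im z). f (Complex (Re z) t) = h (Complex (Re z) t)"
  by (rule eventually_mono) (simp add: assms(1) uhp_iff)
 then show "py f z = py h z" unfolding py_def by (intro deriv_cong_ev) auto
qed

lemma eigen_lincomb:
 assumes f: "eigen_on f lam" and h: "eigen_on h lam"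
 shows "eigen_on (%z. a * f z + b * h z) lam"
proof -
 let ?g = "%z. a * f z + b * h z"
 have Cf: "C2_on_uhp f" and Ch: "C2_on_uhp h" using f h by (auto simp: eigen_on_def)
 have 1: "px ?g z = a * px f z + b * px h z" "py ?g z = a * py f z + b * py h z" if "z : uhp" for z
  using px_lincomb[OF C2D(1)[OF Cf that] C2D(1)[OF Ch that]] by auto
 have 2: "px (px ?g) z = a * px (px f) z + b * px (px h) z" "py (px ?g) z = a * py (px f) z + b * py (px h) z"
   "px (py ?g) z = a * px (py f) z + b * px (py h) z" "py (py ?g) z = a * py (py f) z + b * py (py h) z" if z: "z : uhp" for z
 proof -
  note cx = px_cong_uhp[of "px ?g" "%z. a * px f z + b * px h z", OF 1(1) z] and cy = px_cong_uhp[of "py ?g" "%z. a * py f z + b * py h z", OF 1(2) z]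
  note lx = px_lincomb[OF C2D(2)[OF Cf z] C2D(2)[OF Ch z], of a b] and ly = px_lincomb[OF C2D(3)[OF Cf z] C2D(3)[OF Ch z], of a b]
  show "px (px ?g) z = a * px (px f) z + b * px (px h) z" using cx(1) lx(1) by simp
  show "py (px ?g) z = a * py (px f) z + b * py (px h) z" using cx(2) lx(2) by simp
  show "px (py ?g) z = a * px (py f) z + b * px (py h) z" using cy(1) ly(1) by simp
  show "py (py ?g) z = a * py (py f) z + b * py (py h) z" using cy(2) ly(2) by simp
 qed
 have d: "(%z. a * u z + b * v z) differentiable (at z)" if "u differentiable (at z)" "v differentiable (at z)" for u v :: "complex => real" and z
  using that by (intro differentiable_add differentiable_mult differentiable_const)
 have cc: "continuous_on uhp w" if "continuous_on uhp u" "continuous_on uhp v" "!!z. z : uhp ==> w z = a * u z + b * v z" for u v w :: "complex => real"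
 proof -
  have "continuous_on uhp (%z. a * u z + b * v z)" using that by (intro continuous_intros)
  then show ?thesis using that(3) continuous_on_cong by (metis (no_types, lifting))
 qed
 have "C2_on_uhp ?g"
  unfolding C2_on_uhp_def differentiable_on_eq_differentiable_at[OF open_uhp]
 proof (intro conjI ballI)
  fix z assume z: "z : uhp"
  show "?g differentiable (at z)" using d[OF C2D(1)[OF Cf z] C2D(1)[OF Ch z]] .
  show "px ?g differentiable (at z)" by (rule differentiable_cong_uhp[OF 1(1) z d[OF C2D(2)[OF Cf z] C2D(2)[OF Ch z]]])
  show "py ?g differentiable (at z)" by (rule differentiable_cong_uhp[OF 1(2) z d[OF C2D(3)[OF Cf z] C2D(3)[OF Ch z]]])
 next
  show "continuous_on uhp (px (px ?g))" by (rule cc[OF _ _ 2(1)]) (use Cf Ch in "auto simp: C2_on_uhp_def")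
  show "continuous_on uhp (py (px ?g))" by (rule cc[OF _ _ 2(2)]) (use Cf Ch in "auto simp: C2_on_uhp_def")
  show "continuous_on uhp (px (py ?g))" by (rule cc[OF _ _ 2(3)]) (use Cf Ch in "auto simp: C2_on_uhp_def")
  show "continuous_on uhp (py (py ?g))" by (rule cc[OF _ _ 2(4)]) (use Cf Ch in "auto simp: C2_on_uhp_def")
 qed
 moreover have "hyp_laplacian ?g z = lam * ?g z" if z: "z : uhp" for z
 proof -
  have "hyp_laplacian ?g z = a * hyp_laplacian f z + b * hyp_laplacian h z"
   unfolding hyp_laplacian_def 2(1)[OF z] 2(4)[OF z] by (simp add: algebra_simps)
  also have "... = a * (lam * f z) + b * (lam * h z)" using f h z by (simp add: eigen_on_def)
  finally show ?thesis by (simp add: algebra_simps)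
 qed
 ultimately show ?thesis by (simp add: eigen_on_def)
qed

lemma open_hmu_null:
 assumes "open U" "U \<subseteq> uhp" "AE z in hmu. z ~: U" shows "U = {}"
proof (rule ccontr)
 assume ne: "U ~= {}"
 have m: "(%z. ennreal (indicator uhp z / (Im z)^2)) : borel_measurable lborel" by measurable
 have "AE z in lborel. 0 < ennreal (indicator uhp z / (Im z)^2) --> z ~: U"
  using assms(3) unfolding hmu_def AE_density[OF m] .
 moreover have "0 < ennreal (indicator uhp z / (Im z)^2)" if "z : U" for z
  using that assms(2) by (auto simp: uhp_iff)
 ultimately have "AE z in lborel. z ~: U" by (elim eventually_mono) blast
 then have "U : null_sets lborel" using assms(1) by (simp add: AE_iff_null_sets)
 then have "emeasure lborel U = 0" by blast
 then have "negligible U" using assms(1) by (simp add: negligible_iff_emeasure0)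
 then show False using open_not_negligible[OF assms(1) ne] by simp
qed

context fuchsian
begin

lemma efun_lincomb: "efun f lam ==> efun h lam ==> efun (%z. a * f z + b * h z) lam"
 using eigen_lincomb by (auto simp: efun_def)

lemma efun_zero: "efun (%_. 0) lam"
 using eigen_const[of 0] by (simp add: efun_def eigen_on_def)

lemma efun_sum: "finite E ==> (!!e. e : E ==> efun e lam) ==> efun (%z. \<Sum>e\<in>E. c e * e z) lam"
proof (induction E rule: finite_induct)
 case empty then show ?case using efun_zero by simp
next
 case (insert e E)
 have "efun (%z. c e * e z + 1 * (\<Sum>e\<in>E. c e * e z)) lam"
  by (rule efun_lincomb) (use insert in auto)
 then show ?case using insert by simp
qed

lemma efun_iff: "f : eigenspace \<Gamma> lam \<longleftrightarrow> efun f lam"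
 by (auto simp: eigenspace_def efun_def eigen_on_def)

text \<open>By unfolding, the set where \<open>f\<close> is nonzero is null for the hyperbolic area;
  it is open by continuity, hence empty.\<close>

lemma efun_definite:
 assumes f: "efun f lam" and z: "(\<integral>z. f z * f z \<partial>nu) = 0"
 shows "f = (%_. 0)"
proof -
 note [measurable] = efun_measurable[OF f]
 define U where "U = {z:uhp. f z ~= 0}"
 have oU: "open U"
 proof -
  have "U = uhp \<inter> f -` (-{0})" by (auto simp: U_def)
  moreover have "open (uhp \<inter> f -` (-{0}))" by (rule continuous_open_preimage[OF efun_cont[OF f] open_uhp]) auto
  ultimately show ?thesis by simp
 qed
 have "(\<integral>\<^sup>+ z. ennreal (f z * f z) \<partial>nu) = 0"
  using nn_integral_eq_integral[OF efun_mult_integrable[OF f f]] z by simp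
 then have "AE z in nu. f z * f z = 0" by (subst (asm) nn_integral_0_iff_AE) (auto simp: measurable_cong_sets[OF sets_nu refl])
 then have ae: "AE z in hmu. 0 < chi z --> f z = 0" unfolding nu_def by (subst (asm) AE_density) auto
 define F where "F z = (indicator U z :: ennreal)" for z
 have [measurable]: "F : borel_measurable borel" unfolding F_def by (rule borel_measurable_indicator) (use oU in simp)
 have "(\<integral>\<^sup>+ z. F z * indicator uhp z \<partial>hmu) = (\<integral>\<^sup>+ z. chi z * (\<integral>\<^sup>+ g. F (g z) \<partial>count_space \<Gamma>) \<partial>hmu)"
  by (rule unfolding_sum) simp
 also have "... = (\<integral>\<^sup>+ z. 0 \<partial>hmu)"
 proof (rule nn_integral_cong_AE, use ae in eventually_elim)
  fix z assume a: "0 < chi z --> f z = 0"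
  show "chi z * (\<integral>\<^sup>+ g. F (g z) \<partial>count_space \<Gamma>) = 0"
  proof (cases "chi z = 0")
   case False
   then have fz: "f z = 0" "z : uhp" using a chi_support by (auto simp: zero_less_iff_neq_zero)
   have "(\<integral>\<^sup>+ g. F (g z) \<partial>count_space \<Gamma>) = (\<integral>\<^sup>+ g. 0 \<partial>count_space \<Gamma>)"
    by (rule nn_integral_cong) (use fz f in "auto simp: F_def U_def efun_def indicator_def")
   then show ?thesis by simp
  qed simp
 qed
 finally have "(\<integral>\<^sup>+ z. F z * indicator uhp z \<partial>hmu) = 0" by simp
 then have "AE z in hmu. F z * indicator uhp z = 0" by (subst (asm) nn_integral_0_iff_AE) auto
 then have "AE z in hmu. z ~: U" by (rule eventually_mono) (auto simp: F_def U_def indicator_def)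
 then have "U = {}" using open_hmu_null[OF oU] by (auto simp: U_def)
 then show ?thesis using f by (auto simp: U_def efun_def fun_eq_iff)
qed

abbreviation fscale :: "real => (complex => real) => complex => real" where "fscale \<equiv> (%c f. (%z. c * f z))"

lemma vector_space_fun: "vector_space fscale"
 by unfold_locales (auto simp: fun_eq_iff algebra_simps)

interpretation FS: vector_space fscale by (rule vector_space_fun)

lemma gram_schmidt:
 assumes "finite B" "FS.independent B" "!!b. b : B ==> efun b lam"
 shows "EX E. finite E & card E = card B & E \<subseteq> FS.span B & (ALL e:E. efun e lam) &
  (ALL e:E. ALL e':E. (\<integral>z. e z * e' z \<partial>nu) = (if e = e' then 1 else 0))"
 using assms
proof (induction B rule: finite_induct)
 case empty then show ?case by (intro exI[of _ "{}"]) auto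
next
 case (insert b B)
 have ind: "FS.independent B" "b ~: FS.span B"
  using insert.prems(1) insert.hyps by (auto simp: FS.independent_insert)
 obtain E where E: "finite E" "card E = card B" "E \<subseteq> FS.span B" "!!e. e : E ==> efun e lam"
  "!!e e'. e : E ==> e' : E ==> (\<integral>z. e z * e' z \<partial>nu) = (if e = e' then 1 else 0)"
  using insert.IH[OF ind(1)] insert.prems(2) by blast
 define c where "c e = (\<integral>z. b z * e z \<partial>nu)" for e
 define s where "s z = (\<Sum>e\<in>E. c e * e z)" for z
 have eb: "efun b lam" using insert.prems by simp
 have es: "efun s lam" unfolding s_def by (rule efun_sum[OF E(1,4)])
 define b' where "b' z = b z - s z" for z
 have eb': "efun b' lam" using efun_lincomb[OF eb es, of 1 "-1"] by (simp add: b'_def[abs_def])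
 have sspan: "s : FS.span B"
 proof -
  have "s = (\<Sum>e\<in>E. fscale (c e) e)" 
  proof
   fix z
   have "(\<Sum>e\<in>A. fscale (c e) e) z = (\<Sum>e\<in>A. c e * e z)" if "finite A" for A using that by (induction A) auto
   then show "s z = (\<Sum>e\<in>E. fscale (c e) e) z" using E(1) by (simp add: s_def)
  qed
  also have "... : FS.span B" by (intro FS.span_sum FS.span_scale) (use E(3) in auto)
  finally show ?thesis .
 qed
 have b'0: "b' ~= (%_. 0)"
 proof
  assume "b' = (%_. 0)"
  then have "b = s" by (auto simp: b'_def fun_eq_iff)
  then show False using ind(2) sspan by simp
 qed
 define n where "n = (\<integral>z. b' z * b' z \<partial>nu)"
 have "n >= 0" unfolding n_def by (rule integral_nonneg_AE) simp
 moreover have "n ~= 0" using efun_definite[OF eb'] b'0 by (auto simp: n_def)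
 ultimately have n: "n > 0" by simp
 define e0 where "e0 z = b' z / sqrt n" for z
 have ee0: "efun e0 lam" using efun_lincomb[OF eb' eb', of "1 / sqrt n" 0] by (simp add: e0_def[abs_def])
 have e00: "(\<integral>z. e0 z * e0 z \<partial>nu) = 1"
 proof -
  have "e0 z * e0 z = (b' z * b' z) / n" for z using n by (simp add: e0_def)
  then show ?thesis using n by (simp add: n_def[symmetric])
 qed
 have orth: "(\<integral>z. e0 z * e z \<partial>nu) = 0" if e: "e : E" for e
 proof -
  have i: "integrable nu (%z. c e' * (e' z * e z))" if "e' : E" for e'
   using efun_mult_integrable[OF E(4)[OF that] E(4)[OF e]] by simp
  have "(\<integral>z. s z * e z \<partial>nu) = (\<integral>z. (\<Sum>e'\<in>E. c e' * (e' z * e z)) \<partial>nu)"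
   unfolding s_def sum_distrib_right by (simp add: mult.assoc)
  also have "... = (\<Sum>e'\<in>E. \<integral>z. c e' * (e' z * e z) \<partial>nu)" by (rule Bochner_Integration.integral_sum) (rule i)
  also have "... = (\<Sum>e'\<in>E. c e' * (if e' = e then 1 else 0))" by (intro sum.cong refl) (simp add: E(5) e)
  also have "... = c e" using E(1) e by (simp add: if_distrib cong: if_cong)
  finally have "(\<integral>z. s z * e z \<partial>nu) = c e" .
  then have "(\<integral>z. b z * e z - s z * e z \<partial>nu) = 0"
   using efun_mult_integrable[OF eb E(4)[OF e]] efun_mult_integrable[OF es E(4)[OF e]] by (simp add: c_def)
  moreover have "e0 z * e z = (b z * e z - s z * e z) / sqrt n" for z by (simp add: e0_def b'_def field_simps)
  ultimately show ?thesis by simp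
 qed
 have e0E: "e0 ~: E" using orth[of e0] e00 by auto
 have e0span: "e0 : FS.span (insert b B)"
 proof -
  have "e0 = fscale (1 / sqrt n) (b - s)" by (auto simp: e0_def b'_def fun_eq_iff)
  moreover have "b : FS.span (insert b B)" "s : FS.span (insert b B)"
   using FS.span_base[of b "insert b B"] sspan FS.span_mono[of B "insert b B"] by auto
  ultimately show ?thesis using FS.span_scale FS.span_diff by metis
 qed
 show ?case
 proof (intro exI[of _ "insert e0 E"] conjI ballI)
  show "insert e0 E \<subseteq> FS.span (insert b B)" using e0span E(3) FS.span_mono[of B "insert b B"] by auto
  fix e e' assume h: "e : insert e0 E" "e' : insert e0 E"
  have "(\<integral>z. e z * e0 z \<partial>nu) = 0" if "e : E" for e using orth[OF that] by (simp add: mult.commute)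
  then show "(\<integral>z. e z * e' z \<partial>nu) = (if e = e' then 1 else 0)" using h E(5) orth e00 e0E by auto
 qed (use E insert.hyps e0E ee0 in auto)
qed

lemma multiplicity_family:
 "EX E. finite E & card E = multiplicity \<Gamma> lam & (ALL e:E. efun e lam) &
  (ALL e:E. ALL e':E. (\<integral>z. e z * e' z \<partial>nu) = (if e = e' then 1 else 0))"
proof -
 obtain B where B: "B \<subseteq> eigenspace \<Gamma> lam" "FS.independent B" "card B = FS.dim (eigenspace \<Gamma> lam)"
  using FS.basis_exists[of "eigenspace \<Gamma> lam"] by metis
 have m: "multiplicity \<Gamma> lam = card B" using B(3) by (simp add: multiplicity_def)
 show ?thesis
 proof (cases "finite B")
  case True
  then show ?thesis using gram_schmidt[OF True B(2), of lam] B(1) efun_iff m by (metis subsetD)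
 next
  \<comment> \<open>An infinite basis has \<open>card\<close> equal to 0, so the multiplicity is 0
    and the empty family has the right size.\<close>
  case False
  then show ?thesis by (intro exI[of _ "{}"]) (simp add: m)
 qed
qed

lemma N_small_bound:
 assumes S: "S < 0" and sep: "2 * rr S <= systole \<Gamma>"
 shows "real (N_small \<Gamma>) * mval S <= measure nu UNIV"
proof -
 define L where "L = {lam. 0 <= lam & lam <= 1/4 & eigenspace \<Gamma> lam ~= {0}}"
 have N: "N_small \<Gamma> = (\<Sum>lam\<in>L. multiplicity \<Gamma> lam)" by (simp add: N_small_def L_def)
 show ?thesis
 proof (cases "finite L")
  case True
  obtain E where E: "!!lam. finite (E lam)" "!!lam. card (E lam) = multiplicity \<Gamma> lam" "!!lam e. e : E lam ==> efun e lam"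
   "!!lam e e'. e : E lam ==> e' : E lam ==> (\<integral>z. e z * e' z \<partial>nu) = (if e = e' then 1 else 0)"
   using multiplicity_family by metis
  define I where "I = (SIGMA lam:L. E lam)"
  have "real (card I) * mval S <= measure nu UNIV"
  proof (rule spectral_bound[where f = snd and lam = fst, OF _ _ _ _ _ S])
   show "finite I" unfolding I_def using True E(1) by simp
   show "efun (snd i) (fst i)" "0 <= fst i" "fst i <= 1/4" if "i : I" for i using that E(3) by (auto simp: I_def L_def)
   show "(\<integral>z. snd i z * snd j z \<partial>nu) = (if i = j then 1 else 0)" if "i : I" "j : I" for i j
   proof (cases "fst i = fst j")
    case True
    then show ?thesis using that E(4)[of "snd i" "fst i" "snd j"] by (auto simp: I_def split: if_splits)
   next
    case False
    then show ?thesis using that orthogonal[OF E(3) _ _ E(3), of "snd i" "fst i" "snd j" "fst j"] by (auto simp: I_def L_def)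
   qed
   show "ALL g:\<Gamma> - {id}. ALL w:uhp. 2 * rr S <= hyp_dist w (g w)"
    using systole_le sep by (force intro: order_trans)
  qed
  moreover have "card I = N_small \<Gamma>" unfolding I_def N using True E(1,2) by (simp add: card_SigmaI)
  ultimately show ?thesis by simp
 next
  \<comment> \<open>A sum over an infinite index set is 0 by convention.\<close>
  case False
  then show ?thesis by (simp add: N)
 qed
qed

end

section \<open>Linear algebra of the hyperboloid\<close>

lemma hdet_cycle: "hdet s t u = hdet t u s"
 by (simp add: hdet_def algebra_simps)

lemma hdet_swap: "hdet s u t = - hdet s t u"
 by (simp add: hdet_def minus_divide_left algebra_simps)

lemma hdet_same [simp]: "hdet s s u = 0" "hdet s t t = 0" "hdet s t s = 0"
 by (simp_all add: hdet_def algebra_simps)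

lemma hcosh_normsq:
 assumes "z : uhp" "w : uhp"
 shows "hcosh z w = ((cmod z)^2 + (cmod w)^2 - 2 * Re z * Re w) / (2 * Im z * Im w)"
 unfolding hcosh_formula[OF assms] cmod_power2 by (simp add: power2_eq_square algebra_simps)

text \<open>Cramer's rule expresses the point over \<open>z\<close> in the basis \<open>s\<close>, \<open>t\<close>, \<open>u\<close>; pair it with \<open>w\<close>.\<close>
lemma cramer:
 assumes "s : uhp" "t : uhp" "u : uhp" "w : uhp" "z : uhp"
 shows "hcosh w z * hdet s t u = hdet z t u * hcosh w s + hdet s z u * hcosh w t + hdet s t z * hcosh w u"
proof -
 define As At Au Aw Az where "As = (cmod s)^2" and "At = (cmod t)^2" and "Au = (cmod u)^2" and "Aw = (cmod w)^2" and "Az = (cmod z)^2"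
 have pos: "Im s > 0" "Im t > 0" "Im u > 0" "Im w > 0" "Im z > 0" using assms by (auto simp: uhp_iff)
 have E: "hcosh w s = (Aw + As - 2 * Re w * Re s) / (2 * Im w * Im s)" "hcosh w t = (Aw + At - 2 * Re w * Re t) / (2 * Im w * Im t)"
  "hcosh w u = (Aw + Au - 2 * Re w * Re u) / (2 * Im w * Im u)" "hcosh w z = (Aw + Az - 2 * Re w * Re z) / (2 * Im w * Im z)"
  unfolding As_def At_def Au_def Aw_def Az_def using hcosh_normsq assms by auto
 have D: "hdet s t u = (Re s * (At - Au) - As * (Re t - Re u) + Au * Re t - At * Re u) / (Im s * Im t * Im u)"
  "hdet z t u = (Re z * (At - Au) - Az * (Re t - Re u) + Au * Re t - At * Re u) / (Im z * Im t * Im u)"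
  "hdet s z u = (Re s * (Az - Au) - As * (Re z - Re u) + Au * Re z - Az * Re u) / (Im s * Im z * Im u)"
  "hdet s t z = (Re s * (At - Az) - As * (Re t - Re z) + Az * Re t - At * Re z) / (Im s * Im t * Im z)"
  unfolding hdet_def As_def At_def Au_def Az_def by auto
 have id: "(Aw + Az - 2 * xw * xz) * (xs * (At - Au) - As * (xt - xu) + Au * xt - At * xu) =
   (xz * (At - Au) - Az * (xt - xu) + Au * xt - At * xu) * (Aw + As - 2 * xw * xs)
   + (xs * (Az - Au) - As * (xz - xu) + Au * xz - Az * xu) * (Aw + At - 2 * xw * xt)
   + (xs * (At - Az) - As * (xt - xz) + Az * xt - At * xz) * (Aw + Au - 2 * xw * xu)" for xs xt xu xw xz
  by (simp add: algebra_simps)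
 define M where "M = 2 * Im w * Im z * Im s * Im t * Im u"
 have f1: "hcosh w z * hdet s t u = ((Aw + Az - 2 * Re w * Re z) * (Re s * (At - Au) - As * (Re t - Re u) + Au * Re t - At * Re u)) / M"
  unfolding E(4) D(1) M_def times_divide_times_eq by (simp only: mult_ac)
 have f2: "hdet z t u * hcosh w s = ((Re z * (At - Au) - Az * (Re t - Re u) + Au * Re t - At * Re u) * (Aw + As - 2 * Re w * Re s)) / M"
  unfolding E(1) D(2) M_def times_divide_times_eq by (simp only: mult_ac)
 have f3: "hdet s z u * hcosh w t = ((Re s * (Az - Au) - As * (Re z - Re u) + Au * Re z - Az * Re u) * (Aw + At - 2 * Re w * Re t)) / M"
  unfolding E(2) D(3) M_def times_divide_times_eq by (simp only: mult_ac)
 have f4: "hdet s t z * hcosh w u = ((Re s * (At - Az) - As * (Re t - Re z) + Az * Re t - At * Re z) * (Aw + Au - 2 * Re w * Re u)) / M"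
  unfolding E(3) D(4) M_def times_divide_times_eq by (simp only: mult_ac)
 show ?thesis unfolding f1 f2 f3 f4 id add_divide_distrib ..
qed

text \<open>The numerator is linear in \<open>(|z|^2, Re z, 1)\<close> with the coordinates of a
  cross product as coefficients; the test points \<open>\<i>\<close>, \<open>2 * \<i>\<close> and
  \<open>1 + \<i>\<close> force these to vanish.\<close>

lemma hdet_nondegenerate:
 assumes "s : uhp" "t : uhp" and "!!z. z : uhp ==> hdet s t z = 0"
 shows "s = t"
proof -
 have y: "Im s > 0" "Im t > 0" using assms by (auto simp: uhp_iff)
 have n: "Re s * ((cmod t)^2 - (cmod z)^2) - (cmod s)^2 * (Re t - Re z) + (cmod z)^2 * Re t - (cmod t)^2 * Re z = 0" if "z : uhp" for z
  using assms(3)[OF that] y that unfolding hdet_def by (auto simp: uhp_iff)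
 define As At where "As = (cmod s)^2" and "At = (cmod t)^2"
 have c: "(cmod (2 * \<i>))^2 = 4" "(cmod (1 + \<i>))^2 = 2" by (simp_all add: cmod_power2)
 have 1: "Re s * (At - 1) - As * Re t + Re t = 0"
  using n[of \<i>] by (simp add: uhp_iff As_def At_def)
 have 2: "Re s * (At - 4) - As * Re t + 4 * Re t = 0"
  using n[of "2*\<i>"] c(1) by (simp add: uhp_iff As_def At_def)
 have 3: "Re s * (At - 2) - As * (Re t - 1) + 2 * Re t - At = 0"
  using n[of "1+\<i>"] c(2) by (simp add: uhp_iff As_def At_def)
 have "Re s = Re t" using 1 2 by (simp add: algebra_simps)
 moreover have "As = At" using 1 3 \<open>Re s = Re t\<close> by (auto simp: algebra_simps)
 then have "(cmod s)^2 = (cmod t)^2" by (simp add: As_def At_def)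
 ultimately have "(Im s)^2 = (Im t)^2" by (simp add: cmod_power2)
 then have "Im s = Im t" using y by (simp add: power2_eq_iff_nonneg)
 then show ?thesis using \<open>Re s = Re t\<close> by (simp add: complex_eq_iff)
qed

text \<open>If the determinant vanishes, Cramer's rule becomes a linear relation among the three
  points for each \<open>z\<close>. Pairing it with the centre shows that its coefficients add up to
  0, and pairing it with the three points then makes \<open>hdet s t z\<close> vanish for all
  \<open>z\<close>.\<close>

lemma cocircular_hdet_nz:
 assumes u: "s : uhp" "t : uhp" "u : uhp" "c : uhp" and ne: "s ~= t" "t ~= u" "s ~= u"
  and eq: "hcosh c s = hcosh c t" "hcosh c t = hcosh c u"
 shows "hdet s t u ~= 0"
proof
 assume D: "hdet s t u = 0"
 define k where "k = hcosh c s"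
 have k: "k > 0" using hcosh_ge_1[OF u(4,1)] by (simp add: k_def)
 define p q r where "p = hcosh s t - 1" and "q = hcosh s u - 1" and "r = hcosh t u - 1"
 have pqr: "p > 0" "q > 0" "r > 0" using hcosh_gt_1 u ne by (auto simp: p_def q_def r_def)
 have "hdet s t z = 0" if z: "z : uhp" for z
 proof -
  define h1 h2 h3 where "h1 = hdet z t u" and "h2 = hdet s z u" and "h3 = hdet s t z"
  have "0 = h1 * k + h2 * k + h3 * k" using cramer[OF u z] D eq by (simp add: h1_def h2_def h3_def k_def)
  then have "k * (h1 + h2 + h3) = 0" by (simp add: algebra_simps)
  then have s: "h1 + h2 + h3 = 0" using k by simp
  have 1: "0 = h1 + h2 * (p + 1) + h3 * (q + 1)"
   using cramer[OF u(1,2,3) u(1) z] D by (simp add: h1_def h2_def h3_def p_def q_def)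
  have 2: "0 = h1 * (p + 1) + h2 + h3 * (r + 1)"
   using cramer[OF u(1,2,3) u(2) z] D by (simp add: h1_def h2_def h3_def p_def r_def hcosh_sym[of t s])
  have 3: "0 = h1 * (q + 1) + h2 * (r + 1) + h3"
   using cramer[OF u(1,2,3) u(3) z] D by (simp add: h1_def h2_def h3_def q_def r_def hcosh_sym[of u])
  have a: "h2 * p + h3 * q = 0" "h1 * p + h3 * r = 0" "h1 * q + h2 * r = 0"
   using s 1 2 3 by (simp_all add: algebra_simps)
  have "h3 * (2 * q * r) = - p * (h1 * q + h2 * r)"
  proof -
   have "h1 * p = - (h3 * r)" "h2 * p = - (h3 * q)" using a by linarith+
   moreover have "p * (h1 * q) = (h1 * p) * q" "p * (h2 * r) = (h2 * p) * r" by (simp_all only: mult_ac)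
   ultimately have "p * (h1 * q) = - (h3 * r) * q" "p * (h2 * r) = - (h3 * q) * r" by simp_all
   then show ?thesis by (simp add: algebra_simps)
  qed
  then have "h3 * (2 * q * r) = 0" using a by simp
  then show ?thesis using pqr by (simp add: h3_def)
 qed
 then show False using hdet_nondegenerate[OF u(1,2)] ne by blast
qed

text \<open>The right-hand side is the pairing with a vector of the future cone whose Lorentz square
  is \<open>- q\<close>; dividing by \<open>sqrt q\<close> puts it on the hyperboloid.\<close>

lemma timelike_center:
 assumes "al * ga - be\<^sup>2 = q" "q > 0" "ga > 0"
 shows "EX c:uhp. ALL z:uhp. hcosh c z * sqrt q = (al - 2 * be * Re z + ga * (cmod z)^2) / (2 * Im z)"
proof -
 define c where "c = Complex (be / ga) (sqrt q / ga)"
 have c: "c : uhp" using assms by (simp add: c_def uhp_iff)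
 have n: "(cmod c)^2 = al / ga"
 proof -
  have "(cmod c)^2 = (be\<^sup>2 + q) / ga\<^sup>2" unfolding cmod_power2 c_def using assms by (simp add: power_divide add_divide_distrib)
  also have "... = al * ga / ga\<^sup>2" using assms by simp
  finally show ?thesis using assms by (simp add: power2_eq_square)
 qed
 have "hcosh c z * sqrt q = (al - 2 * be * Re z + ga * (cmod z)^2) / (2 * Im z)" if z: "z : uhp" for z
 proof -
  have y: "Im z > 0" using z by (simp add: uhp_iff)
  have s: "sqrt q > 0" using assms by simp
  have "hcosh c z = (al / ga + (cmod z)^2 - 2 * (be / ga) * Re z) / (2 * (sqrt q / ga) * Im z)"
   unfolding hcosh_normsq[OF c z] n by (simp add: c_def)
  also have "... = (ga * (al / ga + (cmod z)^2 - 2 * (be / ga) * Re z)) / (ga * (2 * (sqrt q / ga) * Im z))"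
   using assms by (intro mult_divide_mult_cancel_left[symmetric]) auto
  also have "... = (al - 2 * be * Re z + ga * (cmod z)^2) / (2 * Im z * sqrt q)"
  proof -
   have "ga * (al / ga + (cmod z)^2 - 2 * (be / ga) * Re z) = al - 2 * be * Re z + ga * (cmod z)^2"
    using assms(3) by (simp add: field_simps)
   moreover have "ga * (2 * (sqrt q / ga) * Im z) = 2 * Im z * sqrt q" using assms(3) by simp
   ultimately show ?thesis by simp
  qed
  finally show ?thesis using y s by simp
 qed
 then show ?thesis using c by blast
qed

text \<open>The centre is moved by a multiple of the cross product of \<open>s\<close> and
  \<open>t\<close>, which pairs to 0 with both, so an equidistant centre stays equidistant.
  \<open>q l\<close> is minus the Lorentz square of the moved vector; while it is positive there is
  a point of the plane below the vector.\<close>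

lemma move_center:
 assumes c0: "c0 : uhp" and s: "s : uhp" and t: "t : uhp" and l: "l >= 0"
  and q: "q = (%l. 1 - 2 * l * hdet s t c0 - 4 * ((hcosh s t)^2 - 1) * l^2)" and qp: "!!m. 0 <= m ==> m <= l ==> q m > 0"
 shows "EX c:uhp. ALL z:uhp. hcosh c z * sqrt (q l) = hcosh c0 z - l * hdet s t z"
proof -
 have y: "Im c0 > 0" "Im s > 0" "Im t > 0" using assms by (auto simp: uhp_iff)
 define As At where "As = (cmod s)^2" and "At = (cmod t)^2"
 define a0 b0 g0 where "a0 = (cmod c0)^2 / Im c0" and "b0 = Re c0 / Im c0" and "g0 = 1 / Im c0"
 define a1 b1 g1 where "a1 = 2 * (Re s * At - As * Re t) / (Im s * Im t)" and "b1 = (At - As) / (Im s * Im t)" and "g1 = 2 * (Re t - Re s) / (Im s * Im t)"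
 have e0: "hcosh c0 z = (a0 - 2 * b0 * Re z + g0 * (cmod z)^2) / (2 * Im z)" if "z : uhp" for z
 proof -
  have "(a0 - 2 * b0 * Re z + g0 * (cmod z)^2) = ((cmod c0)^2 + (cmod z)^2 - 2 * Re c0 * Re z) / Im c0"
   using y by (simp add: a0_def b0_def g0_def field_simps)
  then show ?thesis using hcosh_normsq[OF c0 that] by simp
 qed
 have e1: "hdet s t z = (a1 - 2 * b1 * Re z + g1 * (cmod z)^2) / (2 * Im z)" if "z : uhp" for z
 proof -
  define N where "N = Re s * (At - (cmod z)^2) - As * (Re t - Re z) + (cmod z)^2 * Re t - At * Re z"
  have "a1 - 2 * b1 * Re z + g1 * (cmod z)^2 = 2 * N / (Im s * Im t)"
   unfolding a1_def b1_def g1_def N_def by (simp add: divide_inverse algebra_simps)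
  then show ?thesis unfolding hdet_def As_def[symmetric] At_def[symmetric] N_def[symmetric] by simp
 qed
 have q0: "a0 * g0 - b0^2 = 1"
  unfolding a0_def b0_def g0_def cmod_power2 using y by (simp add: field_simps power2_eq_square)
 have q1: "a1 * g1 - b1^2 = - 4 * ((hcosh s t)^2 - 1)"
 proof -
  have "(hcosh s t)^2 - 1 = ((As + At - 2 * Re s * Re t)^2 - (2 * Im s * Im t)^2) / (2 * Im s * Im t)^2"
  proof -
   have gen: "(n / m)^2 - 1 = (n^2 - m^2) / m^2" if "m ~= 0" for n m :: real
    using that by (simp add: power_divide diff_divide_distrib)
   show ?thesis unfolding hcosh_normsq[OF s t] As_def At_def by (rule gen) (use y in auto)
  qed
  moreover have "a1 * g1 - b1^2 = (4 * (Re s * At - As * Re t) * (Re t - Re s) - (At - As)^2) / (Im s * Im t)^2"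
  proof -
   have gen: "2 * X / m * (2 * Y / m) - (Z / m)^2 = (4 * X * Y - Z^2) / m^2" for X Y Z m :: real
    by (simp add: power_divide diff_divide_distrib power2_eq_square)
   show ?thesis unfolding a1_def b1_def g1_def by (rule gen)
  qed
  moreover have "4 * (Re s * At - As * Re t) * (Re t - Re s) - (At - As)^2 = - ((As + At - 2 * Re s * Re t)^2 - (2 * Im s * Im t)^2)"
   unfolding As_def At_def cmod_power2 by (simp add: power2_eq_square algebra_simps)
  ultimately have "a1 * g1 - b1^2 = - X / (Im s * Im t)^2" "(hcosh s t)^2 - 1 = X / (2 * (Im s * Im t))^2"
   if "X = (As + At - 2 * Re s * Re t)^2 - (2 * Im s * Im t)^2" for X using that by (simp_all add: mult.assoc)
  note XX = this[OF refl]
  have gen: "- Y / m^2 = - 4 * (Y / (2 * m)^2)" for Y m :: real by (simp add: power_mult_distrib)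
  show ?thesis unfolding XX by (rule gen)
 qed
 have q01: "a0 * g1 + a1 * g0 - 2 * b0 * b1 = 2 * hdet s t c0"
 proof -
  have "2 * hdet s t c0 = (a1 - 2 * b1 * Re c0 + g1 * (cmod c0)^2) / Im c0" 
  proof -
   have gen: "2 * (N / (2 * y)) = N / y" for N y :: real by simp
   show ?thesis unfolding e1[OF c0] by (rule gen)
  qed
  also have "... = a0 * g1 + a1 * g0 - 2 * b0 * b1" unfolding a0_def b0_def g0_def
   by (simp add: divide_inverse algebra_simps)
  finally show ?thesis by simp
 qed
 define Y where "Y x0 x1 m = x0 - m * x1" for x0 x1 m :: real
 have qY: "Y a0 a1 m * Y g0 g1 m - (Y b0 b1 m)^2 = q m" for m
 proof -
  have "Y a0 a1 m * Y g0 g1 m - (Y b0 b1 m)^2 = (a0 * g0 - b0^2) - m * (a0 * g1 + a1 * g0 - 2 * b0 * b1) + m^2 * (a1 * g1 - b1^2)"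
   by (simp add: Y_def power2_eq_square algebra_simps)
  then show ?thesis unfolding q0 q1 q01 q by (simp add: algebra_simps)
 qed
 \<comment> \<open>The vector cannot leave the future cone: where the coefficient of
   \<open>|z|^2\<close> vanished, at \<open>m = g0 / g1\<close>, \<open>q m\<close> would be minus a
   square.\<close>
 have g: "Y g0 g1 l > 0"
 proof (rule ccontr)
  assume neg: "~ Y g0 g1 l > 0"
  have g00: "g0 > 0" using y by (simp add: g0_def)
  then have "l > 0" "g1 > 0" using neg l by (auto simp: Y_def not_less) (metis le_less mult_zero_left not_less, smt (verit) mult_nonneg_nonpos)
  define m where "m = g0 / g1"
  have "0 <= m" "m <= l" using g00 \<open>g1 > 0\<close> neg by (auto simp: m_def Y_def field_simps)
  then have "q m > 0" by (rule qp)
  moreover have "Y g0 g1 m = 0" using \<open>g1 > 0\<close> by (simp add: Y_def m_def)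
  ultimately show False using qY[of m] by simp (smt (verit) zero_le_power2)
 qed
 obtain c where c: "c : uhp" "ALL z:uhp. hcosh c z * sqrt (q l) = (Y a0 a1 l - 2 * Y b0 b1 l * Re z + Y g0 g1 l * (cmod z)^2) / (2 * Im z)"
  using timelike_center[OF qY[of l] qp[OF l order_refl] g] by blast
 have "hcosh c z * sqrt (q l) = hcosh c0 z - l * hdet s t z" if "z : uhp" for z
  unfolding c(2)[rule_format, OF that] e0[OF that] e1[OF that] Y_def
  by (simp add: diff_divide_distrib[symmetric] algebra_simps)
 then show ?thesis using c(1) by blast
qed

lemma negligible_conic:
 assumes "D ~= (0::real)"
 shows "negligible {z. al * (cmod z)^2 + be * Re z + D * Im z + ga = 0}"
proof (cases "al = 0")
 case True
 have "{z. al * (cmod z)^2 + be * Re z + D * Im z + ga = 0} = {z. Complex be D \<bullet> z = - ga}"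
  by (auto simp: True inner_complex_def)
 moreover have "Complex be D ~= 0" using assms by (simp add: complex_eq_iff)
 ultimately show ?thesis by (simp add: negligible_hyperplane)
next
 case False
 define c where "c = Complex (- be / (2 * al)) (- D / (2 * al))"
 have "cmod (z - c) = sqrt ((cmod c)^2 - ga / al)" if "al * (cmod z)^2 + be * Re z + D * Im z + ga = 0" for z
 proof -
  have "(cmod (z - c))^2 = (cmod z)^2 + (cmod c)^2 - 2 * (Re z * Re c + Im z * Im c)"
   unfolding cmod_power2 by (simp add: power2_eq_square algebra_simps)
  also have "2 * (Re z * Re c + Im z * Im c) = - (be * Re z + D * Im z) / al"
   using False by (simp add: c_def field_simps)
  also have "... = (cmod z)^2 + ga / al"
  proof -
   have "- (be * Re z + D * Im z) = al * (cmod z)^2 + ga" using that by linarith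
   then show ?thesis using False by (simp add: add_divide_distrib)
  qed
  finally have "(cmod (z - c))^2 = (cmod c)^2 - ga / al" by simp
  then show ?thesis by (metis norm_ge_zero real_sqrt_unique)
 qed
 then have "{z. al * (cmod z)^2 + be * Re z + D * Im z + ga = 0} \<subseteq> sphere c (sqrt ((cmod c)^2 - ga / al))"
  by (auto simp: dist_norm norm_minus_commute)
 then show ?thesis using negligible_sphere negligible_subset by blast
qed

text \<open>For \<open>z\<close> on a circle through \<open>a\<close>, \<open>b\<close>,
  \<open>c\<close>, Cramer's rule paired with the centre says that the three coefficients add up to
  \<open>hdet a b c\<close>. Multiplied by \<open>Im z\<close> this is the equation of a circle or
  line in which \<open>Im z\<close> carries the nonzero coefficient \<open>- D0\<close>.\<close>

lemma negligible_cocircular: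
 assumes u: "a : uhp" "b : uhp" "c : uhp" and D: "hdet a b c ~= 0"
 shows "negligible {z:uhp. EX w:uhp. hcosh w a = hcosh w b & hcosh w b = hcosh w c & hcosh w c = hcosh w z}"
proof -
 define D0 where "D0 = hdet a b c"
 define Aa Ab Ac where "Aa = (cmod a)^2" and "Ab = (cmod b)^2" and "Ac = (cmod c)^2"
 define ya yb yc where "ya = Im a" and "yb = Im b" and "yc = Im c"
 have y: "ya > 0" "yb > 0" "yc > 0" using u by (auto simp: ya_def yb_def yc_def uhp_iff)
 define P Q R where "P = 1 / (yb * yc)" and "Q = 1 / (ya * yc)" and "R = 1 / (ya * yb)"
 define al be ga where "al = - (Re b - Re c) * P + (Re a - Re c) * Q + (Re b - Re a) * R"
  and "be = (Ab - Ac) * P + (Ac - Aa) * Q + (Aa - Ab) * R"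
  and "ga = (Ac * Re b - Ab * Re c) * P + (Aa * Re c - Ac * Re a) * Q + (Re a * Ab - Aa * Re b) * R"
 have "{z:uhp. EX w:uhp. hcosh w a = hcosh w b & hcosh w b = hcosh w c & hcosh w c = hcosh w z} \<subseteq> {z. al * (cmod z)^2 + be * Re z + (- D0) * Im z + ga = 0}"
 proof safe
  fix z w assume z: "z : uhp" and w: "w : uhp" and e: "hcosh w a = hcosh w b" "hcosh w b = hcosh w c" "hcosh w c = hcosh w z"
  have k: "hcosh w z > 0" using hcosh_ge_1[OF w z] by simp
  have "hcosh w z * D0 = hcosh w z * (hdet z b c + hdet a z c + hdet a b z)"
   using cramer[OF u w z] e by (simp add: D0_def algebra_simps)
  then have h: "D0 = hdet z b c + hdet a z c + hdet a b z" using k by simp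
  have yz: "Im z > 0" using z by (simp add: uhp_iff)
  have gen: "y * (N / (y * m * n)) = N * (1 / (m * n))" "y * (N / (m * y * n)) = N * (1 / (m * n))" "y * (N / (m * n * y)) = N * (1 / (m * n))" if "y > 0" for y N m n :: real
   using that by simp_all
  have "Im z * hdet z b c = (Re z * (Ab - Ac) - (cmod z)^2 * (Re b - Re c) + Ac * Re b - Ab * Re c) * P"
   unfolding hdet_def Ab_def Ac_def yb_def yc_def P_def by (rule gen(1)[OF yz])
  moreover have "Im z * hdet a z c = (Re a * ((cmod z)^2 - Ac) - Aa * (Re z - Re c) + Ac * Re z - (cmod z)^2 * Re c) * Q"
   unfolding hdet_def Aa_def Ac_def ya_def yc_def Q_def by (rule gen(2)[OF yz])
  moreover have "Im z * hdet a b z = (Re a * (Ab - (cmod z)^2) - Aa * (Re b - Re z) + (cmod z)^2 * Re b - Ab * Re z) * R"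
   unfolding hdet_def Aa_def Ab_def ya_def yb_def R_def by (rule gen(3)[OF yz])
  ultimately have "Im z * hdet z b c + Im z * hdet a z c + Im z * hdet a b z = al * (cmod z)^2 + be * Re z + ga"
   unfolding al_def be_def ga_def by (simp only:) (simp add: algebra_simps)
  then have "Im z * D0 = al * (cmod z)^2 + be * Re z + ga" unfolding h distrib_left .
  then show "al * (cmod z)^2 + be * Re z + (- D0) * Im z + ga = 0" by (simp add: mult.commute)
 qed
 moreover have "negligible {z. al * (cmod z)^2 + be * Re z + (- D0) * Im z + ga = 0}"
  by (rule negligible_conic) (use D in "simp add: D0_def")
 ultimately show ?thesis by (rule negligible_subset[rotated])
qed

section \<open>Delaunay complexes of generic nets\<close>

context fuchsian
begin

definition orb :: "complex set => complex set" where "orb P = {g p | g p. g : \<Gamma> & p : P}"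

definition ineq :: "complex set => bool" where
 "ineq A \<longleftrightarrow> (ALL s:A. ALL t:A. ALL g:\<Gamma>. t = g s --> s = t)"

text \<open>Only quadruples of pairwise inequivalent sites matter: a new orbit enters such a
  quadruple at most once, so a new point has to avoid only circles through older sites. In a fine
  net the sites nearest to a given point are always inequivalent.\<close>

definition generic :: "complex set => bool" where
 "generic P \<longleftrightarrow> (\<forall>A\<subseteq>orb P. card A = 4 --> ineq A --> ~ (EX w:uhp. EX k. ALL s:A. hcosh w s = k))"

lemma orb_uhp: "P \<subseteq> uhp ==> orb P \<subseteq> uhp"
 using in_uhp by (auto simp: orb_def)

lemma orb_inv: "P \<subseteq> uhp ==> g : \<Gamma> ==> s : orb P ==> g s : orb P"
 unfolding orb_def using cmp_props by (smt (verit) mem_Collect_eq subsetD)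

lemma subset_orb: "P \<subseteq> orb P"
proof
 fix p assume "p : P"
 then have "id p : orb P" using id_in unfolding orb_def by blast
 then show "p : orb P" by simp
qed

lemma countable_orb: "countable P ==> countable (orb P)"
proof -
 assume "countable P"
 moreover have "orb P = (%(g, p). g p) ` (\<Gamma> \<times> P)" by (auto simp: orb_def)
 ultimately show ?thesis using countable_Gamma by simp
qed

lemma orb_insert: "orb (insert p P) = {g p | g. g : \<Gamma>} \<union> orb P"
 by (auto simp: orb_def)

lemma ineq_subset: "ineq A ==> B \<subseteq> A ==> ineq B"
 by (auto simp: ineq_def)

lemma generic_insert:
 assumes P: "P \<subseteq> uhp" "generic P" "p : uhp" "p ~: orb P"
  and bad: "!!a b c w. a : orb P ==> b : orb P ==> c : orb P ==> w : uhp ==> a ~= b ==> b ~= c ==> a ~= c ==>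
    hcosh w a = hcosh w b ==> hcosh w b = hcosh w c ==> hcosh w c = hcosh w p ==> False"
 shows "generic (insert p P)"
 unfolding generic_def
proof (intro allI impI notI)
 fix A assume A: "A \<subseteq> orb (insert p P)" "card A = 4" "ineq A" and "EX w:uhp. EX k. ALL s:A. hcosh w s = k"
 then obtain w k where w: "w : uhp" "!!s. s : A ==> hcosh w s = k" by blast
 have finA: "finite A" using A(2) by (metis card.infinite zero_neq_numeral)
 have Au: "A \<subseteq> uhp" using A(1) orb_uhp[of "insert p P"] P by auto
 show False
 proof (cases "A \<subseteq> orb P")
  case True
  then have "~ (EX w:uhp. EX k. ALL s:A. hcosh w s = k)" using P(2) A(2,3) by (simp add: generic_def)
  then show False using w by auto
 next
  case False
  then obtain s g where s: "s : A" "g : \<Gamma>" "s = g p" using A(1) unfolding orb_insert by blast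
  have rest: "t : orb P" if tA: "t : A" "t ~= s" for t
  proof (rule ccontr)
   assume "t ~: orb P"
   then obtain h where h: "h : \<Gamma>" "t = h p" using A(1) tA unfolding orb_insert by blast
   have "t = cmp h (ivt g) s" using h s cmp_props ivt_props P(3) in_uhp by simp
   then show False using A(3) tA s h cmp_props(1) ivt_props(1) unfolding ineq_def by metis
  qed
  have "card (A - {s}) = 3" using A(2) s finA by simp
  then obtain a b c where abc: "A - {s} = {a, b, c}" "a ~= b" "b ~= c" "a ~= c" by (auto simp: card_3_iff)
  \<comment> \<open>Translating by the inverse of \<open>g\<close> turns the new site of the
    quadruple into \<open>p\<close> itself.\<close>
  let ?h = "ivt g"
  have hG: "?h : \<Gamma>" using ivt_props s by blast
  have in3: "a : A" "b : A" "c : A" "a ~= s" "b ~= s" "c ~= s" using abc by auto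
  then have o3: "a : orb P" "b : orb P" "c : orb P" using rest by auto
  have u3: "a : uhp" "b : uhp" "c : uhp" "s : uhp" using in3 s Au by auto
  have "hcosh (?h w) (?h x) = k" if "x : A" for x using hcosh_inv[OF hG w(1)] Au that w(2) by auto
  then have e: "hcosh (?h w) (?h a) = k" "hcosh (?h w) (?h b) = k" "hcosh (?h w) (?h c) = k" "hcosh (?h w) (?h s) = k"
   using in3 s by auto
  have "?h s = p" using s ivt_props P(3) by simp
  then show False
   using bad[of "?h a" "?h b" "?h c" "?h w"] e orb_inv[OF P(1) hG] o3 in_uhp[OF hG w(1)] inj[OF hG] u3 abc by auto
 qed
qed

text \<open>Each new point is taken from a small disc, outside the orbit of the old ones and outside
  countably many negligible loci of points cocircular with three old sites.\<close>

lemma net_exists_aux: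
 assumes "finite Ks" "Ks \<subseteq> uhp" "e > 0"
 shows "EX P. finite P & P \<subseteq> uhp & ineq P & generic P & (ALL k:Ks. EX p:P. hyp_dist k p < e)"
 using assms(1,2)
proof (induction Ks rule: finite_induct)
 case empty
 have "generic {}" by (auto simp: generic_def orb_def)
 then show ?case by (intro exI[of _ "{}"]) (auto simp: ineq_def)
next
 case (insert k Ks)
 then obtain P where P: "finite P" "P \<subseteq> uhp" "ineq P" "generic P" "!!k. k : Ks ==> EX p:P. hyp_dist k p < e" by auto
 have k: "k : uhp" using insert by simp
 define U where "U = {z:uhp. hcosh k z < cosh e}"
 have oU: "open U"
 proof -
  have "U = uhp \<inter> (%z. hcosh k z) -` {..<cosh e}" by (auto simp: U_def)
  moreover have "open (uhp \<inter> (%z. hcosh k z) -` {..<cosh e})"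
   by (rule continuous_open_preimage) (use open_uhp k in "auto intro!: continuous_intros")
  ultimately show ?thesis by simp
 qed
 have "cosh e > 1" using cosh_real_nonneg_less_iff[of 0 e] assms(3) by simp
 then have "k : U" using k by (simp add: U_def)
 then have nU: "~ negligible U" using open_not_negligible[OF oU] by blast
 define T where "T = {(a,b,c). a : orb P & b : orb P & c : orb P & a ~= b & b ~= c & a ~= c}"
 define Z where "Z = (%(a,b,c). {z:uhp. EX w:uhp. hcosh w a = hcosh w b & hcosh w b = hcosh w c & hcosh w c = hcosh w z})"
 have co: "countable (orb P)" using countable_orb[OF countable_finite[OF P(1)]] .
 have "countable T"
 proof (rule countable_subset)
  show "T \<subseteq> orb P \<times> orb P \<times> orb P" by (auto simp: T_def)
 qed (use co in auto)
 then have cT: "countable (Z ` T)" by simp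
 have nZ: "negligible X" if "X : Z ` T" for X
 proof -
  obtain a b c where x: "X = Z (a,b,c)" "(a,b,c) : T" using \<open>X : Z ` T\<close> by auto
  have u: "a : uhp" "b : uhp" "c : uhp" using x orb_uhp[OF P(2)] by (auto simp: T_def)
  show ?thesis
  proof (cases "hdet a b c = 0")
   case True
   have "X = {}" using cocircular_hdet_nz[OF u] True x by (auto simp: Z_def T_def)
   then show ?thesis by simp
  next
   case False
   then show ?thesis unfolding x(1) Z_def using negligible_cocircular[OF u False] by simp
  qed
 qed
 have "negligible (orb P \<union> \<Union> (Z ` T))"
 proof (rule negligible_Un)
  have "negligible (\<Union> ((%x. {x}) ` orb P))" by (rule negligible_countable_Union) (use co in auto)
  then show "negligible (orb P)" by simp
  show "negligible (\<Union> (Z ` T))" by (rule negligible_countable_Union[OF cT nZ])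
 qed
 then obtain p where p: "p : U" "p ~: orb P" "p ~: \<Union> (Z ` T)" using nU negligible_subset by blast
 have pu: "p : uhp" "hyp_dist k p < e" using p k assms(3) by (auto simp: U_def hyp_dist_less_iff)
 have "generic (insert p P)"
 proof (rule generic_insert[OF P(2,4) pu(1) p(2)])
  fix a b c w assume h: "a : orb P" "b : orb P" "c : orb P" "w : uhp" "a ~= b" "b ~= c" "a ~= c"
    "hcosh w a = hcosh w b" "hcosh w b = hcosh w c" "hcosh w c = hcosh w p"
  then have "(a,b,c) : T" by (simp add: T_def)
  moreover have "p : Z (a,b,c)" unfolding Z_def using pu(1) h(4,8,9,10) by blast
  ultimately have "(a,b,c) : T" "p : Z (a,b,c)" by auto
  then show False using p(3) by blast
 qed
 moreover have "ineq (insert p P)"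
  unfolding ineq_def
 proof (intro ballI impI)
  fix s t g assume h: "s : insert p P" "t : insert p P" "g : \<Gamma>" "t = g s"
  show "s = t"
  proof (cases "s = p")
   case True
   show ?thesis
   proof (rule ccontr)
    assume "s ~= t"
    then have t: "t : P" using h True by auto
    have "p = ivt g t" using h True ivt_props pu by simp
    then have "p : orb P" using t ivt_props h unfolding orb_def by blast
    then show False using p by simp
   qed
  next
   case False
   then have s: "s : P" using h by simp
   then have "t : orb P" using h unfolding orb_def by blast
   then have "t : P" using h p by auto
   then show ?thesis using P(3) s h unfolding ineq_def by blast
  qed
 qed
 ultimately show ?case using P pu by (intro exI[of _ "insert p P"]) auto
qed

text \<open>Two sites nearest to a common point are closer than \<open>2 * eps\<close>; this has to
  stay below the systole, so that they are inequivalent. The factor 16 leaves ample room.\<close>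

definition eps :: real where "eps = systole \<Gamma> / 16"

lemma eps_pos: "eps > 0" using systole_pos by (simp add: eps_def)

lemma net_exists:
 "EX P. finite P & P \<subseteq> uhp & ineq P & generic P & (ALL z:uhp. EX s:orb P. hyp_dist z s < eps)"
proof -
 define B where "B k = {z:uhp. hcosh k z < cosh (eps/2)}" for k
 have oB: "open (B k)" if k: "k : uhp" for k
 proof -
  have "B k = uhp \<inter> (%z. hcosh k z) -` {..<cosh (eps/2)}" by (auto simp: B_def)
  moreover have "open (uhp \<inter> (%z. hcosh k z) -` {..<cosh (eps/2)})"
   by (rule continuous_open_preimage) (use open_uhp k in "auto intro!: continuous_intros")
  ultimately show ?thesis by simp
 qed
 have "cosh (eps/2) > 1" using cosh_real_nonneg_less_iff[of 0 "eps/2"] eps_pos by simp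
 then have "KK \<subseteq> (\<Union>k\<in>KK. B k)" using KK(2) by (auto simp: B_def)
 then obtain Ks where Ks: "Ks \<subseteq> KK" "finite Ks" "KK \<subseteq> (\<Union>k\<in>Ks. B k)"
  using compactE_image[OF KK(1), of KK B] oB KK(2) by blast
 obtain P where P: "finite P" "P \<subseteq> uhp" "ineq P" "generic P" "!!k. k : Ks ==> EX p:P. hyp_dist k p < eps/2"
 proof -
  have "Ks \<subseteq> uhp" "eps / 2 > 0" using Ks(1) KK(2) eps_pos by auto
  from net_exists_aux[OF Ks(2) this] show ?thesis using that by blast
 qed
 have "EX s:orb P. hyp_dist z s < eps" if z: "z : uhp" for z
 proof -
  obtain f where f: "f : \<Gamma>" "f z : KK" using move[OF z] .
  then obtain k where k: "k : Ks" "f z : B k" using Ks(3) by blast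
  obtain p where p: "p : P" "hyp_dist k p < eps/2" using P(5)[OF k(1)] by blast
  have ku: "k : uhp" "p : uhp" "f z : uhp" using k Ks KK p P in_uhp f z by auto
  have "hcosh k (f z) < cosh (eps/2)" using k by (simp add: B_def)
  then have "hyp_dist k (f z) < eps/2" by (subst hyp_dist_less_iff) (use ku eps_pos in auto)
  then have "hyp_dist (f z) p < eps" using hyp_triangle[OF ku(3,1,2)] p hyp_dist_sym[of k "f z"] by simp
  moreover have "hyp_dist (f z) p = hyp_dist z (ivt f p)"
   using hyp_dist_isom[OF isom[OF f(1)] z, of "ivt f p"] ivt_props[OF f(1)] ivt_right[OF f(1) ku(2)] in_uhp ku by simp
  moreover have "ivt f p : orb P" using ivt_props[OF f(1)] p unfolding orb_def by blast
  ultimately show ?thesis by auto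
 qed
 then show ?thesis using P by blast
qed

end

locale net = fuchsian +
 fixes P :: "complex set"
 assumes finP: "finite P" and P_uhp: "P \<subseteq> uhp" and ineqP: "ineq P" and genP: "generic P"
  and dense: "!!z. z : uhp ==> EX s:orb P. hyp_dist z s < eps"
begin

section \<open>Voronoi cells and Delaunay simplices\<close>

abbreviation SS where "SS \<equiv> orb P"

lemma SS_uhp: "s : SS ==> s : uhp" using orb_uhp[OF P_uhp] by blast
lemma SS_inv: "g : \<Gamma> ==> s : SS ==> g s : SS" using orb_inv[OF P_uhp] by blast
lemma P_SS: "p : P ==> p : SS" using subset_orb by blast

lemma dense': "z : uhp ==> EX s:SS. hcosh z s < cosh eps"
 using dense hyp_dist_less_iff SS_uhp eps_pos by (metis less_imp_le)

lemma short_translate: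
 assumes "s : uhp" "g : \<Gamma>" "hyp_dist s (g s) < systole \<Gamma>" shows "g = id"
 using systole_le[OF assms(2) _ assms(1)] assms(3) by force

lemma SS_locally_finite:
 assumes "compact K" "K \<subseteq> uhp" shows "finite {s:SS. EX z:K. hcosh z s <= C}"
proof -
 have "{s:SS. EX z:K. hcosh z s <= C} \<subseteq> (\<Union>p\<in>P. (%f. f p) ` {f:\<Gamma>. EX z:K. hcosh z (f p) <= C})"
  unfolding orb_def by blast
 moreover have "finite ..." using finP finite_near[OF assms] P_uhp by blast
 ultimately show ?thesis using finite_subset by blast
qed

text \<open>The point \<open>z\<close> lies in the closed Voronoi cell of the site
  \<open>s\<close>.\<close>

definition near :: "complex => complex => bool" where
 "near z s \<longleftrightarrow> s : SS & (ALL t:SS. hcosh z s <= hcosh z t)"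

lemma near_exists: assumes z: "z : uhp" shows "EX s. near z s"
proof -
 define A where "A = {s:SS. EX w:{z}. hcosh w s <= cosh eps}"
 have finA: "finite A" unfolding A_def by (rule SS_locally_finite) (use z in auto)
 obtain s0 where s0: "s0 : SS" "hcosh z s0 < cosh eps" using dense'[OF z] by blast
 then have "A ~= {}" by (auto simp: A_def)
 then obtain s where s: "s : A" "!!t. t : A ==> hcosh z s <= hcosh z t"
  using finA by (metis arg_min_if_finite(1) arg_min_least)
 have "near z s" unfolding near_def
 proof (intro conjI ballI)
  show "s : SS" using s by (simp add: A_def)
  fix t assume t: "t : SS"
  show "hcosh z s <= hcosh z t"
  proof (cases "t : A")
   case True then show ?thesis by (rule s(2))
  next
   case False
   then have "hcosh z t > cosh eps" using t by (auto simp: A_def)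
   moreover have "hcosh z s <= cosh eps" using s(1) by (simp add: A_def)
   ultimately show ?thesis by simp
  qed
 qed
 then show ?thesis by blast
qed

lemma near_less: assumes "z : uhp" "near z s" shows "hcosh z s < cosh eps" "hyp_dist z s < eps"
proof -
 show "hcosh z s < cosh eps" using dense'[OF assms(1)] assms(2) by (auto simp: near_def)
 then show "hyp_dist z s < eps" using assms SS_uhp eps_pos by (simp add: near_def hyp_dist_less_iff)
qed

lemma near_inv: assumes "g : \<Gamma>" "z : uhp" "near z s" shows "near (g z) (g s)"
 unfolding near_def
proof (intro conjI ballI)
 show "g s : SS" using assms SS_inv by (simp add: near_def)
 fix t assume t: "t : SS"
 have "hcosh (g z) (g s) = hcosh z s" using hcosh_inv assms SS_uhp by (simp add: near_def)
 also have "... <= hcosh z (ivt g t)" using assms SS_inv ivt_props t by (simp add: near_def)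
 also have "... = hcosh (g z) t" using hcosh_inv[OF assms(1,2), of "ivt g t"] ivt_right[OF assms(1)] ivt_props[OF assms(1)] in_uhp SS_uhp t by simp
 finally show "hcosh (g z) (g s) <= hcosh (g z) t" .
qed

lemma near_eq: "near z s ==> near z t ==> hcosh z s = hcosh z t"
 by (auto simp: near_def intro: order_antisym)

lemma near_close: assumes "z : uhp" "near z s" "near z t" shows "hyp_dist s t < 2 * eps"
proof -
 have u: "s : uhp" "t : uhp" using assms SS_uhp by (auto simp: near_def)
 have "hyp_dist s t <= hyp_dist s z + hyp_dist z t" by (rule hyp_triangle) (use u assms in auto)
 then show ?thesis using near_less(2)[OF assms(1,2)] near_less(2)[OF assms(1,3)] hyp_dist_sym[of z s] by simp
qed

lemma near_ineq: assumes z: "z : uhp" shows "ineq {s. near z s}"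
 unfolding ineq_def
proof (intro ballI impI)
 fix s t g assume h: "s : {s. near z s}" "t : {s. near z s}" "g : \<Gamma>" "t = g s"
 have "hyp_dist s t < 2 * eps" using near_close[OF z] h by simp
 then have "g = id" using short_translate[of s g] h SS_uhp systole_pos by (simp add: near_def eps_def)
 then show "s = t" using h by simp
qed

lemma near_four:
 assumes z: "z : uhp" and n: "near z a" "near z b" "near z c" "near z d" and ne: "a ~= b" "a ~= c" "b ~= c"
 shows "d : {a, b, c}"
proof (rule ccontr)
 assume d: "d ~: {a, b, c}"
 let ?A = "{a, b, c, d}"
 have "card ?A = 4" using ne d by auto
 moreover have "?A \<subseteq> SS" using n by (auto simp: near_def)
 moreover have "ineq ?A" by (rule ineq_subset[OF near_ineq[OF z]]) (use n in auto)
 moreover have "ALL s:?A. hcosh z s = hcosh z a" using near_eq[OF n(1,1)] near_eq[OF n(2,1)] near_eq[OF n(3,1)] near_eq[OF n(4,1)] by simp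
 ultimately show False using genP z unfolding generic_def by meson
qed

text \<open>The Delaunay condition: \<open>A\<close> lies on a circle without sites inside, centred
  at a common point of the Voronoi cells. \<open>tri\<close> lists the triangles in positive
  orientation.\<close>

definition Spx :: "complex set => bool" where "Spx A \<longleftrightarrow> (EX c:uhp. ALL s:A. near c s)"
definition adj :: "complex => complex => bool" where "adj s t \<longleftrightarrow> s ~= t & Spx {s, t}"
definition tri :: "complex => complex => complex => bool" where "tri s t u \<longleftrightarrow> Spx {s, t, u} & hdet s t u > 0"

lemma Spx_mono: "Spx A ==> B \<subseteq> A ==> Spx B" unfolding Spx_def by blast
lemma Spx_SS: "Spx A ==> s : A ==> s : SS" unfolding Spx_def near_def by blast

lemma Spx_inv: assumes "g : \<Gamma>" "Spx A" shows "Spx (g ` A)"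
 using assms near_inv in_uhp unfolding Spx_def by (metis (no_types, lifting) imageE)

lemma Spx_close: "Spx A ==> s : A ==> t : A ==> hyp_dist s t < 2 * eps"
 unfolding Spx_def using near_close by blast

lemma adj_sym: "adj s t ==> adj t s" by (auto simp: adj_def insert_commute)

lemma adj_inv: assumes "g : \<Gamma>" "adj s t" shows "adj (g s) (g t)"
 using Spx_inv[OF assms(1), of "{s,t}"] assms inj[OF assms(1), of s t] Spx_SS[of "{s,t}"] SS_uhp by (auto simp: adj_def)

lemma tri_distinct: "tri s t u ==> s ~= t & t ~= u & s ~= u" by (auto simp: tri_def)

lemma tri_cycle: "tri s t u ==> tri t u s"
 using hdet_cycle[of s t u] by (simp add: tri_def insert_commute)

lemma tri_adj: "tri s t u ==> adj s t"
 using Spx_mono[of "{s,t,u}" "{s,t}"] tri_distinct[of s t u] by (auto simp: tri_def adj_def)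

lemma tri_SS: "tri s t u ==> s : SS & t : SS & u : SS"
 using Spx_SS[of "{s,t,u}"] by (auto simp: tri_def)

lemma tri_inv: assumes "g : \<Gamma>" "tri s t u" shows "tri (g s) (g t) (g u)"
 using Spx_inv[OF assms(1), of "{s,t,u}"] assms hdet_isom[OF isom[OF assms(1)], of s t u] tri_SS[OF assms(2)] SS_uhp by (auto simp: tri_def)

lemma Spx3_oriented:
 assumes "Spx {s, t, u}" "s ~= t" "t ~= u" "s ~= u" shows "tri s t u \<or> tri s u t"
proof -
 obtain c where c: "c : uhp" "near c s" "near c t" "near c u" using assms(1) unfolding Spx_def by auto
 have "hdet s t u ~= 0"
  by (rule cocircular_hdet_nz[of s t u c]) (use c assms near_eq[OF c(2,3)] near_eq[OF c(3,4)] SS_uhp in "auto simp: near_def")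
 then show ?thesis using assms(1) hdet_swap[of s u t] by (auto simp: tri_def insert_commute)
qed

text \<open>Each of the two empty circles has the other third vertex outside or on it. Cramer's rule
  paired with both centres turns this into opposite inequalities, so \<open>u'\<close> lies on the
  circle of \<open>s\<close>, \<open>t\<close>, \<open>u\<close>; genericity leaves no fourth site
  there.\<close>

lemma left_triangle_unique:
 assumes "tri s t u" "tri s t u'" shows "u = u'"
proof -
 obtain c where c: "c : uhp" "near c s" "near c t" "near c u" using assms(1) unfolding tri_def Spx_def by auto
 obtain c' where c': "c' : uhp" "near c' s" "near c' t" "near c' u'" using assms(2) unfolding tri_def Spx_def by auto
 have uh: "s : uhp" "t : uhp" "u : uhp" "u' : uhp" using c c' SS_uhp by (auto simp: near_def)
 define D h1 h2 h3 where "D = hdet s t u" and "h1 = hdet u' t u" and "h2 = hdet s u' u" and "h3 = hdet s t u'"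
 have pos: "D > 0" "h3 > 0" using assms by (auto simp: tri_def D_def h3_def)
 define k k' where "k = hcosh c s" and "k' = hcosh c' s"
 have kk: "k > 0" "k' > 0" using hcosh_ge_1[OF c(1) uh(1)] hcosh_ge_1[OF c'(1) uh(1)] by (auto simp: k_def k'_def)
 have ck: "hcosh c t = k" "hcosh c u = k" "hcosh c' t = k'" "hcosh c' u' = k'" 
  using near_eq[OF c(2,3)] near_eq[OF c(2,4)] near_eq[OF c'(2,3)] near_eq[OF c'(2,4)] by (simp_all add: k_def k'_def)
 have ge: "hcosh c u' >= k" "hcosh c' u >= k'" using c c' by (auto simp: near_def k_def k'_def)
 have 1: "hcosh c u' * D = k * (h1 + h2 + h3)"
  using cramer[OF uh(1,2,3) c(1) uh(4)] ck by (simp add: D_def h1_def h2_def h3_def k_def algebra_simps)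
 have 2: "k' * D = k' * (h1 + h2) + h3 * hcosh c' u"
  using cramer[OF uh(1,2,3) c'(1) uh(4)] ck by (simp add: D_def h1_def h2_def h3_def k'_def algebra_simps)
 have "k * D <= k * (h1 + h2 + h3)" using 1 ge(1) pos by (metis mult_right_mono less_imp_le)
 then have a: "D <= h1 + h2 + h3" using kk by simp
 have "k' * (h1 + h2 + h3) <= k' * D" using 2 ge(2) pos by (simp add: distrib_left mult.commute[of h3])
 then have "h1 + h2 + h3 <= D" using kk by simp
 then have "hcosh c u' * D = k * D" using 1 a by simp
 then have "hcosh c u' = k" using pos by simp
 then have "near c u'" using c c' by (auto simp: near_def k_def)
 then have "u' : {s, t, u}" using near_four[OF c(1,2,3,4)] tri_distinct[OF assms(1)] by blast
 then show ?thesis using tri_distinct[OF assms(2)] by auto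
qed

text \<open>Push the centre of an empty circle through \<open>s\<close> and \<open>t\<close> along
  their bisector to the left, until the circle first meets another site.\<close>

lemma left_triangle_exists:
 assumes "adj s t" shows "EX u. tri s t u"
proof -
 obtain c0 where c0: "c0 : uhp" "near c0 s" "near c0 t" using assms unfolding adj_def Spx_def by auto
 have uh: "s : uhp" "t : uhp" and SSst: "s : SS" "t : SS" using c0 SS_uhp by (auto simp: near_def)
 have st: "s ~= t" using assms by (simp add: adj_def)
 define k where "k = hcosh c0 s"
 have k: "k >= 1" "k < cosh eps" "hcosh c0 t = k" using hcosh_ge_1[OF c0(1) uh(1)] near_less(1)[OF c0(1,2)] near_eq[OF c0(2,3)] by (auto simp: k_def)
 have ge: "hcosh c0 u >= k" if "u : SS" for u using c0(2) that by (simp add: near_def k_def)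
 define h where "h = hdet s t"
 define q where "q = (%l. 1 - 2 * l * hdet s t c0 - 4 * ((hcosh s t)^2 - 1) * l^2)"
 define b where "b = 4 * ((hcosh s t)^2 - 1)"
 have bp: "b > 0" using hcosh_gt_1[OF uh st] by (simp add: b_def power2_eq_square) (metis less_1_mult)
 \<comment> \<open>At \<open>q l = q1\<close> the circle through \<open>s\<close> and
   \<open>t\<close> has radius exactly \<open>eps\<close>, so by density some site is strictly
   inside it.\<close>
 define q1 where "q1 = (k / cosh eps)^2"
 have ce: "cosh eps > 0" by simp
 have q1: "q1 > 0" "q1 < 1"
 proof -
  have "0 < k / cosh eps" "k / cosh eps < 1" using k ce by auto
  then have "(k / cosh eps)^2 < 1^2" by (intro power_strict_mono) auto
  then show "q1 > 0" "q1 < 1" using \<open>0 < k / cosh eps\<close> by (auto simp: q1_def)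
 qed
 have lim: "filterlim q at_bot at_top"
 proof -
  have "q = (%l. 1 - 2 * l * hdet s t c0 - b * l^2)" by (simp add: q_def b_def)
  moreover have "filterlim (%l. 1 - 2 * l * d - b * l^2) at_bot at_top" for d :: real using bp by real_asymp
  ultimately show ?thesis by simp
 qed
 then have "eventually (%l. q l <= q1 / 2) at_top" unfolding filterlim_at_bot by blast
 then have "eventually (%l. q l <= q1 / 2 & l > 0) at_top"
  using eventually_gt_at_top[of "0::real"] by (rule eventually_conj)
 from eventually_happens[OF this] obtain l2 where "q l2 <= q1 / 2" "l2 > 0" by auto
 then have l2: "q l2 < q1" "l2 > 0" using q1 by auto
 have cq: "continuous_on A q" for A unfolding q_def by (intro continuous_intros)
 have "EX x>=0. x <= l2 & q x = q1"
  by (rule IVT2') (use l2 q1 cq in "auto simp: q_def")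
 then obtain l1 where l1: "0 <= l1" "q l1 = q1" by blast
 have l1p: "l1 > 0" using l1 q1 by (cases "l1 = 0") (auto simp: q_def)
 \<comment> \<open>\<open>q\<close> is concave and positive at both ends of the interval.\<close>
 have qpos: "q m > 0" if m: "0 <= m" "m <= l1" for m
 proof -
  define x where "x = m / l1"
  have x: "0 <= x" "x <= 1" "m = x * l1" using m l1p by (auto simp: x_def)
  have "q m - ((1 - x) * q 0 + x * q l1) = b * l1^2 * (x * (1 - x))"
   unfolding q_def b_def x(3) by (simp add: power2_eq_square algebra_simps)
  moreover have "... >= 0" using bp x by simp
  moreover have "(1 - x) * q 0 + x * q l1 > 0"
  proof -
   have "(1 - x) * 1 + x * q1 > 0" using x q1 by (cases "x = 1") (auto intro: add_pos_nonneg)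
   then show ?thesis using l1 by (simp add: q_def)
  qed
  ultimately show ?thesis by linarith
 qed
 have mc: "EX c:uhp. ALL z:uhp. hcosh c z * sqrt (q l) = hcosh c0 z - l * h z" if "0 <= l" "l <= l1" for l
  unfolding h_def by (rule move_center[OF c0(1) uh that(1) q_def]) (use qpos that in auto)
 obtain c1 where c1: "c1 : uhp" "!!z. z : uhp ==> hcosh c1 z * sqrt (q l1) = hcosh c0 z - l1 * h z" using mc[of l1] l1 by auto
 have sq1: "sqrt (q l1) = k / cosh eps" using l1 k by (simp add: q1_def)
 define U where "U = {u:SS. hcosh c1 u < cosh eps}"
 have "U \<subseteq> {s:SS. EX z:{c1}. hcosh z s <= cosh eps}" by (auto simp: U_def)
 then have finU: "finite U" using SS_locally_finite[of "{c1}" "cosh eps"] c1 finite_subset by auto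
 have neU: "U ~= {}" using dense'[OF c1(1)] by (auto simp: U_def)
 have Uiff: "u : U \<longleftrightarrow> hcosh c0 u - l1 * h u < k" if "u : SS" for u
 proof -
  have "hcosh c1 u * (k / cosh eps) = hcosh c0 u - l1 * h u" using c1(2)[OF SS_uhp[OF that]] sq1 by simp
  moreover have "hcosh c1 u < cosh eps \<longleftrightarrow> hcosh c1 u * (k / cosh eps) < cosh eps * (k / cosh eps)"
   using k ce by (subst mult_less_cancel_right_pos) auto
  ultimately show ?thesis using that ce by (simp add: U_def)
 qed
 have hU: "h u > 0" if "u : U" for u
 proof -
  have "l1 * h u > 0" using Uiff ge that by (auto simp: U_def) (smt (verit))
  then show ?thesis using l1p by (simp add: zero_less_mult_iff)
 qed
 \<comment> \<open>The parameter at which the moving circle passes through \<open>u\<close>; the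
   site with the smallest one is met first.\<close>
 define r where "r u = (hcosh c0 u - k) / h u" for u
 obtain u where u: "u : U" "!!v. v : U ==> r u <= r v"
  using finU neU by (metis arg_min_if_finite(1) arg_min_least)
 define l where "l = r u"
 have uSS: "u : SS" using u by (simp add: U_def)
 have l: "0 <= l" "l <= l1"
 proof -
  show "0 <= l" using ge[OF uSS] hU[OF u(1)] by (simp add: l_def r_def)
  have "hcosh c0 u - k < l1 * h u" using Uiff[OF uSS] u(1) by simp
  then show "l <= l1" using hU[OF u(1)] by (simp add: l_def r_def divide_le_eq)
 qed
 obtain c where c: "c : uhp" "!!z. z : uhp ==> hcosh c z * sqrt (q l) = hcosh c0 z - l * h z" using mc[OF l] by auto
 have sq: "sqrt (q l) > 0" using qpos[OF l] by simp
 have lower: "hcosh c0 v - l * h v >= k" if v: "v : SS" for v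
 proof (cases "v : U")
  case True
  have "l * h v <= r v * h v" using u(2)[OF True] hU[OF True] by (simp add: l_def)
  also have "... = hcosh c0 v - k" using hU[OF True] by (simp add: r_def)
  finally show ?thesis by simp
 next
  case False
  then have a: "hcosh c0 v - l1 * h v >= k" using Uiff[OF v] by simp
  show ?thesis
  proof (cases "h v >= 0")
   case True then have "l * h v <= l1 * h v" using l by (intro mult_right_mono) auto
   then show ?thesis using a by simp
  next
   case False then have "l * h v <= 0" using l by (simp add: mult_nonneg_nonpos)
   then show ?thesis using ge[OF v] by simp
  qed
 qed
 have vals: "hcosh c s * sqrt (q l) = k" "hcosh c t * sqrt (q l) = k" "hcosh c u * sqrt (q l) = k"
  using c(2)[OF uh(1)] c(2)[OF uh(2)] c(2)[OF SS_uhp[OF uSS]] k hU[OF u(1)] by (auto simp: h_def k_def l_def r_def)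
 have nr: "near c v" if "v : SS" "hcosh c v * sqrt (q l) = k" for v
  unfolding near_def
 proof (intro conjI ballI)
  fix w assume "w : SS"
  then have "hcosh c v * sqrt (q l) <= hcosh c w * sqrt (q l)" using that lower[of w] c(2)[OF SS_uhp[of w]] by simp
  then show "hcosh c v <= hcosh c w" using sq by simp
 qed (use that in auto)
 have "Spx {s, t, u}" unfolding Spx_def using c(1) nr[OF SSst(1) vals(1)] nr[OF SSst(2) vals(2)] nr[OF uSS vals(3)] by auto
 then show ?thesis using hU[OF u(1)] by (auto simp: tri_def h_def)
qed

end

section \<open>Area of hyperbolic triangles\<close>

text \<open>The angle at \<open>p\<close> according to the law of cosines; the square roots are sinh
  of the adjacent sides.\<close>

definition ang :: "complex => complex => complex => real" where
 "ang p t u = arccos ((hcosh p t * hcosh p u - hcosh t u) / (sqrt ((hcosh p t)^2 - 1) * sqrt ((hcosh p u)^2 - 1)))"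

definition Tri :: "complex => complex => complex => complex set" where
 "Tri p t u = {z:uhp. hdet p t z >= 0 & hdet t u z >= 0 & hdet u p z >= 0}"

lemma Tri_cycle: "Tri p t u = Tri t u p"
 by (auto simp: Tri_def)

lemma hdet_polar:
 assumes p: "p : uhp" and z: "z : uhp" "w : uhp" and e: "cay p z = of_real r1 * cis x" "cay p w = of_real r2 * cis y"
 shows "hdet p z w = 2 * (2 * r1 / (1 - r1^2)) * (2 * r2 / (1 - r2^2)) * sin (y - x)"
proof -
 have c: "(cmod (cay p z))^2 = r1^2" "(cmod (cay p w))^2 = r2^2" using e by (simp_all add: norm_mult)
 have "Im (cnj (cay p z) * cay p w) = r1 * r2 * sin (y - x)"
  unfolding e by (simp add: sin_diff algebra_simps)
 then show ?thesis unfolding hdet_cay[OF p z] c by simp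
qed

lemma hcosh_polar:
 assumes p: "p : uhp" and z: "z : uhp" "w : uhp" and e: "cay p z = of_real r1 * cis x" "cay p w = of_real r2 * cis y"
 shows "hcosh z w = ((1 + r1^2) / (1 - r1^2)) * ((1 + r2^2) / (1 - r2^2)) - (2 * r1 / (1 - r1^2)) * (2 * r2 / (1 - r2^2)) * cos (y - x)"
proof -
 have c: "(cmod (cay p z))^2 = r1^2" "(cmod (cay p w))^2 = r2^2" using e by (simp_all add: norm_mult)
 have "Re (cay p z * cnj (cay p w)) = r1 * r2 * cos (y - x)"
  unfolding e by (simp add: cos_diff algebra_simps)
 then show ?thesis unfolding hcosh_cay[OF p z] c by (simp add: diff_divide_distrib)
qed

lemma sin_ge_0_window:
 assumes "0 < al" "al < pi" "0 <= ta" "ta < 2 * pi"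
 shows "sin ta >= 0 & sin (al - ta) >= 0 \<longleftrightarrow> ta <= al"
proof
 assume h: "sin ta >= 0 & sin (al - ta) >= 0"
 have 1: "ta <= pi"
 proof (rule ccontr)
  assume "~ ta <= pi" then have "sin ta < 0" using assms by (intro sin_lt_zero) auto
  then show False using h by simp
 qed
 show "ta <= al"
 proof (rule ccontr)
  assume "~ ta <= al"
  then have "sin (ta - al) > 0" using 1 assms by (intro sin_gt_zero) auto
  then show False using h sin_minus[of "ta - al"] by simp
 qed
next
 assume "ta <= al"
 then show "sin ta >= 0 & sin (al - ta) >= 0" using assms by (auto intro!: sin_ge_zero)
qed

text \<open>\<open>cosh s\<close> is coth of the distance from the centre, and \<open>G\<close> is
  the lower bound that the side of a triangle opposite to the centre imposes on it in a given
  direction.\<close>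

lemma coth_integral:
 assumes G: "G > 1"
 shows "(\<integral>\<^sup>+ s. ennreal (1 / (sinh s)^2) * indicator {s. s < 0 & cosh s >= G} s \<partial>lborel) = ennreal (G / sqrt (G^2 - 1) - 1)"
proof -
 define s0 where "s0 = - arcosh G"
 have s0: "s0 < 0" "cosh s0 = G" using G by (auto simp: s0_def)
 have iff: "s < 0 & cosh s >= G \<longleftrightarrow> s <= s0" for s
 proof -
  have "cosh s >= G \<longleftrightarrow> - s0 <= - s" if "s < 0"
   using cosh_real_nonneg_le_iff[of "- s0" "- s"] that s0 by simp
  then show ?thesis using s0(1) by (cases "s < 0") auto
 qed
 have lim: "(cc \<longlongrightarrow> 1) at_bot" unfolding cc_def by real_asymp
 have "(\<integral>\<^sup>+ s. ennreal (1 / (sinh s)^2) * indicator {s. s < 0 & cosh s >= G} s \<partial>lborel) = (\<integral>\<^sup>+ s. ennreal ((aa s)^2) * indicator {..s0} s \<partial>lborel)"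
  by (intro nn_integral_cong) (use s0 in "auto simp: iff indicator_def aa_sq")
 also have "... = ennreal (cc s0 - 1)"
  by (rule nn_integral_FTC_atMost[OF _ _ _ lim]) (use s0 in "auto intro!: cc_deriv")
 also have "cc s0 = G / sqrt (G^2 - 1)"
 proof -
  have sh: "sinh s0 < 0" using s0 by simp
  have "(sinh s0)^2 = G^2 - 1" using cosh_square_eq[of s0] s0 by simp
  then have "sqrt (G^2 - 1) = - sinh s0" using sh by (metis abs_of_neg real_sqrt_abs)
  moreover have "cc s0 = - cosh s0 / sinh s0"
  proof -
   have e: "exp s0 > 0" by simp
   have c: "cosh s0 = (1 + (exp s0)^2) / (2 * exp s0)" "sinh s0 = - (1 - (exp s0)^2) / (2 * exp s0)"
    unfolding cosh_field_def sinh_field_def by (simp_all add: exp_minus field_simps power2_eq_square)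
   have gen: "(1 + q) / (1 - q) = (- 1 - q) / (q - 1)" if "0 < 1 - q" for q :: real using that by (simp add: divide_simps) (simp add: algebra_simps)?
   show ?thesis unfolding cc_def c using gen[OF exp_sq_less_1[OF s0(1)]] e by simp
  qed
  ultimately show ?thesis using s0 by simp
 qed
 finally show ?thesis .
qed

lemma sin_concave_chord:
 assumes "0 <= ta" "ta <= al" "al < pi"
 shows "sin al <= sin (al - ta) + sin ta"
proof -
 have p: "sin (al - ta) >= 0" "sin ta >= 0" using assms by (auto intro!: sin_ge_zero)
 have "sin al = sin ((al - ta) + ta)" by simp
 also have "... = sin (al - ta) * cos ta + cos (al - ta) * sin ta" by (rule sin_add)
 also have "... <= sin (al - ta) * 1 + 1 * sin ta" by (intro add_mono mult_left_mono mult_right_mono p) auto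
 finally show ?thesis by simp
qed

text \<open>For \<open>h = (A sin - B cos) / K\<close> one has \<open>h' = g / K\<close> and
  \<open>1 - h^2 = (g^2 - 1) / K^2\<close>, so an antiderivative is \<open>arcsin h\<close> minus
  the angle.\<close>

lemma arcsin_integral:
 fixes A B al :: real
 assumes al: "0 < al" and G: "!!ta. 0 <= ta ==> ta <= al ==> A * cos ta + B * sin ta > 1" and K: "K = sqrt (A^2 + B^2 - 1)"
 shows "(\<integral>\<^sup>+ ta. ennreal ((A * cos ta + B * sin ta) / sqrt ((A * cos ta + B * sin ta)^2 - 1) - 1) * indicator {0..al} ta \<partial>lborel)
  = ennreal ((arcsin ((A * sin al - B * cos al) / K) - al) - arcsin (- B / K))"
proof -
 define g where "g ta = A * cos ta + B * sin ta" for ta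
 define h where "h ta = (A * sin ta - B * cos ta) / K" for ta
 have gh: "(g ta)^2 + (A * sin ta - B * cos ta)^2 = A^2 + B^2" for ta
 proof -
  have "(g ta)^2 + (A * sin ta - B * cos ta)^2 = A^2 * ((sin ta)^2 + (cos ta)^2) + B^2 * ((sin ta)^2 + (cos ta)^2)"
   unfolding g_def by (simp add: power2_eq_square algebra_simps del: sin_cos_squared_add sin_cos_squared_add2 sin_cos_squared_add3)
  then show ?thesis by simp
 qed
 have g1: "g ta > 1" "(g ta)^2 > 1" if "0 <= ta" "ta <= al" for ta
  using G[OF that] by (auto simp: g_def intro: one_less_power)
 have K2: "A^2 + B^2 - 1 > 0" using gh[of 0] g1(2)[of 0] al by (smt (verit) zero_le_power2)
 then have Kp: "K > 0" "K^2 = A^2 + B^2 - 1" by (auto simp: K)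
 have h2: "1 - (h ta)^2 = ((g ta)^2 - 1) / K^2" for ta
 proof -
  have "(A * sin ta - B * cos ta)^2 = K^2 - ((g ta)^2 - 1)" using gh[of ta] Kp by simp
  then have "(h ta)^2 = (K^2 - ((g ta)^2 - 1)) / K^2" by (simp only: h_def power_divide)
  then show ?thesis using Kp(1) by (simp add: diff_divide_distrib)
 qed
 have der: "((%ta. arcsin (h ta) - ta) has_real_derivative g ta / sqrt ((g ta)^2 - 1) - 1) (at ta)" if ta: "0 <= ta" "ta <= al" for ta
 proof -
  have "1 - (h ta)^2 > 0" unfolding h2 using g1(2)[OF ta] Kp(1) by (intro divide_pos_pos) auto
  then have "(h ta)^2 < 1" by simp
  then have hb: "- 1 < h ta" "h ta < 1" by (auto simp: abs_square_less_1 abs_less_iff)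
  have dh: "(h has_real_derivative g ta / K) (at ta)"
   unfolding h_def[abs_def] g_def using Kp by (auto intro!: derivative_eq_intros)
  have "((%ta. arcsin (h ta)) has_real_derivative inverse (sqrt (1 - (h ta)^2)) * (g ta / K)) (at ta)"
   by (rule DERIV_chain2[OF DERIV_arcsin[OF hb] dh])
  moreover have "inverse (sqrt (1 - (h ta)^2)) * (g ta / K) = g ta / sqrt ((g ta)^2 - 1)"
   unfolding h2 using Kp by (simp add: real_sqrt_divide field_simps)
  ultimately have "((%ta. arcsin (h ta)) has_real_derivative g ta / sqrt ((g ta)^2 - 1)) (at ta)" by simp
  from DERIV_diff[OF this DERIV_ident] show ?thesis .
 qed
 have pos: "0 <= g ta / sqrt ((g ta)^2 - 1) - 1" if ta: "0 <= ta" "ta <= al" for ta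
 proof -
  have "sqrt ((g ta)^2 - 1) <= g ta" using g1[OF ta] by (intro real_le_lsqrt) auto
  moreover have "sqrt ((g ta)^2 - 1) > 0" using g1[OF ta] by simp
  ultimately show ?thesis by simp
 qed
 have mg[measurable]: "g : borel_measurable borel" unfolding g_def[abs_def] by measurable
 have "(\<integral>\<^sup>+ ta. ennreal (g ta / sqrt ((g ta)^2 - 1) - 1) * indicator {0..al} ta \<partial>lborel) = ennreal ((arcsin (h al) - al) - (arcsin (h 0) - 0))"
  by (rule nn_integral_FTC_Icc[of _ 0 al, OF _ der pos]) (use al in auto)
 then show ?thesis by (simp add: g_def h_def)
qed

text \<open>Identifies the two boundary values of \<open>arcsin_integral\<close> with the cosines of
  the remaining angles, up to sign; \<open>a\<close>, \<open>b\<close>, \<open>c\<close> are cosh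
  and \<open>sa\<close>, \<open>sb\<close>, \<open>sc\<close> sinh of the sides.\<close>

lemma triangle_trig:
 fixes a b c sa sb sc al :: real
 assumes s: "sa > 0" "sb > 0" "sc > 0" "sa^2 = a^2 - 1" "sb^2 = b^2 - 1" "sc^2 = c^2 - 1"
  and al: "sin al > 0" and a: "a = c * b - sc * sb * cos al"
  and A: "A = c / sc" and B: "B = (b * sc - c * sb * cos al) / (sc * sb * sin al)" and K: "K = sqrt (A^2 + B^2 - 1)"
 shows "- B / K = - ((a * c - b) / (sc * sa))" "(A * sin al - B * cos al) / K = (a * b - c) / (sa * sb)"
proof -
 define d where "d = sc * sb * sin al"
 have d: "d > 0" using s al by (simp add: d_def)
 have ca: "sc * sb * cos al = c * b - a" using a by simp
 have d2: "d^2 = sc^2 * sb^2 - (c * b - a)^2"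
 proof -
  have "d^2 = (sc * sb)^2 * (1 - (cos al)^2)" unfolding d_def power_mult_distrib sin_squared_eq ..
  also have "... = sc^2 * sb^2 - (sc * sb * cos al)^2" by (simp add: power_mult_distrib algebra_simps)
  finally show ?thesis unfolding ca .
 qed
 have Bn: "B = (a * c - b) / (sc * d)"
 proof -
  have "sc * (b * sc - c * sb * cos al) = b * sc^2 - c * (sc * sb * cos al)" by (simp add: power2_eq_square algebra_simps)
  also have "... = a * c - b" unfolding ca s(6) by (simp add: power2_eq_square algebra_simps)
  finally have "b * sc - c * sb * cos al = (a * c - b) / sc" using s by (simp add: field_simps)
  then show ?thesis unfolding B d_def[symmetric] by simp
 qed
 have AB: "A^2 + B^2 - 1 = (sa / d)^2"
 proof -
  have k: "d^2 + (a * c - b)^2 = sa^2 * sc^2" unfolding d2 s(4,5,6) by (simp add: power2_eq_square algebra_simps)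
  have "sc^2 > 0" using s(3) by simp
  then have "A^2 - 1 = 1 / sc^2" unfolding A power_divide using s(6) by (simp add: divide_simps)
  then have "A^2 + B^2 - 1 = 1 / sc^2 + (a * c - b)^2 / (sc^2 * d^2)" unfolding Bn by (simp add: power_divide power_mult_distrib)
  also have "... = (d^2 + (a * c - b)^2) / (sc^2 * d^2)" using d s(3) by (simp add: add_divide_distrib)
  also have "... = (sa / d)^2" unfolding k using d s(3) by (simp add: power_divide)
  finally show ?thesis .
 qed
 have Kd: "K = sa / d" unfolding K AB using s d by simp
 show "- B / K = - ((a * c - b) / (sc * sa))" unfolding Bn Kd using d s by simp
 have sd: "sin al = d / (sc * sb)" "cos al = (c * b - a) / (sc * sb)" using s ca by (auto simp: d_def field_simps)
 have "A * sin al - B * cos al = (c * d^2 - (a * c - b) * (c * b - a)) / (sc^2 * sb * d)"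
  unfolding A Bn sd using s(1-3) d by (simp add: divide_simps) (simp add: power2_eq_square algebra_simps)?
 also have "c * d^2 - (a * c - b) * (c * b - a) = sc^2 * (a * b - c)"
  unfolding d2 s(5,6) by (simp add: power2_eq_square algebra_simps)
 also have "sc^2 * (a * b - c) / (sc^2 * sb * d) = (a * b - c) / (sb * d)" using s(3) by simp
 finally have "A * sin al - B * cos al = (a * b - c) / (sb * d)" .
 then show "(A * sin al - B * cos al) / K = (a * b - c) / (sa * sb)" unfolding Kd using d s by simp
qed

lemma cay_polar_form:
 assumes "p : uhp" "t : uhp" "t ~= p"
 obtains r x where "0 < r" "r < 1" "cay p t = of_real r * cis x"
  "hcosh p t = (1 + r^2) / (1 - r^2)" "sqrt ((hcosh p t)^2 - 1) = 2 * r / (1 - r^2)" "2 * r / (1 - r^2) > 0"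
proof -
 define r where "r = cmod (cay p t)"
 have n0: "cay p t ~= 0" using assms cay_denom_nz[of p t] by (simp add: cay_def)
 have r: "0 < r" "r < 1" using n0 norm_cay_less_1[OF assms(1,2)] by (auto simp: r_def)
 have r2: "r^2 < 1" using r by (simp add: abs_square_less_1)
 have e: "hcosh p t = (1 + r^2) / (1 - r^2)" using hcosh_center[OF assms(1,2)] by (simp add: r_def)
 have "(hcosh p t)^2 - 1 = (2 * r / (1 - r^2))^2"
 proof -
  have gen: "((1 + q) / (1 - q))^2 - 1 = 4 * q / (1 - q)^2" if "q < 1" for q :: real
  proof -
   have "((1 + q) / (1 - q))^2 - 1 = ((1 + q)^2 - (1 - q)^2) / (1 - q)^2" using that by (simp add: power_divide diff_divide_distrib)
   also have "(1 + q)^2 - (1 - q)^2 = 4 * q" by (simp add: power2_eq_square algebra_simps)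
   finally show ?thesis .
  qed
  show ?thesis unfolding e gen[OF r2] by (simp add: power_divide power_mult_distrib)
 qed
 moreover have pos: "2 * r / (1 - r^2) > 0" using r r2 by simp
 ultimately have "sqrt ((hcosh p t)^2 - 1) = 2 * r / (1 - r^2)" by (simp only: real_sqrt_abs abs_of_pos)
 moreover have "cay p t = of_real r * cis (Arg (cay p t))" using rcis_cmod_Arg[of "cay p t"] by (simp add: rcis_def r_def)
 ultimately show ?thesis using that r e pos by blast
qed

text \<open>The triangle is swept in polar coordinates about \<open>p\<close>, first over the radius
  and then over the angle at \<open>p\<close>. The third claim, that it stays inside the sector of
  its angle at \<open>p\<close>, serves the angle sums around a vertex.\<close>

lemma triangle_area:
 assumes p: "p : uhp" and t: "t : uhp" and u: "u : uhp" and D: "hdet p t u > 0"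
 shows "emeasure hmu (Tri p t u) = ennreal (pi - ang p t u - ang t u p - ang u p t)"
  "0 <= pi - ang p t u - ang t u p - ang u p t"
  "EX x al. 0 < al & al < pi & ang p t u = al & (ALL s<0. ALL th. pol p (Complex s th) : Tri p t u --> sin (th - x) >= 0 & sin (al - (th - x)) >= 0)"
proof -
 have ne: "t ~= p" "u ~= p" "t ~= u" using D by auto
 obtain rt x where rt: "0 < rt" "rt < 1" "cay p t = of_real rt * cis x" "hcosh p t = (1 + rt^2) / (1 - rt^2)" "sqrt ((hcosh p t)^2 - 1) = 2 * rt / (1 - rt^2)" "2 * rt / (1 - rt^2) > 0"
  using cay_polar_form[OF p t ne(1)] .
 obtain ru y where ru: "0 < ru" "ru < 1" "cay p u = of_real ru * cis y" "hcosh p u = (1 + ru^2) / (1 - ru^2)" "sqrt ((hcosh p u)^2 - 1) = 2 * ru / (1 - ru^2)" "2 * ru / (1 - ru^2) > 0"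
  using cay_polar_form[OF p u ne(2)] .
 define c b a where "c = hcosh p t" and "b = hcosh p u" and "a = hcosh t u"
 define sc sb sa where "sc = 2 * rt / (1 - rt^2)" and "sb = 2 * ru / (1 - ru^2)" and "sa = sqrt (a^2 - 1)"
 have a1: "a > 1" using hcosh_gt_1[OF t u ne(3)] by (simp add: a_def)
 have s: "sa > 0" "sb > 0" "sc > 0" "sa^2 = a^2 - 1" "sb^2 = b^2 - 1" "sc^2 = c^2 - 1"
 proof -
  have "a^2 > 1" using a1 by (simp add: one_less_power)
  then show "sa > 0" "sa^2 = a^2 - 1" by (auto simp: sa_def)
  show "sb > 0" "sc > 0" using rt ru by (auto simp: sb_def sc_def)
  have "b^2 - 1 >= 0" "c^2 - 1 >= 0" using hcosh_ge_1[OF p u] hcosh_ge_1[OF p t] by (auto simp: b_def c_def one_le_power)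
  then show "sb^2 = b^2 - 1" "sc^2 = c^2 - 1" using rt(5) ru(5) by (auto simp: sb_def sc_def b_def c_def real_sqrt_pow2 simp flip: rt(5) ru(5))
 qed
 have Dsin: "hdet p t u = 2 * sc * sb * sin (y - x)" using hdet_polar[OF p t u rt(3) ru(3)] by (simp add: sc_def sb_def)
 have siny: "sin (y - x) > 0" 
 proof -
  have "2 * sc * sb > 0" using s by simp
  then show ?thesis using D unfolding Dsin by (metis zero_less_mult_pos)
 qed
 \<comment> \<open>The angle from \<open>t\<close> to \<open>u\<close> reduced to the interval from
   0 to pi, which is possible because the orientation makes its sine positive.\<close>
 define al where "al = arccos (cos (y - x))"
 have al1: "cos al = cos (y - x)" "0 <= al" "al <= pi" by (auto simp: al_def intro: arccos_lbound arccos_ubound)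
 have "(sin al)^2 = (sin (y - x))^2" unfolding sin_squared_eq al1(1) ..
 then have al2: "sin al = sin (y - x)" using sin_ge_zero[OF al1(2,3)] siny by (simp add: power2_eq_iff_nonneg)
 have al: "0 < al" "al < pi" "sin al > 0" using al1 al2 siny by (auto simp: less_le)
 have cisal: "cis (x + al) = cis y"
 proof -
  have "cis al = cis (y - x)" using al1(1) al2 by (simp add: cis.code)
  then have "cis x * cis al = cis x * cis (y - x)" by simp
  then show ?thesis unfolding cis_mult by simp
 qed
 have ru3: "cay p u = of_real ru * cis (x + al)" using ru(3) cisal by simp
 have acos: "a = c * b - sc * sb * cos al"
  using hcosh_polar[OF p t u rt(3) ru3] rt(4) ru(4) by (simp add: a_def b_def c_def sb_def sc_def)
 define A B K where "A = c / sc" and "B = (b * sc - c * sb * cos al) / (sc * sb * sin al)" and "K = sqrt (A^2 + B^2 - 1)"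
 define G where "G ta = A * cos ta + B * sin ta" for ta
 have Gsin: "G ta = (c / sc) * (sin (al - ta) / sin al) + (b / sb) * (sin ta / sin al)" for ta
 proof -
  have Beq: "B = b / (sb * sin al) - c * cos al / (sc * sin al)"
   unfolding B_def using s al by (simp add: diff_divide_distrib)
  show ?thesis unfolding G_def A_def sin_diff Beq using s(1-3) al(3) by (simp add: field_simps)
 qed
 have cs: "c / sc > 1" "b / sb > 1"
 proof -
  have "c > 1" "b > 1" using hcosh_gt_1 p t u ne by (auto simp: c_def b_def)
  moreover have "sc < c" "sb < b"
  proof -
   have "sc^2 < c^2" "sb^2 < b^2" using s by auto
   then show "sc < c" "sb < b" using \<open>c > 1\<close> \<open>b > 1\<close> by (auto intro: power2_less_imp_less)
  qed
  ultimately show "c / sc > 1" "b / sb > 1" using s by auto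
 qed
 have G1: "G ta > 1" if ta: "0 <= ta" "ta <= al" for ta
 proof -
  have p1: "sin (al - ta) / sin al >= 0" "sin ta / sin al >= 0" using ta al by (auto intro!: divide_nonneg_pos sin_ge_zero)
  have sum: "sin (al - ta) / sin al + sin ta / sin al >= 1"
   using sin_concave_chord[OF ta al(2)] al(3) by (simp add: add_divide_distrib[symmetric])
  show ?thesis
  proof (cases "sin (al - ta) / sin al = 0")
   case True
   have "sin ta / sin al >= 1" using sum unfolding True by simp
   then have "(b / sb) * (sin ta / sin al) >= (b / sb) * 1" using cs by (intro mult_left_mono) auto
   then show ?thesis unfolding Gsin True using cs by simp
  next
   case False
   then have "(c / sc) * (sin (al - ta) / sin al) > 1 * (sin (al - ta) / sin al)" using cs p1 by (intro mult_strict_right_mono) (auto simp: less_le)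
   moreover have "(b / sb) * (sin ta / sin al) >= 1 * (sin ta / sin al)" using cs p1 by (intro mult_right_mono) auto
   ultimately show ?thesis unfolding Gsin using sum by linarith
  qed
 qed
 have pz: "cay p (pol p (Complex s th)) = of_real (exp s) * cis th" "pol p (Complex s th) : uhp" if "s < 0" for s th
 proof -
  have "cay p (pol p (Complex s th)) = exp (Complex s th)" unfolding pol_def by (rule cay_icay[OF p]) (use that in simp)
  then show "cay p (pol p (Complex s th)) = of_real (exp s) * cis th" by (simp add: exp_eq_polar)
  show "pol p (Complex s th) : uhp" by (rule pol_in_uhp[OF p]) (use that in simp)
 qed
 \<comment> \<open>Two half-planes cut out the sector; by Cramer's rule the third one is
   \<open>cosh s >= G\<close>, the polar equation of the opposite side.\<close>
 have inT: "pol p (Complex s th) : Tri p t u \<longleftrightarrow> sin (th - x) >= 0 & sin (al - (th - x)) >= 0 & cosh s >= G (th - x)" if s0: "s < 0" for s th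
 proof -
  define z where "z = pol p (Complex s th)"
  define e where "e = exp s"
  have z: "cay p z = of_real e * cis th" "z : uhp" using pz[OF s0] by (auto simp: z_def e_def)
  have e: "0 < e" "1 - e^2 > 0" using exp_sq_less_1[OF s0] by (auto simp: e_def)
  define sr cr where "sr = 2 * e / (1 - e^2)" and "cr = (1 + e^2) / (1 - e^2)"
  have sr: "sr > 0" using e by (simp add: sr_def)
  have crs: "cr = cosh s * sr"
  proof -
   have "cosh s = (1 + e^2) / (2 * e)" unfolding cosh_field_def e_def by (simp add: exp_minus field_simps power2_eq_square)
   then show ?thesis using e by (simp add: cr_def sr_def)
  qed
  have Epz: "hcosh p z = cr" using hcosh_center[OF p z(2)] z(1) e by (simp add: cr_def norm_mult)
  have h1: "hdet p t z = 2 * sc * sr * sin (th - x)" using hdet_polar[OF p t z(2) rt(3) z(1)] by (simp add: sc_def sr_def)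
  have h2: "hdet p z u = 2 * sr * sb * sin (al - (th - x))" using hdet_polar[OF p z(2) u z(1) ru3] by (simp add: sb_def sr_def algebra_simps)
  have h0: "hdet p t u = 2 * sc * sb * sin al" using Dsin al2 by simp
  have "cr * hdet p t u = hdet z t u + hdet p z u * c + hdet p t z * b"
   using cramer[OF p t u p z(2)] Epz by (simp add: c_def b_def)
  then have h3: "hdet t u z = 2 * sr * (cosh s * (sc * sb * sin al) - (c * sb * sin (al - (th - x)) + b * sc * sin (th - x)))"
   unfolding h0 h1 h2 crs hdet_cycle[of z t u, symmetric] by (simp add: algebra_simps)
  have "c * sb * sin (al - (th - x)) + b * sc * sin (th - x) = G (th - x) * (sc * sb * sin al)"
   unfolding Gsin using s al(3) by (simp add: field_simps)
  then have h3': "hdet t u z = 2 * sr * (sc * sb * sin al) * (cosh s - G (th - x))"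
   unfolding h3 by (simp add: algebra_simps)
  have pm: "0 <= k * v \<longleftrightarrow> 0 <= v" if "k > 0" for k v :: real using that by (simp add: zero_le_mult_iff)
  have "hdet t u z >= 0 \<longleftrightarrow> cosh s >= G (th - x)" unfolding h3' by (subst pm) (use sr s al(3) in auto)
  moreover have "hdet p t z >= 0 \<longleftrightarrow> sin (th - x) >= 0" unfolding h1 by (subst pm) (use sr s al(3) in auto)
  moreover have "hdet u p z >= 0 \<longleftrightarrow> sin (al - (th - x)) >= 0" unfolding hdet_cycle[of u p z] h2 by (subst pm) (use sr s al(3) in auto)
  ultimately show ?thesis using z(2) unfolding Tri_def z_def[symmetric] by blast
 qed
 have sq: "sqrt (c^2 - 1) = sc" "sqrt (b^2 - 1) = sb" using rt(5) ru(5) by (auto simp: c_def b_def sc_def sb_def)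
 have angA: "ang p t u = al"
 proof -
  have "(c * b - a) / (sc * sb) = cos al" using acos s by simp
  then show ?thesis unfolding ang_def c_def[symmetric] b_def[symmetric] a_def[symmetric] sq
   using al by (simp add: arccos_cos)
 qed
 have angB: "ang t u p = arccos ((a * c - b) / (sc * sa))"
  unfolding ang_def hcosh_sym[of t p] hcosh_sym[of u p] a_def[symmetric] b_def[symmetric] c_def[symmetric] sa_def[symmetric] sq
  by (simp add: mult.commute)
 have angC: "ang u p t = arccos ((a * b - c) / (sa * sb))"
  unfolding ang_def hcosh_sym[of u p] hcosh_sym[of u t] a_def[symmetric] b_def[symmetric] c_def[symmetric] sa_def[symmetric] sq
  by (simp add: mult.commute)
 note trig = triangle_trig[OF s al(3) acos A_def B_def K_def]
 have Gint: "(\<integral>\<^sup>+ ta. ennreal (G ta / sqrt ((G ta)^2 - 1) - 1) * indicator {0..al} ta \<partial>lborel)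
  = ennreal ((arcsin ((A * sin al - B * cos al) / K) - al) - arcsin (- B / K))"
  unfolding G_def by (rule arcsin_integral[OF al(1) _ K_def]) (use G1 in "auto simp: G_def")
 have GK: "A^2 + B^2 - 1 > 0 & (A * sin ta - B * cos ta)\<^sup>2 <= A^2 + B^2 - 1" if ta: "0 <= ta" "ta <= al" for ta
 proof -
  have "(G ta)^2 + (A * sin ta - B * cos ta)^2 = A^2 * ((sin ta)^2 + (cos ta)^2) + B^2 * ((sin ta)^2 + (cos ta)^2)"
   unfolding G_def by (simp add: power2_eq_square algebra_simps del: sin_cos_squared_add sin_cos_squared_add2 sin_cos_squared_add3)
  then have "(G ta)^2 + (A * sin ta - B * cos ta)^2 = A^2 + B^2" by simp
  moreover have "(G ta)^2 > 1" using G1[OF ta] by (simp add: one_less_power)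
  ultimately show ?thesis by (smt (verit) zero_le_power2)
 qed
 have bd: "\<bar>(A * sin ta - B * cos ta) / K\<bar> <= 1" if ta: "0 <= ta" "ta <= al" for ta
 proof -
  have K0: "K > 0" using GK[OF ta] by (simp add: K_def)
  have "\<bar>A * sin ta - B * cos ta\<bar> <= K" unfolding K_def using GK[OF ta] by (metis real_sqrt_abs real_sqrt_le_iff)
  then show ?thesis using K0 by (simp add: abs_divide)
 qed
 have bC: "\<bar>(a * b - c) / (sa * sb)\<bar> <= 1" using bd[of al] trig(2) al by simp
 have bB: "\<bar>(a * c - b) / (sc * sa)\<bar> <= 1"
 proof -
  have "\<bar>- B / K\<bar> <= 1" using bd[of 0] al(1) by simp
  then show ?thesis unfolding trig(1) abs_minus_cancel .
 qed
 have asin: "arcsin v = pi / 2 - arccos v" if "\<bar>v\<bar> <= 1" for v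
  using that by (simp add: arcsin_arccos_eq abs_le_iff)
 have val: "(arcsin ((A * sin al - B * cos al) / K) - al) - arcsin (- B / K) = pi - ang p t u - ang t u p - ang u p t"
 proof -
  have "arcsin (- B / K) = - arcsin ((a * c - b) / (sc * sa))" unfolding trig(1) by (rule arcsin_minus) (use bB in \<open>simp_all only: abs_le_iff\<close>, linarith)
  then show ?thesis unfolding trig(2) angA angB angC using asin[OF bC] asin[OF bB] by simp
 qed
 \<comment> \<open>\<open>ennreal\<close> truncates negative numbers to 0, so the sign needs an
   argument: a vanishing integral would contradict the positive integrand.\<close>
 have mono: "0 <= (arcsin ((A * sin al - B * cos al) / K) - al) - arcsin (- B / K)"
 proof (rule ccontr)
  assume neg: "~ ?thesis"
  then have "(\<integral>\<^sup>+ ta. ennreal (G ta / sqrt ((G ta)^2 - 1) - 1) * indicator {0..al} ta \<partial>lborel) = 0" using Gint by (simp add: ennreal_neg)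
  moreover have mG[measurable]: "G : borel_measurable borel" unfolding G_def[abs_def] by measurable
  ultimately have "AE ta in lborel. ennreal (G ta / sqrt ((G ta)^2 - 1) - 1) * indicator {0..al} ta = 0"
   by (subst (asm) nn_integral_0_iff_AE) auto
  moreover have "ennreal (G ta / sqrt ((G ta)^2 - 1) - 1) * indicator {0..al} ta ~= 0" if "ta : {0<..<al}" for ta
  proof -
   have g: "G ta > 1" "(G ta)^2 > 1" using G1[of ta] that by (auto simp: one_less_power)
   have "sqrt ((G ta)^2 - 1) < sqrt ((G ta)^2)" by (rule real_sqrt_less_mono) simp
   then have "sqrt ((G ta)^2 - 1) < G ta" using g by simp
   moreover have "sqrt ((G ta)^2 - 1) > 0" using g by simp
   ultimately have "G ta / sqrt ((G ta)^2 - 1) - 1 > 0" by simp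
   then show ?thesis using that by (simp add: indicator_def ennreal_eq_0_iff)
  qed
  ultimately have "AE ta in lborel. ta ~: {0<..<al}" by (elim eventually_mono) blast
  then have "emeasure lborel {0<..<al} = 0" using AE_iff_null_sets[of "{0<..<al}" lborel] by (auto dest: null_setsD1)
  then show False using al by simp
 qed
 then show "0 <= pi - ang p t u - ang t u p - ang u p t" unfolding val .
 show "EX x al. 0 < al & al < pi & ang p t u = al & (ALL s<0. ALL th. pol p (Complex s th) : Tri p t u --> sin (th - x) >= 0 & sin (al - (th - x)) >= 0)"
  using inT angA al by blast
 have mT[measurable]: "Tri p t u : sets borel"
  unfolding Tri_def hdet_def by measurable
 have mG[measurable]: "G : borel_measurable borel" unfolding G_def[abs_def] by measurable
 define W where "W s ta = (indicator {0..al} ta * indicator {s. s < 0 & cosh s >= G ta} s :: ennreal)" for s ta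
 have mW: "(%(s, ta). ennreal (1 / (sinh s)^2) * W s ta) : borel_measurable (lborel \<Otimes>\<^sub>M lborel)"
  unfolding W_def indicator_def sinh_field_def cosh_field_def by measurable
 have "emeasure hmu (Tri p t u) = (\<integral>\<^sup>+ z. indicator (Tri p t u) z \<partial>hmu)" using mT by simp
 also have "... = (\<integral>\<^sup>+ s. \<integral>\<^sup>+ th. ennreal (1 / (sinh s)^2) * indicator (Tri p t u) (pol p (Complex s th)) * indicator {x..<x+2*pi} th \<partial>lborel * indicator {..<0} s \<partial>lborel)"
  by (rule hmu_polar[OF p]) measurable
 also have "... = (\<integral>\<^sup>+ s. \<integral>\<^sup>+ ta. ennreal (1 / (sinh s)^2) * W s ta \<partial>lborel \<partial>lborel)"
 proof (rule nn_integral_cong)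
  fix s :: real
  show "(\<integral>\<^sup>+ th. ennreal (1 / (sinh s)^2) * indicator (Tri p t u) (pol p (Complex s th)) * indicator {x..<x+2*pi} th \<partial>lborel) * indicator {..<0} s
    = (\<integral>\<^sup>+ ta. ennreal (1 / (sinh s)^2) * W s ta \<partial>lborel)"
  proof (cases "s < 0")
   case True
   have "(\<integral>\<^sup>+ th. ennreal (1 / (sinh s)^2) * indicator (Tri p t u) (pol p (Complex s th)) * indicator {x..<x+2*pi} th \<partial>lborel)
     = (\<integral>\<^sup>+ th. ennreal (1 / (sinh s)^2) * W s (th - x) \<partial>lborel)"
   proof (rule nn_integral_cong)
    fix th :: real
    show "ennreal (1 / (sinh s)^2) * indicator (Tri p t u) (pol p (Complex s th)) * indicator {x..<x+2*pi} th = ennreal (1 / (sinh s)^2) * W s (th - x)"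
    proof (cases "0 <= th - x & th - x < 2 * pi")
     case w: True
     show ?thesis using inT[OF True, of th] sin_ge_0_window[OF al(1,2), of "th - x"] w True by (auto simp: W_def indicator_def)
    next
     case False
     then show ?thesis using al by (auto simp: W_def indicator_def)
    qed
   qed
   also have "... = (\<integral>\<^sup>+ ta. ennreal (1 / (sinh s)^2) * W s ta \<partial>lborel)"
   proof -
    have mWs: "(%ta. ennreal (1 / (sinh s)^2) * W s ta) : borel_measurable borel"
     unfolding W_def indicator_def by measurable
    show ?thesis using nn_integral_real_affine[OF mWs, of 1 "- x"] by simp
   qed
   finally show ?thesis using True by simp
  qed (simp add: W_def)
 qed
 also have "... = (\<integral>\<^sup>+ ta. \<integral>\<^sup>+ s. ennreal (1 / (sinh s)^2) * W s ta \<partial>lborel \<partial>lborel)"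
  by (rule lborel_pair.Fubini'[symmetric, OF mW])
 also have "... = (\<integral>\<^sup>+ ta. ennreal (G ta / sqrt ((G ta)^2 - 1) - 1) * indicator {0..al} ta \<partial>lborel)"
 proof (rule nn_integral_cong)
  fix ta :: real
  show "(\<integral>\<^sup>+ s. ennreal (1 / (sinh s)^2) * W s ta \<partial>lborel) = ennreal (G ta / sqrt ((G ta)^2 - 1) - 1) * indicator {0..al} ta"
  proof (cases "ta : {0..al}")
   case True
   then show ?thesis using coth_integral[OF G1[of ta]] by (simp add: W_def)
  qed (simp add: W_def)
 qed
 also have "... = ennreal (pi - ang p t u - ang t u p - ang u p t)" unfolding Gint val ..
 finally show "emeasure hmu (Tri p t u) = ennreal (pi - ang p t u - ang t u p - ang u p t)" .
qed

section \<open>The Delaunay triangulation and the area of the quotient\<close>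

text \<open>The normalised sum of two points of the hyperboloid is their midpoint.\<close>

lemma midpoint_center:
 assumes "s : uhp" "t : uhp"
 shows "EX c:uhp. EX k>0. ALL z:uhp. hcosh c z * k = hcosh s z + hcosh t z"
proof -
 define al be ga where "al = (cmod s)^2 / Im s + (cmod t)^2 / Im t" and "be = Re s / Im s + Re t / Im t" and "ga = 1 / Im s + 1 / Im t"
 have p: "Im s > 0" "Im t > 0" using assms by (auto simp: uhp_iff)
 have "((x^2 + a^2) / a + (y^2 + b^2) / b) * (1 / a + 1 / b) - (x / a + y / b)^2 = 2 + ((x - y)^2 + a^2 + b^2) / (a * b)" if "a > 0" "b > 0" for x y a b :: real
  using that by (simp add: divide_simps) (simp add: power2_eq_square algebra_simps)
 from this[OF p] have "al * ga - be\<^sup>2 = 2 + ((Re s - Re t)^2 + (Im s)^2 + (Im t)^2) / (Im s * Im t)"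
  by (simp add: al_def be_def ga_def cmod_power2)
 moreover have "((Re s - Re t)^2 + (Im s)^2 + (Im t)^2) / (Im s * Im t) >= 0" using p by simp
 ultimately have q: "al * ga - be\<^sup>2 > 0" by linarith
 have "ga > 0" using p by (simp add: ga_def add_pos_pos)
 from timelike_center[OF refl q this] obtain c where c: "c : uhp"
  "!!z. z : uhp ==> hcosh c z * sqrt (al * ga - be\<^sup>2) = (al - 2 * be * Re z + ga * (cmod z)^2) / (2 * Im z)" by blast
 have "(al - 2 * be * Re z + ga * (cmod z)^2) / (2 * Im z) = hcosh s z + hcosh t z" if "z : uhp" for z
 proof -
  have gen: "(A / a + B / b - 2 * (x / a + y / b) * X + (1 / a + 1 / b) * Z) / (2 * c) = (A + Z - 2 * x * X) / (2 * a * c) + (B + Z - 2 * y * X) / (2 * b * c)"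
   if "a > 0" "b > 0" "c > 0" for A B x y X Z a b c :: real using that by (simp add: field_simps)
  show ?thesis unfolding hcosh_normsq[OF assms(1) that] hcosh_normsq[OF assms(2) that] al_def be_def ga_def
   using gen[OF p, of "Im z"] that by (simp add: uhp_iff)
 qed
 then show ?thesis using c q by (intro bexI[of _ c] exI[of _ "sqrt (al * ga - be\<^sup>2)"]) auto
qed

text \<open>Reduce \<open>x\<close> modulo \<open>2 * pi\<close>; an arc of length \<open>al\<close>
  that wraps around splits into at most two intervals of the same total length.\<close>

lemma arc_measure:
 assumes al: "0 < al" "al < pi"
 shows "emeasure lborel {th:{0..<2*pi}. sin (th - x) >= 0 & sin (al - (th - x)) >= 0} <= ennreal al"
proof -
 define k where "k = \<lfloor>x / (2 * pi)\<rfloor>"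
 define y where "y = x - of_int k * (2 * pi)"
 have "of_int k <= x / (2 * pi)" "x / (2 * pi) < of_int k + 1" by (auto simp: k_def)
 then have y: "0 <= y" "y < 2 * pi" by (simp_all add: y_def field_simps)
 have per: "sin (v + of_int n * (2 * pi)) = sin v" for v :: real and n using sin.plus_of_int[of v n] by simp
 have sub: "{th:{0..<2*pi}. sin (th - x) >= 0 & sin (al - (th - x)) >= 0} \<subseteq> {y..min (y + al) (2 * pi)} \<union> {0..y - 2 * pi + al}"
 proof
  fix th assume h: "th : {th:{0..<2*pi}. sin (th - x) >= 0 & sin (al - (th - x)) >= 0}"
  define j :: int where "j = (if th >= y then 0 else 1)"
  define ta where "ta = th - y + of_int j * (2 * pi)"
  have t: "0 <= ta" "ta < 2 * pi" using h y by (auto simp: ta_def j_def)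
  have "sin ta = sin (th - x)" using per[of "th - x" "k + j"] by (simp add: ta_def y_def algebra_simps)
  moreover have "sin (al - ta) = sin (al - (th - x))" using per[of "al - (th - x)" "- (k + j)"] by (simp add: ta_def y_def algebra_simps)
  ultimately have "ta <= al" using sin_ge_0_window[OF al t] h by simp
  then show "th : {y..min (y + al) (2 * pi)} \<union> {0..y - 2 * pi + al}" using h by (auto simp: ta_def j_def split: if_splits)
 qed
 have "emeasure lborel {th:{0..<2*pi}. sin (th - x) >= 0 & sin (al - (th - x)) >= 0} <= emeasure lborel ({y..min (y + al) (2 * pi)} \<union> {0..y - 2 * pi + al})"
  by (rule emeasure_mono[OF sub]) simp
 also have "... <= emeasure lborel {y..min (y + al) (2 * pi)} + emeasure lborel {0..y - 2 * pi + al}"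
  by (rule emeasure_subadditive) auto
 also have "... = ennreal (min (y + al) (2 * pi) - y) + ennreal (y - 2 * pi + al)"
  using y al by (simp add: emeasure_lborel_Icc_eq ennreal_neg)
 also have "... <= ennreal al"
 proof (cases "y + al <= 2 * pi")
  case True then show ?thesis by (simp add: ennreal_neg)
 next
  case False then show ?thesis using y by (simp flip: ennreal_plus)
 qed
 finally show ?thesis .
qed

lemma pol_tendsto: assumes "p : uhp" shows "(%n. pol p (Complex (- real n - 1) th)) \<longlonglongrightarrow> p"
proof -
 have "(%n. exp (- real n - 1)) \<longlonglongrightarrow> 0" by real_asymp
 then have "(%n. of_real (exp (- real n - 1)) * cis th) \<longlonglongrightarrow> of_real 0 * cis th" by (rule tendsto_mult[OF tendsto_of_real tendsto_const])
 then have e: "(%n. exp (Complex (- real n - 1) th)) \<longlonglongrightarrow> 0" by (simp add: exp_eq_polar)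
 have "(%n. (p - cnj p * exp (Complex (- real n - 1) th)) / (1 - exp (Complex (- real n - 1) th))) \<longlonglongrightarrow> (p - cnj p * 0) / (1 - 0)"
  by (intro tendsto_intros e) auto
 then show ?thesis by (simp add: pol_def icay_def)
qed

lemma tendsto_hdet:
 assumes "(z \<longlongrightarrow> p) F" "p : uhp" shows "((%n. hdet s t (z n)) \<longlongrightarrow> hdet s t p) F"
proof (cases "Im s * Im t = 0")
 case True then show ?thesis by (auto simp: hdet_def)
next
 case False
 then show ?thesis unfolding hdet_def using assms by (intro tendsto_intros) (auto simp: uhp_iff)
qed

lemma ang_isom:
 assumes "f : hyp_isom" "p : uhp" "t : uhp" "u : uhp" shows "ang (f p) (f t) (f u) = ang p t u"
 using assms by (simp add: ang_def hcosh_isom)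

context net
begin

text \<open>Let \<open>t\<close> be a site closest to \<open>s\<close> among the others. Then
  \<open>cosh d(s,r) + cosh d(t,r) >= 1 + cosh d(s,t)\<close> for every site \<open>r\<close>, which
  says that the midpoint lies in the Voronoi cells of both.\<close>

lemma adj_exists: "EX s t. adj s t"
proof -
 obtain s where s: "s : SS" using near_exists[of \<i>] by (auto simp: near_def uhp_iff)
 obtain g where g: "g : \<Gamma>" "g ~= id" using nontrivial by blast
 have su: "s : uhp" using SS_uhp[OF s] .
 define A where "A = {t:SS. t ~= s & hcosh s t <= hcosh s (g s)}"
 have "finite A" by (rule finite_subset[OF _ SS_locally_finite[of "{s}" "hcosh s (g s)"]]) (auto simp: A_def su)
 moreover have "g s : A" using g s SS_inv fix_id[OF g(1) su] by (auto simp: A_def)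
 ultimately obtain t where t: "t : A" "!!r. r : A ==> hcosh s t <= hcosh s r"
  by (metis arg_min_if_finite(1) arg_min_least empty_iff)
 have tS: "t : SS" "t ~= s" "t : uhp" using t SS_uhp by (auto simp: A_def)
 have min: "hcosh s t <= hcosh s r" if "r : SS" "r ~= s" for r
  using t that by (cases "r : A") (auto simp: A_def)
 obtain c k where c: "c : uhp" "k > 0" "!!z. z : uhp ==> hcosh c z * k = hcosh s z + hcosh t z"
  using midpoint_center[OF su tS(3)] by blast
 have lower: "1 + hcosh s t <= hcosh s r + hcosh t r" if "r : SS" for r
 proof (cases "r = s")
  case True then show ?thesis using hcosh_sym[of s t] by simp
 next
  case False then show ?thesis using min[OF that False] hcosh_ge_1[OF tS(3) SS_uhp[OF that]] by simp
 qed
 have "near c r" if "r = s \<or> r = t" for r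
  unfolding near_def
 proof (intro conjI ballI)
  show "r : SS" using that s tS by auto
  fix v assume v: "v : SS"
  have "hcosh c r * k = 1 + hcosh s t" using that c(3)[OF su] c(3)[OF tS(3)] hcosh_sym[of s t] by auto
  also have "... <= hcosh c v * k" using lower[OF v] c(3)[OF SS_uhp[OF v]] by simp
  finally show "hcosh c r <= hcosh c v" using c(2) by simp
 qed
 then have "adj s t" using c(1) tS(2) unfolding adj_def Spx_def by auto
 then show ?thesis by blast
qed

text \<open>The sum of the coefficients in Cramer's rule. Divided by \<open>hdet s t u\<close> it is
  \<open>hcosh c z / hcosh c s\<close> with \<open>c\<close> the circumcentre.\<close>

definition wt :: "complex => complex => complex => complex => real" where
 "wt z s t u = hdet z t u + hdet s z u + hdet s t z"

lemma tri_center: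
 assumes "tri s t u"
 obtains c where "c : uhp" "near c s" "near c t" "near c u" "!!z. z : uhp ==> hcosh c z * hdet s t u = hcosh c s * wt z s t u"
proof -
 obtain c where c: "c : uhp" "near c s" "near c t" "near c u" using assms unfolding tri_def Spx_def by auto
 have uh: "s : uhp" "t : uhp" "u : uhp" using tri_SS[OF assms] SS_uhp by auto
 have "hcosh c z * hdet s t u = hcosh c s * wt z s t u" if "z : uhp" for z
  using cramer[OF uh c(1) that] near_eq[OF c(3,2)] near_eq[OF c(4,2)] by (simp add: wt_def algebra_simps)
 then show ?thesis using that c by blast
qed

text \<open>A simplex pivot: crossing an edge that separates the triangle from \<open>z\<close> strictly lowers
  the height of the lower hull over \<open>z\<close>, so a minimising triangle contains \<open>z\<close>.\<close>
lemma pivot: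
 assumes T: "tri s t u" and z: "z : uhp" and neg: "hdet t u z < 0"
 shows "EX v. tri u t v & wt z u t v / hdet u t v < wt z s t u / hdet s t u"
proof -
 obtain v where v: "tri u t v" using left_triangle_exists[OF adj_sym[OF tri_adj[OF tri_cycle[OF T]]]] by blast
 have uh: "s : uhp" "t : uhp" "u : uhp" using tri_SS[OF T] SS_uhp by auto
 obtain c where c: "c : uhp" "near c u" "near c t" "near c v" and cz: "!!z. z : uhp ==> hcosh c z * hdet u t v = hcosh c u * wt z u t v"
  using tri_center[OF v] by blast
 have D: "hdet s t u > 0" "hdet u t v > 0" using T v by (auto simp: tri_def)
 define k where "k = hcosh c u"
 have k: "k > 0" using hcosh_ge_1[OF c(1) uh(3)] by (simp add: k_def)
 have gt: "hcosh c s > k"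
 proof (rule ccontr)
  assume "~ ?thesis"
  then have "near c s" using c(2) tri_SS[OF T] unfolding near_def k_def by (meson le_less_linear order_trans)
  then have "s : {u, t, v}" using near_four[OF c(1,2,3,4)] tri_distinct[OF v] by blast
  then have "hdet u t s > 0" using tri_distinct[OF T] D by auto
  then show False using D hdet_swap[of s u t] hdet_cycle[of s u t] by simp
 qed
 have "hcosh c z * hdet s t u = hdet z t u * hcosh c s + k * (hdet s z u + hdet s t z)"
  using cramer[OF uh c(1) z] near_eq[OF c(3,2)] by (simp add: k_def algebra_simps)
 also have "... = hdet z t u * (hcosh c s - k) + k * wt z s t u" by (simp add: wt_def algebra_simps)
 also have "... < k * wt z s t u" using gt neg hdet_cycle[of z t u] by (simp add: mult_neg_pos)
 finally have "hcosh c z / k < wt z s t u / hdet s t u" using D k by (simp add: field_simps)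
 moreover have "hcosh c z / k = wt z u t v / hdet u t v" using cz[OF z] D k by (simp add: k_def field_simps)
 ultimately show ?thesis using v by auto
qed

text \<open>A minimiser for \<open>pivot\<close> exists because a bound on the height bounds the
  distance from \<open>z\<close> to the circumcentre and so leaves finitely many triangles.\<close>

lemma covering:
 assumes z: "z : uhp" shows "EX s t u. tri s t u & z : Tri s t u"
proof -
 obtain s0 t0 u0 where T0: "tri s0 t0 u0" using adj_exists left_triangle_exists by blast
 define rh where "rh s t u = wt z s t u / hdet s t u" for s t u
 define R where "R = arcosh (max 1 (cosh eps * rh s0 t0 u0))"
 have R: "R >= 0" "cosh R >= cosh eps * rh s0 t0 u0" by (auto simp: R_def)
 define A where "A = {s:SS. EX z':{z}. hcosh z' s <= cosh (R + eps)}"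
 have finA: "finite A" unfolding A_def by (rule SS_locally_finite) (use z in auto)
 have inA: "s : A & t : A & u : A" if T: "tri s t u" "rh s t u <= rh s0 t0 u0" for s t u
 proof -
  obtain c where c: "c : uhp" "near c s" "near c t" "near c u" and cz: "!!z. z : uhp ==> hcosh c z * hdet s t u = hcosh c s * wt z s t u"
   using tri_center[OF T(1)] by blast
  have D: "hdet s t u > 0" using T by (simp add: tri_def)
  have cr: "hcosh c z = hcosh c s * rh s t u" using cz[OF z] D by (simp add: rh_def field_simps)
  have k1: "hcosh c s >= 1" using hcosh_ge_1 c SS_uhp by (simp add: near_def)
  have "rh s t u > 0" using cr k1 hcosh_ge_1[OF c(1) z] by (metis less_le_trans not_less zero_less_one zero_less_mult_pos)
  then have "hcosh c z <= cosh eps * rh s0 t0 u0" unfolding cr using near_less(1)[OF c(1,2)] T(2) k1 by (intro mult_mono) auto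
  then have "hyp_dist z c <= R" using R hyp_dist_le_iff[OF z c(1) R(1)] hcosh_sym[of z c] by simp
  moreover have "hyp_dist c v < eps" if "near c v" for v using near_less(2)[OF c(1) that] .
  ultimately have "hyp_dist z v <= R + eps" if "near c v" for v
   using hyp_triangle[OF z c(1), of v] that SS_uhp[of v] by (smt (verit) near_def)
  then have "hcosh z v <= cosh (R + eps)" if "near c v" for v
   using that hyp_dist_le_iff[OF z, of v "R + eps"] SS_uhp[of v] R(1) eps_pos by (auto simp: near_def)
  then show ?thesis using c by (auto simp: A_def near_def)
 qed
 define T where "T = {(s, t, u). tri s t u & rh s t u <= rh s0 t0 u0}"
 have "T \<subseteq> A \<times> A \<times> A" using inA by (auto simp: T_def)
 then have "finite T" using finA by (meson finite_SigmaI finite_subset)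
 moreover have "T ~= {}" using T0 by (auto simp: T_def)
 ultimately obtain x where x: "x : T" "!!y. y : T ==> (%(s, t, u). rh s t u) x <= (%(s, t, u). rh s t u) y"
  by (metis arg_min_if_finite(1) arg_min_least)
 obtain s t u where xe: "x = (s, t, u)" by (metis prod_cases3)
 have stu: "tri s t u" "rh s t u <= rh s0 t0 u0" using x(1) by (auto simp: T_def xe)
 have min: "rh s t u <= rh a b c" if "tri a b c" for a b c
  using x(2)[of "(a, b, c)"] that stu by (cases "rh a b c <= rh s0 t0 u0") (auto simp: T_def xe)
 \<comment> \<open>The height does not depend on which vertex is listed first, so minimality can be
   used at all three sides.\<close>
 have cyc: "rh a b c = rh b c a" for a b c
  using hdet_cycle[of a b c] hdet_cycle[of z b c] hdet_cycle[of a z c] hdet_cycle[of z c a] hdet_cycle[of a b z] hdet_cycle[of b z a] hdet_cycle[of b c z]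
  by (simp add: rh_def wt_def)
 have nn: "hdet b c z >= 0" if "tri a b c" "rh a b c = rh s t u" for a b c
  using pivot[OF that(1) z] min that(2) unfolding rh_def by (metis leD leI)
 have "hdet t u z >= 0" using nn stu by blast
 moreover have "hdet u s z >= 0" using nn[OF tri_cycle[OF stu(1)]] cyc[of s t u] by simp
 moreover have "hdet s t z >= 0" using nn[OF tri_cycle[OF tri_cycle[OF stu(1)]]] cyc[of s t u] cyc[of t u s] by simp
 ultimately show ?thesis using z stu unfolding Tri_def by blast
qed

text \<open>Pair Cramer's rule with \<open>z\<close> itself: the coefficients are nonnegative and
  every \<open>hcosh\<close> is at least 1, so their sum is at most \<open>hdet s t u\<close>. Hence
  the triangle lies in its circumscribed disc.\<close>

lemma Tri_center_le:
 assumes T: "tri s t u" and z: "z : Tri s t u"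
 obtains c where "c : uhp" "near c s" "near c t" "near c u" "hcosh c z <= hcosh c s"
proof -
 have uh: "s : uhp" "t : uhp" "u : uhp" using tri_SS[OF T] SS_uhp by auto
 have zu: "z : uhp" using z by (simp add: Tri_def)
 obtain c where c: "c : uhp" "near c s" "near c t" "near c u" and cz: "!!z. z : uhp ==> hcosh c z * hdet s t u = hcosh c s * wt z s t u"
  using tri_center[OF T] by blast
 have D: "hdet s t u > 0" using T by (simp add: tri_def)
 have nn: "hdet z t u >= 0" "hdet s z u >= 0" "hdet s t z >= 0"
  using z hdet_cycle[of z t u] hdet_cycle[of u s z] by (auto simp: Tri_def)
 have m: "a <= a * b" if "0 <= a" "1 <= b" for a b :: real using mult_left_mono[OF that(2,1)] by simp
 have "wt z s t u <= hdet z t u * hcosh z s + hdet s z u * hcosh z t + hdet s t z * hcosh z u"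
  using hcosh_ge_1[OF zu uh(1)] hcosh_ge_1[OF zu uh(2)] hcosh_ge_1[OF zu uh(3)] nn
  unfolding wt_def by (intro add_mono m) auto
 also have "... = hdet s t u" using cramer[OF uh zu zu] by simp
 finally have "hcosh c z * hdet s t u <= hcosh c s * hdet s t u"
  unfolding cz[OF zu] using hcosh_ge_1[OF c(1) uh(1)] by (intro mult_left_mono) auto
 then have "hcosh c z <= hcosh c s" using D by simp
 then show ?thesis using that c by blast
qed

lemma SS_Tri_vertex:
 assumes "tri s t u" "p : Tri s t u" "p : SS" shows "p : {s, t, u}"
proof -
 obtain c where c: "c : uhp" "near c s" "near c t" "near c u" "hcosh c p <= hcosh c s" using Tri_center_le[OF assms(1,2)] .
 then have "near c p" using assms(3) unfolding near_def by (meson order_trans)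
 then show ?thesis using near_four[OF c(1-4)] tri_distinct[OF assms(1)] by blast
qed

lemma Tri_hcosh:
 assumes T: "tri s t u" "z : Tri s t u" and v: "v : {s, t, u}" shows "hcosh z v <= cosh (2 * eps)"
proof -
 obtain c where c: "c : uhp" "near c s" "near c t" "near c u" "hcosh c z <= hcosh c s" using Tri_center_le[OF T] .
 have z: "z : uhp" using T by (simp add: Tri_def)
 have vn: "near c v" and vu: "v : uhp" using v c SS_uhp by (auto simp: near_def)
 have "hcosh c z < cosh eps" using c(5) near_less(1)[OF c(1,2)] by simp
 then have "hyp_dist c z < eps" using hyp_dist_less_iff[OF c(1) z] eps_pos by simp
 then have "hyp_dist z v <= 2 * eps" using hyp_triangle[OF z c(1) vu] near_less(2)[OF c(1) vn] hyp_dist_sym[of c z] by simp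
 then show ?thesis using hyp_dist_le_iff[OF z vu] eps_pos by simp
qed

section \<open>Vertices, edges and triangles modulo the group\<close>

definition red :: "complex => complex => complex" where "red s = (SOME g. g : \<Gamma> & g s : P)"
definition Lp :: "complex => (complex \<times> complex) set" where "Lp p = {(t, u). tri p t u}"
text \<open>Triangles of M with a marked vertex, each represented by the translate whose marked
  vertex is in \<open>P\<close>; \<open>LE\<close> does the same for directed edges. A triangle of M
  thus counts three times and an edge twice.\<close>

definition LT :: "(complex \<times> complex \<times> complex) set" where "LT = Sigma P Lp"
definition LE :: "(complex \<times> complex) set" where "LE = (SIGMA p:P. {t. adj p t})"
text \<open>Marks the next vertex and translates it back into \<open>P\<close>.\<close>

definition rot :: "complex \<times> complex \<times> complex => complex \<times> complex \<times> complex" where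
 "rot = (%(p, t, u). (red t t, red t u, red t p))"
definition rev :: "complex \<times> complex => complex \<times> complex" where
 "rev = (%(p, t). (red t t, red t p))"

lemma red: assumes "s : SS" shows "red s : \<Gamma>" "red s s : P"
proof -
 obtain g p where g: "g : \<Gamma>" "p : P" "s = g p" using assms by (auto simp: orb_def)
 then have "ivt g : \<Gamma> & ivt g s : P" using ivt_props[OF g(1)] P_uhp by auto
 then have "EX g. g : \<Gamma> & g s : P" by blast
 from someI_ex[OF this, folded red_def] show "red s : \<Gamma>" "red s s : P" by auto
qed

lemma P_id: "p : P ==> g : \<Gamma> ==> g p : P ==> g = id"
 using ineqP fix_id[of g p] P_uhp unfolding ineq_def by (metis subsetD)

lemma adj_SS: "adj s t ==> s : SS & t : SS"
 using Spx_SS[of "{s,t}"] by (auto simp: adj_def)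

lemma adj_not_equiv: assumes "adj s t" "g : \<Gamma>" shows "t ~= g s"
proof
 assume e: "t = g s"
 have "hyp_dist s t < 2 * eps" using assms by (intro Spx_close[of "{s,t}"]) (auto simp: adj_def)
 then have "g = id" using short_translate[of s g] e assms adj_SS SS_uhp systole_pos by (simp add: eps_def)
 then show False using e assms by (auto simp: adj_def)
qed

lemma LE_I: "(p, t) : LE \<longleftrightarrow> p : P & adj p t" by (auto simp: LE_def)
lemma LT_I: "(p, t, u) : LT \<longleftrightarrow> p : P & tri p t u" by (auto simp: LT_def Lp_def)

lemma finite_LE: "finite LE"
proof -
 have "LE \<subseteq> P \<times> {s:SS. EX z:P. hcosh z s <= cosh (2 * eps)}"
 proof
  fix e assume "e : LE"
  then obtain p t where e: "e = (p, t)" "p : P" "adj p t" by (cases e) (auto simp: LE_I)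
  have "hyp_dist p t < 2 * eps" using e by (intro Spx_close[of "{p,t}"]) (auto simp: adj_def)
  then have "hcosh p t <= cosh (2 * eps)" using hyp_dist_less_iff[of p t "2 * eps"] eps_pos adj_SS[OF e(3)] SS_uhp by simp
  then show "e : P \<times> {s:SS. EX z:P. hcosh z s <= cosh (2 * eps)}" using e adj_SS by auto
 qed
 moreover have "finite {s:SS. EX z:P. hcosh z s <= cosh (2 * eps)}" by (rule SS_locally_finite) (use finP P_uhp finite_imp_compact in auto)
 ultimately show ?thesis using finP by (meson finite_SigmaI finite_subset)
qed

text \<open>Every directed edge has exactly one triangle on its left.\<close>

lemma LT_LE: "bij_betw (%(p, t, u). (p, t)) LT LE"
proof (rule bij_betwI')
 fix x y assume "x : LT" "y : LT"
 then show "((case x of (p, t, u) => (p, t)) = (case y of (p, t, u) => (p, t))) = (x = y)"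
  using left_triangle_unique by (cases x; cases y) (auto simp: LT_I)
next
 fix x assume "x : LT" then show "(case x of (p, t, u) => (p, t)) : LE" using tri_adj by (cases x) (auto simp: LT_I LE_I)
next
 fix y assume "y : LE"
 then obtain p t where y: "y = (p, t)" "p : P" "adj p t" by (cases y) (auto simp: LE_I)
 then obtain u where "tri p t u" using left_triangle_exists by blast
 then have "y = (p, t)" "(p, t, u) : LT" using y by (auto simp: LT_I)
 then show "EX x:LT. y = (case x of (p, t, u) => (p, t))" by (intro bexI[of _ "(p, t, u)"]) auto
qed

lemma finite_LT: "finite LT" using bij_betw_finite[OF LT_LE] finite_LE by simp
lemma card_LT: "card LT = card LE" using bij_betw_same_card[OF LT_LE] .

lemma finite_Lp: assumes "p : P" shows "finite (Lp p)"
proof -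
 have "x : snd ` LT" if "x : Lp p" for x using assms that image_eqI[of x snd "(p, x)" LT] by (simp add: LT_def)
 then have "Lp p \<subseteq> snd ` LT" by blast
 then show ?thesis using finite_LT finite_subset by blast
qed

lemma rot_LT: assumes "x : LT" shows "rot x : LT"
proof -
 obtain p t u where x: "x = (p, t, u)" "tri p t u" using assms by (cases x) (auto simp: LT_I)
 have "t : SS" using tri_SS[OF x(2)] by simp
 from red[OF this] tri_inv[OF red(1)[OF this] tri_cycle[OF x(2)]] show ?thesis by (simp add: x rot_def LT_I)
qed

text \<open>The three translations compose to an element that carries \<open>p\<close> back into
  \<open>P\<close>, hence to the identity.\<close>

lemma rot3: assumes "x : LT" shows "rot (rot (rot x)) = x"
proof -
 obtain p t u where x: "x = (p, t, u)" "p : P" "tri p t u" using assms by (cases x) (auto simp: LT_I)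
 have S: "p : SS" "t : SS" "u : SS" using tri_SS[OF x(3)] by auto
 note U = S[THEN SS_uhp]
 define g where "g = red t"
 have g: "g : \<Gamma>" using red S by (simp add: g_def)
 define h where "h = red (g u)"
 have h: "h : \<Gamma>" using red SS_inv[OF g S(3)] by (simp add: h_def)
 define k where "k = red (h (g p))"
 have k: "k : \<Gamma>" "k (h (g p)) : P" using red SS_inv[OF h SS_inv[OF g S(1)]] by (auto simp: k_def)
 define m where "m = cmp k (cmp h g)"
 have m: "m : \<Gamma>" "!!z. z : uhp ==> m z = k (h (g z))" using cmp_props g h k in_uhp by (auto simp: m_def)
 have "m = id" using P_id[OF x(2) m(1)] m(2)[OF U(1)] k(2) by simp
 then have "k (h (g z)) = z" if "z : uhp" for z using m(2)[OF that] by simp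
 then show ?thesis using U by (simp add: x rot_def g_def[symmetric] h_def[symmetric] k_def[symmetric])
qed

lemma rot_bij: "bij_betw rot LT LT"
 by (rule bij_betw_byWitness[where f' = "rot \<circ> rot"]) (auto simp: rot3 rot_LT)

lemma rev_LE: assumes "x : LE" shows "rev x : LE"
proof -
 obtain p t where x: "x = (p, t)" "adj p t" using assms by (cases x) (auto simp: LE_I)
 have "t : SS" using adj_SS[OF x(2)] by simp
 from red[OF this] adj_inv[OF red(1)[OF this] adj_sym[OF x(2)]] show ?thesis by (simp add: x rev_def LE_I)
qed

lemma rev2: assumes "x : LE" shows "rev (rev x) = x"
proof -
 obtain p t where x: "x = (p, t)" "p : P" "adj p t" using assms by (cases x) (auto simp: LE_I)
 have S: "p : SS" "t : SS" using adj_SS[OF x(3)] by auto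
 define g where "g = red t"
 have g: "g : \<Gamma>" using red S by (simp add: g_def)
 define h where "h = red (g p)"
 have h: "h : \<Gamma>" "h (g p) : P" using red SS_inv[OF g S(1)] by (auto simp: h_def)
 define m where "m = cmp h g"
 have m: "m : \<Gamma>" "!!z. z : uhp ==> m z = h (g z)" using cmp_props g h in_uhp by (auto simp: m_def)
 have "m = id" using P_id[OF x(2) m(1)] m(2)[OF SS_uhp[OF S(1)]] h(2) by simp
 then have "h (g z) = z" if "z : uhp" for z using m(2)[OF that] by simp
 then show ?thesis using S[THEN SS_uhp] by (simp add: x rev_def g_def[symmetric] h_def[symmetric])
qed

lemma rev_bij: "bij_betw rev LE LE"
 by (rule bij_betw_byWitness[where f' = rev]) (auto simp: rev2 rev_LE)

lemma rev_ne: assumes "x : LE" shows "rev x ~= x"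
proof
 assume e: "rev x = x"
 obtain p t where x: "x = (p, t)" "p : P" "adj p t" using assms by (cases x) (auto simp: LE_I)
 then have "p = red t t" using e by (simp add: rev_def)
 then show False using adj_not_equiv[OF adj_sym[OF x(3)], of "red t"] red adj_SS[OF x(3)] by auto
qed

lemma rot_ne: assumes "x : LT" shows "rot x ~= x" "rot (rot x) ~= x" "rot (rot x) ~= rot x"
proof -
 have 1: "rot y ~= y" if y: "y : LT" for y
 proof
  assume e: "rot y = y"
  obtain p t u where x: "y = (p, t, u)" "p : P" "tri p t u" using y by (cases y) (auto simp: LT_I)
  then have "p = red t t" using e by (simp add: rot_def)
  then show False using adj_not_equiv[OF adj_sym[OF tri_adj[OF x(3)]], of "red t"] red tri_SS[OF x(3)] by auto
 qed
 show "rot x ~= x" "rot (rot x) ~= rot x" using 1 assms rot_LT by auto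
 then show "rot (rot x) ~= x" using rot3[OF assms] by metis
qed

lemma sum_LE_rev:
 assumes "!!g s t. g : \<Gamma> ==> adj s t ==> ph (g s) (g t) = ph s t"
 shows "(\<Sum>(p, t)\<in>LE. ph p t) = (\<Sum>(p, t)\<in>LE. ph t p)"
proof -
 have "(\<Sum>x\<in>LE. (%(p, t). ph p t) (rev x)) = (\<Sum>x\<in>LE. (%(p, t). ph p t) x)" by (rule sum.reindex_bij_betw[OF rev_bij])
 moreover have "(%(p, t). ph p t) (rev x) = (%(p, t). ph t p) x" if xL: "x : LE" for x
  
 proof -
  obtain p t where x: "x = (p, t)" "adj p t" using xL by (cases x) (auto simp: LE_I)
  then show ?thesis using assms[of "red t" t p] red adj_SS adj_sym by (auto simp: rev_def)
 qed
 ultimately show ?thesis by (simp cong: sum.cong)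
qed

lemma sum_LT_rot:
 assumes "!!g s t u. g : \<Gamma> ==> tri s t u ==> ph (g s) (g t) (g u) = ph s t u"
 shows "(\<Sum>(p, t, u)\<in>LT. ph p t u) = (\<Sum>(p, t, u)\<in>LT. ph t u p)"
proof -
 have "(\<Sum>x\<in>LT. (%(p, t, u). ph p t u) (rot x)) = (\<Sum>x\<in>LT. (%(p, t, u). ph p t u) x)" by (rule sum.reindex_bij_betw[OF rot_bij])
 moreover have "(%(p, t, u). ph p t u) (rot x) = (%(p, t, u). ph t u p) x" if xL: "x : LT" for x
 proof -
  obtain p t u where x: "x = (p, t, u)" "tri p t u" using xL by (cases x) (auto simp: LT_I)
  then show ?thesis using assms[of "red t" t u p] red tri_SS tri_cycle by (auto simp: rot_def)
 qed
 ultimately show ?thesis by (simp cong: sum.cong)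
qed

text \<open>Let points of the ray tend to \<open>p\<close>. By local finiteness one triangle
  contains infinitely many of them; being closed it contains \<open>p\<close>, and a site in a
  Delaunay triangle is one of its vertices.\<close>

lemma angle_cover:
 assumes p: "p : P" shows "EX x:Lp p. EX s<0. pol p (Complex s th) : Tri p (fst x) (snd x)"
proof -
 have pu: "p : uhp" using p P_uhp by auto
 define z where "z n = pol p (Complex (- real n - 1) th)" for n
 have lim: "z \<longlonglongrightarrow> p" unfolding z_def by (rule pol_tendsto[OF pu])
 have zu: "z n : uhp" for n unfolding z_def by (rule pol_in_uhp[OF pu]) simp
 define K where "K = insert p (range z)"
 define A where "A = {s:SS. EX z:K. hcosh z s <= cosh (2 * eps)}"
 have "finite A" unfolding A_def by (rule SS_locally_finite) (use compact_sequence_with_limit[OF lim] zu pu in "auto simp: K_def")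
 then have fin: "finite (A \<times> A \<times> A)" by simp
 have "ALL n:UNIV. EX x:A \<times> A \<times> A. (%n (s, t, u). tri s t u & z n : Tri s t u) n x"
 proof
  fix n
  obtain s t u where T: "tri s t u" "z n : Tri s t u" using covering[OF zu] by blast
  have "v : A" if "v : {s, t, u}" for v using Tri_hcosh[OF T that] tri_SS[OF T(1)] that by (auto simp: A_def K_def)
  then show "EX x:A \<times> A \<times> A. (%n (s, t, u). tri s t u & z n : Tri s t u) n x" using T by (intro bexI[of _ "(s, t, u)"]) auto
 qed
 from pigeonhole_infinite_rel[OF infinite_UNIV_nat fin this] obtain s t u
  where inf: "infinite {n. tri s t u & z n : Tri s t u}" by (auto simp del: Collect_conj_eq)
 have T: "tri s t u" by (rule ccontr) (use inf in simp)
 then have inf': "infinite {n. z n : Tri s t u}" using inf by simp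
 have nn: "hdet a b p >= 0" if h: "!!n. z n : Tri s t u ==> hdet a b (z n) >= 0" for a b
 proof (rule ccontr)
  assume "~ hdet a b p >= 0"
  then have "eventually (%n. hdet a b (z n) < 0) sequentially" using tendsto_hdet[OF lim pu, of a b] by (intro order_tendstoD(2)) auto
  then obtain N where N: "!!n. n >= N ==> hdet a b (z n) < 0" by (auto simp: eventually_sequentially)
  then have "{n. z n : Tri s t u} \<subseteq> {..<N}" using h by (metis (mono_tags) lessThan_iff linorder_not_less mem_Collect_eq subsetI)
  then show False using inf' finite_subset by blast
 qed
 have "p : Tri s t u" unfolding Tri_def using nn pu by (auto simp: Tri_def)
 then have v: "p : {s, t, u}" using SS_Tri_vertex[OF T] P_SS[OF p] by blast
 obtain n where n: "z n : Tri s t u" using inf' not_finite_existsD by blast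
 have "EX a b. tri p a b & z n : Tri p a b"
  using v T n tri_cycle[OF T] tri_cycle[OF tri_cycle[OF T]] Tri_cycle[of s t u] Tri_cycle[of t u s] by auto
 then obtain a b where ab: "tri p a b" "z n : Tri p a b" by blast
 then show ?thesis unfolding z_def by (intro bexI[of _ "(a, b)"] exI[of _ "- real n - 1"]) (auto simp: Lp_def)
qed

text \<open>The sectors of the triangles at \<open>p\<close> cover all directions, so their lengths
  add up to at least a full turn.\<close>

lemma angle_sum:
 assumes p: "p : P" shows "2 * pi <= (\<Sum>(t, u)\<in>Lp p. ang p t u)"
proof -
 have ex: "EX y. 0 < ang p (fst x) (snd x) & ang p (fst x) (snd x) < pi & (ALL s<0. ALL th. pol p (Complex s th) : Tri p (fst x) (snd x) --> sin (th - y) >= 0 & sin (ang p (fst x) (snd x) - (th - y)) >= 0)"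
  if "x : Lp p" for x
 proof -
  have T: "tri p (fst x) (snd x)" using that by (auto simp: Lp_def)
  show ?thesis using triangle_area(3)[of p "fst x" "snd x"] tri_SS[OF T] SS_uhp T unfolding tri_def by metis
 qed
 define y where "y x = (SOME y. 0 < ang p (fst x) (snd x) & ang p (fst x) (snd x) < pi & (ALL s<0. ALL th. pol p (Complex s th) : Tri p (fst x) (snd x) --> sin (th - y) >= 0 & sin (ang p (fst x) (snd x) - (th - y)) >= 0))" for x
 note Y = someI_ex[OF ex, folded y_def]
 define B where "B x = {th:{0..<2*pi}. sin (th - y x) >= 0 & sin (ang p (fst x) (snd x) - (th - y x)) >= 0}" for x
 have cov: "{0..<2*pi} \<subseteq> (\<Union>x\<in>Lp p. B x)"
 proof
  fix th :: real assume t: "th : {0..<2*pi}"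
  obtain x s where x: "x : Lp p" "s < 0" "pol p (Complex s th) : Tri p (fst x) (snd x)" using angle_cover[OF p] by blast
  then have "th : B x" using Y[OF x(1)] t by (auto simp: B_def)
  then show "th : (\<Union>x\<in>Lp p. B x)" using x by blast
 qed
 have Bm: "B x : sets lborel" for x
 proof -
  have "B x = {th:space borel. 0 <= th & th < 2*pi & sin (th - y x) >= 0 & sin (ang p (fst x) (snd x) - (th - y x)) >= 0}" by (auto simp: B_def)
  also have "... : sets borel" by measurable
  finally show ?thesis by simp
 qed
 have "ennreal (2 * pi) = emeasure lborel {0..<2*pi}" by simp
 also have "... <= emeasure lborel (\<Union>x\<in>Lp p. B x)" by (rule emeasure_mono[OF cov]) (use Bm finite_Lp[OF p] in auto)
 also have "... <= (\<Sum>x\<in>Lp p. emeasure lborel (B x))" by (rule emeasure_subadditive_finite) (use Bm finite_Lp[OF p] in auto)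
 also have "... <= (\<Sum>x\<in>Lp p. ennreal (ang p (fst x) (snd x)))" unfolding B_def by (intro sum_mono arc_measure) (use Y in auto)
 also have "... = ennreal (\<Sum>x\<in>Lp p. ang p (fst x) (snd x))" by (rule sum_ennreal) (use Y in "auto intro: less_imp_le")
 finally have "ennreal (2 * pi) <= ennreal (\<Sum>x\<in>Lp p. ang p (fst x) (snd x))" .
 moreover have "0 <= (\<Sum>x\<in>Lp p. ang p (fst x) (snd x))" by (intro sum_nonneg less_imp_le) (use Y in auto)
 ultimately have "2 * pi <= (\<Sum>x\<in>Lp p. ang p (fst x) (snd x))" using ennreal_le_iff by blast
 then show ?thesis by (simp add: case_prod_beta)
qed

lemma Tri_borel [measurable]: "Tri s t u : sets borel"
 unfolding Tri_def hdet_def using open_uhp by measurable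

lemma indicator_isom_measurable: "f : \<Gamma> ==> A : sets borel ==> (%z. indicator A (f z) :: ennreal) : borel_measurable borel"
 by (rule measurable_compose[OF isom_measurable borel_measurable_indicator])

lemma Tri_inv: assumes "f : \<Gamma>" "s : uhp" "t : uhp" "u : uhp" "z : Tri s t u" shows "f z : Tri (f s) (f t) (f u)"
 using assms hdet_isom[OF isom[OF assms(1)]] in_uhp unfolding Tri_def by auto

text \<open>A triangle containing \<open>z\<close> is counted at each of its three vertices, and
  these have distinct representatives in \<open>P\<close>; unfolding turns the count into
  areas.\<close>

lemma three_nu: "3 * emeasure nu UNIV <= (\<Sum>(p, t, u)\<in>LT. emeasure hmu (Tri p t u))"
proof -
 define n where "n p z = (\<Sum>x\<in>Lp p. \<integral>\<^sup>+ f. indicator (Tri p (fst x) (snd x)) (f z) \<partial>count_space \<Gamma>)" for p z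
 have mn [measurable]: "n p : borel_measurable borel" for p unfolding n_def by (intro borel_measurable_sum Gamma_nn_integral_measurable indicator_isom_measurable Tri_borel)
 have n1: "n p z >= (1::ennreal)" if "x : Lp p" "f : \<Gamma>" "f z : Tri p (fst x) (snd x)" "p : P" for p z f x
 proof -
  have "(1::ennreal) = (\<integral>\<^sup>+ h. indicator {f} h \<partial>count_space \<Gamma>)" using that(2) by simp
  also have "... <= (\<integral>\<^sup>+ h. indicator (Tri p (fst x) (snd x)) (h z) \<partial>count_space \<Gamma>)"
   by (rule nn_integral_mono) (use that(3) in "auto simp: indicator_def")
  also have "... <= n p z" unfolding n_def using that(1) finite_Lp[OF that(4)] by (intro member_le_sum) auto
  finally show ?thesis .
 qed
 have n3: "3 <= (\<Sum>p\<in>P. n p z)" if z: "z : uhp" for z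
 proof -
  obtain s t u where T: "tri s t u" "z : Tri s t u" using covering[OF z] by blast
  have one: "n (red a a) z >= 1 & red a a : P" if h: "tri a b c" "z : Tri a b c" for a b c
  proof -
   have S: "a : SS" "b : SS" "c : SS" using tri_SS[OF h(1)] by auto
   have "red a z : Tri (red a a) (red a b) (red a c)" using Tri_inv red(1)[OF S(1)] S SS_uhp h(2) by blast
   then show ?thesis using n1[of "(red a b, red a c)" "red a a" "red a" z] red[OF S(1)] tri_inv[OF red(1)[OF S(1)] h(1)] by (auto simp: Lp_def)
  qed
  have dist: "red a a ~= red b b" if h: "tri a b c" for a b c
  proof
   assume e: "red a a = red b b"
   have S: "a : SS" "b : SS" using tri_SS[OF h] by auto
   have "b = cmp (ivt (red b)) (red a) a"
    using cmp_props[OF ivt_props(1)[OF red(1)[OF S(2)]] red(1)[OF S(1)]] ivt_props(2)[OF red(1)[OF S(2)] SS_uhp[OF S(2)]] e SS_uhp[OF S(1)] by simp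
   then show False using adj_not_equiv[OF tri_adj[OF h]] cmp_props(1)[OF ivt_props(1)[OF red(1)[OF S(2)]] red(1)[OF S(1)]] by blast
  qed
  note c1 = tri_cycle[OF T(1)] and c2 = tri_cycle[OF tri_cycle[OF T(1)]]
  let ?Q = "{red s s, red t t, red u u}"
  have d: "red s s ~= red t t" "red t t ~= red u u" "red u u ~= red s s" using dist[OF T(1)] dist[OF c1] dist[OF c2] by auto
  have o: "n (red s s) z >= 1" "n (red t t) z >= 1" "n (red u u) z >= 1" "?Q \<subseteq> P"
   using one[OF T] one[OF c1] one[OF c2] T(2) Tri_cycle[of s t u] Tri_cycle[of t u s] by auto
  have "(3::ennreal) = 1 + (1 + 1)" by simp
  also have "... <= n (red s s) z + (n (red t t) z + n (red u u) z)" using o by (intro add_mono) auto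
  also have "... = (\<Sum>p\<in>?Q. n p z)" using d by simp
  also have "... <= (\<Sum>p\<in>P. n p z)" by (rule sum_mono2[OF finP o(4)]) simp
  finally show ?thesis .
 qed
 have "3 * emeasure nu UNIV = (\<integral>\<^sup>+ z. 3 \<partial>nu)" by simp
 also have "... = (\<integral>\<^sup>+ z. chi z * 3 \<partial>hmu)" by (rule nn_integral_nu) simp
 also have "... <= (\<integral>\<^sup>+ z. chi z * (\<Sum>p\<in>P. n p z) \<partial>hmu)"
 proof (rule nn_integral_mono)
  fix z show "chi z * 3 <= chi z * (\<Sum>p\<in>P. n p z)"
  proof (cases "z : uhp")
   case True then show ?thesis using n3 by (intro mult_left_mono) auto
  next
   case False then have "chi z = 0" using chi_support by blast
   then show ?thesis by simp
  qed
 qed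
 also have "... = (\<integral>\<^sup>+ z. (\<Sum>p\<in>P. \<Sum>x\<in>Lp p. chi z * (\<integral>\<^sup>+ f. indicator (Tri p (fst x) (snd x)) (f z) \<partial>count_space \<Gamma>)) \<partial>hmu)"
  by (simp add: n_def sum_distrib_left)
 also have "... = (\<Sum>p\<in>P. \<Sum>x\<in>Lp p. \<integral>\<^sup>+ z. chi z * (\<integral>\<^sup>+ f. indicator (Tri p (fst x) (snd x)) (f z) \<partial>count_space \<Gamma>) \<partial>hmu)"
 proof -
  have m: "(%z. chi z * (\<integral>\<^sup>+ f. indicator (Tri p (fst x) (snd x)) (f z) \<partial>count_space \<Gamma>)) : borel_measurable hmu" for p x
   unfolding measurable_hmu by (intro borel_measurable_times_ennreal chi_measurable Gamma_nn_integral_measurable indicator_isom_measurable Tri_borel)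
  show ?thesis by (subst nn_integral_sum, intro borel_measurable_sum m) (intro sum.cong refl nn_integral_sum m)
 qed
 also have "... = (\<Sum>p\<in>P. \<Sum>x\<in>Lp p. emeasure hmu (Tri p (fst x) (snd x)))"
 proof (intro sum.cong refl)
  fix p x
  have "(\<integral>\<^sup>+ z. chi z * (\<integral>\<^sup>+ f. indicator (Tri p (fst x) (snd x)) (f z) \<partial>count_space \<Gamma>) \<partial>hmu) = (\<integral>\<^sup>+ z. indicator (Tri p (fst x) (snd x)) z * indicator uhp z \<partial>hmu)"
   by (rule unfolding_sum[symmetric]) measurable
  also have "... = (\<integral>\<^sup>+ z. indicator (Tri p (fst x) (snd x)) z \<partial>hmu)"
   by (rule nn_integral_cong) (auto simp: indicator_def Tri_def)
  finally show "(\<integral>\<^sup>+ z. chi z * (\<integral>\<^sup>+ f. indicator (Tri p (fst x) (snd x)) (f z) \<partial>count_space \<Gamma>) \<partial>hmu) = emeasure hmu (Tri p (fst x) (snd x))" by simp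
 qed
 also have "... = (\<Sum>(p, t, u)\<in>LT. emeasure hmu (Tri p t u))"
  unfolding LT_def by (subst sum.Sigma) (use finP finite_Lp in "auto simp: case_prod_beta")
 finally show ?thesis .
qed

text \<open>Summed over \<open>LT\<close>, the three angles contribute equally by rotation, each at
  least \<open>2 * pi * card P\<close>. Since edges and triangles satisfy \<open>2 E = 3 F\<close>,
  the bound is \<open>- 2 * pi * (V - E + F)\<close>.\<close>

lemma area_bound: "measure nu UNIV <= pi * real (card LE) / 3 - 2 * pi * real (card P)"
proof -
 have U: "p : uhp & t : uhp & u : uhp & hdet p t u > 0 & p : P & tri p t u" if "(p, t, u) : LT" for p t u
  using that tri_SS SS_uhp by (auto simp: LT_I tri_def)
 define S where "S = (\<Sum>(p, t, u)\<in>LT. ang p t u)"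
 have ai: "ang (g s) (g t) (g u) = ang s t u" if "g : \<Gamma>" "tri s t u" for g s t u
  using ang_isom[OF isom[OF that(1)]] tri_SS[OF that(2)] SS_uhp by blast
 have S1: "S = (\<Sum>(p, t, u)\<in>LT. ang t u p)" unfolding S_def by (rule sum_LT_rot) (rule ai)
 have S2: "S = (\<Sum>(p, t, u)\<in>LT. ang u p t)" unfolding S1 by (rule sum_LT_rot[of "%p t u. ang t u p"]) (use ai tri_cycle in blast)
 have Seq: "S = (\<Sum>p\<in>P. \<Sum>(t, u)\<in>Lp p. ang p t u)" unfolding S_def LT_def by (subst sum.Sigma) (use finP finite_Lp in auto)
 have "(\<Sum>p\<in>P. 2 * pi) <= S" unfolding Seq by (rule sum_mono) (rule angle_sum)
 then have SP: "S >= 2 * pi * real (card P)" by (simp add: mult.commute)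
 have "3 * emeasure nu UNIV <= (\<Sum>(p, t, u)\<in>LT. ennreal (pi - ang p t u - ang t u p - ang u p t))"
  using three_nu by (rule order_trans) (auto intro!: sum_mono simp: triangle_area(1) dest!: U)
 also have "... = ennreal (\<Sum>(p, t, u)\<in>LT. (pi - ang p t u - ang t u p - ang u p t))"
  unfolding case_prod_beta by (rule sum_ennreal) (use U triangle_area(2) in "auto simp: case_prod_beta")
 also have "(\<Sum>(p, t, u)\<in>LT. (pi - ang p t u - ang t u p - ang u p t)) = pi * real (card LE) - 3 * S"
 proof -
  have "(\<Sum>(p, t, u)\<in>LT. (pi - ang p t u - ang t u p - ang u p t)) = (\<Sum>(p, t, u)\<in>LT. pi) - (\<Sum>(p, t, u)\<in>LT. ang p t u) - (\<Sum>(p, t, u)\<in>LT. ang t u p) - (\<Sum>(p, t, u)\<in>LT. ang u p t)"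
   unfolding case_prod_beta by (simp add: sum_subtractf)
  then show ?thesis using S_def S1 S2 by (simp add: case_prod_beta card_LT)
 qed
 finally have le: "3 * emeasure nu UNIV <= ennreal (pi * real (card LE) - 3 * S)" .
 have "0 <= (\<Sum>(p, t, u)\<in>LT. (pi - ang p t u - ang t u p - ang u p t))" by (rule sum_nonneg) (use U triangle_area(2) in "auto simp: case_prod_beta")
 then have nn: "0 <= pi * real (card LE) - 3 * S"
  using \<open>(\<Sum>(p, t, u)\<in>LT. (pi - ang p t u - ang t u p - ang u p t)) = pi * real (card LE) - 3 * S\<close> by simp
 have "3 * emeasure nu UNIV = ennreal (3 * measure nu UNIV)"
  using finite_measure.emeasure_eq_measure[OF finite_nu] by (simp add: ennreal_mult)
 then have "3 * measure nu UNIV <= pi * real (card LE) - 3 * S" using le nn by simp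
 then show ?thesis using SP by (simp add: field_simps)
qed

end

section \<open>Integral cochains\<close>

text \<open>\<open>Rk Z n\<close>: \<open>Z\<close> contains \<open>n\<close> linearly independent vectors.\<close>
definition Rk :: "('b => int) set => nat => bool" where
 "Rk Z n \<longleftrightarrow> (EX (I::nat set) w. finite I & card I = n & (ALL i:I. w i : Z) &
   (ALL x. (ALL e. (\<Sum>i\<in>I. x i * w i e) = 0) --> (ALL i:I. x i = (0::int))))"

definition int_closed :: "('b => int) set => bool" where
 "int_closed Z \<longleftrightarrow> (ALL a:Z. ALL b:Z. ALL k l. (%e. k * a e + l * b e) : Z)"

definition int_lin :: "('b => int) set => (('b => int) => int) => bool" where
 "int_lin Z L \<longleftrightarrow> (ALL a:Z. ALL b:Z. ALL k l. L (%e. k * a e + l * b e) = k * L a + l * L b)"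

text \<open>\<open>Rk\<close> uses sets of naturals as index sets; any finite index set can be
  renumbered.\<close>

lemma RkI:
 assumes "finite A" "!!i. i : A ==> w i : Z" "!!x i. (ALL e. (\<Sum>i\<in>A. x i * w i e) = 0) ==> i : A ==> x i = (0::int)"
 shows "Rk Z (card A)"
proof -
 obtain h where h: "bij_betw h {0..<card A} A" using ex_bij_betw_nat_finite[OF assms(1)] by blast
 have "x i = 0" if x: "ALL e. (\<Sum>i\<in>{0..<card A}. x i * w (h i) e) = 0" and i: "i : {0..<card A}" for x :: "nat => int" and i
 proof -
  define y where "y j = x (the_inv_into {0..<card A} h j)" for j
  have yh: "y (h i) = x i" if "i : {0..<card A}" for i using h that by (simp add: y_def the_inv_into_f_f bij_betw_def)
  have s1: "(\<Sum>j\<in>A. y j * w j e) = (\<Sum>i\<in>{0..<card A}. y (h i) * w (h i) e)" for e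
   by (rule sum.reindex_bij_betw[OF h, symmetric])
  have s2: "(\<Sum>i\<in>{0..<card A}. y (h i) * w (h i) e) = (\<Sum>i\<in>{0..<card A}. x i * w (h i) e)" for e
   by (rule sum.cong) (use yh in auto)
  have "ALL e. (\<Sum>j\<in>A. y j * w j e) = 0" unfolding s1 s2 using x by simp
  then have "y (h i) = 0" by (rule assms(3)) (use bij_betwE[OF h] i in blast)
  then show ?thesis using yh[OF i] by simp
 qed
 then have "ALL x. (ALL e. (\<Sum>i\<in>{0..<card A}. x i * w (h i) e) = 0) --> (ALL i:{0..<card A}. x i = (0::int))" by blast
 moreover have "ALL i:{0..<card A}. w (h i) : Z" using bij_betwE[OF h] assms(2) by blast
 ultimately show ?thesis unfolding Rk_def by (intro exI[of _ "{0..<card A}"] exI[of _ "%i. w (h i)"] conjI) simp_all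
qed

text \<open>Gaussian elimination without division: \<open>w i\<close> is replaced by
  \<open>c * w i - L (w i) * w j\<close>, so one linear condition costs at most one
  dimension.\<close>

lemma Rk_kernel:
 assumes R: "Rk Z (Suc n)" and cl: "int_closed Z" and lin: "int_lin Z L"
 shows "Rk {a:Z. L a = 0} n"
proof -
 from R[unfolded Rk_def] obtain I :: "nat set" and w where I0: "finite I & card I = Suc n & (ALL i:I. w i : Z) &
   (ALL x. (ALL e. (\<Sum>i\<in>I. x i * w i e) = 0) --> (ALL i:I. x i = (0::int)))" by (elim exE) (rule that)
 have I: "finite I" "card I = Suc n" "!!i. i : I ==> w i : Z" using I0 by auto
 have ind: "(ALL e. (\<Sum>i\<in>I. x i * w i e) = 0) ==> (ALL i:I. x i = (0::int))" for x using conjunct2[OF conjunct2[OF conjunct2[OF I0]]] by blast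
 \<comment> \<open>If \<open>L\<close> vanishes on the whole family, any \<open>j\<close> may be
   dropped; the multiplier \<open>c\<close> is then 1.\<close>
 have "EX j:I. L (w j) ~= 0 \<or> (ALL i:I. L (w i) = 0)" using I(2) by (metis card.empty ex_in_conv nat.distinct(1))
 then obtain j where j: "j : I" "L (w j) ~= 0 \<or> (ALL i:I. L (w i) = 0)" by blast
 define c where "c = (if L (w j) = 0 then 1 else L (w j))"
 have c: "c ~= 0" by (simp add: c_def)
 define w' where "w' i = (%e. c * w i e + (- L (w i)) * w j e)" for i
 have wZ: "w' i : Z" "L (w' i) = 0" if "i : I" for i
 proof -
  show "w' i : Z" using cl I(3) that j(1) unfolding int_closed_def w'_def by blast
  have "L (w' i) = c * L (w i) + (- L (w i)) * L (w j)" using lin I(3) that j(1) unfolding int_lin_def w'_def by blast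
  then show "L (w' i) = 0" using j(2) that by (auto simp: c_def)
 qed
 have "Rk {a:Z. L a = 0} (card (I - {j}))"
 proof (rule RkI[where w = w'])
  fix x :: "nat => int" and i assume x: "ALL e. (\<Sum>i\<in>I - {j}. x i * w' i e) = 0" and i: "i : I - {j}"
  define y where "y i = (if i = j then - (\<Sum>i\<in>I - {j}. x i * L (w i)) else c * x i)" for i
  have "(\<Sum>i\<in>I. y i * w i e) = 0" for e
  proof -
   have "(\<Sum>i\<in>I. y i * w i e) = y j * w j e + (\<Sum>i\<in>I - {j}. y i * w i e)" by (rule sum.remove[OF I(1) j(1)])
   also have "(\<Sum>i\<in>I - {j}. y i * w i e) = (\<Sum>i\<in>I - {j}. c * x i * w i e)" by (rule sum.cong) (auto simp: y_def)
   also have "y j * w j e + ... = (\<Sum>i\<in>I - {j}. x i * w' i e)"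
    by (simp add: y_def w'_def algebra_simps sum.distrib sum_subtractf sum_distrib_left sum_distrib_right)
   finally show ?thesis using x by simp
  qed
  then have "y i = 0" using ind i by blast
  then show "x i = 0" using i c by (auto simp: y_def)
 qed (use I wZ in auto)
 then show ?thesis using I j by simp
qed

lemma Rk_kernels:
 assumes "finite J" "Rk Z (n + card J)" "int_closed Z" "!!j. j : J ==> int_lin Z (L j)"
 shows "Rk {a:Z. ALL j:J. L j a = 0} n & int_closed {a:Z. ALL j:J. L j a = 0}"
 using assms
proof (induction J arbitrary: n rule: finite_induct)
 case empty then show ?case by simp
next
 case (insert j J)
 let ?Z = "{a:Z. ALL j:J. L j a = 0}"
 have h: "Rk Z (Suc n + card J)" using insert by simp
 have l: "int_lin Z (L i)" if "i : J" for i using insert.prems(3) that by simp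
 have IH': "Rk ?Z (Suc n) & int_closed ?Z" by (rule insert.IH[OF h insert.prems(2)]) (rule l)
 note IH = IH'[THEN conjunct1] IH'[THEN conjunct2]
 have "int_lin ?Z (L j)" using insert.prems(3)[of j] unfolding int_lin_def by blast
 from Rk_kernel[OF IH this] have "Rk {a:?Z. L j a = 0} n" .
 moreover have "{a:?Z. L j a = 0} = {a:Z. ALL j:insert j J. L j a = 0}" by blast
 moreover have "int_closed {a:?Z. L j a = 0}"
  unfolding int_closed_def
 proof (intro ballI allI)
  fix a b k l assume ab: "a : {a:?Z. L j a = 0}" "b : {a:?Z. L j a = 0}"
  have aZ: "a : ?Z" "b : ?Z" "L j a = 0" "L j b = 0" using ab by auto
  have "(%e. k * a e + l * b e) : ?Z" using IH(2)[unfolded int_closed_def] aZ(1,2) by blast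
  moreover have "L j (%e. k * a e + l * b e) = 0" using \<open>int_lin ?Z (L j)\<close>[unfolded int_lin_def, rule_format, OF aZ(1,2)] aZ(3,4) by simp
  ultimately show "(%e. k * a e + l * b e) : {a:?Z. L j a = 0}" by blast
 qed
 ultimately show ?case by simp
qed

lemma Rk_nonzero: assumes "Rk Z n" "n > 0" shows "EX a:Z. a ~= (%_. 0)"
proof -
 from assms(1)[unfolded Rk_def] obtain I :: "nat set" and w where I0: "finite I & card I = n & (ALL i:I. w i : Z) &
   (ALL x. (ALL e. (\<Sum>i\<in>I. x i * w i e) = 0) --> (ALL i:I. x i = (0::int)))" by (elim exE) (rule that)
 have I: "finite I" "card I = n" "!!i. i : I ==> w i : Z" using I0 by auto
 have ind: "(ALL e. (\<Sum>i\<in>I. x i * w i e) = 0) ==> (ALL i:I. x i = (0::int))" for x using conjunct2[OF conjunct2[OF conjunct2[OF I0]]] by blast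
 obtain i where i: "i : I" using I assms(2) by fastforce
 have "w i ~= (%_. 0)"
 proof
  assume z: "w i = (%_. 0)"
  have "(\<Sum>k\<in>I. (if k = i then 1 else 0) * w k e) = 0" for e by (rule sum.neutral) (use z in auto)
  then have "ALL k:I. (if k = i then 1 else 0) = (0::int)" using ind[of "%k. if k = i then 1 else 0"] by blast
  then show False using i by auto
 qed
 then show ?thesis using I(3)[OF i] by blast
qed

section \<open>Cochains of the quotient complex\<close>

context net
begin

definition CE :: "(complex \<times> complex) set set" where "CE = (%e. {e, rev e}) ` LE"
definition CT :: "(complex \<times> complex \<times> complex) set set" where "CT = (%x. {x, rot x, rot (rot x)}) ` LT"

lemma card_CE: "2 * card CE = card LE"
proof -
 have "2 * card CE = card (\<Union>CE)"
 proof (rule card_partition)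
  show "finite CE" "finite (\<Union>CE)" using finite_LE by (auto simp: CE_def)
  show "card c = 2" if c: "c : CE" for c
  proof -
   obtain x where x: "x : LE" "c = {x, rev x}" using c by (auto simp: CE_def)
   have "x ~= rev x" using rev_ne[OF x(1)] by metis
   then show ?thesis unfolding x(2) by simp
  qed
  show "c1 \<inter> c2 = {}" if c: "c1 : CE" "c2 : CE" "c1 ~= c2" for c1 c2
  proof (rule ccontr)
   assume "c1 \<inter> c2 ~= {}"
   then obtain y where y: "y : c1" "y : c2" by blast
   obtain x1 x2 where x: "x1 : LE" "c1 = {x1, rev x1}" "x2 : LE" "c2 = {x2, rev x2}" using c unfolding CE_def by blast
   have "c1 = {y, rev y}" using y(1) rev2[OF x(1)] unfolding x(2) by (elim insertE emptyE) (simp_all add: insert_commute)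
   moreover have "c2 = {y, rev y}" using y(2) rev2[OF x(3)] unfolding x(4) by (elim insertE emptyE) (simp_all add: insert_commute)
   ultimately show False using c by simp
  qed
 qed
 also have "\<Union>CE = LE" using rev_LE by (auto simp: CE_def)
 finally show ?thesis .
qed

lemma CT_same: assumes "x : LT" "y : LT" "y : {x, rot x, rot (rot x)}" shows "{y, rot y, rot (rot y)} = {x, rot x, rot (rot x)}"
 using assms(3) by (elim insertE emptyE) (simp_all add: rot3[OF assms(1)] insert_commute)

lemma card_CT: "3 * card CT = card LT"
proof -
 have "3 * card CT = card (\<Union>CT)"
 proof (rule card_partition)
  show "finite CT" "finite (\<Union>CT)" using finite_LT by (auto simp: CT_def)
  show "card c = 3" if c: "c : CT" for c
  proof -
   obtain x where x: "x : LT" "c = {x, rot x, rot (rot x)}" using c by (auto simp: CT_def)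
   show ?thesis unfolding x(2) using rot_ne[OF x(1), THEN not_sym] by simp
  qed
  show "c1 \<inter> c2 = {}" if c: "c1 : CT" "c2 : CT" "c1 ~= c2" for c1 c2
  proof (rule ccontr)
   assume "c1 \<inter> c2 ~= {}"
   then obtain y where y: "y : c1" "y : c2" by blast
   obtain x1 x2 where x: "x1 : LT" "c1 = {x1, rot x1, rot (rot x1)}" "x2 : LT" "c2 = {x2, rot x2, rot (rot x2)}" using c unfolding CT_def by blast
   have yL: "y : LT" using y(1) x(1) rot_LT[OF x(1)] rot_LT[OF rot_LT[OF x(1)]] unfolding x(2) by blast
   have "c1 = c2" using CT_same[OF x(1) yL] CT_same[OF x(3) yL] y unfolding x(2,4) by blast
   then show False using c by simp
  qed
 qed
 also have "\<Union>CT = LT"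
 proof (intro equalityI subsetI)
  fix y assume "y : \<Union>CT"
  then obtain x where x: "x : LT" "y : {x, rot x, rot (rot x)}" unfolding CT_def by blast
  then show "y : LT" using rot_LT[OF x(1)] rot_LT[OF rot_LT[OF x(1)]] by blast
 qed (auto simp: CT_def)
 finally show ?thesis .
qed

lemma CT_eq: assumes "T : CT" "x : T" shows "x : LT" "T = {x, rot x, rot (rot x)}"
proof -
 obtain y where y: "y : LT" "T = {y, rot y, rot (rot y)}" using assms by (auto simp: CT_def)
 show x: "x : LT" using assms(2) y(1) rot_LT[OF y(1)] rot_LT[OF rot_LT[OF y(1)]] unfolding y(2) by blast
 show "T = {x, rot x, rot (rot x)}" using CT_same[OF y(1) x] assms(2) unfolding y(2) by blast
qed

text \<open>Alternating 1-cochains of the quotient complex, as invariant functions on directed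
  edges; the value 0 off the edges makes a cochain determined by its edge values.\<close>

definition ZZ :: "(complex \<times> complex => int) set" where
 "ZZ = {a. (ALL g:\<Gamma>. ALL s t. adj s t --> a (g s, g t) = a (s, t)) & (ALL s t. adj s t --> a (t, s) = - a (s, t)) & (ALL s t. ~ adj s t --> a (s, t) = 0)}"

lemma ZZ_D: assumes "a : ZZ" shows "g : \<Gamma> ==> adj s t ==> a (g s, g t) = a (s, t)" "a (t, s) = - a (s, t)" "~ adj s t ==> a (s, t) = 0"
proof -
 show "g : \<Gamma> ==> adj s t ==> a (g s, g t) = a (s, t)" "~ adj s t ==> a (s, t) = 0" using assms by (auto simp: ZZ_def)
 show "a (t, s) = - a (s, t)"
 proof (cases "adj s t")
  case False
  then have "~ adj t s" using adj_sym by blast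
  then show ?thesis using assms False by (simp add: ZZ_def)
 qed (use assms in "simp add: ZZ_def")
qed

lemma ZZ_closed: "int_closed ZZ" unfolding int_closed_def ZZ_def by (auto simp: algebra_simps)

definition nf :: "complex => complex => complex \<times> complex" where "nf s t = (red s s, red s t)"

lemma red_P: assumes "p : P" shows "red p = id" using P_id[OF assms] red[OF P_SS[OF assms]] by blast

text \<open>Both \<open>red (g s)\<close> after \<open>g\<close> and \<open>red s\<close> carry
  \<open>s\<close> into \<open>P\<close>; by \<open>P_id\<close> they agree.\<close>

lemma red_translate: assumes "g : \<Gamma>" "s : SS" "z : uhp" shows "red (g s) (g z) = red s z"
proof -
 have S: "g s : SS" using SS_inv assms by blast
 have su: "s : uhp" "red s s : uhp" using SS_uhp assms red P_uhp by auto
 note r = red[OF assms(2)] and r' = red[OF S]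
 define m where "m = cmp (cmp (red (g s)) g) (ivt (red s))"
 have m: "m : \<Gamma>" "!!z. z : uhp ==> m z = red (g s) (g (ivt (red s) z))"
  using cmp_props ivt_props r r' assms(1) in_uhp by (auto simp: m_def)
 have "m = id" using P_id[OF r(2) m(1)] m(2)[OF su(2)] ivt_props(2)[OF r(1) su(1)] r'(2) by simp
 then have "red (g s) (g (ivt (red s) (red s z))) = red s z" using m(2)[of "red s z"] in_uhp[OF r(1) assms(3)] by simp
 then show ?thesis using ivt_props(2)[OF r(1) assms(3)] by simp
qed

lemma nf_inv: "g : \<Gamma> ==> adj s t ==> nf (g s) (g t) = nf s t"
 using red_translate adj_SS SS_uhp by (auto simp: nf_def)

lemma nf_LE: "(p, t) : LE ==> nf p t = (p, t)" "(p, t) : LE ==> nf t p = rev (p, t)"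
 using red_P by (auto simp: nf_def LE_I rev_def)

text \<open>For each edge take the cochain that is 1 on its chosen direction, -1 on the reverse and
  0 on all other edges.\<close>

lemma ZZ_rank: "Rk ZZ (card CE)"
proof (rule RkI)
 show fin: "finite CE" using finite_LE by (simp add: CE_def)
 define e where "e C = (SOME x. x : C)" for C :: "(complex \<times> complex) set"
 have e: "e C : C" if "C : CE" for C unfolding e_def by (rule someI_ex) (use that in "auto simp: CE_def")
 have eL: "e C : LE & C = {e C, rev (e C)}" if "C : CE" for C
  using e[OF that] that rev_LE rev2 unfolding CE_def by auto
 define w where "w C = (%(s, t). if adj s t then (if nf s t = e C then 1 else 0) - (if nf t s = e C then 1 else (0::int)) else 0)" for C
 show "w C : ZZ" if "C : CE" for C
  using nf_inv adj_inv adj_sym unfolding ZZ_def w_def by auto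
 fix x :: "(complex \<times> complex) set => int" and C assume x: "ALL y. (\<Sum>i\<in>CE. x i * w i y) = 0" and C: "C : CE"
 have wd: "w D (e C) = (if D = C then 1 else 0)" if D: "D : CE" for D
 proof -
  obtain p t where pt: "e C = (p, t)" by fastforce
  have L: "(p, t) : LE" using eL[OF C] pt by simp
  have "e C = e D \<longleftrightarrow> D = C" using eL[OF C] eL[OF D] by metis
  moreover have "rev (e C) ~= e D"
  proof
   assume r: "rev (e C) = e D"
   then have "D = {rev (e C), rev (rev (e C))}" using eL[OF D] by simp
   then have "D = C" using eL[OF C] rev2[of "e C"] by auto
   then show False using r rev_ne[of "e C"] eL[OF C] by simp
  qed
  ultimately show ?thesis using nf_LE[OF L] L by (auto simp: pt w_def LE_I)
 qed
 have "0 = (\<Sum>i\<in>CE. x i * w i (e C))" by (rule x[rule_format, symmetric])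
 also have "... = (\<Sum>i\<in>CE. if i = C then x i else 0)" by (rule sum.cong) (auto simp: wd)
 also have "... = x C" using C fin by simp
 finally show "x C = 0" by simp
qed

text \<open>The coboundary on triangles.\<close>

definition tau :: "(complex \<times> complex => int) => complex \<times> complex \<times> complex => int" where
 "tau a = (%(p, t, u). a (p, t) + a (t, u) + a (u, p))"
text \<open>The divergence, up to sign the adjoint of the coboundary of functions on vertices.
  Harmonic means that both \<open>tau\<close> and \<open>dv\<close> vanish.\<close>

definition dv :: "(complex \<times> complex => int) => complex => int" where "dv a p = (\<Sum>t\<in>{t. adj p t}. a (p, t))"

lemma sum_LE_0: assumes "a : ZZ" shows "(\<Sum>e\<in>LE. a e) = 0"
proof -
 have "(\<Sum>(p, t)\<in>LE. a (p, t)) = (\<Sum>(p, t)\<in>LE. a (t, p))" by (rule sum_LE_rev) (rule ZZ_D(1)[OF assms])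
 also have "... = - (\<Sum>(p, t)\<in>LE. a (p, t))" 
 proof -
  have "(case e of (p, t) => a (t, p)) = - (case e of (p, t) => a (p, t))" for e using ZZ_D(2)[OF assms, of "snd e" "fst e"] by (simp add: case_prod_beta)
  then have "(\<Sum>(p, t)\<in>LE. a (t, p)) = (\<Sum>e\<in>LE. - (case e of (p, t) => a (p, t)))" by (rule sum.cong[OF refl])
  then show ?thesis unfolding sum_negf .
 qed
 finally show ?thesis by simp
qed

lemma tau_inv: assumes "a : ZZ" "g : \<Gamma>" "tri s t u" shows "tau a (g s, g t, g u) = tau a (s, t, u)"
 using ZZ_D(1)[OF assms(1,2) tri_adj[OF assms(3)]] ZZ_D(1)[OF assms(1,2) tri_adj[OF tri_cycle[OF assms(3)]]]
  ZZ_D(1)[OF assms(1,2) tri_adj[OF tri_cycle[OF tri_cycle[OF assms(3)]]]] by (simp add: tau_def)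

lemma tau_rot: assumes "a : ZZ" "x : LT" shows "tau a (rot x) = tau a x"
proof -
 obtain p t u where x: "x = (p, t, u)" "tri p t u" using assms(2) by (cases x) (auto simp: LT_I)
 have "tau a (rot x) = tau a (t, u, p)" using tau_inv[OF assms(1) _ tri_cycle[OF x(2)]] red tri_SS[OF x(2)] by (simp add: x rot_def)
 then show ?thesis by (simp add: x tau_def)
qed

text \<open>Each of the three edge terms sums to the total over all directed edges, where an edge
  cancels against its reverse.\<close>

lemma sum_tau: assumes a: "a : ZZ" shows "(\<Sum>x\<in>LT. tau a x) = 0"
proof -
 let ?S = "\<Sum>(p, t, u)\<in>LT. a (p, t)"
 have i: "a (g s, g t) = a (s, t)" if "g : \<Gamma>" "tri s t u" for g s t u using ZZ_D(1)[OF a that(1) tri_adj[OF that(2)]] .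
 have 1: "?S = (\<Sum>(p, t, u)\<in>LT. a (t, u))" by (rule sum_LT_rot[of "%s t u. a (s, t)"]) (rule i)
 have 2: "... = (\<Sum>(p, t, u)\<in>LT. a (u, p))" by (rule sum_LT_rot[of "%s t u. a (t, u)"]) (use i tri_cycle in blast)
 have "?S = (\<Sum>x\<in>LT. a ((%(p, t, u). (p, t)) x))" by (simp add: case_prod_beta)
 also have "... = (\<Sum>e\<in>LE. a e)" by (rule sum.reindex_bij_betw[OF LT_LE])
 finally have "?S = 0" using sum_LE_0[OF a] by simp
 moreover have "(\<Sum>x\<in>LT. tau a x) = ?S + (\<Sum>(p, t, u)\<in>LT. a (t, u)) + (\<Sum>(p, t, u)\<in>LT. a (u, p))"
  by (simp add: tau_def case_prod_beta sum.distrib)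
 ultimately show ?thesis using 1 2 by simp
qed

lemma finite_adj: assumes "p : P" shows "finite {t. adj p t}"
proof -
 have "t : snd ` LE" if "adj p t" for t using assms that image_eqI[of t snd "(p, t)" LE] by (simp add: LE_I)
 then have "{t. adj p t} \<subseteq> snd ` LE" by blast
 then show ?thesis using finite_LE finite_subset by blast
qed

lemma sum_LE_P: "(\<Sum>(p, t)\<in>LE. (f p t :: 'c::comm_monoid_add)) = (\<Sum>p\<in>P. \<Sum>t\<in>{t. adj p t}. f p t)"
 unfolding LE_def by (subst sum.Sigma) (use finP finite_adj in auto)

text \<open>There are as many unknowns as edges. Both families of conditions, on triangles and at
  vertices, have a relation by \<open>sum_tau\<close> and \<open>sum_LE_0\<close>, so one condition
  of each is dropped and recovered at the end; hence the constant 2.\<close>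

lemma cochain_exists:
 fixes L :: "nat => (complex \<times> complex => int) => int"
 assumes lin: "!!j. j < d ==> int_lin {a:ZZ. ALL x:LT. tau a x = 0} (L j)"
  and card: "card CT + card P + d < card CE + 2"
 shows "EX a:ZZ. a ~= (%_. 0) & (ALL x:LT. tau a x = 0) & (ALL p:P. dv a p = 0) & (ALL j<d. L j a = 0)"
proof -
 obtain s t u where T: "tri s t u" using covering[of \<i>] by (auto simp: uhp_iff)
 then have s: "s : SS" using tri_SS by blast
 have x0: "(red s s, red s t, red s u) : LT" using red[OF s] tri_inv[OF red(1)[OF s] T] by (simp add: LT_I)
 obtain T0 where T0: "T0 : CT" using x0 by (auto simp: CT_def)
 obtain p0 where p0: "p0 : P" using red[OF s] by blast
 have fin: "finite CT" using finite_LT by (simp add: CT_def)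
 have c1: "card (CT - {T0}) = card CT - 1" "card CT > 0" "card (P - {p0}) = card P - 1" "card P > 0"
  using fin T0 p0 finP card_gt_0_iff by auto
 define r where "r T = (SOME x. x : T)" for T :: "(complex \<times> complex \<times> complex) set"
 have r: "r T : T" if "T : CT" for T unfolding r_def by (rule someI_ex) (use that in "auto simp: CT_def")
 define n where "n = card CE - (card CT - 1) - (card P - 1) - d"
 have n: "n > 0" "card CE = n + d + card (P - {p0}) + card (CT - {T0})" using card c1 by (auto simp: n_def)
 have lt: "int_lin ZZ (%a. tau a (r T))" for T by (auto simp: int_lin_def tau_def case_prod_beta algebra_simps)
 let ?Z1 = "{a:ZZ. ALL T:CT - {T0}. tau a (r T) = 0}"
 have R1: "Rk ?Z1 (n + d + card (P - {p0})) & int_closed ?Z1"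
  by (rule Rk_kernels) (use fin ZZ_rank ZZ_closed lt n in auto)
 have Z1: "?Z1 = {a:ZZ. ALL x:LT. tau a x = 0}"
 proof (intro equalityI subsetI)
  fix a assume "a : ?Z1"
  then have a: "a : ZZ" "!!T. T : CT - {T0} ==> tau a (r T) = 0" by auto
  have const: "tau a x = tau a (r T)" if "T : CT" "x : T" for T x
  proof -
   have L: "r T : LT" and e: "T = {r T, rot (r T), rot (rot (r T))}" using CT_eq[OF that(1) r[OF that(1)]] by auto
   show ?thesis using that(2) tau_rot[OF a(1) L] tau_rot[OF a(1) rot_LT[OF L]] by (subst (asm) e) auto
  qed
  have off: "tau a x = 0" if "x : LT" "x ~: T0" for x
  proof -
   have m: "{x, rot x, rot (rot x)} : CT" using that by (auto simp: CT_def)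
   moreover have "{x, rot x, rot (rot x)} ~= T0" using that by blast
   ultimately show ?thesis using const[OF m, of x] a(2) by simp
  qed
  have T0L: "T0 \<subseteq> LT" using CT_eq[OF T0] by blast
  have "0 = (\<Sum>x\<in>LT. tau a x)" using sum_tau[OF a(1)] by simp
  also have "... = (\<Sum>x\<in>T0. tau a x)" by (rule sum.mono_neutral_right[OF finite_LT T0L]) (use off in auto)
  also have "... = of_nat (card T0) * tau a (r T0)" using const[OF T0] by simp
  finally have "tau a (r T0) = 0" using T0L finite_LT r[OF T0] by (auto simp: finite_subset)
  then have "ALL x:LT. tau a x = 0" using off const[OF T0] by metis
  then show "a : {a:ZZ. ALL x:LT. tau a x = 0}" using a by simp
 qed (use r CT_eq in blast)
 have ld: "int_lin ?Z1 (%a. dv a p)" for p by (auto simp: int_lin_def dv_def sum.distrib sum_distrib_left)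
 let ?Z2 = "{a:?Z1. ALL p:P - {p0}. dv a p = 0}"
 have R2: "Rk ?Z2 (n + d) & int_closed ?Z2" by (rule Rk_kernels[where L = "%p a. dv a p"]) (use finP R1 ld in auto)
 have ll: "int_lin ?Z2 (L j)" if "j : {..<d}" for j using lin[of j] that unfolding Z1 int_lin_def by auto
 have "Rk {a:?Z2. ALL j:{..<d}. L j a = 0} n" using Rk_kernels[of "{..<d}" ?Z2 n L] R2 ll by auto
 from Rk_nonzero[OF this n(1)] obtain a where a: "a : ZZ" "a ~= (%_. 0)" "ALL x:LT. tau a x = 0" "ALL p:P - {p0}. dv a p = 0" "ALL j<d. L j a = 0"
  unfolding Z1 by auto
 have "0 = (\<Sum>(p, t)\<in>LE. a (p, t))" using sum_LE_0[OF a(1)] by simp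
 also have "... = (\<Sum>p\<in>P. dv a p)" unfolding dv_def by (rule sum_LE_P)
 also have "... = dv a p0 + (\<Sum>p\<in>P - {p0}. dv a p)" by (rule sum.remove[OF finP p0])
 finally have "dv a p0 = 0" using a(4) by simp
 then have "ALL p:P. dv a p = 0" using a(4) by blast
 then show ?thesis using a by blast
qed

end

section \<open>Winding numbers and the first homology group\<close>

definition cpair :: "('b => complex) => ('b \<Rightarrow>\<^sub>0 int) => complex" where
 "cpair w c = (\<Sum>x\<in>Poly_Mapping.keys c. of_int (Poly_Mapping.lookup c x) * w x)"

lemma cpair_superset:
 assumes "finite A" "Poly_Mapping.keys c \<subseteq> A" shows "cpair w c = (\<Sum>x\<in>A. of_int (Poly_Mapping.lookup c x) * w x)"
 unfolding cpair_def by (rule sum.mono_neutral_left) (use assms in "auto simp: in_keys_iff")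

lemma cpair_add: "cpair w (c + d) = cpair w c + cpair w d"
proof -
 let ?A = "Poly_Mapping.keys c \<union> Poly_Mapping.keys d"
 have "cpair w (c + d) = (\<Sum>x\<in>?A. of_int (Poly_Mapping.lookup (c + d) x) * w x)" by (rule cpair_superset) (use keys_add[of c d] in auto)
 moreover have "cpair w c = (\<Sum>x\<in>?A. of_int (Poly_Mapping.lookup c x) * w x)" by (rule cpair_superset) auto
 moreover have "cpair w d = (\<Sum>x\<in>?A. of_int (Poly_Mapping.lookup d x) * w x)" by (rule cpair_superset) auto
 ultimately show ?thesis by (simp add: lookup_add distrib_right sum.distrib)
qed

lemma cpair_cmul: "cpair w (frag_cmul k c) = of_int k * cpair w c"
proof -
 have "cpair w (frag_cmul k c) = (\<Sum>x\<in>Poly_Mapping.keys c. of_int (Poly_Mapping.lookup (frag_cmul k c) x) * w x)"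
  by (rule cpair_superset) (use keys_cmul[of k c] in auto)
 then show ?thesis by (simp add: cpair_def sum_distrib_left mult.assoc)
qed

lemma cpair_0 [simp]: "cpair w 0 = 0" by (simp add: cpair_def)
lemma cpair_of [simp]: "cpair w (frag_of x) = w x" by (simp add: cpair_def)
lemma cpair_sum: "cpair w (sum f A) = (\<Sum>a\<in>A. cpair w (f a))"
 by (induction A rule: infinite_finite_induct) (auto simp: cpair_add)

lemma cpair_boundary:
 assumes "p > 0"
 shows "cpair w (chain_boundary p c) = cpair (%sg. \<Sum>k\<le>p. (- 1) ^ k * w (singular_face p k sg)) c"
 using assms unfolding chain_boundary_def frag_extend_def by (simp add: cpair_sum cpair_cmul cpair_def[of _ c])

section \<open>The winding cochain of a map to the punctured plane\<close>

definition seg :: "real => nat => real" where "seg t = (%i. if i = 0 then 1 - t else if i = 1 then t else 0)"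
definition v0 :: "nat => real" where "v0 = (%i. if i = 0 then 1 else 0)"
text \<open>The increment of a logarithm of \<open>u\<close> along the 1-simplex divided by
  \<open>2 * pi * \<i>\<close>. On a path that is not closed it is a complex number, not an
  integer.\<close>

definition wn :: "('a => complex) => ((nat => real) => 'a) => complex" where
 "wn u sg = winding_number (%t. u (sg (seg t))) 0"

lemma seg_in: "0 <= t ==> t <= 1 ==> seg t : standard_simplex 1"
 by (auto simp: seg_def standard_simplex_def atMost_Suc)

lemma v0_in: "v0 : standard_simplex 0" by (auto simp: v0_def standard_simplex_def)

lemma standard_simplex_0: "standard_simplex 0 = {v0}"
 by (auto simp: v0_def standard_simplex_def fun_eq_iff)

lemma face_1: "simplical_face 0 v0 = seg 1" "simplical_face 1 v0 = seg 0"
 by (auto simp: simplical_face_def v0_def seg_def fun_eq_iff)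

lemma singular_face_1: "singular_face 1 0 sg v0 = sg (seg 1)" "singular_face 1 1 sg v0 = sg (seg 0)"
 using v0_in face_1 by (auto simp: singular_face_def)

lemma wn_log:
 assumes "continuous_on {0..1} q" "!!t. 0 <= t ==> t <= 1 ==> u (sg (seg t)) = exp (q t)"
 shows "wn u sg = (q 1 - q 0) / (2 * of_real pi * \<i>)"
proof -
 have "wn u sg = winding_number (exp \<circ> q) 0" unfolding wn_def by (rule winding_number_cong) (use assms in auto)
 also have "... = (q 1 - q 0) / (2 * of_real pi * \<i>)" using winding_number_compose_exp[of q] assms(1) by (simp add: path_def pathfinish_def pathstart_def)
 finally show ?thesis .
qed

lemma simplex_compose_continuous:
 fixes P :: "'b::topological_space => nat => real"
 assumes "singular_simplex p X sg" "continuous_map X euclidean u" "!!i. continuous_on T (%z. P z i)" "!!z. z : T ==> P z : standard_simplex p"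
 shows "continuous_on T (%z. u (sg (P z)))" "!!z. z : T ==> sg (P z) : topspace X"
proof -
 have s: "continuous_map (subtopology (powertop_real UNIV) (standard_simplex p)) X sg" using assms(1) by (simp add: singular_simplex_def)
 have "continuous_map (top_of_set T) (powertop_real UNIV) P"
  unfolding continuous_map_componentwise_UNIV using assms(3) by simp
 then have P: "continuous_map (top_of_set T) (subtopology (powertop_real UNIV) (standard_simplex p)) P"
  using assms(4) by (auto simp: continuous_map_in_subtopology)
 have "continuous_map (top_of_set T) euclidean (u \<circ> sg \<circ> P)"
  by (intro continuous_map_compose[OF P] continuous_map_compose[OF s] assms(2))
 then show "continuous_on T (%z. u (sg (P z)))" by (simp add: o_def)
 show "sg (P z) : topspace X" if "z : T" for z
  using continuous_map_image_subset_topspace[OF continuous_map_compose[OF P s]] that by auto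
qed

locale circle_map =
 fixes X :: "'a topology" and u :: "'a => complex"
 assumes cont: "continuous_map X euclidean u" and nz: "!!x. x : topspace X ==> u x ~= 0"
begin

lemma seg_path:
 assumes "singular_simplex 1 X sg"
 obtains q where "continuous_on {0..1} q" "!!t. 0 <= t ==> t <= 1 ==> u (sg (seg t)) = exp (q t)"
proof -
 have c: "continuous_on {0..1::real} (%t. seg t i)" for i unfolding seg_def by (cases "i = 0"; cases "i = 1") (auto intro!: continuous_intros)
 have s: "seg t : standard_simplex 1" if "t : {0..1}" for t using that seg_in by auto
 note cc = simplex_compose_continuous[OF assms cont c s]
 obtain q where "continuous_on {0..1} q" "!!t. t : {0..1} ==> u (sg (seg t)) = exp (q t)"
  by (rule continuous_logarithm_on_contractible[OF cc(1)]) (use cc(2) nz in "auto intro: convex_imp_contractible")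
 then show ?thesis using that by auto
qed

text \<open>The 2-simplex is contractible, so \<open>u\<close> has a logarithm on it and the
  increments along the three sides cancel.\<close>

lemma wn_boundary:
 assumes sg: "singular_simplex 2 X sg"
 shows "(\<Sum>k\<le>2. (- 1) ^ k * wn u (singular_face 2 k sg)) = 0"
proof -
 \<comment> \<open>The standard 2-simplex as a plane triangle, whose vertices 0, 1 and
   \<open>\<i>\<close> are the simplex vertices 0, 1 and 2.\<close>
 define T where "T = {z. 0 <= Re z & 0 <= Im z & Re z + Im z <= 1}"
 define Q :: "complex => nat => real" where "Q z = (%i. if i = 0 then 1 - Re z - Im z else if i = 1 then Re z else if i = 2 then Im z else 0)" for z
 have cT: "convex T"
 proof -
  have "T = {z. \<i> \<bullet> z >= 0} \<inter> {z. 1 \<bullet> z >= 0} \<inter> {z. (1 + \<i>) \<bullet> z <= 1}" by (auto simp: T_def inner_complex_def)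
  then show ?thesis by (simp only:) (intro convex_Int convex_halfspace_le convex_halfspace_ge)
 qed
 have c: "continuous_on T (%z. Q z i)" for i unfolding Q_def by (cases "i = 0"; cases "i = 1"; cases "i = 2") (auto intro!: continuous_intros)
 have s: "Q z : standard_simplex 2" if "z : T" for z
  using that by (auto simp: T_def Q_def standard_simplex_def numeral_2_eq_2 atMost_Suc)
 note cc = simplex_compose_continuous[OF sg cont c s]
 obtain G where G: "continuous_on T G" "!!z. z : T ==> u (sg (Q z)) = exp (G z)"
  by (rule continuous_logarithm_on_contractible[OF cc(1) convex_imp_contractible[OF cT]]) (use cc(2) nz in auto)
 have w: "wn u (singular_face 2 k sg) = (G (l 1) - G (l 0)) / (2 * of_real pi * \<i>)"
  if l: "continuous_on {0..1} l" "!!t. 0 <= t ==> t <= 1 ==> l t : T" "!!t. 0 <= t ==> t <= 1 ==> simplical_face k (seg t) = Q (l t)" for k and l :: "real => complex"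
 proof (rule wn_log)
  show "continuous_on {0..1} (%t. G (l t))" by (rule continuous_on_compose2[OF G(1) l(1)]) (use l(2) in auto)
  fix t :: real assume t: "0 <= t" "t <= 1"
  show "u (singular_face 2 k sg (seg t)) = exp (G (l t))"
   using G(2)[OF l(2)[OF t]] l(3)[OF t] seg_in[OF t] by (simp add: singular_face_def)
 qed
 have 0: "wn u (singular_face 2 0 sg) = (G (Complex 0 1) - G (Complex 1 0)) / (2 * of_real pi * \<i>)"
  using w[of "%t. Complex (1 - t) t" 0] by (force simp: T_def Q_def simplical_face_def seg_def fun_eq_iff Complex_eq intro!: continuous_intros)
 have 1: "wn u (singular_face 2 1 sg) = (G (Complex 0 1) - G (Complex 0 0)) / (2 * of_real pi * \<i>)"
  using w[of "%t. Complex 0 t" 1] by (force simp: T_def Q_def simplical_face_def seg_def fun_eq_iff Complex_eq intro!: continuous_intros)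
 have 2: "wn u (singular_face 2 2 sg) = (G (Complex 1 0) - G (Complex 0 0)) / (2 * of_real pi * \<i>)"
  using w[of "%t. Complex t 0" 2] by (force simp: T_def Q_def simplical_face_def seg_def fun_eq_iff Complex_eq intro!: continuous_intros)
 have "(\<Sum>k\<le>2. (- 1) ^ k * wn u (singular_face 2 k sg)) = wn u (singular_face 2 0 sg) - wn u (singular_face 2 1 sg) + wn u (singular_face 2 2 sg)"
  by (simp add: numeral_2_eq_2 atMost_Suc)
 then show ?thesis unfolding 0 1 2 by (simp add: diff_divide_distrib)
qed

lemma cpair_relboundary:
 assumes "singular_relboundary 1 X {} c" shows "cpair (wn u) c = 0"
proof -
 obtain d where d: "singular_chain 2 X d" "chain_boundary 2 d = c"
  using assms unfolding singular_relboundary_def mod_subset_empty Suc_1 by blast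
 have "cpair (wn u) c = cpair (%sg. \<Sum>k\<le>2. (- 1) ^ k * wn u (singular_face 2 k sg)) d"
  unfolding d(2)[symmetric] by (rule cpair_boundary) simp
 also have "... = 0" unfolding cpair_def by (rule sum.neutral) (use d(1) wn_boundary in "auto simp: singular_chain_def")
 finally show ?thesis .
qed

text \<open>Subtract the coboundary of \<open>th\<close>, the principal logarithm over
  \<open>2 * pi * \<i>\<close>: it vanishes on cycles, and what remains is an integer on every
  1-simplex.\<close>

lemma cpair_cycle_int:
 assumes "singular_relcycle 1 X {} c" shows "cpair (wn u) c : \<int>"
proof -
 have c: "singular_chain 1 X c" "chain_boundary 1 c = 0" using assms unfolding singular_relcycle_def mod_subset_empty by auto
 define th where "th ta = Ln (u (ta v0)) / (2 * of_real pi * \<i>)" for ta :: "(nat => real) => 'a"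
 have int: "wn u sg - (th (singular_face 1 0 sg) - th (singular_face 1 1 sg)) : \<int>" if sg: "singular_simplex 1 X sg" for sg
 proof -
  obtain q where q: "continuous_on {0..1} q" "!!t. 0 <= t ==> t <= 1 ==> u (sg (seg t)) = exp (q t)" using seg_path[OF sg] by blast
  obtain n1 :: int where n1: "q 1 - Ln (exp (q 1)) = of_int n1 * (2 * of_real pi * \<i>)"
   using exp_eq[of "q 1" "Ln (exp (q 1))"] by (auto simp: algebra_simps)
  obtain n0 :: int where n0: "q 0 - Ln (exp (q 0)) = of_int n0 * (2 * of_real pi * \<i>)"
   using exp_eq[of "q 0" "Ln (exp (q 0))"] by (auto simp: algebra_simps)
  have "wn u sg - (th (singular_face 1 0 sg) - th (singular_face 1 1 sg)) = ((q 1 - Ln (exp (q 1))) - (q 0 - Ln (exp (q 0)))) / (2 * of_real pi * \<i>)"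
   unfolding th_def singular_face_1 using wn_log[of q u sg, OF q] q(2)[of 1] q(2)[of 0] by (simp add: diff_divide_distrib)
  also have "... = of_int (n1 - n0)" unfolding n1 n0 by (simp add: divide_simps) (simp add: algebra_simps)?
  finally show ?thesis by simp
 qed
 have "cpair (wn u) c = cpair (wn u) c - cpair th (chain_boundary 1 c)" using c by simp
 also have "cpair th (chain_boundary 1 c) = cpair (%sg. th (singular_face 1 0 sg) - th (singular_face 1 1 sg)) c"
  by (subst cpair_boundary) (simp_all add: atMost_Suc)
 also have "cpair (wn u) c - ... = (\<Sum>sg\<in>Poly_Mapping.keys c. of_int (Poly_Mapping.lookup c sg) * (wn u sg - (th (singular_face 1 0 sg) - th (singular_face 1 1 sg))))"
  unfolding cpair_def by (simp add: right_diff_distrib sum_subtractf)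
 also have "... : \<int>" by (intro Ints_sum Ints_mult int Ints_of_int) (use c(1) in "auto simp: singular_chain_def")
 finally show ?thesis .
qed

end

text \<open>The isomorphism is used only to get cycles whose classes generate: an additive
  functional that kills boundaries descends to homology classes, and vanishing on generators it
  vanishes on all cycles.\<close>

lemma H1_generators:
 fixes X :: "'a topology"
 assumes "homology_group 1 X \<cong> free_Abelian_group {..<n::nat}"
 obtains z where "!!i. i < n ==> singular_relcycle 1 X {} (z i)"
  "!!W c. [|!!a b. W (a + b) = W a + (W b :: complex); !!b. singular_relboundary 1 X {} b ==> W b = 0; !!i. i < n ==> W (z i) = 0; singular_relcycle 1 X {} c|] ==> W c = 0"
proof -
 let ?H = "homology_group 1 X" and ?F = "free_Abelian_group {..<n}"
 have "?F \<cong> ?H" using assms by (simp add: group.iso_sym)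
 then obtain h where h: "h : hom ?F ?H" "bij_betw h (carrier ?F) (carrier ?H)" by (auto simp: is_iso_def iso_def)
 have car: "carrier ?H = homologous_rel_set 1 X {} ` singular_relcycle_set 1 X {}"
  using carrier_relative_homology_group[of 1 X "{}"] by simp
 have mul: "A \<otimes>\<^bsub>?H\<^esub> B = (\<Union>r\<in>A. \<Union>s\<in>B. {r + s})" for A B using mult_relative_homology_group[of 1 X "{}"] by simp
 define r where "r K = (SOME c. singular_relcycle 1 X {} c & K = homologous_rel_set 1 X {} c)" for K
 have r: "singular_relcycle 1 X {} (r K) & K = homologous_rel_set 1 X {} (r K)" if "K : carrier ?H" for K
  unfolding r_def by (rule someI_ex) (use that in "auto simp: car")
 have hc: "h x : carrier ?H" if "Poly_Mapping.keys x \<subseteq> {..<n}" for x using h(1) that by (auto simp: hom_def Pi_iff)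
 have key: "W c = 0" if W: "!!a b. W (a + b) = W a + (W b :: complex)" "!!b. singular_relboundary 1 X {} b ==> W b = 0" "!!i. i < n ==> W (r (h (frag_of i))) = 0"
  and c: "singular_relcycle 1 X {} c" for W c
 proof -
  have hom: "W a = W b" if "homologous_rel 1 X {} a b" for a b
   using W(1)[of "a - b" b] W(2)[of "a - b"] that by (simp add: homologous_rel_def)
  have W0: "W 0 = 0" using W(2)[of 0] by simp
  have addh: "W (r (h (x + y))) = W (r (h x)) + W (r (h y))" if xy: "Poly_Mapping.keys x \<subseteq> {..<n}" "Poly_Mapping.keys y \<subseteq> {..<n}" for x y
  proof -
   have "h (x + y) = h x \<otimes>\<^bsub>?H\<^esub> h y" using h(1) xy by (auto simp: hom_def)
   moreover have "r (h x) : h x" using r[OF hc[OF xy(1)]] homologous_rel_refl by blast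
   moreover have "r (h y) : h y" using r[OF hc[OF xy(2)]] homologous_rel_refl by blast
   ultimately have "r (h x) + r (h y) : h (x + y)" unfolding mul by blast
   moreover have "Poly_Mapping.keys (x + y) \<subseteq> {..<n}" using xy keys_add[of x y] by blast
   ultimately have "homologous_rel 1 X {} (r (h (x + y))) (r (h x) + r (h y))" using r[OF hc[of "x + y"]] by blast
   from hom[OF this] show ?thesis unfolding W(1) .
  qed
  have all: "W (r (h x)) = 0" if "Poly_Mapping.keys x \<subseteq> {..<n}" for x
  proof (rule free_Abelian_group_induct[OF that])
   show "W (r (h 0)) = 0" using addh[of 0 0] by simp
   show "W (r (h (x - y))) = 0" if xy: "Poly_Mapping.keys x \<subseteq> {..<n}" "Poly_Mapping.keys y \<subseteq> {..<n}" "W (r (h x)) = 0" "W (r (h y)) = 0" for x y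
   proof -
    have "Poly_Mapping.keys (x - y) \<subseteq> {..<n}" using xy keys_diff[of x y] by blast
    then show ?thesis using addh[of "x - y" y] xy by simp
   qed
   show "W (r (h (frag_of a))) = 0" if "a : {..<n}" for a using W(3) that by simp
  qed
  have "homologous_rel_set 1 X {} c : carrier ?H" using c by (auto simp: car)
  then obtain x where x: "Poly_Mapping.keys x \<subseteq> {..<n}" "homologous_rel_set 1 X {} c = h x"
   using h(2) unfolding bij_betw_def by (metis (no_types, lifting) carrier_free_Abelian_group_iff imageE)
  have "c : h x" using x(2) homologous_rel_refl by blast
  then have "homologous_rel 1 X {} (r (h x)) c" using r[OF hc[OF x(1)]] by blast
  from hom[OF this] all[OF x(1)] show ?thesis by simp
 qed
 show ?thesis
 proof (rule that)
  show "singular_relcycle 1 X {} (r (h (frag_of i)))" if "i < n" for i using r[OF hc[of "frag_of i"]] that by simp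
 qed (use key in blast)
qed

section \<open>Circle-valued maps from cocycles\<close>

lemma wn_powi:
 assumes "circle_map X u" "circle_map X v" "singular_simplex 1 X sg" "!!x. x : topspace X ==> w x = u x powi k * v x powi l"
 shows "wn w sg = of_int k * wn u sg + of_int l * wn v sg"
proof -
 obtain q where q: "continuous_on {0..1} q" "!!t. 0 <= t ==> t <= 1 ==> u (sg (seg t)) = exp (q t)" using circle_map.seg_path[OF assms(1,3)] by blast
 obtain r where r: "continuous_on {0..1} r" "!!t. 0 <= t ==> t <= 1 ==> v (sg (seg t)) = exp (r t)" using circle_map.seg_path[OF assms(2,3)] by blast
 have top: "sg (seg t) : topspace X" if "0 <= t" "t <= 1" for t
  using assms(3) seg_in[OF that] unfolding singular_simplex_def continuous_map_def by (auto simp: Pi_iff)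
 have "wn w sg = ((of_int k * q 1 + of_int l * r 1) - (of_int k * q 0 + of_int l * r 0)) / (2 * of_real pi * \<i>)"
  by (rule wn_log[where q = "%t. of_int k * q t + of_int l * r t"]) (use q r assms(4)[OF top] in "auto intro!: continuous_intros simp: exp_add exp_power_int")
 also have "... = of_int k * ((q 1 - q 0) / (2 * of_real pi * \<i>)) + of_int l * ((r 1 - r 0) / (2 * of_real pi * \<i>))"
  by (simp only: times_divide_eq_right add_divide_distrib[symmetric]) (simp add: algebra_simps)
 finally show ?thesis using wn_log[where q = q and u = u and sg = sg, OF q] wn_log[where q = r and u = v and sg = sg, OF r] by simp
qed

lemma continuous_on_Min:
 fixes f :: "'b => 'a::topological_space => real"
 assumes "finite A" "A ~= {}" "!!s. s : A ==> continuous_on N (f s)"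
 shows "continuous_on N (%z. Min ((%s. f s z) ` A))"
 using assms by (induction rule: finite_ne_induct) (auto intro!: continuous_on_min)

lemma continuous_on_local:
 fixes f :: "complex => 'b::topological_space"
 assumes "!!x. x : S ==> EX N. open N & x : N & continuous_on N f" shows "continuous_on S f"
proof (intro continuous_at_imp_continuous_on ballI)
 fix x assume "x : S" then show "isCont f x" using assms continuous_on_interior interior_open by metis
qed

text \<open>A point of the geodesic segment from \<open>s\<close> to \<open>c\<close> is a
  nonnegative combination of the two end points in the hyperboloid model.\<close>

lemma ray_hcosh:
 assumes s: "s : uhp" and c: "c : uhp" and ta: "0 <= ta" "ta <= 1"
 shows "icay s (of_real ta * cay s c) : uhp"
  "EX al>=0. EX be>=0. ALL r:uhp. hcosh (icay s (of_real ta * cay s c)) r = al * hcosh s r + be * hcosh c r"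
proof -
 define w where "w = cay s c"
 have w: "cmod w < 1" using norm_cay_less_1[OF s c] by (simp add: w_def)
 have tw: "cmod (of_real ta * w) < 1" using w ta mult_right_le_one_le[of "cmod w" ta] by (simp add: norm_mult mult.commute)
 show v: "icay s (of_real ta * cay s c) : uhp" using icay_in_uhp[OF s tw] by (simp add: w_def)
 have cv: "cay s (icay s (of_real ta * cay s c)) = of_real ta * w" using cay_icay[OF s tw] by (simp add: w_def)
 define W where "W = (cmod w)^2"
 have W: "0 <= W" "W < 1" using w by (auto simp: W_def abs_square_less_1)
 have n2: "(cmod (of_real ta * w))^2 = ta\<^sup>2 * W" by (simp add: norm_mult power_mult_distrib W_def)
 have tW: "ta\<^sup>2 * W < 1" using tw unfolding n2[symmetric] by (simp add: abs_square_less_1)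
 have t1: "1 - ta * W >= 0" using ta W mult_le_one[of ta W] by simp
 define al be where "al = (1 - ta) * (1 - ta * W) / (1 - ta\<^sup>2 * W)" and "be = ta * (1 - W) / (1 - ta\<^sup>2 * W)"
 have "hcosh (icay s (of_real ta * cay s c)) r = al * hcosh s r + be * hcosh c r" if r: "r : uhp" for r
 proof -
  define R C where "R = (cmod (cay s r))^2" and "C = Re (w * cnj (cay s r))"
  have R: "R < 1" using norm_cay_less_1[OF s r] by (simp add: R_def abs_square_less_1)
  have 1: "hcosh (icay s (of_real ta * cay s c)) r = ((1 + ta\<^sup>2 * W) * (1 + R) - 4 * (ta * C)) / ((1 - ta\<^sup>2 * W) * (1 - R))"
  proof -
   have "Re (of_real ta * w * cnj (cay s r)) = ta * C" by (simp add: C_def algebra_simps)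
   then show ?thesis unfolding hcosh_cay[OF s v r] cv n2 R_def by simp
  qed
  have 2: "hcosh c r = ((1 + W) * (1 + R) - 4 * C) / ((1 - W) * (1 - R))"
   unfolding hcosh_cay[OF s c r] W_def R_def C_def w_def ..
  have 3: "hcosh s r = (1 + R) / (1 - R)" unfolding hcosh_center[OF s r] R_def ..
  have gen: "A / (D * M) = a / D * (B / M) + b * K / D * (E / (K * M))" if "A = a * B + b * E" "D > 0" "M > 0" "K > 0" for A a B b E D M K :: real
   using that by (simp add: field_simps)
  show ?thesis unfolding 1 2 3 al_def be_def
   by (rule gen) (use R W tW in "auto simp: algebra_simps power2_eq_square")
 qed
 moreover have "al >= 0" "be >= 0" using ta W tW t1 by (auto simp: al_def be_def)
 ultimately show "EX al>=0. EX be>=0. ALL r:uhp. hcosh (icay s (of_real ta * cay s c)) r = al * hcosh s r + be * hcosh c r" by blast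
qed

context net
begin

text \<open>Voronoi cells are star-shaped about their sites: add the inequality at \<open>c\<close>
  to the trivial one at \<open>s\<close>.\<close>

lemma near_ray:
 assumes "c : uhp" "near c s" "0 <= ta" "ta <= 1" shows "near (icay s (of_real ta * cay s c)) s"
proof -
 have S: "s : SS" "s : uhp" using assms(2) SS_uhp by (auto simp: near_def)
 obtain al be where ab: "al >= 0" "be >= 0" "!!r. r : uhp ==> hcosh (icay s (of_real ta * cay s c)) r = al * hcosh s r + be * hcosh c r"
  using ray_hcosh(2)[OF S(2) assms(1,3,4)] by blast
 show ?thesis unfolding near_def
 proof (intro conjI ballI)
  fix t assume t: "t : SS"
  have "al * hcosh s s + be * hcosh c s <= al * hcosh s t + be * hcosh c t"
   using ab hcosh_ge_1[OF S(2) SS_uhp[OF t]] assms(2) t by (intro add_mono mult_left_mono) (auto simp: near_def)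
  then show "hcosh (icay s (of_real ta * cay s c)) s <= hcosh (icay s (of_real ta * cay s c)) t"
   using ab(3)[OF S(2)] ab(3)[OF SS_uhp[OF t]] by simp
 qed (rule S)
qed

lemma SS_local:
 assumes "z : uhp"
 obtains N A where "open N" "z : N" "N \<subseteq> uhp" "finite A" "A \<subseteq> SS" "ALL y:N. ALL s:SS. hcosh y s < 2 * cosh eps --> s : A"
proof -
 obtain r where r: "r > 0" "cball z r \<subseteq> uhp" using open_uhp assms open_contains_cball by blast
 define A where "A = {s:SS. EX y:cball z r. hcosh y s <= 2 * cosh eps}"
 have "finite A" unfolding A_def by (rule SS_locally_finite[OF compact_cball r(2)])
 then show ?thesis by (intro that[of "ball z r" A]) (use r in "auto simp: A_def intro: less_imp_le")
qed

section \<open>Thickened Voronoi cells and the circle-valued map\<close>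

definition Em :: "complex => real" where "Em z = hcosh z (SOME s. near z s)"

lemma Em_near: assumes "z : uhp" "near z s" shows "Em z = hcosh z s"
 unfolding Em_def using someI[of "near z", OF assms(2)] assms(2) by (rule near_eq)

lemma Em_le: assumes "z : uhp" "s : SS" shows "Em z <= hcosh z s"
 using near_exists[OF assms(1)] Em_near[OF assms(1)] assms(2) unfolding near_def by metis

lemma Em_bounds: assumes "z : uhp" shows "Em z >= 1" "Em z < cosh eps"
proof -
 obtain s where s: "near z s" using near_exists[OF assms] by blast
 then show "Em z >= 1" "Em z < cosh eps" using Em_near[OF assms s] hcosh_ge_1[OF assms] near_less(1)[OF assms s] SS_uhp by (auto simp: near_def)
qed

lemma Em_inv: assumes "g : \<Gamma>" "z : uhp" shows "Em (g z) = Em z"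
proof -
 obtain s where s: "near z s" using near_exists[OF assms(2)] by blast
 then show ?thesis using Em_near[OF assms(2) s] Em_near[OF in_uhp[OF assms] near_inv[OF assms s]] hcosh_inv[OF assms] SS_uhp by (simp add: near_def)
qed

lemma continuous_on_hcosh_left: "s : uhp ==> N \<subseteq> uhp ==> continuous_on N (%z. hcosh z s)"
 by (intro continuous_intros) auto

lemma continuous_Em: "continuous_on uhp Em"
proof (rule continuous_on_local)
 fix z assume z: "z : uhp"
 obtain N A where N: "open N" "z : N" "N \<subseteq> uhp" "finite A" "A \<subseteq> SS" "ALL y:N. ALL s:SS. hcosh y s < 2 * cosh eps --> s : A"
  using SS_local[OF z] .
 note N6 = N(6)[rule_format]
 have m: "Em y = Min ((%s. hcosh y s) ` A) & A ~= {}" if y: "y : N" for y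
 proof -
  have yu: "y : uhp" using y N(3) by blast
  obtain s where s: "near y s" using near_exists[OF yu] by blast
  have sA: "s : A" using N6[OF y, of s] s near_less(1)[OF yu s] cosh_real_ge_1[of eps] by (auto simp: near_def)
  have "Min ((%s. hcosh y s) ` A) = hcosh y s"
   by (rule Min_eqI) (use N(4,5) sA s in "auto simp: near_def")
  then show ?thesis using Em_near[OF yu s] sA by auto
 qed
 have "continuous_on N (%y. Min ((%s. hcosh y s) ` A))"
  by (rule continuous_on_Min) (use N m[OF N(2)] SS_uhp continuous_on_hcosh_left in auto)
 then have "continuous_on N Em" using m by (simp cong: continuous_on_cong)
 then show "EX N. open N & z : N & continuous_on N Em" using N by blast
qed

text \<open>Sites that are nearly nearest at a point close to \<open>z\<close> are nearest at
  \<open>z\<close> itself, because the other sites are farther from \<open>z\<close> by a definite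
  factor.\<close>

lemma delta_local:
 assumes z: "z : uhp"
 shows "EX N de. open N & z : N & 0 < de & de < 1 & (ALL y:N \<inter> uhp. Spx {s:SS. hcosh y s < (1 + de) * Em y})"
proof -
 obtain N A where N: "open N" "z : N" "N \<subseteq> uhp" "finite A" "A \<subseteq> SS" "ALL y:N. ALL s:SS. hcosh y s < 2 * cosh eps --> s : A"
  using SS_local[OF z] .
 note N6 = N(6)[rule_format]
 obtain s0 where s0: "near z s0" using near_exists[OF z] by blast
 have s0u: "s0 : uhp" "s0 : SS" using s0 SS_uhp by (auto simp: near_def)
 define k where "k = hcosh z s0"
 have k: "k > 0" using hcosh_ge_1[OF z s0u(1)] by (simp add: k_def)
 define B where "B = {s:A. ~ near z s}"
 have finB: "finite B" using N(4) by (simp add: B_def)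
 have Bk: "hcosh z s > k" if "s : B" for s
  using that N(5) s0 unfolding B_def near_def k_def by (force intro: order_trans)
 \<comment> \<open>Half of the smallest relative gap at \<open>z\<close>, so that the inequality is
   strict there and persists nearby; the bound 1/2 keeps all candidates among the finitely many
   sites \<open>A\<close>.\<close>
 define de where "de = Min (insert (1/2) ((%s. (hcosh z s / k - 1) / 2) ` B))"
 have de1: "0 < de" unfolding de_def using finB Bk k by (auto simp: Min_gr_iff)
 have de3: "de <= 1/2" unfolding de_def using finB by (intro Min_le) auto
 have de2: "de <= (hcosh z s / k - 1) / 2" if "s : B" for s unfolding de_def using finB that by (intro Min_le) auto
 have "eventually (%y. ALL s:B. (1 + de) * hcosh y s0 < hcosh y s) (nhds z)"
 proof (intro eventually_ball_finite[OF finB] ballI)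
  fix s assume s: "s : B"
  have su: "s : uhp" using s N(5) SS_uhp by (auto simp: B_def)
  define H where "H = (%y. hcosh y s - (1 + de) * hcosh y s0)"
  have "continuous_on uhp H" unfolding H_def using su s0u by (intro continuous_intros) auto
  then have "isCont H z" using z open_uhp by (simp add: continuous_on_eq_continuous_at)
  then have t: "(H \<longlongrightarrow> H z) (nhds z)" by (simp add: isCont_def tendsto_at_iff_tendsto_nhds)
  have "de < hcosh z s / k - 1" using de2[OF s] de1 by simp
  then have "(1 + de) * k < hcosh z s" using k by (simp add: field_simps)
  then have "0 < H z" by (simp add: k_def H_def)
  from order_tendstoD(1)[OF t this] show "eventually (%y. (1 + de) * hcosh y s0 < hcosh y s) (nhds z)" by (simp add: H_def)
 qed
 then obtain M where M: "open M" "z : M" "!!y s. y : M ==> s : B ==> (1 + de) * hcosh y s0 < hcosh y s"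
  unfolding eventually_nhds by blast
 have "Spx {s:SS. hcosh y s < (1 + de) * Em y}" if y: "y : N \<inter> M" for y
  unfolding Spx_def
 proof (intro bexI[OF _ z] ballI)
  fix s assume s: "s : {s:SS. hcosh y s < (1 + de) * Em y}"
  have yu: "y : uhp" using y N(3) by blast
  have "(1 + de) * Em y <= 2 * cosh eps" using de1 de3 Em_bounds[OF yu] by (intro mult_mono) auto
  then have sA: "s : A" using N6[of y s] y s by auto
  have "(1 + de) * Em y <= (1 + de) * hcosh y s0" using Em_le[OF yu s0u(2)] de1 by (intro mult_left_mono) auto
  then have "s ~: B" using M(3)[of y s] y s by auto
  then show "near z s" using sA by (simp add: B_def)
 qed
 then show ?thesis using N M de1 de3 by (intro exI[of _ "N \<inter> M"] exI[of _ de]) auto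
qed

text \<open>Finitely many of the local constants serve for \<open>KK\<close>, and translation
  carries the smallest one everywhere.\<close>

lemma delta_exists: "EX de. 0 < de & de < 1 & (ALL z:uhp. Spx {s:SS. hcosh z s < (1 + de) * Em z})"
proof -
 define Q where "Q z x \<longleftrightarrow> open (fst x) & z : fst x & 0 < snd x & snd x < 1 & (ALL y:fst x \<inter> uhp. Spx {s:SS. hcosh y s < (1 + snd x) * Em y})" for z and x :: "complex set \<times> real"
 have "ALL z:KK. EX x. Q z x"
 proof
  fix z assume "z : KK"
  then obtain N de where "open N & z : N & 0 < de & de < 1 & (ALL y:N \<inter> uhp. Spx {s:SS. hcosh y s < (1 + de) * Em y})"
   using delta_local[of z] KK(2) by (auto simp del: Int_iff)
  then have "Q z (N, de)" by (simp add: Q_def)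
  then show "EX x. Q z x" ..
 qed
 from bchoice[OF this] obtain h where h: "ALL z:KK. Q z (h z)" by (elim exE) (rule that)
 define N de where "N z = fst (h z)" and "de z = snd (h z)" for z
 have N: "open (N z) & z : N z & 0 < de z & de z < 1 & (ALL y:N z \<inter> uhp. Spx {s:SS. hcosh y s < (1 + de z) * Em y})" if "z : KK" for z
  using h that unfolding Q_def N_def de_def by simp
 obtain D where D: "D \<subseteq> KK" "finite D" "KK \<subseteq> (\<Union>z\<in>D. N z)"
  by (rule compactE_image[OF KK(1), of KK N]) (use N in auto)
 define d where "d = Min (insert (1/2) (de ` D))"
 have d: "0 < d" "d < 1" "!!z. z : D ==> d <= de z"
  unfolding d_def using D N by (auto simp: Min_gr_iff Min_less_iff)
 have "Spx {s:SS. hcosh z s < (1 + d) * Em z}" if z: "z : uhp" for z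
 proof -
  obtain f where f: "f : \<Gamma>" "f z : KK" using move[OF z] by blast
  obtain y where y: "y : D" "f z : N y" using D f by blast
  have fu: "f z : uhp" using in_uhp f z by blast
  have S: "Spx {s:SS. hcosh (f z) s < (1 + de y) * Em (f z)}" using N[of y] y D fu by blast
  have "{s:SS. hcosh z s < (1 + d) * Em z} \<subseteq> ivt f ` {s:SS. hcosh (f z) s < (1 + de y) * Em (f z)}"
  proof
   fix s assume s: "s : {s:SS. hcosh z s < (1 + d) * Em z}"
   have su: "s : uhp" using s SS_uhp by blast
   have "(1 + d) * Em z <= (1 + de y) * Em z" using d(3)[OF y(1)] Em_bounds[OF z] by (intro mult_right_mono) auto
   then have "f s : {s:SS. hcosh (f z) s < (1 + de y) * Em (f z)}" using s SS_inv[OF f(1)] hcosh_inv[OF f(1) z su] Em_inv[OF f(1) z] by auto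
   moreover have "s = ivt f (f s)" using ivt_props(2)[OF f(1) su] by simp
   ultimately show "s : ivt f ` {s:SS. hcosh (f z) s < (1 + de y) * Em (f z)}" by blast
  qed
  then show ?thesis using Spx_mono[OF Spx_inv[OF ivt_props(1)[OF f(1)] S]] by blast
 qed
 then show ?thesis using d by blast
qed

definition dl :: real where "dl = (SOME de. 0 < de & de < 1 & (ALL z:uhp. Spx {s:SS. hcosh z s < (1 + de) * Em z}))"
text \<open>The \<open>psi t\<close> are tent functions on slightly thickened Voronoi cells, whose nerve is still the Delaunay complex;
  \<open>fs a s\<close> interpolates the cochain \<open>a\<close> seen from \<open>s\<close>, and a change of \<open>s\<close> alters it by an integer.\<close>
definition psi :: "complex => complex => real" where "psi t z = max 0 ((1 + dl) * Em z - hcosh z t)"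
definition Su :: "complex => complex set" where "Su z = {t:SS. hcosh z t < (1 + dl) * Em z}"
definition fs :: "(complex \<times> complex => int) => complex => complex => real" where
 "fs a s z = (\<Sum>t\<in>Su z. of_int (a (s, t)) * psi t z) / (\<Sum>t\<in>Su z. psi t z)"
definition UU :: "(complex \<times> complex => int) => complex => complex" where
 "UU a z = exp (2 * of_real pi * \<i> * of_real (fs a (SOME s. near z s) z))"
definition cocyc :: "(complex \<times> complex => int) set" where "cocyc = {a:ZZ. ALL x:LT. tau a x = 0}"

lemma dl: "0 < dl" "dl < 1" "z : uhp ==> Spx (Su z)"
 using someI_ex[OF delta_exists, folded dl_def] by (auto simp: Su_def)

lemma near_Su: assumes "z : uhp" "near z s" shows "s : Su z"
 using assms Em_near[OF assms] Em_bounds[OF assms(1)] dl(1) by (auto simp: Su_def near_def)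

lemma psi_pos: "t : Su z ==> psi t z > 0" by (auto simp: Su_def psi_def)
lemma psi_0: "t : SS ==> t ~: Su z ==> psi t z = 0" by (auto simp: Su_def psi_def)

lemma Su_less: assumes "z : uhp" "t : Su z" shows "hcosh z t < 2 * cosh eps"
proof -
 have "(1 + dl) * Em z <= 2 * cosh eps" using dl Em_bounds[OF assms(1)] by (intro mult_mono) auto
 then show ?thesis using assms by (simp add: Su_def)
qed

lemma finite_Su: assumes "z : uhp" shows "finite (Su z)"
proof -
 have "Su z \<subseteq> {s:SS. EX y:{z}. hcosh y s <= 2 * cosh eps}" using Su_less[OF assms] by (auto simp: Su_def intro: less_imp_le)
 then show ?thesis by (rule finite_subset) (rule SS_locally_finite, use assms in auto)
qed

lemma sum_psi_pos: assumes "z : uhp" shows "(\<Sum>t\<in>Su z. psi t z) > 0"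
 using near_exists[OF assms] near_Su[OF assms] finite_Su[OF assms] psi_pos by (intro sum_pos) auto

lemma continuous_psi: "t : SS ==> N \<subseteq> uhp ==> continuous_on N (psi t)"
 unfolding psi_def[abs_def] by (intro continuous_intros continuous_on_subset[OF continuous_Em] continuous_on_hcosh_left) (auto simp: SS_uhp)

text \<open>Locally \<open>Su\<close> may be replaced by one fixed finite set of sites, since the
  tent functions vanish off \<open>Su\<close>.\<close>

lemma continuous_fs: "continuous_on uhp (fs a s)"
proof (rule continuous_on_local)
 fix z assume z: "z : uhp"
 obtain N A where N: "open N" "z : N" "N \<subseteq> uhp" "finite A" "A \<subseteq> SS" "ALL y:N. ALL s:SS. hcosh y s < 2 * cosh eps --> s : A"
  using SS_local[OF z] .
 note N6 = N(6)[rule_format]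
 have sub: "Su y \<subseteq> A" if "y : N" for y using N(3) N6 Su_less that by (auto simp: Su_def)
 have e: "(\<Sum>t\<in>Su y. c t * psi t y) = (\<Sum>t\<in>A. c t * psi t y)" if "y : N" for y and c :: "complex => real"
  by (rule sum.mono_neutral_left[OF N(4) sub[OF that]]) (use psi_0 N(5) in auto)
 have e1: "(\<Sum>t\<in>Su y. psi t y) = (\<Sum>t\<in>A. psi t y)" if "y : N" for y using e[OF that, of "%_. 1"] by simp
 have "continuous_on N (%y. (\<Sum>t\<in>A. of_int (a (s, t)) * psi t y) / (\<Sum>t\<in>A. psi t y))"
 proof (intro continuous_intros ballI)
  show "(\<Sum>t\<in>A. psi t y) ~= 0" if "y : N" for y using sum_psi_pos[of y] e1[OF that] that N(3) by auto
 qed (use continuous_psi N in auto)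
 then have "continuous_on N (fs a s)" by (rule continuous_on_cong[THEN iffD1, rotated 2]) (auto simp: fs_def e e1)
 then show "EX N. open N & z : N & continuous_on N (fs a s)" using N by blast
qed

text \<open>Nondegenerate triples are triangles in one of the two orientations; degenerate ones
  follow from alternation.\<close>

lemma cocyc_Spx: assumes a: "a : cocyc" and S: "Spx {s, t, u}" shows "a (s, t) + a (t, u) + a (u, s) = 0"
proof -
 have Z: "a : ZZ" and tau0: "!!x. x : LT ==> tau a x = 0" using a by (auto simp: cocyc_def)
 have anti: "a (y, x) = - a (x, y)" for x y by (rule ZZ_D(2)[OF Z])
 have diag: "a (x, x) = 0" for x using anti[of x x] by simp
 have T: "a (x, y) + a (y, w) + a (w, x) = 0" if t: "tri x y w" for x y w
 proof -
  have x: "x : SS" using tri_SS[OF t] by simp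
  have "(red x x, red x y, red x w) : LT" using red[OF x] tri_inv[OF red(1)[OF x] t] by (simp add: LT_I)
  from tau0[OF this] tau_inv[OF Z red(1)[OF x] t] have "tau a (x, y, w) = 0" by (simp only:)
  then show ?thesis by (simp add: tau_def)
 qed
 consider "s = t" | "t = u" | "s = u" | "tri s t u" | "tri s u t" using Spx3_oriented[OF S] by blast
 then show ?thesis
 proof cases
  case 1 then show ?thesis using diag[of s] anti[of u s] by simp
 next
  case 2 then show ?thesis using diag[of t] anti[of s t] by simp
 next
  case 3 then show ?thesis using diag[of s] anti[of s t] by simp
 next
  case 4 then show ?thesis by (rule T)
 next
  case 5 then show ?thesis using T[OF 5] anti[of s u] anti[of u t] anti[of t s] by simp
 qed
qed

text \<open>By \<open>dl\<close> all sites in \<open>Su z\<close> span a simplex, so the cocycle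
  relation gives \<open>a (s, t) - a (s', t) = a (s, s')\<close> for each \<open>t\<close>, and a
  weighted average of equal numbers is that number.\<close>

lemma fs_diff:
 assumes a: "a : cocyc" and z: "z : uhp" and s: "s : Su z" "s' : Su z" shows "fs a s z - fs a s' z = of_int (a (s, s'))"
proof -
 have Z: "a : ZZ" using a by (simp add: cocyc_def)
 let ?D = "\<Sum>t\<in>Su z. psi t z"
 have D: "?D > 0" by (rule sum_psi_pos[OF z])
 have k: "a (s, t) - a (s', t) = a (s, s')" if "t : Su z" for t
 proof -
  have "Spx {s, t, s'}" by (rule Spx_mono[OF dl(3)[OF z]]) (use s that in auto)
  from cocyc_Spx[OF a this] show ?thesis using ZZ_D(2)[OF Z, of t s'] ZZ_D(2)[OF Z, of s s'] by simp
 qed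
 have "fs a s z - fs a s' z = (\<Sum>t\<in>Su z. of_int (a (s, t) - a (s', t)) * psi t z) / ?D"
  unfolding fs_def by (simp add: diff_divide_distrib left_diff_distrib sum_subtractf)
 also have "(\<Sum>t\<in>Su z. of_int (a (s, t) - a (s', t)) * psi t z) = (\<Sum>t\<in>Su z. of_int (a (s, s')) * psi t z)" by (rule sum.cong) (simp_all only: k)
 also have "... / ?D = of_int (a (s, s'))" using D by (simp add: sum_distrib_left[symmetric])
 finally show ?thesis .
qed

lemma exp_int: "exp (2 * of_real pi * \<i> * of_real (x + of_int n)) = exp (2 * of_real pi * \<i> * of_real x)"
 using exp_integer_2pi[of "of_int n"] by (simp add: exp_add algebra_simps)

lemma UU_eq: assumes a: "a : cocyc" and z: "z : uhp" and s: "s : Su z" shows "UU a z = exp (2 * of_real pi * \<i> * of_real (fs a s z))"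
proof -
 define s0 where "s0 = (SOME s. near z s)"
 have n: "near z s0" unfolding s0_def by (rule someI_ex) (rule near_exists[OF z])
 have "fs a s0 z = fs a s z + of_int (a (s0, s))" using fs_diff[OF a z near_Su[OF z n] s] by simp
 then show ?thesis unfolding UU_def s0_def[symmetric] by (simp only: exp_int)
qed

text \<open>On the open set where \<open>psi s\<close> is positive, the fixed site \<open>s\<close>
  can replace the chosen nearest site.\<close>

lemma continuous_UU: assumes a: "a : cocyc" shows "continuous_on uhp (UU a)"
proof (rule continuous_on_local)
 fix z assume z: "z : uhp"
 obtain s where s: "near z s" using near_exists[OF z] by blast
 have sS: "s : SS" using s by (simp add: near_def)
 define N where "N = {y:uhp. psi s y > 0}"
 have iff: "y : N \<longleftrightarrow> y : uhp & s : Su y" for y using psi_pos psi_0[OF sS] by (force simp: N_def)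
 have "N = uhp \<inter> psi s -` {0<..}" by (auto simp: N_def)
 then have "open N" using continuous_open_preimage[OF continuous_psi[OF sS order_refl] open_uhp open_greaterThan] by simp
 moreover have "z : N" using iff z near_Su[OF z s] by simp
 moreover have "continuous_on N (UU a)"
 proof -
  have "N \<subseteq> uhp" using iff by blast
  then have "continuous_on N (%y. exp (2 * of_real pi * \<i> * of_real (fs a s y)))"
   by (intro continuous_intros continuous_on_subset[OF continuous_fs])
  then show ?thesis by (rule continuous_on_cong[THEN iffD1, rotated 2]) (use UU_eq[OF a] iff in auto)
 qed
 ultimately show "EX N. open N & z : N & continuous_on N (UU a)" by blast
qed

lemma Su_inv: assumes g: "g : \<Gamma>" and z: "z : uhp" shows "Su (g z) = g ` Su z" "t : SS ==> psi (g t) (g z) = psi t z"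
proof -
 show "t : SS ==> psi (g t) (g z) = psi t z" using hcosh_inv[OF g z SS_uhp] Em_inv[OF g z] by (simp add: psi_def)
 have "g t : Su (g z)" if "t : Su z" for t using that SS_inv[OF g] hcosh_inv[OF g z SS_uhp] Em_inv[OF g z] by (simp add: Su_def)
 moreover have "t : g ` Su z" if t: "t : Su (g z)" for t
 proof -
  have tu: "t : uhp" "t : SS" using t SS_uhp by (auto simp: Su_def)
  have i: "ivt g t : SS" "g (ivt g t) = t" using SS_inv[OF ivt_props(1)[OF g] tu(2)] ivt_right[OF g tu(1)] by auto
  then have "ivt g t : Su z" using t hcosh_inv[OF g z SS_uhp[OF i(1)]] Em_inv[OF g z] by (simp add: Su_def)
  then show ?thesis using i(2) by (metis imageI)
 qed
 ultimately show "Su (g z) = g ` Su z" by blast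
qed

lemma ZZ_inv: assumes a: "a : ZZ" and g: "g : \<Gamma>" and S: "s : SS" "t : SS" shows "a (g s, g t) = a (s, t)"
proof (cases "adj s t")
 case False
 have "~ adj (g s) (g t)"
 proof
  assume "adj (g s) (g t)"
  from adj_inv[OF ivt_props(1)[OF g] this] show False using False ivt_props(2)[OF g] SS_uhp[OF S(1)] SS_uhp[OF S(2)] by simp
 qed
 then show ?thesis using ZZ_D(3)[OF a] False by simp
qed (rule ZZ_D(1)[OF a g])

lemma fs_inv: assumes a: "a : ZZ" and g: "g : \<Gamma>" and z: "z : uhp" and s: "s : SS" shows "fs a (g s) (g z) = fs a s z"
proof -
 have i: "inj_on g (Su z)" using inj[OF g] SS_uhp by (auto simp: inj_on_def Su_def)
 have S: "t : SS" if "t : Su z" for t using that by (simp add: Su_def)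
 show ?thesis unfolding fs_def Su_inv(1)[OF g z] sum.reindex[OF i]
  using S Su_inv(2)[OF g z] ZZ_inv[OF a g s] by (simp cong: sum.cong)
qed

lemma UU_inv: assumes a: "a : cocyc" and g: "g : \<Gamma>" and z: "z : uhp" shows "UU a (g z) = UU a z"
proof -
 obtain s where s: "near z s" using near_exists[OF z] by blast
 have "UU a (g z) = exp (2 * of_real pi * \<i> * of_real (fs a (g s) (g z)))" by (rule UU_eq[OF a in_uhp[OF g z] near_Su[OF in_uhp[OF g z] near_inv[OF g z s]]])
 then show ?thesis using fs_inv[of a, OF _ g z, of s] a s UU_eq[OF a z near_Su[OF z s]] by (simp add: cocyc_def near_def)
qed

lemma UU_comb:
 assumes "a : cocyc" "b : cocyc" "z : uhp"
 shows "UU (%e. k * a e + l * b e) z = UU a z powi k * UU b z powi l"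
proof -
 have "fs (%e. k * a e + l * b e) s z = of_int k * fs a s z + of_int l * fs b s z" for s
  unfolding fs_def times_divide_eq_right add_divide_distrib[symmetric] by (simp add: distrib_right sum.distrib sum_distrib_left mult.assoc)
 then show ?thesis unfolding UU_def by (simp add: exp_power_int exp_add[symmetric] algebra_simps)
qed

lemma cocyc_closed: "int_closed cocyc"
 unfolding int_closed_def
proof (intro ballI allI)
 fix a b k l assume ab: "a : cocyc" "b : cocyc"
 have "tau (%e. k * a e + l * b e) x = k * tau a x + l * tau b x" for x by (simp add: tau_def case_prod_beta algebra_simps)
 then show "(%e. k * a e + l * b e) : cocyc" using ab ZZ_closed unfolding cocyc_def int_closed_def by simp
qed

end

section \<open>Genus, area and the main theorem\<close>

context fuchsian
begin

lemma orbit_inv: assumes "g : \<Gamma>" "z : uhp" shows "orbit \<Gamma> (g z) = orbit \<Gamma> z"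
proof (intro equalityI subsetI)
 fix w assume "w : orbit \<Gamma> (g z)"
 then obtain f where f: "f : \<Gamma>" "w = f (g z)" by (auto simp: orbit_def)
 have "w = cmp f g z" using cmp_props(2)[OF f(1) assms(1,2)] f(2) by simp
 then show "w : orbit \<Gamma> z" using cmp_props(1)[OF f(1) assms(1)] unfolding orbit_def by blast
next
 fix w assume "w : orbit \<Gamma> z"
 then obtain f where f: "f : \<Gamma>" "w = f z" by (auto simp: orbit_def)
 have "w = cmp f (ivt g) (g z)" using cmp_props(2)[OF f(1) ivt_props(1)[OF assms(1)] in_uhp[OF assms]] ivt_props(2)[OF assms] f by simp
 then show "w : orbit \<Gamma> (g z)" using cmp_props(1)[OF f(1) ivt_props(1)[OF assms(1)]] unfolding orbit_def by blast
qed

lemma orbit_eqD: assumes "orbit \<Gamma> z = orbit \<Gamma> w" shows "EX f:\<Gamma>. w = f z"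
proof -
 have "w : orbit \<Gamma> w" using id_in by (auto simp: orbit_def intro!: exI[of _ id])
 then show ?thesis using assms by (auto simp: orbit_def)
qed

text \<open>The straight segment from \<open>z\<close> to \<open>g z\<close> stays in the convex set
  \<open>uhp\<close> and closes up in the quotient; the cycle represents the deck transformation
  \<open>g\<close>.\<close>

lemma translate_cycle:
 assumes Q: "quotient_map (top_of_set uhp) X (orbit \<Gamma>)" and g: "g : \<Gamma>" and z: "z : uhp"
 obtains sg where "singular_relcycle 1 X {} (frag_of sg)" "!!t. 0 <= t ==> t <= 1 ==> z + of_real t * (g z - z) : uhp & sg (seg t) = orbit \<Gamma> (z + of_real t * (g z - z))"
proof -
 define l where "l x = z + of_real (x 1) * (g z - z)" for x :: "nat => real"
 define sg where "sg = restrict (%x. orbit \<Gamma> (l x)) (standard_simplex 1)"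
 have conv: "z + of_real t * (g z - z) : uhp" if "0 <= t" "t <= 1" for t
 proof -
  have "(1 - t) *\<^sub>R z + t *\<^sub>R g z : uhp" using convexD[OF convex_uhp z in_uhp[OF g z], of "1 - t" t] that by simp
  then show ?thesis by (simp add: scaleR_conv_of_real algebra_simps)
 qed
 have lu: "l x : uhp" if "x : standard_simplex 1" for x using conv[of "x 1"] that by (auto simp: l_def standard_simplex_def)
 have "continuous_map (powertop_real UNIV) euclideanreal (%x. x 1)" by (rule continuous_map_product_projection) simp
 moreover have "continuous_map euclideanreal euclidean (%t. z + of_real t * (g z - z))" by (auto intro!: continuous_intros)
 ultimately have "continuous_map (powertop_real UNIV) euclidean ((%t. z + of_real t * (g z - z)) \<circ> (%x. x (1::nat)))" by (rule continuous_map_compose)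
 then have "continuous_map (powertop_real UNIV) euclidean l" by (simp add: l_def[abs_def] o_def)
 then have "continuous_map (subtopology (powertop_real UNIV) (standard_simplex 1)) (top_of_set uhp) l"
  by (auto simp: continuous_map_in_subtopology lu intro: continuous_map_from_subtopology)
 from continuous_map_compose[OF this quotient_imp_continuous_map[OF Q]]
 have "continuous_map (subtopology (powertop_real UNIV) (standard_simplex 1)) X sg"
  by (rule continuous_map_eq) (auto simp: sg_def)
 then have s: "singular_simplex 1 X sg" by (simp add: singular_simplex_def sg_def)
 have seg: "sg (seg t) = orbit \<Gamma> (z + of_real t * (g z - z))" if "0 <= t" "t <= 1" for t
  using seg_in[OF that] by (simp add: sg_def l_def seg_def)
 have "singular_face 1 0 sg v0 = singular_face 1 1 sg v0" unfolding singular_face_1 using seg[of 0] seg[of 1] orbit_inv[OF g z] by simp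
 then have "singular_face 1 0 sg = singular_face 1 1 sg"
  by (intro extensionalityI[of _ "standard_simplex 0"]) (auto simp: singular_face_def standard_simplex_0)
 then have "chain_boundary 1 (frag_of sg) = 0" by (simp add: chain_boundary_of atMost_Suc)
 then have "singular_relcycle 1 X {} (frag_of sg)" unfolding singular_relcycle_def mod_subset_empty using s by (simp add: singular_chain_of)
 then show ?thesis using that seg conv by blast
qed

end

context net
begin

text \<open>On the Voronoi cell of \<open>r\<close> both \<open>F\<close> and
  \<open>2 * pi * \<i> * fs a r\<close> are logarithms of \<open>UU a\<close>, so their difference
  is the same at every point of the cell as at \<open>r\<close>. Compare the cells of
  \<open>s\<close> and \<open>t\<close> at a common point.\<close>

lemma cocycle_log_coboundary:
 assumes a: "a : cocyc" and F: "continuous_on uhp F" "!!z. z : uhp ==> UU a z = exp (F z)" and st: "adj s t"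
 shows "2 * of_real pi * \<i> * of_int (a (s, t)) = (F t - 2 * of_real pi * \<i> * of_real (fs a t t)) - (F s - 2 * of_real pi * \<i> * of_real (fs a s s))"
proof -
 obtain c where c: "c : uhp" "near c s" "near c t" using st unfolding adj_def Spx_def by auto
 \<comment> \<open>Along the segment from \<open>r\<close> to \<open>c\<close>, two logarithms of
   the same function have the same increment.\<close>
 have const: "F c - 2 * of_real pi * \<i> * of_real (fs a r c) = F r - 2 * of_real pi * \<i> * of_real (fs a r r)" if n: "near c r" for r
 proof -
  have r: "r : SS" "r : uhp" using n SS_uhp by (auto simp: near_def)
  define v where "v ta = icay r (of_real ta * cay r c)" for ta
  have w: "cmod (cay r c) < 1" using norm_cay_less_1[OF r(2) c(1)] .
  have vu: "v ta : uhp" "near (v ta) r" if "0 <= ta" "ta <= 1" for ta using ray_hcosh(1)[OF r(2) c(1) that] near_ray[OF c(1) n that] by (auto simp: v_def)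
  have ne: "1 - of_real ta * cay r c ~= 0" if "0 <= ta" "ta <= 1" for ta
  proof -
   have "cmod (of_real ta * cay r c) < 1" using w that mult_right_le_one_le[of "cmod (cay r c)" ta] by (simp add: norm_mult mult.commute)
   then show ?thesis by auto
  qed
  have cv: "continuous_on {0..1} v" unfolding v_def icay_def using ne by (intro continuous_intros) auto
  have c1: "continuous_on {0..1} (%ta. F (v ta))" by (rule continuous_on_compose2[OF F(1) cv]) (use vu in auto)
  have c2: "continuous_on {0..1} (%ta. 2 * of_real pi * \<i> * of_real (fs a r (v ta)))"
   by (intro continuous_intros continuous_on_compose2[OF continuous_fs cv]) (use vu in auto)
  have "winding_number (exp \<circ> (%ta. F (v ta))) 0 = winding_number (exp \<circ> (%ta. 2 * of_real pi * \<i> * of_real (fs a r (v ta)))) 0"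
   by (rule winding_number_cong) (use F(2) UU_eq[OF a _ near_Su] vu in auto)
  moreover have "v 0 = r" "v 1 = c" using icay_cay[OF r(2) c(1)] by (auto simp: v_def)
  ultimately have "F c - F r = 2 * of_real pi * \<i> * of_real (fs a r c) - 2 * of_real pi * \<i> * of_real (fs a r r)"
   using winding_number_compose_exp[of "%ta. F (v ta)"] winding_number_compose_exp[of "%ta. 2 * of_real pi * \<i> * of_real (fs a r (v ta))"] c1 c2
   by (simp add: path_def pathfinish_def pathstart_def)
  then show ?thesis by (simp add: algebra_simps)
 qed
 have "of_real (fs a s c) - of_real (fs a t c) = (of_int (a (s, t)) :: complex)"
  using fs_diff[OF a c(1) near_Su[OF c(1,2)] near_Su[OF c(1,3)]] by (metis of_real_diff of_real_of_int_eq)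
 then have "2 * of_real pi * \<i> * of_int (a (s, t)) = (F c - 2 * of_real pi * \<i> * of_real (fs a t c)) - (F c - 2 * of_real pi * \<i> * of_real (fs a s c))"
  by (simp add: algebra_simps flip: right_diff_distrib)
 then show ?thesis unfolding const[OF c(2)] const[OF c(3)] .
qed

text \<open>An invariant logarithm makes \<open>2 * pi * \<i> * a\<close> the coboundary of an
  invariant function \<open>be\<close>. Summation by parts turns the sum of squares of
  \<open>a\<close> into a sum of \<open>dv a\<close> against \<open>be\<close>, which is 0.\<close>

lemma harmonic_zero:
 assumes a: "a : cocyc" and dv: "!!p. p : P ==> dv a p = 0" and F: "continuous_on uhp F" "!!z. z : uhp ==> UU a z = exp (F z)"
  and inv: "!!g z. g : \<Gamma> ==> z : uhp ==> F (g z) = F z"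
 shows "a = (%_. 0)"
proof -
 have Z: "a : ZZ" using a by (simp add: cocyc_def)
 define be where "be s = F s - 2 * of_real pi * \<i> * of_real (fs a s s)" for s
 have beinv: "be (g s) = be s" if "g : \<Gamma>" "s : SS" for g s using inv[OF that(1) SS_uhp[OF that(2)]] fs_inv[OF Z that(1) SS_uhp[OF that(2)] that(2)] by (simp add: be_def)
 have cob: "2 * of_real pi * \<i> * of_int (a (s, t)) = be t - be s" if "adj s t" for s t
  unfolding be_def by (rule cocycle_log_coboundary[OF a F(1) _ that]) (rule F(2))
 define c where "c s t = (of_int (a (s, t)) :: complex)" for s t
 have cinv: "c (g s) (g t) = c s t" if "g : \<Gamma>" "adj s t" for g s t using ZZ_D(1)[OF Z that] by (simp add: c_def)
 have "(\<Sum>(p, t)\<in>LE. c p t * be p) = (\<Sum>p\<in>P. \<Sum>t\<in>{t. adj p t}. c p t * be p)" by (rule sum_LE_P)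
 also have "... = (\<Sum>p\<in>P. of_int (dv a p) * be p)" by (simp add: dv_def c_def sum_distrib_right)
 also have "... = 0" using dv by simp
 finally have s1: "(\<Sum>(p, t)\<in>LE. c p t * be p) = 0" .
 have "(\<Sum>(p, t)\<in>LE. c p t * be p) = (\<Sum>(p, t)\<in>LE. c t p * be t)"
  by (rule sum_LE_rev[of "%s t. c s t * be s"]) (use cinv beinv adj_SS in auto)
 also have "... = - (\<Sum>(p, t)\<in>LE. c p t * be t)"
 proof -
  have "(case e of (p, t) => c t p * be t) = - (case e of (p, t) => c p t * be t)" for e using ZZ_D(2)[OF Z, of "snd e" "fst e"] by (simp add: case_prod_beta c_def)
  then have "(\<Sum>(p, t)\<in>LE. c t p * be t) = (\<Sum>e\<in>LE. - (case e of (p, t) => c p t * be t))" by (rule sum.cong[OF refl])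
  then show ?thesis unfolding sum_negf .
 qed
 finally have s2: "(\<Sum>(p, t)\<in>LE. c p t * be t) = 0" using s1 by simp
 have "2 * of_real pi * \<i> * of_int (\<Sum>e\<in>LE. (a e)\<^sup>2) = (\<Sum>(p, t)\<in>LE. c p t * (2 * of_real pi * \<i> * of_int (a (p, t))))"
  by (simp add: case_prod_beta c_def sum_distrib_left power2_eq_square mult_ac)
 also have "... = (\<Sum>(p, t)\<in>LE. c p t * (be t - be p))"
  by (rule sum.cong) (use cob in "auto simp: LE_I")
 also have "... = (\<Sum>(p, t)\<in>LE. c p t * be t) - (\<Sum>(p, t)\<in>LE. c p t * be p)"
  by (simp add: case_prod_beta right_diff_distrib sum_subtractf)
 finally have "2 * of_real pi * \<i> * of_int (\<Sum>e\<in>LE. (a e)\<^sup>2) = (0::complex)" unfolding s1 s2 by simp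
 moreover have "n = 0" if "2 * of_real pi * \<i> * of_int n = (0::complex)" for n :: int using that by simp
 ultimately have "(\<Sum>e\<in>LE. (a e)\<^sup>2) = 0" by blast
 then have a0: "a e = 0" if "e : LE" for e using that finite_LE by (simp add: sum_nonneg_eq_0_iff)
 have "a (s, t) = 0" for s t
 proof (cases "adj s t")
  case True
  then have S: "s : SS" using adj_SS by blast
  have "(red s s, red s t) : LE" using red[OF S] adj_inv[OF red(1)[OF S] True] by (simp add: LE_I)
  from a0[OF this] show ?thesis using ZZ_D(1)[OF Z red(1)[OF S] True] by simp
 qed (rule ZZ_D(3)[OF Z])
 then show ?thesis by auto
qed

lemma descend:
 assumes Q: "quotient_map (top_of_set uhp) X (orbit \<Gamma>)" and a: "a : cocyc"
 shows "EX u. circle_map X u & (ALL z:uhp. u (orbit \<Gamma> z) = UU a z)"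
proof -
 have c: "continuous_map (top_of_set uhp) euclidean (UU a)" using continuous_UU[OF a] by simp
 have e: "UU a x = UU a y" if xy: "x : topspace (top_of_set uhp)" "y : topspace (top_of_set uhp)" "orbit \<Gamma> x = orbit \<Gamma> y" for x y
  using orbit_eqD[OF xy(3)] UU_inv[OF a] xy(1) by auto
 obtain u where u: "continuous_map X euclidean u" "ALL x:uhp. u (orbit \<Gamma> x) = UU a x"
 proof (rule quotient_map_lift_exists[OF Q c])
  fix u assume "continuous_map X euclidean u" "!!x. x : topspace (top_of_set uhp) ==> u (orbit \<Gamma> x) = UU a x"
  then show ?thesis by (intro that) auto
 qed (rule e)
 have "u x ~= 0" if x: "x : topspace X" for x
 proof -
  have "x : orbit \<Gamma> ` uhp" using quotient_imp_surjective_map[OF Q] x by simp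
  then show ?thesis using u(2) by (auto simp: UU_def)
 qed
 then show ?thesis using u by (intro exI[of _ u]) (auto simp: circle_map_def)
qed

text \<open>If it failed, \<open>cochain_exists\<close> would give a nonzero harmonic cochain whose
  circle-valued map winds zero times around all generators of the homology. Its logarithm is then
  invariant, contradicting \<open>harmonic_zero\<close>.\<close>

lemma genus_bound:
 assumes Q: "quotient_map (top_of_set uhp) X (orbit \<Gamma>)" and H: "homology_group 1 X \<cong> free_Abelian_group {..<2 * g}"
 shows "card CE + 2 <= card CT + card P + 2 * g"
proof (rule ccontr)
 assume "~ ?thesis"
 then have lt: "card CT + card P + 2 * g < card CE + 2" by simp
 obtain z where z: "!!i. i < 2 * g ==> singular_relcycle 1 X {} (z i)"
  and gen: "!!W c. [|!!a b. W (a + b) = W a + (W b :: complex); !!b. singular_relboundary 1 X {} b ==> W b = 0; !!i. i < 2 * g ==> W (z i) = 0; singular_relcycle 1 X {} c|] ==> W c = 0"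
  by (rule H1_generators[OF H]) blast
 define ub where "ub a = (SOME u. circle_map X u & (ALL z:uhp. u (orbit \<Gamma> z) = UU a z))" for a
 have ub: "circle_map X (ub a)" "!!z. z : uhp ==> ub a (orbit \<Gamma> z) = UU a z" if "a : cocyc" for a
  using someI_ex[OF descend[OF Q that], folded ub_def] by auto
 \<comment> \<open>The pairing is a complex number that happens to be an integer; the floor extracts
   it as an \<open>int\<close>, as the dimension count requires.\<close>
 define L where "L j a = \<lfloor>Re (cpair (wn (ub a)) (z j))\<rfloor>" for j a
 have L: "of_int (L j a) = cpair (wn (ub a)) (z j)" if "j < 2 * g" "a : cocyc" for j a
  using circle_map.cpair_cycle_int[OF ub(1)[OF that(2)] z[OF that(1)]] unfolding L_def by (elim Ints_cases) simp
 have lin: "int_lin {a:ZZ. ALL x:LT. tau a x = 0} (L j)" if j: "j < 2 * g" for j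
  unfolding int_lin_def cocyc_def[symmetric]
 proof (intro ballI allI)
  fix a b k l assume ab: "a : cocyc" "b : cocyc"
  let ?c = "%e. k * a e + l * b e"
  have c: "?c : cocyc" using cocyc_closed ab unfolding int_closed_def by blast
  have "ub ?c x = ub a x powi k * ub b x powi l" if "x : topspace X" for x
  proof -
   obtain y where "y : uhp" "x = orbit \<Gamma> y" using quotient_imp_surjective_map[OF Q] \<open>x : topspace X\<close> by auto
   then show ?thesis using ub(2) ab c UU_comb[OF ab] by simp
  qed
  then have w: "wn (ub ?c) sg = of_int k * wn (ub a) sg + of_int l * wn (ub b) sg" if "singular_simplex 1 X sg" for sg
   using wn_powi[OF ub(1)[OF ab(1)] ub(1)[OF ab(2)] that] by blast
  have ch: "singular_chain 1 X (z j)" using z[OF j] by (simp add: singular_relcycle_def)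
  have "cpair (wn (ub ?c)) (z j) = of_int k * cpair (wn (ub a)) (z j) + of_int l * cpair (wn (ub b)) (z j)"
   unfolding cpair_def sum_distrib_left sum.distrib[symmetric]
   by (rule sum.cong) (use w ch in "auto simp: singular_chain_def algebra_simps")
  then have "(of_int (L j ?c) :: complex) = of_int (k * L j a + l * L j b)" using L[OF j] ab c by simp
  then show "L j ?c = k * L j a + l * L j b" by (simp only: of_int_eq_iff)
 qed
 have "EX a:ZZ. a ~= (%_. 0) & (ALL x:LT. tau a x = 0) & (ALL p:P. dv a p = 0) & (ALL j<2 * g. L j a = 0)"
  by (rule cochain_exists[OF _ lt]) (rule lin)
 then obtain a where a: "a : ZZ" "a ~= (%_. 0)" "ALL x:LT. tau a x = 0" "ALL p:P. dv a p = 0" "ALL j<2 * g. L j a = 0"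
  by (elim bexE conjE) (rule that)
 have ac: "a : cocyc" using a by (simp add: cocyc_def)
 have W: "cpair (wn (ub a)) c = 0" if "singular_relcycle 1 X {} c" for c
  by (rule gen[OF cpair_add circle_map.cpair_relboundary[OF ub(1)[OF ac]] _ that]) (use L[OF _ ac] a(5) in auto)
 obtain F where F: "continuous_on uhp F" "!!z. z : uhp ==> UU a z = exp (F z)"
  by (rule continuous_logarithm_on_contractible[OF continuous_UU[OF ac] convex_imp_contractible[OF convex_uhp]]) (auto simp: UU_def)
 \<comment> \<open>The increment of \<open>F\<close> from \<open>y\<close> to \<open>h y\<close> is
   \<open>2 * pi * \<i>\<close> times the winding along a cycle of the quotient, which is 0 by
   \<open>W\<close>.\<close>
 have "F (h y) = F y" if h: "h : \<Gamma>" "y : uhp" for h y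
 proof -
  obtain sg where sg: "singular_relcycle 1 X {} (frag_of sg)" "!!t. 0 <= t ==> t <= 1 ==> y + of_real t * (h y - y) : uhp & sg (seg t) = orbit \<Gamma> (y + of_real t * (h y - y))"
   by (rule translate_cycle[OF Q h]) blast
  have "wn (ub a) sg = (F (y + of_real 1 * (h y - y)) - F (y + of_real 0 * (h y - y))) / (2 * of_real pi * \<i>)"
  proof (rule wn_log[where q = "%t. F (y + of_real t * (h y - y))"])
   show "continuous_on {0..1} (%t. F (y + of_real t * (h y - y)))"
    by (rule continuous_on_compose2[OF F(1)]) (use sg(2) in "auto intro!: continuous_intros")
  qed (use sg(2) ub(2)[OF ac] F(2) in simp)
  then show ?thesis using W[OF sg(1)] by simp
 qed
 then have "a = (%_. 0)" using harmonic_zero[OF ac _ F] a(4) by blast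
 then show False using a(2) by simp
qed

lemma area_genus:
 assumes "quotient_map (top_of_set uhp) X (orbit \<Gamma>)" "homology_group 1 X \<cong> free_Abelian_group {..<2 * g}"
 shows "measure nu UNIV <= 4 * pi * (real g - 1)"
proof -
 have "real (card CE) + 2 <= real (card CT) + real (card P) + 2 * real g" using genus_bound[OF assms] by linarith
 moreover have "2 * real (card CE) = real (card LE)" "3 * real (card CT) = real (card LE)" using card_CE card_CT card_LT by linarith+
 moreover have "m / 6 - v <= 2 * (h - 1)" if "e + 2 <= f + v + 2 * h" "2 * e = m" "3 * f = m" for e f v h m :: real using that by simp
 ultimately have "real (card LE) / 6 - real (card P) <= 2 * (real g - 1)" by blast
 then have "2 * pi * (real (card LE) / 6 - real (card P)) <= 2 * pi * (2 * (real g - 1))" by (intro mult_left_mono) auto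
 then show ?thesis using area_bound by (simp add: algebra_simps)
qed

end

theorem mainTheorem19:
  fixes \<Gamma> :: "(complex \<Rightarrow> complex) set" and g :: nat
  assumes "cocompact_fuchsian \<Gamma>"
    and "surface_genus \<Gamma> g"
    and "g \<ge> 2"
  shows "real (N_small \<Gamma>) < min (24 * pi\<^sup>2 * (real g - 1) / (systole \<Gamma>) ^ 3)
                                  (16 * (real g - 1) / (systole \<Gamma>)\<^sup>2)"
proof -
 interpret fuchsian \<Gamma> using assms(1) by unfold_locales
 obtain P where P: "finite P" "P \<subseteq> uhp" "ineq P" "generic P" "ALL z:uhp. EX s:orb P. hyp_dist z s < eps" using net_exists by blast
 interpret net \<Gamma> P using P by unfold_locales auto
 obtain X where X: "quotient_map (top_of_set uhp) X (orbit \<Gamma>)" "homology_group 1 X \<cong> free_Abelian_group {..<2 * g}"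
  using assms(2) by (auto simp: surface_genus_def)
 define l where "l = systole \<Gamma>"
 have l: "l > 0" using systole_pos by (simp add: l_def)
 \<comment> \<open>Chosen so that \<open>rr S\<close> is half the systole:
   \<open>rr S = 2 artanh (exp S)\<close>.\<close>
 define S where "S = ln (tanh (l / 4))"
 have S0: "S < 0" using l tanh_real_lt_1[of "l / 4"] by (simp add: S_def)
 have rS: "rr S = l / 2"
 proof -
  have "exp S = tanh (l / 4)" using l by (simp add: S_def)
  then have "rr S = 2 * artanh (tanh (l / 4))" by (simp add: rr_def artanh_def)
  then show ?thesis by (simp add: artanh_tanh_real)
 qed
 have "real (N_small \<Gamma>) * mval S <= measure nu UNIV" using N_small_bound[OF S0] rS by (simp add: l_def)
 also have "... <= 4 * pi * (real g - 1)" by (rule area_genus[OF X])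
 finally have N: "real (N_small \<Gamma>) * mval S <= 4 * pi * (real g - 1)" .
 have g1: "real g - 1 > 0" using assms(3) by simp
 \<comment> \<open>The strict inequality for \<open>m\<close> is multiplied by the number of
   eigenvalues, so the case of none is treated apart.\<close>
 have key: "real (N_small \<Gamma>) < 4 * pi * (real g - 1) / m" if m: "0 < m" "m < mval S" for m
 proof (cases "N_small \<Gamma> = 0")
  case False
  then have "real (N_small \<Gamma>) * m < real (N_small \<Gamma>) * mval S" using m by (intro mult_strict_left_mono) auto
  then show ?thesis using N m by (simp add: field_simps)
 qed (use m g1 in simp)
 have "real (N_small \<Gamma>) < 4 * pi * (real g - 1) / (pi * (l / 2)^2)" using key[of "pi * (l / 2)^2"] mval_lower_1[OF S0] rS l by simp
 also have "... = 16 * (real g - 1) / l^2" using l by (simp add: power_divide)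
 finally have 1: "real (N_small \<Gamma>) < 16 * (real g - 1) / l^2" .
 have "real (N_small \<Gamma>) < 4 * pi * (real g - 1) / (4 * (l / 2) ^ 3 / (3 * pi))" using key[of "4 * (l / 2) ^ 3 / (3 * pi)"] mval_lower_2[OF S0] rS l by simp
 also have "... = 24 * pi^2 * (real g - 1) / l ^ 3" using l by (simp add: power_divide power2_eq_square)
 finally show ?thesis using 1 by (simp add: l_def)
qed

end
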